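(* Let $m\ge 2$, let $P_1,\ldots,P_m\in\mathbb{C}$ satisfy $P_j\neq P_{j+1}$ for $j=1,\ldots,m-1$, and let $F_{opt}$ be a curve in $\mathcal{A}_{\pi/2}(P_1,P_2,\ldots,P_m)$ having minimal bending energy. For $j=1,\ldots,m-1$ let $(\alpha_j,\beta_{j+1})$ be the chord angles of the $j$-th piece of $F_{opt}$. If the chord angles at interior nodes are all strictly less than $\frac{\pi}{2}$ in magnitude, i.e. $|\beta_j|<\frac{\pi}{2}$ and $|\alpha_j|<\frac{\pi}{2}$ for all $j=2,\ldots,m-1$, then $F_{opt}$ is globally $G^2$.
   Context: A curve is a function $f:[a,b]\to\mathbb{C}$ whose derivative $f'$ is absolutely continuous and non-vanishing. Its bending energy is $\|f\|^2:=\frac14\int_0^{\mathcal{L}}\kappa^2\,ds$, where $\mathcal{L}$ is the arclength of $f$ and $\kappa$ its signed curvature as a function of arclength $s$ (the value $+\infty$ is allowed). A curve is $G^2$ if its unit tangent direction and its signed curvature both change continuously with respect to arclength. An s-curve is a curve which first turns monotonically at most $180^\circ$ in one direction (either counter-clockwise or clockwise) and then turns monotonically at most $180^\circ$ in the opposite direction; that is, for a continuous tangent angle $\theta$ of $f'$ there is $c\in[a,b]$ such that $\theta$ is monotone on $[a,c]$ and monotone in the opposite sense on $[c,b]$, with total change at most $\pi$ in magnitude on each of the two intervals. The chord angles $(\alpha,\beta)$ of an s-curve $f:[a,b]\to\mathbb{C}$ are $\alpha=\arg\frac{f'(a)}{f(b)-f(a)}$, $\beta=\arg\frac{f'(b)}{f(b)-f(a)}$,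 where $\arg$ takes values in $(-\pi,\pi]$. An interpolating curve for $P_1,\ldots,P_m$ is a curve $F:[a,b]\to\mathbb{C}$ for which there are times $a=t_1<t_2<\cdots<t_m=b$ with $F(t_j)=P_j$; its $j$-th piece is the restriction $F_{[t_j,t_{j+1}]}$, which runs from $P_j$ to $P_{j+1}$. $\mathcal{A}_{\pi/2}(P_1,\ldots,P_m)$ is the set of all interpolating curves all of whose pieces are s-curves with chord angles $(\alpha,\beta)$ satisfying $|\alpha|,|\beta|\le\frac{\pi}{2}$. The interior nodes are $P_2,\ldots,P_{m-1}$; the two chord angles at the interior node $P_j$ are $\beta_j$ (terminal chord angle of the $(j-1)$-th piece) and $\alpha_j$ (initial chord angle of the $j$-th piece). *)

theory Defs
  imports "HOL-Analysis.Analysis"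
begin

text \<open>
  A curve is a triple \<open>a\<close>, \<open>b\<close>, \<open>f\<close>; only the values of \<open>f\<close> on \<open>{a..b}\<close> are relevant, and all
  derivatives are taken within the interval, hence are one-sided at its endpoints.
\<close>

abbreviation deriv_on :: "real \<Rightarrow> real \<Rightarrow> (real \<Rightarrow> complex) \<Rightarrow> real \<Rightarrow> complex" where
  "deriv_on a b f t \<equiv> vector_derivative f (at t within {a..b})"

text \<open>
  The usual \<open>\<epsilon>\<close>-\<open>\<delta>\<close> definition of absolute continuity; \<open>D\<close> is a finite family of
  non-overlapping compact intervals \<open>k = {Inf k..Sup k}\<close> inside \<open>{a..b}\<close>.
\<close>

definition absolutely_continuous_fun :: "real \<Rightarrow> real \<Rightarrow> (real \<Rightarrow> complex) \<Rightarrow> bool" where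
  "absolutely_continuous_fun a b h \<longleftrightarrow>
     (\<forall>\<epsilon>>0. \<exists>\<delta>>0. \<forall>D. D division_of \<Union>D \<and> \<Union>D \<subseteq> {a..b} \<and> (\<Sum>k\<in>D. measure lborel k) < \<delta> \<longrightarrow>
        (\<Sum>k\<in>D. norm (h (Sup k) - h (Inf k))) < \<epsilon>)"

definition is_curve :: "real \<Rightarrow> real \<Rightarrow> (real \<Rightarrow> complex) \<Rightarrow> bool" where
  "is_curve a b f \<longleftrightarrow>
     a < b \<and>
     (\<forall>t\<in>{a..b}. f differentiable (at t within {a..b})) \<and>
     (\<forall>t\<in>{a..b}. deriv_on a b f t \<noteq> 0) \<and>
     absolutely_continuous_fun a b (deriv_on a b f)"

definition arclength_fun :: "real \<Rightarrow> real \<Rightarrow> (real \<Rightarrow> complex) \<Rightarrow> real \<Rightarrow> real" where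
  "arclength_fun a b f t = integral {a..t} (\<lambda>u. norm (deriv_on a b f u))"

definition arclength :: "real \<Rightarrow> real \<Rightarrow> (real \<Rightarrow> complex) \<Rightarrow> real" where
  "arclength a b f = arclength_fun a b f b"

text \<open>
  For a curve the arclength function is a bijection from \<open>{a..b}\<close> onto \<open>{0..arclength a b f}\<close>.
  The following functions are meant for arguments \<open>s\<close> in the latter interval.
\<close>

definition arclength_param :: "real \<Rightarrow> real \<Rightarrow> (real \<Rightarrow> complex) \<Rightarrow> real \<Rightarrow> complex" where
  "arclength_param a b f s = f (inv_into {a..b} (arclength_fun a b f) s)"

definition unit_tangent :: "real \<Rightarrow> real \<Rightarrow> (real \<Rightarrow> complex) \<Rightarrow> real \<Rightarrow> complex" where
  "unit_tangent a b f s = deriv_on 0 (arclength a b f) (arclength_param a b f) s"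

text \<open>
  With unit tangent \<open>T = cis \<theta>\<close> one has \<open>T' = \<i> \<theta>' T\<close>, so \<open>Im (cnj T * T')\<close> is the signed curvature
  \<open>d\<theta>/ds\<close>. It is meaningful where \<open>T\<close> is differentiable, that is, for almost every \<open>s\<close>.
\<close>

definition signed_curvature :: "real \<Rightarrow> real \<Rightarrow> (real \<Rightarrow> complex) \<Rightarrow> real \<Rightarrow> real" where
  "signed_curvature a b f s =
     Im (cnj (unit_tangent a b f s) * deriv_on 0 (arclength a b f) (unit_tangent a b f) s)"

definition bending_energy :: "real \<Rightarrow> real \<Rightarrow> (real \<Rightarrow> complex) \<Rightarrow> ennreal" where
  "bending_energy a b f =
     (\<integral>\<^sup>+s\<in>{0..arclength a b f}. ennreal ((signed_curvature a b f s)\<^sup>2) \<partial>lebesgue) / 4"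

text \<open>
  Differentiability of the unit tangent everywhere says that the curvature is defined everywhere;
  without it, \<^const>\<open>vector_derivative\<close> would be unspecified at the exceptional points.
\<close>

definition G2 :: "real \<Rightarrow> real \<Rightarrow> (real \<Rightarrow> complex) \<Rightarrow> bool" where
  "G2 a b f \<longleftrightarrow>
     is_curve a b f \<and>
     continuous_on {0..arclength a b f} (unit_tangent a b f) \<and>
     (\<forall>s\<in>{0..arclength a b f}.
        unit_tangent a b f differentiable (at s within {0..arclength a b f})) \<and>
     continuous_on {0..arclength a b f} (signed_curvature a b f)"

definition tangent_angle :: "real \<Rightarrow> real \<Rightarrow> (real \<Rightarrow> complex) \<Rightarrow> (real \<Rightarrow> real) \<Rightarrow> bool" where
  "tangent_angle a b f \<theta> \<longleftrightarrow>
     continuous_on {a..b} \<theta> \<and>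
     (\<forall>t\<in>{a..b}. deriv_on a b f t = rcis (norm (deriv_on a b f t)) (\<theta> t))"

text \<open>
  Continuous tangent angles of a curve exist and differ by constants, so it does not matter
  whether \<open>\<theta>\<close> is quantified existentially or universally.
\<close>

definition s_curve :: "real \<Rightarrow> real \<Rightarrow> (real \<Rightarrow> complex) \<Rightarrow> bool" where
  "s_curve a b f \<longleftrightarrow>
     is_curve a b f \<and>
     (\<exists>\<theta>. tangent_angle a b f \<theta> \<and>
       (\<exists>c\<in>{a..b}.
          (mono_on {a..c} \<theta> \<and> antimono_on {c..b} \<theta> \<or>
           antimono_on {a..c} \<theta> \<and> mono_on {c..b} \<theta>) \<and>
          \<bar>\<theta> c - \<theta> a\<bar> \<le> pi \<and> \<bar>\<theta> b - \<theta> c\<bar> \<le> pi))"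

definition initial_chord_angle :: "real \<Rightarrow> real \<Rightarrow> (real \<Rightarrow> complex) \<Rightarrow> real" where
  "initial_chord_angle a b f = Arg (deriv_on a b f a / (f b - f a))"

definition terminal_chord_angle :: "real \<Rightarrow> real \<Rightarrow> (real \<Rightarrow> complex) \<Rightarrow> real" where
  "terminal_chord_angle a b f = Arg (deriv_on a b f b / (f b - f a))"

text \<open>
  The points are \<open>P 1, \<dots>, P m\<close> and the times \<open>t 1 < \<dots> < t m\<close>; other indices are irrelevant. The
  curve lives on \<open>{t 1..t m}\<close>, and its \<open>j\<close>-th piece is \<open>F\<close> on \<open>{t j..t (Suc j)}\<close>.
\<close>

definition interpolating_curve ::
    "nat \<Rightarrow> (nat \<Rightarrow> complex) \<Rightarrow> (nat \<Rightarrow> real) \<Rightarrow> (real \<Rightarrow> complex) \<Rightarrow> bool" where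
  "interpolating_curve m P t F \<longleftrightarrow>
     is_curve (t 1) (t m) F \<and>
     (\<forall>j\<in>{1..<m}. t j < t (Suc j)) \<and>
     (\<forall>j\<in>{1..m}. F (t j) = P j)"

text \<open>
  Pieces, and hence chord angles, depend on the times \<open>t\<close>, so an element carries them along with
  the curve.
\<close>

definition A_half_pi ::
    "nat \<Rightarrow> (nat \<Rightarrow> complex) \<Rightarrow> ((nat \<Rightarrow> real) \<times> (real \<Rightarrow> complex)) set" where
  "A_half_pi m P = {(t, F).
     interpolating_curve m P t F \<and>
     (\<forall>j\<in>{1..<m}.
        s_curve (t j) (t (Suc j)) F \<and>
        \<bar>initial_chord_angle (t j) (t (Suc j)) F\<bar> \<le> pi / 2 \<and>
        \<bar>terminal_chord_angle (t j) (t (Suc j)) F\<bar> \<le> pi / 2)}"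

end

theory Submission
  imports Defs
begin

text \<open>
  Parametrise each piece by arclength with tangent angle \<open>\<theta>\<close> and curvature \<open>\<omega>\<close>; its energy is
  \<open>\<integral>\<omega>\<^sup>2 / 4\<close>, and the only constraints are the two end angles, the displacement \<open>\<integral>cis \<theta>\<close> and the shape
  of \<open>\<theta>\<close>. Changing the speed, at which the angles are run through, preserves the end angles and the
  shape. Hence a minimal piece satisfies the Euler-Lagrange equation \<open>\<omega>\<^sup>2 = Re (cnj \<Lambda> * cis \<theta>)\<close> with a constant
  \<open>\<Lambda>\<close>, and truncating the angle at an inflection shows that \<open>\<omega>\<close> vanishes there. So the curvature
  \<open>\<kappa>\<close> of a minimal piece is continuous.

  If an end angle is changed by \<open>\<epsilon>\<close>, the minimal value of \<open>\<integral>\<omega>\<^sup>2\<close> increases by at most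
  \<open>2 \<epsilon> \<kappa> + o(\<epsilon>)\<close> at the final and \<open>- 2 \<epsilon> \<kappa> + o(\<epsilon>)\<close> at the initial end. At an interior node, where the chord
  angles may be varied, both pieces may be rotated simultaneously. So if the curvatures there were different,
  a small rotation in the suitable direction would decrease the energy of the whole curve.
\<close>

section \<open>Almost everywhere differentiability of indefinite integrals\<close>

text \<open>The shape constraint is one-sided: a perturbation of \<open>\<theta>\<close> is in
  general admissible in one direction only and yields no equation. A change of the speed
  \<open>v\<close> has no such restriction. The energy becomes the integral of
  \<open>\<omega>\<^sup>2 / v\<close> and the displacement that of \<open>v cis \<theta>\<close>,
  linear in \<open>v\<close>, so two intervals with independent displacements can correct any small
  error. They exist unless the angle is constant. After replacing \<open>\<theta>\<close> by a
  nearby angle, the correction costs a multiple of their L1 distance; for a change of height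
  \<open>\<epsilon>\<close> on a length \<open>w\<close> this is \<open>O(\<epsilon> w)\<close>,
  small against \<open>\<epsilon>\<close> once \<open>w\<close> is small.

  The delicate case of a rotated end is zero curvature there, since the rotation may add a monotone
  phase. There is room for it only if the arc has no inflection, and this is where the strictly
  acute chord angle enters.

  Given are only absolutely continuous derivatives and possibly infinite energies. So the angle has
  to be exhibited as a primitive, and infinite energy to be excluded by a competitor of finite
  energy.\<close>

definition deviating_points :: "real \<Rightarrow> real \<Rightarrow> (real \<Rightarrow> real) \<Rightarrow> real \<Rightarrow> real set" where
  "deviating_points a b f e = {x\<in>{a..b}. \<forall>d>0. \<exists>h. 0 < \<bar>h\<bar> \<and> \<bar>h\<bar> < d \<and> x + h \<in> {a..b} \<and>
      e * \<bar>h\<bar> \<le> \<bar>integral {a..x+h} f - integral {a..x} f - f x * h\<bar>}"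

lemma integral_diff_interval:
  fixes f :: "real \<Rightarrow> real"
  assumes "f integrable_on {a..b}" "a \<le> u" "u \<le> v" "v \<le> b"
  shows "integral {a..v} f - integral {a..u} f = integral {u..v} f"
proof -
  have "f integrable_on {a..v}"
    using assms by (intro integrable_subinterval_real[OF assms(1)]) auto
  from Henstock_Kurzweil_Integration.integral_combine[OF assms(2,3) this] show ?thesis by simp
qed

text \<open>By Henstock's lemma the errors over a fine tagged partial division have a small sum. A
  Vitali selection provides disjoint intervals, each with an error of at least \<open>e\<close>
  times its length, whose fivefold enlargements cover the set; so the total length of the cover is
  small.\<close>

lemma negligible_deviating_points:
  fixes f :: "real \<Rightarrow> real"
  assumes f: "f integrable_on {a..b}" and e: "0 < e"
  shows "negligible (deviating_points a b f e)"
  unfolding negligible_outer_le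
proof (intro allI impI)
  fix \<epsilon> :: real assume eps: "0 < \<epsilon>"
  \<comment> \<open>A ball of radius \<open>5 * \<bar>h\<bar>\<close> has length
    \<open>10 * \<bar>h\<bar>\<close>, which accounts for the factor 10.\<close>
  define \<eta> where "\<eta> = e * \<epsilon> / 10"
  have "\<eta> > 0" using e eps by (simp add: \<eta>_def)
  from Henstock_lemma[of f a b, OF _ this] f
  obtain \<gamma> where \<gamma>: "gauge \<gamma>" and fine: "\<And>p. \<lbrakk>p tagged_partial_division_of (cbox a b); \<gamma> fine p\<rbrakk> \<Longrightarrow>
             sum (\<lambda>(x,k). norm (measure lborel k *\<^sub>R f x - integral k f)) p < \<eta>" by auto
  let ?E = "deviating_points a b f e"
  let ?dev = "\<lambda>x h. \<bar>integral {a..x+h} f - integral {a..x} f - f x * h\<bar>"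
  have "\<exists>h. 0 < \<bar>h\<bar> \<and> x + h \<in> {a..b} \<and> e * \<bar>h\<bar> \<le> ?dev x h \<and> cball x \<bar>h\<bar> \<subseteq> \<gamma> x"
    if x: "x \<in> ?E" for x
  proof -
    have "open (\<gamma> x)" "x \<in> \<gamma> x" using \<gamma> by (auto simp: gauge_def)
    then obtain d where d: "d > 0" "cball x d \<subseteq> \<gamma> x" by (meson open_contains_cball)
    with x obtain h where h: "0 < \<bar>h\<bar>" "\<bar>h\<bar> < d" "x + h \<in> {a..b}" "e * \<bar>h\<bar> \<le> ?dev x h"
      unfolding deviating_points_def by blast
    have "cball x \<bar>h\<bar> \<subseteq> cball x d" using h(2) by auto
    then show ?thesis using h d(2) by blast
  qed
  then obtain h where h: "\<And>x. x \<in> ?E \<Longrightarrow> 0 < \<bar>h x\<bar>" "\<And>x. x \<in> ?E \<Longrightarrow> x + h x \<in> {a..b}"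
     "\<And>x. x \<in> ?E \<Longrightarrow> e * \<bar>h x\<bar> \<le> ?dev x (h x)" "\<And>x. x \<in> ?E \<Longrightarrow> cball x \<bar>h x\<bar> \<subseteq> \<gamma> x"
    by metis
  have E: "?E \<subseteq> {a..b}" by (auto simp: deviating_points_def)
  have cov: "?E \<subseteq> (\<Union>i\<in>?E. cball i \<bar>h i\<bar>)" by force
  have bd: "0 < \<bar>h i\<bar> \<and> \<bar>h i\<bar> \<le> b - a" if "i \<in> ?E" for i
    using h(1,2)[OF that] E that by force
  obtain C where C: "countable C" "C \<subseteq> ?E"
     "pairwise (\<lambda>i j. disjnt (cball i \<bar>h i\<bar>) (cball j \<bar>h j\<bar>)) C"
     "?E \<subseteq> (\<Union>i\<in>C. cball i (5 * \<bar>h i\<bar>))"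
    by (rule Vitali_covering_lemma_cballs[of ?E "\<lambda>i. i" "\<lambda>i. \<bar>h i\<bar>" ?E "b - a", OF cov bd])
  have fin: "measure lebesgue (\<Union>i\<in>C'. cball i (5 * \<bar>h i\<bar>)) \<le> \<epsilon>" if C': "C' \<subseteq> C" "finite C'" for C'
  proof -
    \<comment> \<open>The interval lies on the side of its tag \<open>x\<close> on which the
      deviation was found, and inside the ball of radius \<open>\<bar>h x\<bar>\<close>; so
      disjointness and fineness are inherited from the balls.\<close>
    define J where "J = (\<lambda>x. {min x (x + h x)..max x (x + h x)})"
    define p where "p = (\<lambda>x. (x, J x)) ` C'"
    have C'E: "C' \<subseteq> ?E" using C' C(2) by auto
    have Jball: "J x \<subseteq> cball x \<bar>h x\<bar>" for x by (auto simp: J_def dist_real_def)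
    have tpd: "p tagged_partial_division_of cbox a b"
      unfolding tagged_partial_division_of_def
    proof (intro conjI allI impI)
      show "finite p" using C' by (simp add: p_def)
    next
      fix x K assume xK: "(x, K) \<in> p"
      then have x: "x \<in> C'" "K = J x" by (auto simp: p_def)
      then have "x \<in> ?E" using C'E by auto
      show "x \<in> K" using x by (auto simp: J_def)
      show "K \<subseteq> cbox a b" using x h(2)[OF \<open>x \<in> ?E\<close>] E \<open>x \<in> ?E\<close> by (auto simp: J_def)
      show "\<exists>a b. K = cbox a b" using x by (auto simp: J_def)
    next
      fix x1 K1 x2 K2
      assume "(x1, K1) \<in> p \<and> (x2, K2) \<in> p \<and> (x1, K1) \<noteq> (x2, K2)"
      then have "x1 \<in> C'" "x2 \<in> C'" "x1 \<noteq> x2" "K1 = J x1" "K2 = J x2" by (auto simp: p_def)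
      then have "disjnt (cball x1 \<bar>h x1\<bar>) (cball x2 \<bar>h x2\<bar>)"
        using C(3) C' by (auto simp: pairwise_def)
      then have "K1 \<inter> K2 = {}" using Jball[of x1] Jball[of x2] \<open>K1 = J x1\<close> \<open>K2 = J x2\<close>
        unfolding disjnt_def by blast
      then show "interior K1 \<inter> interior K2 = {}"
        using interior_subset by blast
    qed
    have gf: "\<gamma> fine p"
      unfolding fine_def p_def using subset_trans[OF Jball h(4)] C'E by auto
    have "(\<Sum>x\<in>C'. \<bar>h x\<bar>) * e \<le> (\<Sum>x\<in>C'. norm (measure lborel (J x) *\<^sub>R f x - integral (J x) f))"
      unfolding sum_distrib_right
    proof (rule sum_mono)
      fix x assume "x \<in> C'"
      then have x: "x \<in> ?E" using C'E by auto
      have xab: "x \<in> {a..b}" "x + h x \<in> {a..b}" using x E h(2) by auto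
      have "norm (measure lborel (J x) *\<^sub>R f x - integral (J x) f) = ?dev x (h x)"
      proof (cases "h x \<ge> 0")
        case True
        then have "integral {a..x + h x} f - integral {a..x} f = integral (J x) f"
          using integral_diff_interval[OF f, of x "x + h x"] xab by (simp add: J_def)
        then show ?thesis using True by (simp add: J_def algebra_simps)
      next
        case False
        then have "integral {a..x} f - integral {a..x + h x} f = integral (J x) f"
          using integral_diff_interval[OF f, of "x + h x" x] xab by (simp add: J_def)
        moreover have "measure lborel (J x) = - h x" using False by (simp add: J_def)
        ultimately show ?thesis by (simp add: algebra_simps)
      qed
      then show "\<bar>h x\<bar> * e \<le> norm (measure lborel (J x) *\<^sub>R f x - integral (J x) f)"
        using h(3)[OF x] by (simp add: mult.commute)
    qed
    also have "\<dots> = (\<Sum>(x,k)\<in>p. norm (measure lborel k *\<^sub>R f x - integral k f))"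
      unfolding p_def by (subst sum.reindex) (auto simp: inj_on_def)
    also have "\<dots> < \<eta>" by (rule fine[OF tpd gf])
    finally have s: "(\<Sum>x\<in>C'. \<bar>h x\<bar>) \<le> \<epsilon> / 10"
      using e by (simp add: \<eta>_def field_simps)
    have "measure lebesgue (\<Union>i\<in>C'. cball i (5 * \<bar>h i\<bar>)) \<le> (\<Sum>i\<in>C'. measure lebesgue (cball i (5 * \<bar>h i\<bar>)))"
      by (intro measure_UNION_le C') auto
    also have "\<dots> = (\<Sum>i\<in>C'. 10 * \<bar>h i\<bar>)"
      by (intro sum.cong refl) (simp add: cball_eq_atLeastAtMost)
    also have "\<dots> \<le> \<epsilon>" using s by (simp add: sum_distrib_left[symmetric])
    finally show ?thesis .
  qed
  have meas: "cball i (5 * \<bar>h i\<bar>) \<in> lmeasurable" for i :: real by simp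
  show "\<exists>T. ?E \<subseteq> T \<and> T \<in> lmeasurable \<and> measure lebesgue T \<le> \<epsilon>"
    using C(4) fmeasurable_UN_bound[OF C(1) meas fin] measure_UN_bound[OF C(1) meas fin] by blast
qed

text \<open>Removing the deviating points for each threshold \<open>1 / (n + 1)\<close> removes
  countably many null sets. The derivative is one-sided at the end points, in agreement with the
  convention for curves.\<close>

theorem indefinite_integral_has_derivative_ae:
  fixes f :: "real \<Rightarrow> real"
  assumes f: "f integrable_on {a..b}"
  obtains N where "negligible N"
    "\<And>x. x \<in> {a..b} - N \<Longrightarrow> ((\<lambda>x. integral {a..x} f) has_real_derivative f x) (at x within {a..b})"
proof
  let ?N = "\<Union>n. deviating_points a b f (inverse (real (Suc n)))"
  show "negligible ?N"
    by (intro negligible_Union_nat negligible_deviating_points f) simp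
  fix x assume x: "x \<in> {a..b} - ?N"
  show "((\<lambda>x. integral {a..x} f) has_real_derivative f x) (at x within {a..b})"
    unfolding has_field_derivative_def has_derivative_within_alt
  proof (intro conjI allI impI)
    show "bounded_linear ((*) (f x))" by (rule bounded_linear_mult_right)
    fix e :: real assume "0 < e"
    then obtain n where n: "inverse (real (Suc n)) < e" using reals_Archimedean by blast
    from x have "x \<notin> deviating_points a b f (inverse (real (Suc n)))" "x \<in> {a..b}" by auto
    then obtain d where d: "d > 0" and dd: "\<And>h. 0 < \<bar>h\<bar> \<Longrightarrow> \<bar>h\<bar> < d \<Longrightarrow> x + h \<in> {a..b} \<Longrightarrow>
      \<bar>integral {a..x+h} f - integral {a..x} f - f x * h\<bar> < inverse (real (Suc n)) * \<bar>h\<bar>"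
      unfolding deviating_points_def mem_Collect_eq using not_le by blast
    show "\<exists>d>0. \<forall>y\<in>{a..b}. norm (y - x) < d \<longrightarrow>
      norm (integral {a..y} f - integral {a..x} f - f x * (y - x)) \<le> e * norm (y - x)"
    proof (intro exI[of _ d] conjI ballI impI d)
      fix y assume y: "y \<in> {a..b}" "norm (y - x) < d"
      show "norm (integral {a..y} f - integral {a..x} f - f x * (y - x)) \<le> e * norm (y - x)"
      proof (cases "y = x")
        case False
        then have "\<bar>integral {a..y} f - integral {a..x} f - f x * (y - x)\<bar> < inverse (real (Suc n)) * \<bar>y - x\<bar>"
          using dd[of "y - x"] y by auto
        also have "\<dots> \<le> e * \<bar>y - x\<bar>" using n by (intro mult_right_mono) auto
        finally show ?thesis by simp
      qed simp
    qed
  qed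
qed

section \<open>Absolutely continuous monotone functions\<close>

text \<open>The formula of \<open>absolutely_continuous_fun\<close> for values in any normed space:
  it is applied to the complex derivative of a curve and to its real tangent angle.\<close>

definition abs_cont :: "real \<Rightarrow> real \<Rightarrow> (real \<Rightarrow> 'a::real_normed_vector) \<Rightarrow> bool" where
  "abs_cont a b h \<longleftrightarrow>
     (\<forall>\<epsilon>>0. \<exists>\<delta>>0. \<forall>D. D division_of \<Union>D \<and> \<Union>D \<subseteq> {a..b} \<and> (\<Sum>k\<in>D. measure lborel k) < \<delta> \<longrightarrow>
        (\<Sum>k\<in>D. norm (h (Sup k) - h (Inf k))) < \<epsilon>)"

text \<open>A continuous monotone function is the distribution function of a finite measure.
  Absolute continuity makes this measure vanish on Lebesgue null sets, so it has a density by the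
  Radon-Nikodym theorem. Monotone functions are enough, because the tangent angle of an s-curve has
  two monotone phases.\<close>

lemma abs_cont_mono_density:
  fixes f :: "real \<Rightarrow> real"
  assumes ab: "a \<le> b" and mono: "mono_on {a..b} f" and cont: "continuous_on {a..b} f"
    and ac: "abs_cont a b f"
  obtains g where "g \<in> borel_measurable borel" "\<And>x. 0 \<le> g x"
    "\<And>x. x \<in> {a..b} \<Longrightarrow> (g has_integral (f x - f a)) {a..x}"
proof -
  \<comment> \<open>The extension is constant outside \<open>{a..b}\<close>, so the measure lives on
    the whole line without additional mass.\<close>
  define F where "F x = f (max a (min b x))" for x
  have clamp: "max a (min b x) \<in> {a..b}" for x using ab by auto
  have F_mono: "F x \<le> F y" if "x \<le> y" for x y
    unfolding F_def using that by (intro mono_onD[OF mono] clamp) auto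
  have F_eq: "F x = f x" if "x \<in> {a..b}" for x using that by (simp add: F_def)
  have F_cont: "continuous_on UNIV F"
    unfolding F_def by (rule continuous_on_compose2[OF cont]) (use ab in \<open>auto intro!: continuous_intros\<close>)
  define M where "M = interval_measure F"
  have sets_M [measurable_cong, simp]: "sets M = sets borel" by (simp add: M_def)
  have Icc: "emeasure M {x..y} = ennreal (F y - F x)" if "x \<le> y" for x y
    unfolding M_def by (rule emeasure_interval_measure_Icc[OF that F_mono F_cont])
  have F_bd: "f a \<le> F x" "F x \<le> f b" for x
    unfolding F_def using ab by (auto intro!: mono_onD[OF mono])
  have UNIV_le: "emeasure M UNIV \<le> ennreal (f b - f a)"
  proof -
    have "UNIV = (\<Union>n. {- real n..real n})"
      by (auto simp: Bex_def) (metis abs_le_iff minus_le_iff real_arch_simple)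
    then have "emeasure M UNIV = emeasure M (\<Union>n. {- real n..real n})" by simp
    also have "\<dots> = (SUP n. emeasure M {- real n..real n})"
      by (rule SUP_emeasure_incseq[symmetric]) (auto simp: incseq_def)
    also have "\<dots> \<le> ennreal (f b - f a)"
      using F_bd by (intro SUP_least) (simp add: Icc ennreal_leI diff_mono)
    finally show ?thesis .
  qed
  have M_ab: "emeasure M {a..b} = ennreal (f b - f a)" using Icc[OF ab] F_eq ab by simp
  have fin: "emeasure M (space M) \<noteq> \<infinity>" using UNIV_le by (auto simp: M_def top_unique)
  interpret M: finite_measure M by standard (use fin in auto)
  have M_compl: "emeasure M (UNIV - {a..b}) = 0"
  proof -
    have "emeasure M (UNIV - {a..b}) = emeasure M UNIV - emeasure M {a..b}"
      using emeasure_compl[of "{a..b}" M] fin M_ab by (simp add: M_def)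
    moreover have "emeasure M UNIV < top" using fin by (simp add: M_def less_top)
    ultimately show ?thesis using UNIV_le M_ab by (simp add: diff_eq_0_ennreal)
  qed
  have null: "emeasure M N = 0" if N: "N \<in> null_sets lborel" for N
  proof -
    \<comment> \<open>Inside the open interval, open neighbourhoods can be kept within
      \<open>{a..b}\<close>, where absolute continuity is available. The end points have no mass by
      continuity.\<close>
    let ?N = "N \<inter> {a<..<b}"
    have Nb: "N \<in> sets borel" using N by (auto simp: null_sets_def)
    have "emeasure lborel ?N \<le> emeasure lborel N" using Nb by (intro emeasure_mono) auto
    then have N0: "emeasure lborel ?N = 0" using null_setsD1[OF N] by simp
    have small: "emeasure M ?N \<le> ennreal e" if e: "e > 0" for e
    proof -
      obtain \<delta> where \<delta>: "\<delta> > 0" and ac0: "\<forall>D. D division_of \<Union>D \<and> \<Union>D \<subseteq> {a..b} \<and>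
          (\<Sum>k\<in>D. measure lborel k) < \<delta> \<longrightarrow> (\<Sum>k\<in>D. norm (f (Sup k) - f (Inf k))) < e"
        using ac[unfolded abs_cont_def, rule_format, OF e] by (elim exE conjE)
      obtain U where U: "open U" "?N \<subseteq> U" "emeasure lborel (U - ?N) < \<delta>"
        using outer_regular_lborel[OF _ \<delta>, of ?N] Nb by auto
      define W where "W = U \<inter> {a<..<b}"
      have W: "open W" "?N \<subseteq> W" using U by (auto simp: W_def)
      have "emeasure lborel W \<le> emeasure lborel (?N \<union> (U - ?N))"
        using U Nb by (intro emeasure_mono) (auto simp: W_def)
      also have "\<dots> \<le> emeasure lborel ?N + emeasure lborel (U - ?N)"
        using U Nb by (intro emeasure_subadditive) auto
      finally have W\<delta>: "emeasure lborel W < \<delta>" using U N0 by simp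
      \<comment> \<open>Inner regularity reduces the open set to its compact subsets, which finitely
        many intervals cover. These may overlap; a division of their union gives the non-overlapping
        family that absolute continuity speaks of.\<close>
      have "emeasure M K \<le> ennreal e" if K: "K \<subseteq> W" "compact K" for K
      proof -
        have "\<exists>u v. x \<in> box u v \<and> cbox u v \<subseteq> W" if "x \<in> K" for x
          by (rule open_contains_cbox[OF W(1) subsetD[OF K(1) that]]) blast
        then obtain u v where uv: "\<And>x. x \<in> K \<Longrightarrow> x \<in> box (u x) (v x)" "\<And>x. x \<in> K \<Longrightarrow> cbox (u x) (v x) \<subseteq> W"
          by metis
        have cov: "K \<subseteq> (\<Union>x\<in>K. box (u x) (v x))" using uv by auto
        obtain X where X: "X \<subseteq> K" "finite X" "K \<subseteq> (\<Union>x\<in>X. box (u x) (v x))"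
          by (rule compactE_image[OF K(2), of K "\<lambda>x. box (u x) (v x)", OF _ cov]) auto
        obtain p where p: "p division_of (\<Union>x\<in>X. cbox (u x) (v x))"
          by (rule elementary_unions_intervals[of "(\<lambda>x. cbox (u x) (v x)) ` X"]) (use X in auto)
        have Up: "\<Union>p = (\<Union>x\<in>X. cbox (u x) (v x))" using p by (auto simp: division_of_def)
        have UpW: "\<Union>p \<subseteq> W" using Up uv X by auto
        have kform: "\<exists>c d. c \<le> d \<and> k = {c..d}" if kp: "k \<in> p" for k
        proof -
          have "k \<noteq> {}" by (rule division_ofD(3)[OF p kp])
          moreover obtain c d where "k = {c..d}" using division_ofD(4)[OF p kp] by auto
          ultimately show ?thesis by (intro exI[of _ c] exI[of _ d]) auto
        qed
        have "(\<Sum>k\<in>p. measure lborel k) = (\<Sum>k\<in>p. measure lebesgue k)"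
          by (intro sum.cong refl measure_completion[symmetric]) (use kform in fastforce)
        also have "\<dots> = measure lebesgue (\<Union>p)"
          using content_division[of p "\<Union>p"] p Up by simp
        also have "\<dots> = measure lborel (\<Union>p)"
          using Up X(2) by (intro measure_completion) auto
        also have "\<dots> < \<delta>"
        proof -
          have "emeasure lborel (\<Union>p) \<le> emeasure lborel W"
            using W by (intro emeasure_mono UpW) auto
          then have lt: "emeasure lborel (\<Union>p) < ennreal \<delta>" using W\<delta> by simp
          then have "emeasure lborel (\<Union>p) = ennreal (measure lborel (\<Union>p))"
            by (intro emeasure_eq_ennreal_measure) (auto simp: top_unique)
          then show ?thesis using lt \<delta> by (simp add: ennreal_less_iff)
        qed
        finally have sm: "(\<Sum>k\<in>p. norm (f (Sup k) - f (Inf k))) < e"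
          using p UpW by (intro ac0[rule_format] conjI) (auto simp: Up W_def)
        have fp: "finite p" by (rule division_ofD(1)[OF p])
        have kM: "emeasure M k = ennreal (norm (f (Sup k) - f (Inf k)))" if kp: "k \<in> p" for k
        proof -
          obtain c d where k: "k = {c..d}" "c \<le> d" using kform[OF kp] by blast
          have "k \<subseteq> {a..b}" using UpW kp by (auto simp: W_def)
          then have cd: "c \<in> {a..b}" "d \<in> {a..b}" using k by auto
          then show ?thesis using k mono_onD[OF mono cd k(2)] by (simp add: Icc F_eq)
        qed
        have "emeasure M K \<le> emeasure M (\<Union>k\<in>p. k)"
        proof (rule emeasure_mono)
          have "(\<Union>x\<in>X. box (u x) (v x)) \<subseteq> (\<Union>x\<in>X. cbox (u x) (v x))"
            by (intro UN_mono box_subset_cbox order_refl)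
          then show "K \<subseteq> (\<Union>k\<in>p. k)" using X(3) Up by simp
          have "closed (\<Union>p)" using Up X(2) by auto
          then show "(\<Union>k\<in>p. k) \<in> sets M" by simp
        qed
        also have "\<dots> \<le> (\<Sum>k\<in>p. emeasure M k)"
          using fp kform by (intro emeasure_subadditive_finite) (auto simp: image_subset_iff, fastforce)
        also have "\<dots> = ennreal (\<Sum>k\<in>p. norm (f (Sup k) - f (Inf k)))"
          by (subst sum_ennreal[symmetric]) (auto simp: kM)
        also have "\<dots> \<le> ennreal e" using sm by (intro ennreal_leI) simp
        finally show ?thesis .
      qed
      then have "(SUP K \<in> {K. K \<subseteq> W \<and> compact K}. emeasure M K) \<le> ennreal e"
        by (intro SUP_least) auto
      then have "emeasure M W \<le> ennreal e"
        using inner_regular[of M W] fin W by simp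
      moreover have "emeasure M ?N \<le> emeasure M W" using W by (intro emeasure_mono) auto
      ultimately show ?thesis by simp
    qed
    have "emeasure M ?N = 0"
      using ennreal_le_epsilon[of 0 "emeasure M ?N"] small by simp
    then have "?N \<in> null_sets M" using Nb by (intro null_setsI) simp_all
    moreover have "{a} \<in> null_sets M" "{b} \<in> null_sets M"
      using Icc[of a a] Icc[of b b] by (intro null_setsI; simp)+
    moreover have "UNIV - {a..b} \<in> null_sets M" using M_compl by (intro null_setsI) simp_all
    ultimately have "(UNIV - {a..b}) \<union> ?N \<union> {a} \<union> {b} \<in> null_sets M"
      by (intro null_sets.Un)
    moreover have "N \<subseteq> (UNIV - {a..b}) \<union> ?N \<union> {a} \<union> {b}" by auto
    ultimately show ?thesis
      using Nb by (metis emeasure_mono le_zero_eq null_setsD1 null_setsD2)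
  qed
  have "absolutely_continuous lborel M"
    unfolding absolutely_continuous_def using null by (intro subsetI null_setsI) (simp_all add: null_sets_def)
  then have "\<exists>d\<in>borel_measurable lborel. density lborel d = M"
    by (rule sigma_finite_measure.Radon_Nikodym[OF sigma_finite_lborel]) simp
  then obtain d where d: "d \<in> borel_measurable lborel" "density lborel d = M" ..
  have [measurable]: "d \<in> borel_measurable borel" using d by simp
  have dint: "(\<integral>\<^sup>+x. d x * indicator A x \<partial>lborel) = emeasure M A" if "A \<in> sets borel" for A
    using that by (simp add: d(2)[symmetric] emeasure_density)
  have "(\<integral>\<^sup>+x. d x \<partial>lborel) \<noteq> \<infinity>" using dint[of UNIV] fin by (simp add: M_def)
  then have dfin: "AE x in lborel. d x \<noteq> \<infinity>" by (rule nn_integral_PInf_AE[OF d(1)])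
  \<comment> \<open>The density may be infinite on a null set, where \<open>enn2real\<close> gives
    0.\<close>
  define g where "g x = enn2real (d x)" for x
  show thesis
  proof (rule that[of g])
    show [measurable]: "g \<in> borel_measurable borel" unfolding g_def by simp
    show "0 \<le> g x" for x by (simp add: g_def)
    fix x assume x: "x \<in> {a..b}"
    have "(\<integral>\<^sup>+t. ennreal (g t * indicator {a..x} t) \<partial>lborel) = (\<integral>\<^sup>+t. d t * indicator {a..x} t \<partial>lborel)"
    proof (rule nn_integral_cong_AE)
      show "AE t in lborel. ennreal (g t * indicator {a..x} t) = d t * indicator {a..x} t"
        using dfin by eventually_elim (simp add: g_def indicator_def ennreal_enn2real_if)
    qed
    also have "\<dots> = ennreal (f x - f a)"
      using x by (simp add: dint Icc F_eq)
    finally have "((\<lambda>t. g t * indicator {a..x} t) has_integral (f x - f a)) UNIV"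
      using x ab mono_onD[OF mono, of a x] by (intro nn_integral_has_integral) (auto simp: g_def)
    then have "((\<lambda>t. if t \<in> {a..x} then g t else 0) has_integral (f x - f a)) UNIV"
      by (rule has_integral_eq[rotated]) (simp add: indicator_def)
    then show "(g has_integral (f x - f a)) {a..x}"
      by (simp only: has_integral_restrict_UNIV)
  qed
qed

section \<open>Primitives and change of speed\<close>

text \<open>The density is Borel rather than Lebesgue measurable so that it may be composed with
  time changes, shifts and reflections.\<close>

definition primitive_on :: "real \<Rightarrow> real \<Rightarrow> (real \<Rightarrow> real) \<Rightarrow> (real \<Rightarrow> real) \<Rightarrow> bool" where
  "primitive_on a b \<theta> \<omega> \<longleftrightarrow> \<omega> \<in> borel_measurable borel \<and> \<omega> absolutely_integrable_on {a..b} \<and>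
     (\<forall>x\<in>{a..b}. (\<omega> has_integral (\<theta> x - \<theta> a)) {a..x})"

lemma absolutely_integrable_on_iff_lborel:
  fixes f :: "real \<Rightarrow> 'a::euclidean_space"
  assumes "f \<in> borel_measurable borel"
  shows "f absolutely_integrable_on {a..b} \<longleftrightarrow> set_integrable lborel {a..b} f"
  unfolding set_integrable_def using assms by (intro integrable_completion) simp

lemma primitive_on_has_integral:
  assumes "primitive_on a b \<theta> \<omega>" "a \<le> x" "x \<le> y" "y \<le> b"
  shows "(\<omega> has_integral (\<theta> y - \<theta> x)) {x..y}"
proof -
  have 1: "(\<omega> has_integral (\<theta> x - \<theta> a)) {a..x}" "(\<omega> has_integral (\<theta> y - \<theta> a)) {a..y}"
    using assms by (auto simp: primitive_on_def)
  then have i: "\<omega> integrable_on {a..y}" by blast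
  have "\<omega> integrable_on {x..y}" by (rule integrable_subinterval_real[OF i]) (use assms in auto)
  moreover have "integral {x..y} \<omega> = \<theta> y - \<theta> x"
    using Henstock_Kurzweil_Integration.integral_combine[OF assms(2,3) i] 1[THEN integral_unique] by simp
  ultimately show ?thesis by (metis integrable_integral)
qed

lemma primitive_on_continuous:
  assumes "primitive_on a b \<theta> \<omega>"
  shows "continuous_on {a..b} \<theta>"
proof (cases "a \<le> b")
  case True
  then have "\<omega> integrable_on {a..b}" using primitive_on_has_integral[OF assms, of a b] by blast
  then have "continuous_on {a..b} (\<lambda>x. \<theta> a + integral {a..x} \<omega>)"
    by (intro continuous_intros indefinite_integral_continuous_1)
  then show ?thesis
    by (rule continuous_on_eq) (use assms in \<open>auto simp: primitive_on_def dest!: bspec integral_unique\<close>)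
qed simp

lemma primitive_on_subinterval:
  assumes "primitive_on a b \<theta> \<omega>" "a \<le> c" "d \<le> b"
  shows "primitive_on c d \<theta> \<omega>"
  unfolding primitive_on_def
proof (intro conjI ballI)
  show "\<omega> \<in> borel_measurable borel" using assms by (auto simp: primitive_on_def)
  show "\<omega> absolutely_integrable_on {c..d}"
    by (rule set_integrable_subset[of _ "{a..b}"]) (use assms in \<open>auto simp: primitive_on_def\<close>)
  show "(\<omega> has_integral (\<theta> x - \<theta> c)) {c..x}" if "x \<in> {c..d}" for x
    using assms that by (intro primitive_on_has_integral[OF assms(1)]) auto
qed

lemma primitive_on_ae_derivative:
  assumes "primitive_on a b \<theta> \<omega>"
  obtains N where "negligible N"
    "\<And>x. x \<in> {a..b} - N \<Longrightarrow> (\<theta> has_real_derivative \<omega> x) (at x within {a..b})"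
proof (cases "a \<le> b")
  case True
  then have i: "\<omega> integrable_on {a..b}" using primitive_on_has_integral[OF assms, of a b] by blast
  obtain N where N: "negligible N" "\<And>x. x \<in> {a..b} - N \<Longrightarrow>
      ((\<lambda>x. integral {a..x} \<omega>) has_real_derivative \<omega> x) (at x within {a..b})"
    by (rule indefinite_integral_has_derivative_ae[OF i]) blast
  have eq: "integral {a..x} \<omega> + \<theta> a = \<theta> x" if "x \<in> {a..b}" for x
    using assms that by (auto simp: primitive_on_def dest!: bspec integral_unique)
  show ?thesis
  proof (rule that[OF N(1)])
    fix x assume x: "x \<in> {a..b} - N"
    have "((\<lambda>x. integral {a..x} \<omega> + \<theta> a) has_real_derivative \<omega> x) (at x within {a..b})"
      using DERIV_add[OF N(2)[OF x] DERIV_const] by simp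
    then show "(\<theta> has_real_derivative \<omega> x) (at x within {a..b})"
      by (rule has_field_derivative_transform_within[OF _ zero_less_one]) (use x eq in auto)
  qed
qed (use that[of "{}"] in auto)

lemma primitive_on_uminus:
  assumes "primitive_on a b \<theta> \<omega>"
  shows "primitive_on a b (\<lambda>x. - \<theta> x) (\<lambda>x. - \<omega> x)"
  unfolding primitive_on_def
proof (intro conjI ballI)
  show "(\<lambda>x. - \<omega> x) \<in> borel_measurable borel" using assms by (auto simp: primitive_on_def)
  show "(\<lambda>x. - \<omega> x) absolutely_integrable_on {a..b}"
    using assms unfolding primitive_on_def set_integrable_def by simp
  show "((\<lambda>x. - \<omega> x) has_integral (- \<theta> x - - \<theta> a)) {a..x}" if "x \<in> {a..b}" for x
    using has_integral_neg[of \<omega> "\<theta> x - \<theta> a" "{a..x}"] assms that by (simp add: primitive_on_def)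
qed

lemma primitive_on_reverse:
  assumes "primitive_on 0 l \<theta> \<omega>"
  shows "primitive_on 0 l (\<lambda>x. \<theta> (l - x)) (\<lambda>x. - \<omega> (l - x))"
  unfolding primitive_on_def
proof (intro conjI ballI)
  have [measurable]: "\<omega> \<in> borel_measurable borel" using assms by (auto simp: primitive_on_def)
  show "(\<lambda>x. - \<omega> (l - x)) \<in> borel_measurable borel" by simp
  have refl: "(h has_integral y) {l-x..l} \<Longrightarrow> ((\<lambda>t. h (l - t)) has_integral y) {0..x}" if "0 \<le> x"
    for h :: "real \<Rightarrow> real" and x y
  proof -
    assume "(h has_integral y) {l-x..l}"
    then have "((\<lambda>t. h (- t)) has_integral y) (cbox (- l) (- (l - x)))"
      by (simp only: has_integral_reflect_real cbox_interval)
    from has_integral_affinity'[OF this, of 1 "- l"] show ?thesis by simp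
  qed
  show *: "((\<lambda>x. - \<omega> (l - x)) has_integral (\<theta> (l - x) - \<theta> (l - 0))) {0..x}" if "x \<in> {0..l}" for x
    using has_integral_neg[OF refl[OF _ primitive_on_has_integral[OF assms, of "l - x" l]]] that by simp
  show "(\<lambda>x. - \<omega> (l - x)) absolutely_integrable_on {0..l}"
  proof (cases "0 \<le> l")
    case True
    have "\<omega> absolutely_integrable_on {0..l}" using assms by (simp add: primitive_on_def)
    then have "(\<lambda>x. \<bar>\<omega> x\<bar>) integrable_on {0..l}"
      unfolding absolutely_integrable_on_def by simp
    then obtain y where "((\<lambda>x. \<bar>\<omega> x\<bar>) has_integral y) {l-l..l}" by auto
    from refl[OF True this] have "(\<lambda>x. \<bar>\<omega> (l - x)\<bar>) integrable_on {0..l}" by blast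
    moreover have "(\<lambda>x. - \<omega> (l - x)) integrable_on {0..l}" using *[of l] True by auto
    ultimately show ?thesis unfolding absolutely_integrable_on_def by simp
  qed simp
qed

lemma primitive_on_shift:
  assumes "primitive_on a b \<theta> \<omega>"
  shows "primitive_on (a + d) (b + d) (\<lambda>x. \<theta> (x - d)) (\<lambda>x. \<omega> (x - d))"
  unfolding primitive_on_def
proof (intro conjI ballI)
  have [measurable]: "\<omega> \<in> borel_measurable borel" using assms by (auto simp: primitive_on_def)
  show "(\<lambda>x. \<omega> (x - d)) \<in> borel_measurable borel" by simp
  have sh: "(h has_integral y) {a..x} \<Longrightarrow> ((\<lambda>t. h (t - d)) has_integral y) {a+d..x+d}"
    for h :: "real \<Rightarrow> real" and x y
  proof -
    assume "(h has_integral y) {a..x}"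
    from has_integral_affinity'[OF this[unfolded cbox_interval[symmetric]], of 1 "- d"]
    show ?thesis by simp
  qed
  show *: "((\<lambda>x. \<omega> (x - d)) has_integral (\<theta> (x - d) - \<theta> (a + d - d))) {a+d..x}" if "x \<in> {a+d..b+d}" for x
    using sh[OF primitive_on_has_integral[OF assms, of a "x - d"]] that by simp
  have "\<omega> absolutely_integrable_on {a..b}" using assms by (simp add: primitive_on_def)
  then have "(\<lambda>x. \<bar>\<omega> x\<bar>) integrable_on {a..b}" "\<omega> integrable_on {a..b}"
    unfolding absolutely_integrable_on_def by simp_all
  then obtain y y' where "((\<lambda>x. \<bar>\<omega> x\<bar>) has_integral y) {a..b}" "(\<omega> has_integral y') {a..b}" by auto
  from this[THEN sh]
  show "(\<lambda>x. \<omega> (x - d)) absolutely_integrable_on {a+d..b+d}"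
    unfolding absolutely_integrable_on_def by auto
qed

lemma nn_integral_interval_eq_integral:
  fixes f :: "real \<Rightarrow> real"
  assumes "f integrable_on {a..b}" "\<And>x. 0 \<le> f x"
  shows "(\<integral>\<^sup>+x\<in>{a..b}. ennreal (f x) \<partial>lborel) = ennreal (integral {a..b} f)"
  using nn_integral_has_integral_lebesgue'[of "{a..b}" f] assms by blast

lemma nn_integral_finite_imp_integrable:
  fixes f :: "real \<Rightarrow> real"
  assumes f: "f \<in> borel_measurable borel" "\<And>x. 0 \<le> f x"
    and fin: "(\<integral>\<^sup>+x\<in>{a..b}. ennreal (f x) \<partial>lborel) < top"
  shows "f integrable_on {a..b}"
proof -
  have eq: "(\<integral>\<^sup>+x. ennreal (f x * indicator {a..b} x) \<partial>lborel) = (\<integral>\<^sup>+x\<in>{a..b}. ennreal (f x) \<partial>lborel)"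
    by (intro nn_integral_cong) (auto simp: indicator_def)
  obtain r where r: "(\<integral>\<^sup>+x\<in>{a..b}. ennreal (f x) \<partial>lborel) = ennreal r" "0 \<le> r"
    using fin by (cases "\<integral>\<^sup>+x\<in>{a..b}. ennreal (f x) \<partial>lborel") auto
  have "((\<lambda>x. f x * indicator {a..b} x) has_integral r) UNIV"
    using f r eq by (intro nn_integral_has_integral) auto
  then have "((\<lambda>t. if t \<in> {a..b} then f t else 0) has_integral r) UNIV"
    by (rule has_integral_eq[rotated]) (simp add: indicator_def)
  then show ?thesis by (auto simp only: has_integral_restrict_UNIV)
qed

lemma bounded_borel_integrable:
  fixes v :: "real \<Rightarrow> real"
  assumes [measurable]: "v \<in> borel_measurable borel" and bd: "\<And>x. \<bar>v x\<bar> \<le> M"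
  shows "v integrable_on {x..y}"
proof -
  have "set_integrable lborel {x..y} v"
    unfolding set_integrable_def
  proof (rule integrableI_bounded_set_indicator[where B=M])
    show "emeasure lborel {x..y} < \<infinity>" by (cases "x \<le> y") auto
    show "AE z in lborel. z \<in> {x..y} \<longrightarrow> norm (v z) \<le> M" using bd by simp
  qed simp_all
  then show ?thesis by (rule set_borel_integral_eq_integral)
qed

text \<open>The speed is given on the whole line, which makes the signed distance
  \<open>travel\<close> a bijection of the reals. The lower bound \<open>m\<close> gives
  surjectivity and a Lipschitz inverse \<open>time_at\<close>.\<close>

locale positive_speed =
  fixes a :: real and v :: "real \<Rightarrow> real" and m :: real
  assumes v_borel [measurable]: "v \<in> borel_measurable borel"
    and m_pos: "0 < m" and v_ge: "\<And>x. m \<le> v x" and v_integrable: "\<And>x y. v integrable_on {x..y}"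
begin

definition travel :: "real \<Rightarrow> real" where
  "travel x = (if a \<le> x then integral {a..x} v else - integral {x..a} v)"

definition time_at :: "real \<Rightarrow> real" where
  "time_at = inv travel"

lemma v_pos: "0 < v x" using m_pos v_ge[of x] by simp

lemma travel_diff: "x \<le> y \<Longrightarrow> travel y - travel x = integral {x..y} v"
  using Henstock_Kurzweil_Integration.integral_combine[of a x y v] Henstock_Kurzweil_Integration.integral_combine[of x a y v]
    Henstock_Kurzweil_Integration.integral_combine[of x y a v] v_integrable
  by (auto simp: travel_def)

lemma travel_start [simp]: "travel a = 0" by (simp add: travel_def)

lemma travel_has_integral: "x \<le> y \<Longrightarrow> (v has_integral (travel y - travel x)) {x..y}"
  using travel_diff v_integrable by (simp add: has_integral_integrable_integral)

lemma travel_lower: "x \<le> y \<Longrightarrow> m * (y - x) \<le> travel y - travel x"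
  using has_integral_le[OF has_integral_const_real[of m x y] travel_has_integral[of x y]] v_ge
  by (simp add: mult.commute)

lemma travel_strict_mono: "strict_mono travel"
proof (rule strict_monoI)
  fix x y :: real assume "x < y"
  then have "0 < m * (y - x)" using m_pos by simp
  also have "\<dots> \<le> travel y - travel x" using travel_lower[of x y] \<open>x < y\<close> by simp
  finally show "travel x < travel y" by simp
qed

lemma travel_less_iff [simp]: "travel x < travel y \<longleftrightarrow> x < y"
  and travel_le_iff [simp]: "travel x \<le> travel y \<longleftrightarrow> x \<le> y"
  and travel_eq_iff [simp]: "travel x = travel y \<longleftrightarrow> x = y"
  using strict_mono_less[OF travel_strict_mono] strict_mono_less_eq[OF travel_strict_mono]
    strict_mono_eq[OF travel_strict_mono] by auto

lemma travel_continuous: "continuous_on S travel"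
proof -
  have "isCont travel x" for x
  proof -
    have "continuous_on {x-1..x+1} (\<lambda>y. travel (x-1) + integral {x-1..y} v)"
      by (intro continuous_intros indefinite_integral_continuous_1 v_integrable)
    then have "continuous_on {x-1..x+1} travel"
      by (rule continuous_on_eq) (auto simp: travel_diff[symmetric])
    then show ?thesis by (rule continuous_on_interior) simp
  qed
  then show ?thesis by (simp add: continuous_at_imp_continuous_on)
qed

lemma travel_surj: "surj travel"
  unfolding surj_def
proof
  fix s :: real
  define r where "r = \<bar>s\<bar> / m"
  have "r \<ge> 0" using m_pos by (simp add: r_def)
  have *: "m * r = \<bar>s\<bar>" using m_pos by (simp add: r_def)
  have "travel (a - r) \<le> s"
    using travel_lower[of "a - r" a] \<open>r \<ge> 0\<close> * by simp
  moreover have "s \<le> travel (a + r)"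
    using travel_lower[of a "a + r"] \<open>r \<ge> 0\<close> * by simp
  ultimately obtain x where "travel x = s"
    using IVT'[of travel "a - r" s "a + r"] travel_continuous \<open>r \<ge> 0\<close> by auto
  then show "\<exists>x. s = travel x" by blast
qed

lemma time_at_travel [simp]: "time_at (travel x) = x"
  unfolding time_at_def by (rule inv_f_f) (simp add: inj_def)

lemma travel_time_at [simp]: "travel (time_at s) = s"
  unfolding time_at_def by (rule surj_f_inv_f[OF travel_surj])

lemma time_at_less_iff [simp]: "time_at x < time_at y \<longleftrightarrow> x < y"
  and time_at_le_iff [simp]: "time_at x \<le> time_at y \<longleftrightarrow> x \<le> y"
  using travel_less_iff[of "time_at x" "time_at y"] travel_le_iff[of "time_at x" "time_at y"] by auto

lemma time_at_continuous: "continuous_on S time_at"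
proof (rule continuous_on_subset[OF lipschitz_on_continuous_on subset_UNIV])
  have "m * \<bar>time_at x - time_at y\<bar> \<le> \<bar>x - y\<bar>" for x y
    using travel_lower[of "time_at x" "time_at y"] travel_lower[of "time_at y" "time_at x"]
    by (cases "x \<le> y") (auto simp: abs_if)
  then show "(1/m)-lipschitz_on UNIV time_at"
    using m_pos by (intro lipschitz_onI) (auto simp: dist_real_def field_simps)
qed

lemma time_at_borel [measurable]: "time_at \<in> borel_measurable borel"
  and travel_borel [measurable]: "travel \<in> borel_measurable borel"
  by (intro borel_measurable_continuous_onI time_at_continuous travel_continuous)+

text \<open>Both measures agree on intervals, where the integral of the speed is the distance. This
  is the substitution rule for a speed that is merely integrable.\<close>

lemma lborel_eq_travel: "lborel = distr (density lborel (\<lambda>x. ennreal (v x))) borel travel"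
proof (rule lborel_eqI)
  fix l u :: real assume "\<And>b. b \<in> Basis \<Longrightarrow> l \<bullet> b \<le> u \<bullet> b"
  then have lu: "l \<le> u" by simp
  have pre: "travel -` box l u = {time_at l<..<time_at u}"
    unfolding box_real by (auto simp: vimage_def) (metis time_at_less_iff time_at_travel)+
  have "emeasure (distr (density lborel (\<lambda>x. ennreal (v x))) borel travel) (box l u)
      = (\<integral>\<^sup>+x\<in>{time_at l<..<time_at u}. ennreal (v x) \<partial>lborel)"
    by (simp add: emeasure_distr emeasure_density pre del: box_real)
  also have "\<dots> = (\<integral>\<^sup>+x\<in>{time_at l..time_at u}. ennreal (v x) \<partial>lborel)"
  proof (rule nn_integral_cong_AE)
    have "AE x in lborel. x \<noteq> time_at l" "AE x in lborel. x \<noteq> time_at u"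
      by (rule AE_lborel_singleton)+
    then show "AE x in lborel. ennreal (v x) * indicator {time_at l<..<time_at u} x =
        ennreal (v x) * indicator {time_at l..time_at u} x"
      by eventually_elim (auto simp: indicator_def)
  qed
  also have "\<dots> = ennreal (u - l)"
    using nn_integral_interval_eq_integral[OF v_integrable, of "time_at l" "time_at u"] lu
      less_imp_le[OF v_pos] travel_diff[of "time_at l" "time_at u"] by simp
  finally show "emeasure (distr (density lborel (\<lambda>x. ennreal (v x))) borel travel) (box l u) =
      ennreal (\<Prod>b\<in>Basis. (u - l) \<bullet> b)" by simp
qed simp

lemma integral_travel:
  fixes f :: "real \<Rightarrow> 'a::euclidean_space"
  assumes [measurable]: "f \<in> borel_measurable borel"
    and int: "(\<lambda>t. v t *\<^sub>R f (travel t)) absolutely_integrable_on {x..y}"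
  shows "f absolutely_integrable_on {travel x..travel y}"
    and "integral {travel x..travel y} f = integral {x..y} (\<lambda>t. v t *\<^sub>R f (travel t))"
proof -
  let ?g = "\<lambda>s. indicat_real {travel x..travel y} s *\<^sub>R f s"
  have g: "v t *\<^sub>R ?g (travel t) = indicat_real {x..y} t *\<^sub>R (v t *\<^sub>R f (travel t))" for t
    by (auto simp: indicator_def)
  have int': "set_integrable lborel {x..y} (\<lambda>t. v t *\<^sub>R f (travel t))"
    using int by (subst (asm) absolutely_integrable_on_iff_lborel) auto
  then have "integrable lborel (\<lambda>t. v t *\<^sub>R ?g (travel t))" unfolding set_integrable_def g .
  then have "integrable (density lborel (\<lambda>x. ennreal (v x))) (\<lambda>t. ?g (travel t))"
    by (rule integrable_density[THEN iffD2, rotated -1]) (auto simp: less_imp_le[OF v_pos])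
  then have "integrable (distr (density lborel (\<lambda>x. ennreal (v x))) borel travel) ?g"
    by (subst integrable_distr_eq) auto
  then have si: "set_integrable lborel {travel x..travel y} f"
    unfolding set_integrable_def lborel_eq_travel[symmetric] .
  then show "f absolutely_integrable_on {travel x..travel y}"
    by (subst absolutely_integrable_on_iff_lborel) auto
  have "integral\<^sup>L lborel ?g = integral\<^sup>L (distr (density lborel (\<lambda>x. ennreal (v x))) borel travel) ?g"
    using lborel_eq_travel by simp
  also have "\<dots> = integral\<^sup>L (density lborel (\<lambda>x. ennreal (v x))) (\<lambda>t. ?g (travel t))"
    by (subst integral_distr) auto
  also have "\<dots> = integral\<^sup>L lborel (\<lambda>t. v t *\<^sub>R ?g (travel t))"
    using v_pos by (subst integral_density) (auto simp: less_imp_le)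
  finally have "(LINT s:{travel x..travel y}|lborel. f s) = (LINT t:{x..y}|lborel. v t *\<^sub>R f (travel t))"
    unfolding set_lebesgue_integral_def g .
  then show "integral {travel x..travel y} f = integral {x..y} (\<lambda>t. v t *\<^sub>R f (travel t))"
    using set_borel_integral_eq_integral(2)[OF si] set_borel_integral_eq_integral(2)[OF int'] by simp
qed

text \<open>Since the angles are kept and the line element is multiplied by \<open>v\<close>, the
  curvature is divided by \<open>v\<close>.\<close>

lemma primitive_on_travel:
  assumes "primitive_on c d \<theta> \<omega>"
  shows "primitive_on (travel c) (travel d) (\<lambda>s. \<theta> (time_at s)) (\<lambda>s. \<omega> (time_at s) / v (time_at s))"
  unfolding primitive_on_def
proof (intro conjI ballI)
  have [measurable]: "\<omega> \<in> borel_measurable borel" using assms by (simp add: primitive_on_def)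
  show bm: "(\<lambda>s. \<omega> (time_at s) / v (time_at s)) \<in> borel_measurable borel" by simp
  have eq: "v t *\<^sub>R (\<omega> (time_at (travel t)) / v (time_at (travel t))) = \<omega> t" for t
    using v_pos[of t] by simp
  have *: "(\<lambda>s. \<omega> (time_at s) / v (time_at s)) absolutely_integrable_on {travel c..travel x} \<and>
     integral {travel c..travel x} (\<lambda>s. \<omega> (time_at s) / v (time_at s)) = integral {c..x} \<omega>" if "x \<le> d" for x
  proof -
    have "\<omega> absolutely_integrable_on {c..x}"
      using primitive_on_subinterval[OF assms order_refl that] by (simp add: primitive_on_def)
    then have "(\<lambda>t. v t *\<^sub>R (\<omega> (time_at (travel t)) / v (time_at (travel t)))) absolutely_integrable_on {c..x}"
      unfolding eq .
    from integral_travel[OF bm this] show ?thesis unfolding eq by blast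
  qed
  show "(\<lambda>s. \<omega> (time_at s) / v (time_at s)) absolutely_integrable_on {travel c..travel d}"
    using * by blast
  fix s assume s: "s \<in> {travel c..travel d}"
  then have t: "c \<le> time_at s" "time_at s \<le> d"
    by (metis atLeastAtMost_iff time_at_le_iff time_at_travel)+
  have "integral {c..time_at s} \<omega> = \<theta> (time_at s) - \<theta> c"
    using primitive_on_has_integral[OF assms order_refl t] by (rule integral_unique)
  then show "((\<lambda>s. \<omega> (time_at s) / v (time_at s)) has_integral (\<theta> (time_at s) - \<theta> (time_at (travel c)))) {travel c..s}"
    using *[OF t(2)] by (simp add: has_integral_iff set_lebesgue_integral_eq_integral(1))
qed

lemma integral_continuous_travel:
  fixes h :: "real \<Rightarrow> 'a::euclidean_space"
  assumes h: "continuous_on {c..d} h"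
  shows "integral {travel c..travel d} (\<lambda>s. h (time_at s)) = integral {c..d} (\<lambda>t. v t *\<^sub>R h t)"
proof -
  \<comment> \<open>Cutting \<open>h\<close> off outside the interval yields a Borel function on the
    line, as \<open>integral_travel\<close> requires.\<close>
  define g where "g t = (indicat_real {c..d} t) *\<^sub>R h t" for t
  have gb [measurable]: "g \<in> borel_measurable borel"
    unfolding g_def by (rule borel_measurable_continuous_on_indicator[OF _ h]) simp
  have "compact (h ` {c..d})" by (intro compact_continuous_image h) simp
  then obtain B where B: "\<And>t. t \<in> {c..d} \<Longrightarrow> norm (h t) \<le> B"
    by (meson bounded_iff compact_imp_bounded image_eqI)
  have "v absolutely_integrable_on {c..d}"
    by (rule nonnegative_absolutely_integrable_1[OF v_integrable]) (simp add: less_imp_le[OF v_pos])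
  then have "integrable lborel (\<lambda>t. B * (indicat_real {c..d} t *\<^sub>R v t))"
    by (subst (asm) absolutely_integrable_on_iff_lborel) (auto simp: set_integrable_def)
  then have "set_integrable lborel {c..d} (\<lambda>t. v t *\<^sub>R g t)"
    unfolding set_integrable_def
  proof (rule Bochner_Integration.integrable_bound)
    have "norm (v z *\<^sub>R g z) \<le> B * v z" if "z \<in> {c..d}" for z
      using v_pos[of z] mult_left_mono[OF B[OF that], of "v z"] that by (simp add: g_def abs_of_pos mult.commute)
    moreover have "0 \<le> B * v z" if "z \<in> {c..d}" for z
      using v_pos[of z] order_trans[OF norm_ge_zero B[OF that]] by simp
    ultimately show "AE z in lborel. norm (indicat_real {c..d} z *\<^sub>R v z *\<^sub>R g z)
        \<le> norm (B * (indicat_real {c..d} z *\<^sub>R v z))"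
      by (intro AE_I2) (simp add: indicator_def)
  qed measurable
  then have "(\<lambda>t. v t *\<^sub>R g (time_at (travel t))) absolutely_integrable_on {c..d}"
    by (subst absolutely_integrable_on_iff_lborel) auto
  from integral_travel(2)[OF _ this]
  have "integral {travel c..travel d} (\<lambda>s. g (time_at s)) = integral {c..d} (\<lambda>t. v t *\<^sub>R g t)" by simp
  moreover have "integral {travel c..travel d} (\<lambda>s. g (time_at s)) = integral {travel c..travel d} (\<lambda>s. h (time_at s))"
  proof (rule integral_cong)
    fix s assume "s \<in> {travel c..travel d}"
    then have "time_at s \<in> {c..d}" by (metis atLeastAtMost_iff time_at_le_iff time_at_travel)
    then show "g (time_at s) = h (time_at s)" by (simp add: g_def)
  qed
  moreover have "integral {c..d} (\<lambda>t. v t *\<^sub>R g t) = integral {c..d} (\<lambda>t. v t *\<^sub>R h t)"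
    by (rule integral_cong) (simp add: g_def)
  ultimately show ?thesis by simp
qed

end

section \<open>Arcs with prescribed displacement\<close>

definition s_shaped :: "real \<Rightarrow> real \<Rightarrow> (real \<Rightarrow> real) \<Rightarrow> bool" where
  "s_shaped a b \<theta> \<longleftrightarrow> (\<exists>c\<in>{a..b}.
     (mono_on {a..c} \<theta> \<and> antimono_on {c..b} \<theta> \<or> antimono_on {a..c} \<theta> \<and> mono_on {c..b} \<theta>) \<and>
     \<bar>\<theta> c - \<theta> a\<bar> \<le> pi \<and> \<bar>\<theta> b - \<theta> c\<bar> \<le> pi)"

text \<open>The variable is arclength, \<open>\<theta>\<close> the tangent angle and
  \<open>\<omega>\<close> the curvature; the curve itself is determined by the angle up to
  translation and is left out. Finite energy is part of the notion.\<close>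

definition s_arc :: "real \<Rightarrow> (real \<Rightarrow> real) \<Rightarrow> (real \<Rightarrow> real) \<Rightarrow> complex \<Rightarrow> bool" where
  "s_arc l \<theta> \<omega> V \<longleftrightarrow> 0 < l \<and> primitive_on 0 l \<theta> \<omega> \<and> s_shaped 0 l \<theta> \<and>
     integral {0..l} (\<lambda>x. cis (\<theta> x)) = V \<and> (\<lambda>x. (\<omega> x)\<^sup>2) integrable_on {0..l}"

text \<open>Four times the bending energy of the arc.\<close>

definition energy :: "real \<Rightarrow> (real \<Rightarrow> real) \<Rightarrow> real" where
  "energy l \<omega> = integral {0..l} (\<lambda>x. (\<omega> x)\<^sup>2)"

text \<open>The end angles are fixed as real numbers, so that a competitor can replace one arc of a
  longer curve without any change of the tangents at its nodes. The length is free.\<close>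

definition minimal_arc :: "real \<Rightarrow> (real \<Rightarrow> real) \<Rightarrow> (real \<Rightarrow> real) \<Rightarrow> complex \<Rightarrow> bool" where
  "minimal_arc l \<theta> \<omega> V \<longleftrightarrow> s_arc l \<theta> \<omega> V \<and>
     (\<forall>l' \<theta>' \<omega>'. s_arc l' \<theta>' \<omega>' V \<and> \<theta>' 0 = \<theta> 0 \<and> \<theta>' l' = \<theta> l \<longrightarrow> energy l \<omega> \<le> energy l' \<omega>')"

lemma energy_nonneg: "0 \<le> energy l \<omega>"
  unfolding energy_def by (cases "(\<lambda>x. (\<omega> x)\<^sup>2) integrable_on {0..l}")
    (auto intro: Henstock_Kurzweil_Integration.integral_nonneg simp: not_integrable_integral)

lemma monotone_on_uminus_iff:
  "mono_on S (\<lambda>x. - \<theta> x) \<longleftrightarrow> antimono_on S \<theta>" "antimono_on S (\<lambda>x. - \<theta> x) \<longleftrightarrow> mono_on S \<theta>"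
  for \<theta> :: "real \<Rightarrow> real"
  by (simp_all add: monotone_on_def)

lemma s_shaped_uminus: "s_shaped a b (\<lambda>x. - \<theta> x) \<longleftrightarrow> s_shaped a b \<theta>"
proof -
  have "\<bar>- x - - y\<bar> = \<bar>x - y\<bar>" for x y :: real by simp
  then show ?thesis unfolding s_shaped_def monotone_on_uminus_iff by (simp only: disj_commute)
qed

text \<open>A monotone reparametrisation respects the phases; surjectivity of \<open>g\<close>
  supplies a preimage of the turning point.\<close>

lemma s_shaped_monotone_image:
  assumes "s_shaped a b \<theta>"
    and g: "\<And>x. x \<in> {a'..b'} \<Longrightarrow> g x \<in> {a..b}" "\<And>x y. x \<le> y \<Longrightarrow> g x \<le> g y" "g a' = a" "g b' = b" "a' \<le> b'"
    and h: "\<And>x. x \<in> {a..b} \<Longrightarrow> \<exists>y\<in>{a'..b'}. g y = x"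
  shows "s_shaped a' b' (\<lambda>s. \<theta> (g s))"
proof -
  obtain c where c: "c \<in> {a..b}"
     "mono_on {a..c} \<theta> \<and> antimono_on {c..b} \<theta> \<or> antimono_on {a..c} \<theta> \<and> mono_on {c..b} \<theta>"
     "\<bar>\<theta> c - \<theta> a\<bar> \<le> pi" "\<bar>\<theta> b - \<theta> c\<bar> \<le> pi"
    using assms(1) unfolding s_shaped_def by blast
  obtain y where y: "y \<in> {a'..b'}" "g y = c" using h[OF c(1)] by blast
  have 1: "g x \<in> {a..c}" if "x \<in> {a'..y}" for x using g(1)[of x] g(2)[of x y] y that by auto
  have 2: "g x \<in> {c..b}" if "x \<in> {y..b'}" for x using g(1)[of x] g(2)[of y x] y that by auto
  show ?thesis
    unfolding s_shaped_def
  proof (intro bexI[of _ y] conjI y(1))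
    show "mono_on {a'..y} (\<lambda>s. \<theta> (g s)) \<and> antimono_on {y..b'} (\<lambda>s. \<theta> (g s)) \<or>
      antimono_on {a'..y} (\<lambda>s. \<theta> (g s)) \<and> mono_on {y..b'} (\<lambda>s. \<theta> (g s))"
      using c(2)
    proof (elim disjE conjE)
      assume *: "mono_on {a..c} \<theta>" "antimono_on {c..b} \<theta>"
      have "mono_on {a'..y} (\<lambda>s. \<theta> (g s))"
        by (intro monotone_onI monotone_onD[OF *(1)] 1 g(2))
      moreover have "antimono_on {y..b'} (\<lambda>s. \<theta> (g s))"
        by (intro monotone_onI monotone_onD[OF *(2)] 2 g(2))
      ultimately show ?thesis by simp
    next
      assume *: "antimono_on {a..c} \<theta>" "mono_on {c..b} \<theta>"
      have "antimono_on {a'..y} (\<lambda>s. \<theta> (g s))"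
        by (intro monotone_onI monotone_onD[OF *(1)] 1 g(2))
      moreover have "mono_on {y..b'} (\<lambda>s. \<theta> (g s))"
        by (intro monotone_onI monotone_onD[OF *(2)] 2 g(2))
      ultimately show ?thesis by simp
    qed
  qed (use c y g in auto)
qed

lemma s_shaped_reverse:
  assumes "s_shaped 0 l \<theta>"
  shows "s_shaped 0 l (\<lambda>x. \<theta> (l - x))"
proof -
  obtain c where c: "c \<in> {0..l}"
     "mono_on {0..c} \<theta> \<and> antimono_on {c..l} \<theta> \<or> antimono_on {0..c} \<theta> \<and> mono_on {c..l} \<theta>"
     "\<bar>\<theta> c - \<theta> 0\<bar> \<le> pi" "\<bar>\<theta> l - \<theta> c\<bar> \<le> pi"
    using assms unfolding s_shaped_def by blast
  have "mono_on {0..l-c} (\<lambda>x. \<theta> (l - x)) \<and> antimono_on {l-c..l} (\<lambda>x. \<theta> (l - x)) \<or>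
     antimono_on {0..l-c} (\<lambda>x. \<theta> (l - x)) \<and> mono_on {l-c..l} (\<lambda>x. \<theta> (l - x))"
    using c(2)
  proof (elim disjE conjE)
    assume *: "mono_on {0..c} \<theta>" "antimono_on {c..l} \<theta>"
    have "mono_on {0..l-c} (\<lambda>x. \<theta> (l - x))"
      by (rule monotone_onI, rule monotone_onD[OF *(2)]) auto
    moreover have "antimono_on {l-c..l} (\<lambda>x. \<theta> (l - x))"
      by (rule monotone_onI, rule monotone_onD[OF *(1)]) auto
    ultimately show ?thesis by simp
  next
    assume *: "antimono_on {0..c} \<theta>" "mono_on {c..l} \<theta>"
    have "antimono_on {0..l-c} (\<lambda>x. \<theta> (l - x))"
      by (rule monotone_onI, rule monotone_onD[OF *(2)]) auto
    moreover have "mono_on {l-c..l} (\<lambda>x. \<theta> (l - x))"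
      by (rule monotone_onI, rule monotone_onD[OF *(1)]) auto
    ultimately show ?thesis by simp
  qed
  then show ?thesis unfolding s_shaped_def using c
    by (intro bexI[of _ "l - c"] conjI) (auto simp: abs_minus_commute)
qed

lemma continuous_on_cis_angle:
  "continuous_on S \<theta> \<Longrightarrow> continuous_on S (\<lambda>x. cis (\<theta> x))" for \<theta> :: "real \<Rightarrow> real"
  unfolding cis_conv_exp by (intro continuous_intros)

lemma cis_integrable:
  "continuous_on {a..b} \<theta> \<Longrightarrow> (\<lambda>x. cis (\<theta> x)) integrable_on {a..b}" for \<theta> :: "real \<Rightarrow> real"
  by (intro integrable_continuous_real continuous_on_cis_angle)

text \<open>The chord has length \<open>2 * \<bar>sin ((a - b) / 2)\<bar>\<close>, and the sine is
  bounded by its argument.\<close>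

lemma norm_cis_diff_le: "norm (cis a - cis b) \<le> \<bar>a - b\<bar>"
proof -
  have "(norm (cis a - cis b))\<^sup>2 = (cos a - cos b)\<^sup>2 + (sin a - sin b)\<^sup>2"
    by (simp add: cmod_power2)
  also have "\<dots> = 2 - 2 * cos (a - b)"
    using sin_cos_squared_add3[of a] sin_cos_squared_add3[of b]
    by (simp add: cos_diff power2_eq_square algebra_simps)
  also have "\<dots> = (2 * sin ((a - b) / 2))\<^sup>2"
  proof -
    have "2 * ((a - b) / 2) = a - b" by simp
    with cos_double_sin[of "(a - b) / 2"] have "cos (a - b) = 1 - 2 * (sin ((a - b) / 2))\<^sup>2" by metis
    then show ?thesis by (simp add: power_mult_distrib)
  qed
  also have "\<dots> \<le> (2 * \<bar>(a - b) / 2\<bar>)\<^sup>2"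
    unfolding abs_le_square_iff[symmetric] using abs_sin_x_le_abs_x[of "(a - b) / 2"] by (simp add: abs_mult)
  finally show ?thesis by (simp add: abs_le_square_iff[symmetric])
qed

text \<open>With speed \<open>v\<close> the curvature becomes \<open>\<omega> / v\<close> and the
  line element is multiplied by \<open>v\<close>, so \<open>(\<omega> / v)\<^sup>2 * v\<close> is
  integrated. The speed may be unbounded, which is how an arc of infinite energy is turned into one
  of finite energy.\<close>

lemma arc_change_speed_integrable:
  assumes l: "0 < l" and p: "primitive_on 0 l \<theta> \<omega>" and s: "s_shaped 0 l \<theta>"
    and v: "v \<in> borel_measurable borel" "0 < m" "\<And>x. m \<le> v x" "\<And>x y. v integrable_on {x..y}"
    and i: "(\<lambda>x. (\<omega> x)\<^sup>2 / v x) integrable_on {0..l}"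
    and V: "integral {0..l} (\<lambda>x. v x *\<^sub>R cis (\<theta> x)) = V"
  obtains l' \<theta>' \<omega>' where "s_arc l' \<theta>' \<omega>' V" "\<theta>' 0 = \<theta> 0" "\<theta>' l' = \<theta> l"
    "energy l' \<omega>' = integral {0..l} (\<lambda>x. (\<omega> x)\<^sup>2 / v x)"
proof -
  interpret positive_speed 0 v m using v by unfold_locales auto
  have [measurable]: "\<omega> \<in> borel_measurable borel" using p by (simp add: primitive_on_def)
  let ?\<theta>' = "\<lambda>s. \<theta> (time_at s)" and ?\<omega>' = "\<lambda>s. \<omega> (time_at s) / v (time_at s)"
  have eq: "v t *\<^sub>R (?\<omega>' (travel t))\<^sup>2 = (\<omega> t)\<^sup>2 / v t" for t
    using v_pos[of t] by (simp add: power_divide power2_eq_square)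
  have t0: "time_at 0 = 0" using time_at_travel[of 0] by simp
  have tl: "0 < travel l" using travel_less_iff[of 0 l] l by (simp del: travel_less_iff)
  have "(\<lambda>x. (\<omega> x)\<^sup>2 / v x) absolutely_integrable_on {0..l}"
    by (rule nonnegative_absolutely_integrable_1[OF i]) (simp add: less_imp_le[OF v_pos])
  then have ai: "(\<lambda>t. v t *\<^sub>R (?\<omega>' (travel t))\<^sup>2) absolutely_integrable_on {0..l}" unfolding eq .
  have "(\<lambda>s. (?\<omega>' s)\<^sup>2) \<in> borel_measurable borel" by measurable
  note e = integral_travel[OF this ai, unfolded eq]
  have "s_shaped 0 (travel l) ?\<theta>'"
  proof (rule s_shaped_monotone_image[OF s])
    show "time_at x \<in> {0..l}" if "x \<in> {0..travel l}" for x
      using that time_at_le_iff[of 0 x] time_at_le_iff[of x "travel l"] by (simp add: t0 del: time_at_le_iff)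
    show "\<exists>y\<in>{0..travel l}. time_at y = x" if "x \<in> {0..l}" for x
      using that travel_le_iff[of 0 x] travel_le_iff[of x l]
      by (intro bexI[of _ "travel x"]) (simp_all del: travel_le_iff)
  qed (use t0 tl in auto)
  moreover have "primitive_on 0 (travel l) ?\<theta>' ?\<omega>'" using primitive_on_travel[OF p] by simp
  moreover have "integral {0..travel l} (\<lambda>x. cis (?\<theta>' x)) = V"
    using integral_continuous_travel[OF continuous_on_cis_angle[OF primitive_on_continuous[OF p]]] V by simp
  moreover have "(\<lambda>s. (?\<omega>' s)\<^sup>2) integrable_on {0..travel l}"
    using set_lebesgue_integral_eq_integral(1)[OF e(1)] by simp
  ultimately have "s_arc (travel l) ?\<theta>' ?\<omega>' V" using tl by (simp add: s_arc_def)
  then show thesis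
  proof (rule that)
    show "energy (travel l) ?\<omega>' = integral {0..l} (\<lambda>x. (\<omega> x)\<^sup>2 / v x)"
      using e(2) by (simp add: energy_def)
  qed (use t0 in simp_all)
qed

text \<open>A speed between positive bounds preserves square integrability of the curvature. This
  version serves for perturbations of speed 1.\<close>

lemma arc_change_speed:
  assumes l: "0 < l" and p: "primitive_on 0 l \<theta> \<omega>" and s: "s_shaped 0 l \<theta>"
    and i: "(\<lambda>x. (\<omega> x)\<^sup>2) integrable_on {0..l}"
    and v: "v \<in> borel_measurable borel" "0 < m" "\<And>x. m \<le> v x" "\<And>x. v x \<le> M"
    and V: "integral {0..l} (\<lambda>x. v x *\<^sub>R cis (\<theta> x)) = V"
  obtains l' \<theta>' \<omega>' where "s_arc l' \<theta>' \<omega>' V" "\<theta>' 0 = \<theta> 0" "\<theta>' l' = \<theta> l"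
    "(\<lambda>x. (\<omega> x)\<^sup>2 / v x) integrable_on {0..l}" "energy l' \<omega>' = integral {0..l} (\<lambda>x. (\<omega> x)\<^sup>2 / v x)"
proof -
  have [measurable]: "\<omega> \<in> borel_measurable borel" "v \<in> borel_measurable borel"
    using p v by (simp_all add: primitive_on_def)
  have vp: "0 < v x" for x using v(2) v(3)[of x] by linarith
  have "\<bar>v x\<bar> \<le> M" for x using vp[of x] v(4)[of x] by simp
  from bounded_borel_integrable[OF v(1) this] have vi: "v integrable_on {x..y}" for x y .
  have "(\<lambda>x. (\<omega> x)\<^sup>2) absolutely_integrable_on {0..l}"
    by (rule nonnegative_absolutely_integrable_1[OF i]) simp
  then have "(\<lambda>x. (\<omega> x)\<^sup>2 / v x) absolutely_integrable_on {0..l}"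
    unfolding set_integrable_def
  proof (rule Bochner_Integration.integrable_bound[OF integrable_mult_right[of "1/m"]])
    show "(\<lambda>x. indicat_real {0..l} x *\<^sub>R ((\<omega> x)\<^sup>2 / v x)) \<in> borel_measurable lebesgue"
      by (rule measurable_completion) measurable
    have "(\<omega> x)\<^sup>2 / v x \<le> (\<omega> x)\<^sup>2 / m" for x
      using v(2) v(3)[of x] by (intro divide_left_mono) (auto simp: vp)
    then show "AE x in lebesgue. norm (indicat_real {0..l} x *\<^sub>R ((\<omega> x)\<^sup>2 / v x))
        \<le> norm (1/m * (indicat_real {0..l} x *\<^sub>R (\<omega> x)\<^sup>2))"
      using v(2) vp by (auto simp: indicator_def abs_of_pos)
  qed
  then have ii: "(\<lambda>x. (\<omega> x)\<^sup>2 / v x) integrable_on {0..l}"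
    by (rule set_lebesgue_integral_eq_integral(1))
  show thesis
    by (rule arc_change_speed_integrable[OF l p s v(1-3) vi ii V]) (rule that[OF _ _ _ ii])
qed

lemma continuous_attains_between:
  fixes f :: "real \<Rightarrow> real"
  assumes cont: "continuous_on {a..b} f" and xy: "x \<in> {a..b}" "y \<in> {a..b}" and k: "f x \<le> k" "k \<le> f y"
  obtains z where "z \<in> {a..b}" "min x y \<le> z" "z \<le> max x y" "f z = k"
proof (cases "x \<le> y")
  case True
  have "continuous_on {x..y} f" by (rule continuous_on_subset[OF cont]) (use xy in auto)
  from IVT'[OF k True this] show thesis using that True xy by force
next
  case False
  then have "y \<le> x" by simp
  have "continuous_on {y..x} f" by (rule continuous_on_subset[OF cont]) (use xy in auto)
  from IVT2'[OF k \<open>y \<le> x\<close> this] show thesis using that False xy by force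
qed

lemma interval_near_point:
  fixes f :: "real \<Rightarrow> real"
  assumes "continuous_on {0..l} f" "0 < l" "x \<in> {0..l}" "0 < e"
  obtains p q where "p < q" "{p..q} \<subseteq> {0..l}" "\<And>t. t \<in> {p..q} \<Longrightarrow> \<bar>f t - f x\<bar> < e"
proof -
  obtain d where d: "d > 0" "\<And>y. y \<in> {0..l} \<Longrightarrow> dist y x < d \<Longrightarrow> dist (f y) (f x) < e"
    using assms unfolding continuous_on_iff by blast
  show thesis
  proof (rule that[of "max 0 (x - d/2)" "min l (x + d/2)"])
    show "max 0 (x - d/2) < min l (x + d/2)" using assms d by auto
    show "\<bar>f t - f x\<bar> < e" if t: "t \<in> {max 0 (x - d/2)..min l (x + d/2)}" for t
    proof -
      have "t \<in> {0..l}" "\<bar>t - x\<bar> < d" using t d(1) by (auto simp: abs_if)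
      then show ?thesis using d(2)[of t] by (simp add: dist_real_def)
    qed
  qed auto
qed

definition displacement :: "(real \<Rightarrow> real) \<Rightarrow> real \<Rightarrow> real \<Rightarrow> complex" where
  "displacement \<theta> p q = integral {p..q} (\<lambda>x. cis (\<theta> x))"

definition det2 :: "complex \<Rightarrow> complex \<Rightarrow> real" where
  "det2 z w = Re z * Im w - Im z * Re w"

lemma cramer: "det2 A B \<noteq> 0 \<Longrightarrow> (det2 W B / det2 A B) *\<^sub>R A + (det2 A W / det2 A B) *\<^sub>R B = W"
proof -
  assume "det2 A B \<noteq> 0"
  moreover have "det2 W B * Re A + det2 A W * Re B = Re W * det2 A B"
    "det2 W B * Im A + det2 A W * Im B = Im W * det2 A B"
    by (simp_all add: det2_def algebra_simps)
  ultimately show ?thesis by (simp add: complex_eq_iff add_divide_distrib[symmetric])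
qed

lemma det2_eq_Im: "det2 z w = Im (cnj z * w)"
  by (simp add: det2_def)

lemma det2_rotate: "det2 (cis u * A) (cis u * B) = det2 A B"
proof -
  have "cnj (cis u * A) * (cis u * B) = (cis (- u) * cis u) * (cnj A * B)"
    by (simp add: cis_cnj mult_ac)
  also have "\<dots> = cnj A * B" by (simp only: cis_mult) simp
  finally show ?thesis by (simp only: det2_eq_Im)
qed

lemma abs_det2_le: "\<bar>det2 z w\<bar> \<le> norm z * norm w"
  using abs_Im_le_cmod[of "cnj z * w"] by (simp add: norm_mult det2_eq_Im)

text \<open>Short intervals around two points with slightly different angles have displacements in
  nearly these two directions. Rotated by \<open>- \<mu>\<close>, where \<open>\<mu>\<close> is half
  way between the angles, both lie in the right half plane, one below and one above the real axis,
  so their determinant is positive.\<close>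

lemma independent_displacements:
  assumes cont: "continuous_on {0..l} \<theta>" and l: "0 < l"
    and nc: "x1 \<in> {0..l}" "y1 \<in> {0..l}" "\<theta> x1 < \<theta> y1"
  obtains p q p' q' where "p < q" "{p..q} \<subseteq> {0..l}" "p' < q'" "{p'..q'} \<subseteq> {0..l}"
    "det2 (displacement \<theta> p q) (displacement \<theta> p' q') \<noteq> 0"
proof -
  \<comment> \<open>At most 1, so that all relative angles stay within \<open>[-1, 1]\<close>, where
    the cosine is at least \<open>cos 1 > 0\<close> and the sine is increasing.\<close>
  define d where "d = min 1 (\<theta> y1 - \<theta> x1)"
  have d: "0 < d" "d \<le> 1" "\<theta> x1 + d \<le> \<theta> y1" using nc by (auto simp: d_def)
  obtain z where z: "z \<in> {0..l}" "\<theta> z = \<theta> x1 + d"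
  proof -
    obtain z where "z \<in> {0..l}" "\<theta> z = \<theta> x1 + d"
      by (rule continuous_attains_between[OF cont nc(1,2), of "\<theta> x1 + d"]) (use d in auto)
    then show ?thesis by (rule that)
  qed
  obtain p q where pq: "p < q" "{p..q} \<subseteq> {0..l}" "\<And>t. t \<in> {p..q} \<Longrightarrow> \<bar>\<theta> t - \<theta> x1\<bar> < d/4"
    by (rule interval_near_point[OF cont l nc(1), of "d/4"]) (use d in auto)
  obtain p' q' where pq': "p' < q'" "{p'..q'} \<subseteq> {0..l}" "\<And>t. t \<in> {p'..q'} \<Longrightarrow> \<bar>\<theta> t - \<theta> z\<bar> < d/4"
    by (rule interval_near_point[OF cont l z(1), of "d/4"]) (use d in auto)
  define \<mu> where "\<mu> = \<theta> x1 + d/2"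
  have rot: "cis (- \<mu>) * displacement \<theta> u w = displacement (\<lambda>t. \<theta> t - \<mu>) u w" for u w
    by (simp add: displacement_def integral_mult_right[symmetric] cis_mult add.commute)
  have ReIm: "Re (displacement (\<lambda>t. \<theta> t - \<mu>) u w) = integral {u..w} (\<lambda>t. cos (\<theta> t - \<mu>)) \<and>
      Im (displacement (\<lambda>t. \<theta> t - \<mu>) u w) = integral {u..w} (\<lambda>t. sin (\<theta> t - \<mu>))" if "{u..w} \<subseteq> {0..l}" for u w
  proof -
    have "(\<lambda>t. cis (\<theta> t - \<mu>)) integrable_on {u..w}"
      using continuous_on_subset[OF cont that] by (intro cis_integrable continuous_intros)
    from integral_linear[OF this bounded_linear_Re] integral_linear[OF this bounded_linear_Im]
    show ?thesis by (simp add: displacement_def o_def)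
  qed
  have ci: "(\<lambda>t. cos (\<theta> t - \<mu>)) integrable_on {u..w}" "(\<lambda>t. sin (\<theta> t - \<mu>)) integrable_on {u..w}"
    if "{u..w} \<subseteq> {0..l}" for u w
    using continuous_on_subset[OF cont that] by (auto intro!: integrable_continuous_real continuous_intros)
  have lower: "k * (w - u) \<le> integral {u..w} f" if "f integrable_on {u..w}" "\<And>t. t \<in> {u..w} \<Longrightarrow> k \<le> f t" "u < w"
    for f :: "real \<Rightarrow> real" and u w k
  proof -
    have "integral {u..w} (\<lambda>t. k) \<le> integral {u..w} f"
      using that by (intro integral_le) auto
    then show ?thesis using that by (simp add: mult.commute)
  qed
  have cos1: "cos 1 \<le> cos t" if "\<bar>t\<bar> \<le> 1" for t :: real
    using cos_monotone_0_pi_le[of "\<bar>t\<bar>" 1] that pi_gt3 by simp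
  have c1: "0 < cos (1::real)" by (rule cos_gt_zero) (use pi_gt3 in auto)
  have s1: "0 < sin (d/4)" using d pi_gt3 by (intro sin_gt_zero) auto
  have sinm: "sin (d/4) \<le> sin t" if "d/4 \<le> t" "t \<le> 1" for t
    using that d pi_gt3 by (intro sin_monotone_2pi_le) auto
  have b1: "- (3*d/4) < \<theta> t - \<mu> \<and> \<theta> t - \<mu> < - (d/4)" if "t \<in> {p..q}" for t
    using pq(3)[OF that] unfolding abs_less_iff \<mu>_def by linarith
  have b2: "d/4 < \<theta> t - \<mu> \<and> \<theta> t - \<mu> < 3*d/4" if "t \<in> {p'..q'}" for t
    using pq'(3)[OF that] z(2) unfolding abs_less_iff \<mu>_def by linarith
  have b1': "\<bar>\<theta> t - \<mu>\<bar> \<le> 1" if "t \<in> {p..q}" for t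
    using b1[OF that] d unfolding abs_le_iff by linarith
  have b2': "\<bar>\<theta> t - \<mu>\<bar> \<le> 1" if "t \<in> {p'..q'}" for t
    using b2[OF that] d unfolding abs_le_iff by linarith
  have b2'': "d/4 \<le> \<theta> t - \<mu>" "\<theta> t - \<mu> \<le> 1" if "t \<in> {p'..q'}" for t
    using b2[OF that] d by linarith+
  have R1: "0 < integral {p..q} (\<lambda>t. cos (\<theta> t - \<mu>))"
  proof -
    have "cos 1 * (q - p) \<le> integral {p..q} (\<lambda>t. cos (\<theta> t - \<mu>))"
      by (intro lower ci cos1 b1' pq)
    moreover have "0 < cos 1 * (q - p)" using c1 pq(1) by simp
    ultimately show ?thesis by linarith
  qed
  have R2: "0 < integral {p'..q'} (\<lambda>t. cos (\<theta> t - \<mu>))"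
  proof -
    have "cos 1 * (q' - p') \<le> integral {p'..q'} (\<lambda>t. cos (\<theta> t - \<mu>))"
      by (intro lower ci cos1 b2' pq')
    moreover have "0 < cos 1 * (q' - p')" using c1 pq'(1) by simp
    ultimately show ?thesis by linarith
  qed
  have I2: "0 < integral {p'..q'} (\<lambda>t. sin (\<theta> t - \<mu>))"
  proof -
    have "sin (d/4) * (q' - p') \<le> integral {p'..q'} (\<lambda>t. sin (\<theta> t - \<mu>))"
      by (intro lower ci sinm b2'' pq')
    moreover have "0 < sin (d/4) * (q' - p')" using s1 pq'(1) by simp
    ultimately show ?thesis by linarith
  qed
  have I1: "integral {p..q} (\<lambda>t. sin (\<theta> t - \<mu>)) < 0"
  proof -
    have "sin (d/4) \<le> - sin (\<theta> t - \<mu>)" if "t \<in> {p..q}" for t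
    proof -
      have "sin (d/4) \<le> sin (- (\<theta> t - \<mu>))"
        using b1[OF that] d by (intro sinm) linarith+
      then show ?thesis by (simp only: sin_minus)
    qed
    then have "sin (d/4) * (q - p) \<le> integral {p..q} (\<lambda>t. - sin (\<theta> t - \<mu>))"
      by (intro lower integrable_neg ci pq)
    moreover have "0 < sin (d/4) * (q - p)" using s1 pq(1) by simp
    ultimately show ?thesis unfolding integral_neg by linarith
  qed
  have "0 < det2 (cis (- \<mu>) * displacement \<theta> p q) (cis (- \<mu>) * displacement \<theta> p' q')"
    unfolding rot det2_def using ReIm[OF pq(2)] ReIm[OF pq'(2)] mult_pos_pos[OF R1 I2] mult_neg_pos[OF I1 R2]
    by simp
  then have "0 < det2 (displacement \<theta> p q) (displacement \<theta> p' q')" by (simp only: det2_rotate)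
  then show thesis using that[OF pq(1,2) pq'(1,2)] by simp
qed

lemma has_integral_indicator_interval:
  fixes f :: "real \<Rightarrow> 'a::euclidean_space"
  assumes f: "f integrable_on {0..l}" and sub: "{p..q} \<subseteq> {0..l}"
  shows "((\<lambda>t. indicat_real {p..q} t *\<^sub>R f t) has_integral integral {p..q} f) {0..l}"
proof -
  have "f integrable_on {p..q}" by (rule integrable_on_subinterval[OF f sub])
  then have "(f has_integral integral {p..q} f) {p..q}" by (rule integrable_integral)
  then have "((\<lambda>t. if t \<in> {p..q} then f t else 0) has_integral integral {p..q} f) {0..l}"
    by (simp only: has_integral_restrict[OF sub])
  then show ?thesis by (rule has_integral_eq[rotated]) (simp add: indicator_def)
qed

lemma displacement_norm_le:
  assumes "continuous_on {0..l} \<theta>" "{p..q} \<subseteq> {0..l}" "0 < l"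
  shows "norm (displacement \<theta> p q) \<le> l"
proof (cases "p \<le> q")
  case True
  have "norm (displacement \<theta> p q) \<le> integral {p..q} (\<lambda>x. 1::real)"
    unfolding displacement_def
    by (rule Henstock_Kurzweil_Integration.integral_norm_bound_integral)
      (use continuous_on_subset[OF assms(1,2)] in \<open>auto intro!: cis_integrable\<close>)
  then show ?thesis using assms True by auto
qed (use assms in \<open>simp add: displacement_def\<close>)

lemma displacement_diff_le:
  assumes cont: "continuous_on {0..l} \<theta>" "continuous_on {0..l} \<theta>'" and sub: "{p..q} \<subseteq> {0..l}"
  shows "norm (displacement \<theta>' p q - displacement \<theta> p q) \<le> integral {0..l} (\<lambda>x. \<bar>\<theta>' x - \<theta> x\<bar>)"
proof -
  have c: "continuous_on {p..q} \<theta>" "continuous_on {p..q} \<theta>'" using cont sub by (auto intro: continuous_on_subset)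
  have i: "(\<lambda>x. \<bar>\<theta>' x - \<theta> x\<bar>) integrable_on {0..l}" "(\<lambda>x. \<bar>\<theta>' x - \<theta> x\<bar>) integrable_on {p..q}"
    by (intro integrable_continuous_real continuous_intros cont c)+
  have "displacement \<theta>' p q - displacement \<theta> p q = integral {p..q} (\<lambda>x. cis (\<theta>' x) - cis (\<theta> x))"
    unfolding displacement_def by (intro Henstock_Kurzweil_Integration.integral_diff[symmetric] cis_integrable c)
  also have "norm \<dots> \<le> integral {p..q} (\<lambda>x. \<bar>\<theta>' x - \<theta> x\<bar>)"
    by (rule Henstock_Kurzweil_Integration.integral_norm_bound_integral)
      (auto intro!: integrable_diff cis_integrable c i norm_cis_diff_le)
  also have "\<dots> \<le> integral {0..l} (\<lambda>x. \<bar>\<theta>' x - \<theta> x\<bar>)"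
    by (rule integral_subset_le[OF sub i(2,1)]) simp
  finally show ?thesis .
qed

text \<open>Passing from \<open>\<theta>\<close> to \<open>\<theta>'\<close> changes every
  displacement by at most the L1 distance \<open>D\<close>. Altering the speed by
  \<open>O(D)\<close> on two intervals with independent displacements restores the total one, and
  affects neither the end angles nor the shape of \<open>\<theta>'\<close>. The constants are chosen
  before \<open>\<theta>'\<close>, so that they serve for a whole family of variations.\<close>

lemma compensate_displacement:
  assumes cont: "continuous_on {0..l} \<theta>" and l: "0 < l"
    and nc: "x1 \<in> {0..l}" "y1 \<in> {0..l}" "\<theta> x1 < \<theta> y1"
  obtains C \<delta> where "0 \<le> C" "0 < \<delta>"
    "\<And>\<theta>' \<omega>'. primitive_on 0 l \<theta>' \<omega>' \<Longrightarrow> s_shaped 0 l \<theta>' \<Longrightarrow> (\<lambda>x. (\<omega>' x)\<^sup>2) integrable_on {0..l} \<Longrightarrow>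
       integral {0..l} (\<lambda>x. \<bar>\<theta>' x - \<theta> x\<bar>) \<le> \<delta> \<Longrightarrow>
       \<exists>l'' \<theta>'' \<omega>''. s_arc l'' \<theta>'' \<omega>'' (displacement \<theta> 0 l) \<and> \<theta>'' 0 = \<theta>' 0 \<and> \<theta>'' l'' = \<theta>' l \<and>
         energy l'' \<omega>'' \<le> (1 + C * integral {0..l} (\<lambda>x. \<bar>\<theta>' x - \<theta> x\<bar>)) * energy l \<omega>'"
proof -
  obtain p q p' q' where I: "p < q" "{p..q} \<subseteq> {0..l}" "p' < q'" "{p'..q'} \<subseteq> {0..l}"
    and det0: "det2 (displacement \<theta> p q) (displacement \<theta> p' q') \<noteq> 0"
    by (rule independent_displacements[OF cont l nc])
  define d where "d = \<bar>det2 (displacement \<theta> p q) (displacement \<theta> p' q')\<bar>"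
  have d: "0 < d" using det0 by (simp add: d_def)
  \<comment> \<open>For \<open>D \<le> \<delta>\<close> the determinant changes by at most
    \<open>2 * l * D \<le> d / 4\<close> and stays above \<open>d / 2\<close>. Cramer's rule bounds
    each correction by \<open>2 * l * D / d\<close>, so the speed differs from 1 by at most
    \<open>r = 4 * l * D / d \<le> 1/2\<close>; then
    \<open>1 / v \<le> 1 + 2 * r = 1 + C * D\<close>.\<close>
  define C where "C = 8 * l / d"
  define \<delta> where "\<delta> = d / (8 * l)"
  show thesis
  proof (rule that)
    show "0 \<le> C" "0 < \<delta>" using l d by (simp_all add: C_def \<delta>_def)
    fix \<theta>' \<omega>' assume p': "primitive_on 0 l \<theta>' \<omega>'" and s': "s_shaped 0 l \<theta>'"
      and i': "(\<lambda>x. (\<omega>' x)\<^sup>2) integrable_on {0..l}" and D\<delta>: "integral {0..l} (\<lambda>x. \<bar>\<theta>' x - \<theta> x\<bar>) \<le> \<delta>"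
    define D where "D = integral {0..l} (\<lambda>x. \<bar>\<theta>' x - \<theta> x\<bar>)"
    have c': "continuous_on {0..l} \<theta>'" by (rule primitive_on_continuous[OF p'])
    have D0: "0 \<le> D" unfolding D_def
      by (intro Henstock_Kurzweil_Integration.integral_nonneg integrable_continuous_real continuous_intros cont c') simp
    define A B where "A = displacement \<theta>' p q" and "B = displacement \<theta>' p' q'"
    define W where "W = displacement \<theta> 0 l - displacement \<theta>' 0 l"
    have W: "norm W \<le> D"
      unfolding W_def D_def using displacement_diff_le[OF cont c', of 0 l] by (simp add: norm_minus_commute)
    have A: "norm A \<le> l" "norm (A - displacement \<theta> p q) \<le> D"
      and B: "norm B \<le> l" "norm (B - displacement \<theta> p' q') \<le> D"
      unfolding A_def B_def D_def using I l c' cont by (auto intro!: displacement_norm_le displacement_diff_le)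
    have "det2 A B - det2 (displacement \<theta> p q) (displacement \<theta> p' q') =
        det2 (A - displacement \<theta> p q) B + det2 (displacement \<theta> p q) (B - displacement \<theta> p' q')"
      by (simp add: det2_def algebra_simps)
    also have "\<bar>\<dots>\<bar> \<le> D * l + l * D"
      by (intro order_trans[OF abs_triangle_ineq] add_mono order_trans[OF abs_det2_le] mult_mono
          A B displacement_norm_le[OF cont I(2) l]) (use D0 l in auto)
    also have "\<dots> \<le> d / 4" using D\<delta> l by (simp add: D_def[symmetric] \<delta>_def field_simps)
    finally have det: "d / 2 \<le> \<bar>det2 A B\<bar>" using d unfolding d_def by linarith
    then have detn: "det2 A B \<noteq> 0" using d by auto
    define x y where "x = det2 W B / det2 A B" and "y = det2 A W / det2 A B"
    have xy: "\<bar>x\<bar> \<le> 2 * l * D / d" "\<bar>y\<bar> \<le> 2 * l * D / d"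
    proof -
      have "\<bar>det2 W B\<bar> \<le> D * l" "\<bar>det2 A W\<bar> \<le> l * D"
        by (intro order_trans[OF abs_det2_le] mult_mono A B W D0; use l in simp)+
      then have "\<bar>x\<bar> \<le> (D * l) / (d/2)" "\<bar>y\<bar> \<le> (l * D) / (d/2)"
        unfolding x_def y_def abs_divide using det d D0 l by (intro frac_le; simp)+
      then show "\<bar>x\<bar> \<le> 2 * l * D / d" "\<bar>y\<bar> \<le> 2 * l * D / d" by (simp_all add: mult_ac)
    qed
    have xyW: "x *\<^sub>R A + y *\<^sub>R B = W" unfolding x_def y_def by (rule cramer[OF detn])
    define v where "v t = 1 + x * indicat_real {p..q} t + y * indicat_real {p'..q'} t" for t
    define r where "r = 4 * l * D / d"
    have r: "0 \<le> r" "r \<le> 1/2" "C * D = 2 * r"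
      using D0 l d D\<delta> by (auto simp: r_def C_def D_def[symmetric] \<delta>_def field_simps)
    have v1: "\<bar>v t - 1\<bar> \<le> r" for t
    proof -
      have "\<bar>v t - 1\<bar> \<le> \<bar>x\<bar> + \<bar>y\<bar>" by (auto simp: v_def indicator_def)
      also have "\<dots> \<le> 2 * l * D / d + 2 * l * D / d" by (rule add_mono[OF xy])
      finally show ?thesis by (simp add: r_def mult_ac)
    qed
    have vb: "1/2 \<le> v t" "v t \<le> 3/2" for t using v1[of t] r(2) by (auto simp: abs_le_iff)
    have [measurable]: "v \<in> borel_measurable borel" unfolding v_def by measurable
    have ci: "(\<lambda>t. cis (\<theta>' t)) integrable_on {0..l}" by (rule cis_integrable[OF c'])
    have "((\<lambda>t. cis (\<theta>' t) + x *\<^sub>R (indicat_real {p..q} t *\<^sub>R cis (\<theta>' t)) + y *\<^sub>R (indicat_real {p'..q'} t *\<^sub>R cis (\<theta>' t)))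
        has_integral (displacement \<theta>' 0 l + x *\<^sub>R A + y *\<^sub>R B)) {0..l}"
      unfolding displacement_def A_def B_def
      by (intro has_integral_add has_integral_cmul integrable_integral ci has_integral_indicator_interval I)
    moreover have "displacement \<theta>' 0 l + x *\<^sub>R A + y *\<^sub>R B = displacement \<theta> 0 l"
      using xyW by (simp add: W_def add.assoc)
    moreover have "cis (\<theta>' t) + x *\<^sub>R (indicat_real {p..q} t *\<^sub>R cis (\<theta>' t)) + y *\<^sub>R (indicat_real {p'..q'} t *\<^sub>R cis (\<theta>' t)) =
       v t *\<^sub>R cis (\<theta>' t)" for t by (simp add: v_def scaleR_add_left)
    ultimately have "integral {0..l} (\<lambda>t. v t *\<^sub>R cis (\<theta>' t)) = displacement \<theta> 0 l"
      by (simp add: integral_unique)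
    from arc_change_speed[OF l p' s' i' _ _ vb this]
    obtain l'' \<theta>'' \<omega>'' where a: "s_arc l'' \<theta>'' \<omega>'' (displacement \<theta> 0 l)" "\<theta>'' 0 = \<theta>' 0" "\<theta>'' l'' = \<theta>' l"
      "(\<lambda>x. (\<omega>' x)\<^sup>2 / v x) integrable_on {0..l}" "energy l'' \<omega>'' = integral {0..l} (\<lambda>x. (\<omega>' x)\<^sup>2 / v x)"
      by auto
    have "energy l'' \<omega>'' \<le> integral {0..l} (\<lambda>x. (1 + 2 * r) * (\<omega>' x)\<^sup>2)"
      unfolding a(5)
    proof (rule integral_le[OF a(4)])
      show "(\<lambda>x. (1 + 2 * r) * (\<omega>' x)\<^sup>2) integrable_on {0..l}"
        by (intro integrable_on_mult_right i')
      fix t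
      have "1 \<le> (1 + 2 * r) * (1 - r)"
      proof -
        have "0 \<le> r * (1 - 2 * r)" using r by simp
        then show ?thesis by (simp add: algebra_simps)
      qed
      also have "\<dots> \<le> (1 + 2 * r) * v t" using v1[of t] r(1) by (intro mult_left_mono) (auto simp: abs_le_iff)
      finally have "1 / v t \<le> 1 + 2 * r" using vb(1)[of t] by (simp add: pos_divide_le_eq)
      then have "(1 / v t) * (\<omega>' t)\<^sup>2 \<le> (1 + 2 * r) * (\<omega>' t)\<^sup>2" by (intro mult_right_mono) auto
      then show "(\<omega>' t)\<^sup>2 / v t \<le> (1 + 2 * r) * (\<omega>' t)\<^sup>2" by simp
    qed
    also have "\<dots> = (1 + C * D) * energy l \<omega>'" by (simp add: energy_def r(3))
    finally show "\<exists>l'' \<theta>'' \<omega>''. s_arc l'' \<theta>'' \<omega>'' (displacement \<theta> 0 l) \<and> \<theta>'' 0 = \<theta>' 0 \<and> \<theta>'' l'' = \<theta>' l \<and>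
         energy l'' \<omega>'' \<le> (1 + C * integral {0..l} (\<lambda>x. \<bar>\<theta>' x - \<theta> x\<bar>)) * energy l \<omega>'"
      using a(1-3) unfolding D_def by blast
  qed
qed

section \<open>The Euler--Lagrange equation\<close>

lemma linear_le_quadratic_imp_zero:
  fixes k :: real
  assumes "0 < e" "\<And>t. \<bar>t\<bar> \<le> e \<Longrightarrow> t * k \<le> K * t\<^sup>2"
  shows "k = 0"
proof (rule ccontr)
  assume k: "k \<noteq> 0"
  \<comment> \<open>Small enough that the hypothesis applies to \<open>t * k\<close> and that
    \<open>K * t\<close> is at most 1/2.\<close>
  define t where "t = min (e / \<bar>k\<bar>) (1 / (2 * (\<bar>K\<bar> + 1)))"
  have t: "0 < t" using assms(1) k by (simp add: t_def)
  have "t \<le> e / \<bar>k\<bar>" by (simp add: t_def)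
  then have "\<bar>t * k\<bar> \<le> e" using k t by (simp add: abs_mult field_simps)
  from assms(2)[OF this] have "t * k\<^sup>2 \<le> K * t * (t * k\<^sup>2)" by (simp add: power2_eq_square algebra_simps)
  then have "1 \<le> K * t" using t k by (simp add: mult_le_cancel_right1 zero_less_mult_iff)
  also have "\<dots> \<le> (\<bar>K\<bar> + 1) * t" using t by (intro mult_right_mono) auto
  also have "\<dots> \<le> (\<bar>K\<bar> + 1) * (1 / (2 * (\<bar>K\<bar> + 1)))" by (intro mult_left_mono) (auto simp: t_def)
  also have "\<dots> = 1/2" by (simp add: field_simps)
  finally show False by simp
qed

text \<open>If \<open>h\<close> leaves the displacement unchanged, the speed
  \<open>1 + \<epsilon> * h\<close> is admissible for both signs of \<open>\<epsilon>\<close>, so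
  the integral of \<open>h * \<omega>\<^sup>2\<close> vanishes. For \<open>h\<close> the indicator
  of an interval minus the combination of two reference indicators with the same displacement, this
  shows that the energy of an interval is a linear function of its displacement.\<close>

lemma euler_lagrange:
  assumes min: "minimal_arc l \<theta> \<omega> V" and nc: "x1 \<in> {0..l}" "y1 \<in> {0..l}" "\<theta> x1 < \<theta> y1"
  obtains \<Lambda> where "\<And>u w. {u..w} \<subseteq> {0..l} \<Longrightarrow> integral {u..w} (\<lambda>x. (\<omega> x)\<^sup>2) = Re (cnj \<Lambda> * displacement \<theta> u w)"
proof -
  have l: "0 < l" and p: "primitive_on 0 l \<theta> \<omega>" and s: "s_shaped 0 l \<theta>"
    and V: "displacement \<theta> 0 l = V" and i: "(\<lambda>x. (\<omega> x)\<^sup>2) integrable_on {0..l}"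
    using min by (auto simp: minimal_arc_def s_arc_def displacement_def)
  have cont: "continuous_on {0..l} \<theta>" by (rule primitive_on_continuous[OF p])
  have ci: "(\<lambda>t. cis (\<theta> t)) integrable_on {0..l}" by (rule cis_integrable[OF cont])
  obtain p q p' q' where I: "p < q" "{p..q} \<subseteq> {0..l}" "p' < q'" "{p'..q'} \<subseteq> {0..l}"
    and det0: "det2 (displacement \<theta> p q) (displacement \<theta> p' q') \<noteq> 0"
    by (rule independent_displacements[OF cont l nc])
  let ?e = "\<lambda>u w. integral {u..w} (\<lambda>x. (\<omega> x)\<^sup>2)"
  let ?A = "displacement \<theta> p q" and ?B = "displacement \<theta> p' q'"
  let ?d = "det2 ?A ?B"
  \<comment> \<open>The solution, by Cramer's rule, of the two linear equations for the reference
    intervals.\<close>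
  define \<Lambda> where "\<Lambda> = Complex ((Im ?B * ?e p q - Im ?A * ?e p' q') / ?d) ((Re ?A * ?e p' q' - Re ?B * ?e p q) / ?d)"
  show thesis
  proof (rule that[of \<Lambda>])
    fix u w assume J: "{u..w} \<subseteq> {0..l}"
    let ?Z = "displacement \<theta> u w"
    define x y where "x = det2 ?Z ?B / ?d" and "y = det2 ?A ?Z / ?d"
    have xy: "x *\<^sub>R ?A + y *\<^sub>R ?B = ?Z" unfolding x_def y_def by (rule cramer[OF det0])
    define h where "h t = indicat_real {u..w} t - x * indicat_real {p..q} t - y * indicat_real {p'..q'} t" for t
    define H where "H = 1 + \<bar>x\<bar> + \<bar>y\<bar>"
    have H: "1 \<le> H" by (simp add: H_def)
    have hH: "\<bar>h t\<bar> \<le> H" for t by (auto simp: h_def H_def indicator_def abs_if)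
    have [measurable]: "h \<in> borel_measurable borel" unfolding h_def by measurable
    define k where "k = ?e u w - x * ?e p q - y * ?e p' q'"
    have hk: "((\<lambda>t. h t * (\<omega> t)\<^sup>2) has_integral k) {0..l}"
    proof -
      have "((\<lambda>t. indicat_real {u..w} t *\<^sub>R (\<omega> t)\<^sup>2 - x *\<^sub>R (indicat_real {p..q} t *\<^sub>R (\<omega> t)\<^sup>2)
         - y *\<^sub>R (indicat_real {p'..q'} t *\<^sub>R (\<omega> t)\<^sup>2)) has_integral (?e u w - x *\<^sub>R ?e p q - y *\<^sub>R ?e p' q')) {0..l}"
        by (intro has_integral_diff has_integral_cmul has_integral_indicator_interval I J i)
      then show ?thesis by (simp add: h_def k_def algebra_simps)
    qed
    have hc: "((\<lambda>t. h t *\<^sub>R cis (\<theta> t)) has_integral 0) {0..l}"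
    proof -
      have "((\<lambda>t. indicat_real {u..w} t *\<^sub>R cis (\<theta> t) - x *\<^sub>R (indicat_real {p..q} t *\<^sub>R cis (\<theta> t))
         - y *\<^sub>R (indicat_real {p'..q'} t *\<^sub>R cis (\<theta> t))) has_integral (?Z - x *\<^sub>R ?A - y *\<^sub>R ?B)) {0..l}"
        unfolding displacement_def
        by (intro has_integral_diff has_integral_cmul has_integral_indicator_interval I J ci)
      then show ?thesis using xy by (simp add: h_def algebra_simps)
    qed
    have "k = 0"
    proof (rule linear_le_quadratic_imp_zero[of "1 / (2 * H)" k "2 * H\<^sup>2 * energy l \<omega>"])
      show "0 < 1 / (2 * H)" using H by simp
      fix \<epsilon> :: real assume e: "\<bar>\<epsilon>\<bar> \<le> 1 / (2 * H)"
      have eh: "\<bar>\<epsilon> * h t\<bar> \<le> 1/2" for t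
      proof -
        have "\<bar>\<epsilon> * h t\<bar> \<le> 1 / (2 * H) * H"
          unfolding abs_mult using e hH H by (intro mult_mono) auto
        then show ?thesis using H by simp
      qed
      define v where "v t = 1 + \<epsilon> * h t" for t
      have vb: "1/2 \<le> v t" "v t \<le> 3/2" for t using eh[of t] unfolding v_def abs_le_iff by linarith+
      have [measurable]: "v \<in> borel_measurable borel" unfolding v_def by measurable
      have "((\<lambda>t. cis (\<theta> t) + \<epsilon> *\<^sub>R (h t *\<^sub>R cis (\<theta> t))) has_integral (displacement \<theta> 0 l + \<epsilon> *\<^sub>R 0)) {0..l}"
        unfolding displacement_def by (intro has_integral_add has_integral_cmul integrable_integral ci hc)
      then have "integral {0..l} (\<lambda>t. v t *\<^sub>R cis (\<theta> t)) = V"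
        by (simp add: v_def scaleR_add_left V integral_unique)
      from arc_change_speed[OF l p s i _ _ vb this]
      obtain l'' \<theta>'' \<omega>'' where a: "s_arc l'' \<theta>'' \<omega>'' V" "\<theta>'' 0 = \<theta> 0" "\<theta>'' l'' = \<theta> l"
        "(\<lambda>x. (\<omega> x)\<^sup>2 / v x) integrable_on {0..l}" "energy l'' \<omega>'' = integral {0..l} (\<lambda>x. (\<omega> x)\<^sup>2 / v x)"
        by auto
      have b: "((\<lambda>t. (\<omega> t)\<^sup>2 - \<epsilon> * (h t * (\<omega> t)\<^sup>2) + 2 * \<epsilon>\<^sup>2 * H\<^sup>2 * (\<omega> t)\<^sup>2) has_integral
          (energy l \<omega> - \<epsilon> * k + 2 * \<epsilon>\<^sup>2 * H\<^sup>2 * energy l \<omega>)) {0..l}"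
        unfolding energy_def
        by (intro has_integral_add has_integral_diff has_integral_mult_right integrable_integral i hk)
      have "energy l \<omega> \<le> energy l'' \<omega>''" using min a(1-3) by (simp add: minimal_arc_def)
      also have "\<dots> \<le> energy l \<omega> - \<epsilon> * k + 2 * \<epsilon>\<^sup>2 * H\<^sup>2 * energy l \<omega>"
        unfolding a(5)
      proof (rule has_integral_le[OF integrable_integral[OF a(4)] b])
        fix t
        let ?z = "\<epsilon> * h t"
        \<comment> \<open>The product \<open>(1 - z + 2 * z\<^sup>2) * (1 + z)\<close> equals
          \<open>1 + z\<^sup>2 * (1 + 2 * z)\<close>, whence an upper bound for
          \<open>1 / (1 + z)\<close> with quadratic error.\<close>
        have "0 \<le> ?z\<^sup>2 * (1 + 2 * ?z)" using eh[of t] by (intro mult_nonneg_nonneg) (auto simp: abs_le_iff)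
        then have "1 \<le> (1 - ?z + 2 * ?z\<^sup>2) * v t" by (simp add: v_def algebra_simps power2_eq_square)
        then have "1 / v t \<le> 1 - ?z + 2 * ?z\<^sup>2" using vb(1)[of t] by (simp add: pos_divide_le_eq)
        also have "\<dots> \<le> 1 - ?z + 2 * (\<epsilon>\<^sup>2 * H\<^sup>2)"
          using hH[of t] H by (auto simp: power_mult_distrib abs_le_square_iff[symmetric] intro!: mult_left_mono)
        finally have "(1 / v t) * (\<omega> t)\<^sup>2 \<le> (1 - ?z + 2 * (\<epsilon>\<^sup>2 * H\<^sup>2)) * (\<omega> t)\<^sup>2" by (intro mult_right_mono) auto
        then show "(\<omega> t)\<^sup>2 / v t \<le> (\<omega> t)\<^sup>2 - \<epsilon> * (h t * (\<omega> t)\<^sup>2) + 2 * \<epsilon>\<^sup>2 * H\<^sup>2 * (\<omega> t)\<^sup>2"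
          by (simp add: algebra_simps)
      qed
      finally show "\<epsilon> * k \<le> 2 * H\<^sup>2 * energy l \<omega> * \<epsilon>\<^sup>2" by (simp add: algebra_simps)
    qed
    then have "?e u w = x * ?e p q + y * ?e p' q'" by (simp add: k_def)
    also have "\<dots> = Re (cnj \<Lambda> * ?Z)"
      by (simp add: x_def y_def \<Lambda>_def det2_def add_divide_distrib diff_divide_distrib algebra_simps)
    finally show "?e u w = Re (cnj \<Lambda> * ?Z)" .
  qed
qed

section \<open>The curvature of a minimal arc is continuous\<close>

lemma DERIV_within_Icc_unique:
  assumes "(F has_real_derivative a) (at x within {0..l})" "(F has_real_derivative b) (at x within {0..l})" "0 < x" "x < l"
  shows "a = b"
proof -
  have "at x within {0..l} = at x" using assms(3,4) by (intro at_within_interior) simp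
  then show ?thesis using assms(1,2) by (simp add: DERIV_unique)
qed

text \<open>Both indefinite integrals are differentiated, that of \<open>f\<close> almost everywhere
  and that of \<open>p\<close> everywhere by continuity.\<close>

lemma ae_eq_of_integrals_eq:
  fixes f p :: "real \<Rightarrow> real"
  assumes f: "f integrable_on {0..l}" and p: "continuous_on {0..l} p"
    and eq: "\<And>x. x \<in> {0..l} \<Longrightarrow> integral {0..x} f = integral {0..x} p"
  obtains N where "negligible N" "\<And>x. x \<in> {0..l} - N \<Longrightarrow> f x = p x"
proof -
  obtain N where N: "negligible N" "\<And>x. x \<in> {0..l} - N \<Longrightarrow>
    ((\<lambda>x. integral {0..x} f) has_real_derivative f x) (at x within {0..l})"
    by (rule indefinite_integral_has_derivative_ae[OF f]) blast
  show thesis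
  proof (rule that[of "N \<union> {0, l}"])
    show "negligible (N \<union> {0, l})" using N(1) by (intro negligible_Un) auto
    fix x assume x: "x \<in> {0..l} - (N \<union> {0, l})"
    have "((\<lambda>x. integral {0..x} p) has_real_derivative p x) (at x within {0..l})"
      using integral_has_real_derivative[OF p] x by auto
    then have "((\<lambda>x. integral {0..x} f) has_real_derivative p x) (at x within {0..l})"
      by (rule has_field_derivative_transform_within[OF _ zero_less_one]) (use x eq in auto)
    from DERIV_within_Icc_unique[OF N(2) this] x show "f x = p x" by auto
  qed
qed

lemma continuous_nonneg_ae:
  fixes p :: "real \<Rightarrow> real"
  assumes p: "continuous_on {0..l} p" and l: "0 < l" and N: "negligible N" "\<And>x. x \<in> {0..l} - N \<Longrightarrow> 0 \<le> p x"
    and x: "x \<in> {0..l}"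
  shows "0 \<le> p x"
proof (rule ccontr)
  assume "\<not> 0 \<le> p x"
  then have "0 < - p x" by simp
  then obtain u w where uw: "u < w" "{u..w} \<subseteq> {0..l}" "\<And>t. t \<in> {u..w} \<Longrightarrow> \<bar>p t - p x\<bar> < - p x"
    by (rule interval_near_point[OF p l x]) blast
  have "p t < 0" if "t \<in> {u..w}" for t using uw(3)[OF that] by (simp add: abs_less_iff)
  then have "\<not> t \<in> {0..l} - N" if "t \<in> {u..w}" for t using N(2)[of t] that by (auto simp: not_le[symmetric])
  then have "{u..w} \<subseteq> N" using uw(2) by auto
  then have "negligible (cbox u w)" using negligible_subset[OF N(1)] by simp
  then show False unfolding negligible_interval using uw(1) by simp
qed

text \<open>On a rising phase the derivative \<open>\<omega>\<close> is nonnegative almost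
  everywhere, hence the nonnegative root of \<open>p\<close>: the sign lost in
  \<open>\<omega>\<^sup>2\<close> is recovered from the phase.\<close>

lemma mono_phase_has_integral:
  assumes prim: "primitive_on 0 l \<theta> \<omega>" and N: "negligible N" "\<And>x. x \<in> {0..l} - N \<Longrightarrow> (\<omega> x)\<^sup>2 = p x"
    and mono: "mono_on {c..d} \<theta>" and xy: "0 \<le> c" "d \<le> l" "c \<le> x" "x \<le> y" "y \<le> d"
  shows "((\<lambda>t. sqrt (p t)) has_integral (\<theta> y - \<theta> x)) {x..y}"
proof -
  obtain N' where N': "negligible N'"
    "\<And>x. x \<in> {0..l} - N' \<Longrightarrow> (\<theta> has_real_derivative \<omega> x) (at x within {0..l})"
    by (rule primitive_on_ae_derivative[OF prim]) blast
  have 1: "negligible (N \<union> N' \<union> {c, d})" using N(1) N'(1) by (intro negligible_Un) auto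
  have 2: "(\<omega> has_integral (\<theta> y - \<theta> x)) {x..y}"
    by (rule primitive_on_has_integral[OF prim]) (use xy in auto)
  have 3: "sqrt (p t) = \<omega> t" if t: "t \<in> {x..y} - (N \<union> N' \<union> {c, d})" for t
  proof -
    have "at t within {0..l} = at t" using t xy by (intro at_within_interior) auto
    then have "(\<theta> has_real_derivative \<omega> t) (at t)" using N'(2)[of t] t xy by auto
    moreover have "t \<in> interior {c..d}" using t xy by auto
    ultimately have "0 \<le> \<omega> t" using mono_on_imp_deriv_nonneg[OF mono] by blast
    moreover have "(\<omega> t)\<^sup>2 = p t" using N(2)[of t] t xy by auto
    ultimately show ?thesis by (simp add: real_sqrt_unique)
  qed
  show ?thesis by (rule has_integral_spike[OF 1 3 2])
qed

lemma antimono_phase_has_integral: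
  assumes prim: "primitive_on 0 l \<theta> \<omega>" and N: "negligible N" "\<And>x. x \<in> {0..l} - N \<Longrightarrow> (\<omega> x)\<^sup>2 = p x"
    and mono: "antimono_on {c..d} \<theta>" and xy: "0 \<le> c" "d \<le> l" "c \<le> x" "x \<le> y" "y \<le> d"
  shows "((\<lambda>t. sqrt (p t)) has_integral (\<theta> x - \<theta> y)) {x..y}"
  using mono_phase_has_integral[OF primitive_on_uminus[OF prim] N(1) _ _ xy, of p] N(2) mono
  by (simp add: monotone_on_uminus_iff)

lemma primitive_on_const: "primitive_on 0 l (\<lambda>_. k) (\<lambda>_. 0)"
  by (simp add: primitive_on_def set_integrable_def)

lemma primitive_on_integrable_lborel:
  assumes "primitive_on a b \<theta> \<omega>"
  shows "set_integrable lborel {a..b} \<omega>"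
  using assms absolutely_integrable_on_iff_lborel[of \<omega> a b] by (simp add: primitive_on_def)

lemma primitive_on_switch:
  assumes f: "primitive_on 0 l f \<omega>" and g: "primitive_on 0 l g \<rho>" and s: "s \<in> {0..l}" "f s = g s"
  shows "primitive_on 0 l (\<lambda>x. if x \<le> s then f x else g x) (\<lambda>x. if x \<le> s then \<omega> x else \<rho> x)"
  unfolding primitive_on_def
proof (intro conjI ballI)
  have [measurable]: "\<omega> \<in> borel_measurable borel" "\<rho> \<in> borel_measurable borel"
    using f g by (auto simp: primitive_on_def)
  show b: "(\<lambda>x. if x \<le> s then \<omega> x else \<rho> x) \<in> borel_measurable borel" by measurable
  have "set_integrable lborel {0..l} (\<lambda>x. \<bar>\<omega> x\<bar> + \<bar>\<rho> x\<bar>)"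
    using primitive_on_integrable_lborel[OF f] primitive_on_integrable_lborel[OF g]
    by (intro set_integral_add set_integrable_abs)
  then have "set_integrable lborel {0..l} (\<lambda>x. if x \<le> s then \<omega> x else \<rho> x)"
    unfolding set_integrable_def
    by (rule Bochner_Integration.integrable_bound) (auto simp: indicator_def)
  then show "(\<lambda>x. if x \<le> s then \<omega> x else \<rho> x) absolutely_integrable_on {0..l}"
    using absolutely_integrable_on_iff_lborel[OF b] by simp
  fix x assume x: "x \<in> {0..l}"
  have 1: "((\<lambda>x. if x \<le> s then \<omega> x else \<rho> x) has_integral (f y - f 0)) {0..y}" if "0 \<le> y" "y \<le> s" for y
    by (rule has_integral_eq[OF _ primitive_on_has_integral[OF f]]) (use that s in auto)
  have 2: "((\<lambda>x. if x \<le> s then \<omega> x else \<rho> x) has_integral (g x - g s)) {s..x}" if "s \<le> x"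
    by (rule has_integral_spike_finite[of "{s}", OF _ _ primitive_on_has_integral[OF g]]) (use that s x in auto)
  show "((\<lambda>x. if x \<le> s then \<omega> x else \<rho> x) has_integral
      ((if x \<le> s then f x else g x) - (if 0 \<le> s then f 0 else g 0))) {0..x}"
  proof (cases "x \<le> s")
    case True
    then show ?thesis using 1[of x] x s by simp
  next
    case False
    then show ?thesis
      using has_integral_combine[OF _ _ 1[of s] 2] s by simp
  qed
qed

lemma energy_switch:
  assumes i: "(\<lambda>x. (\<omega> x)\<^sup>2) integrable_on {0..l}" "(\<lambda>x. (\<rho> x)\<^sup>2) integrable_on {0..l}" and s: "s \<in> {0..l}"
  shows "(\<lambda>x. (if x \<le> s then \<omega> x else \<rho> x)\<^sup>2) integrable_on {0..l}"
    and "energy l (\<lambda>x. if x \<le> s then \<omega> x else \<rho> x) = integral {0..s} (\<lambda>x. (\<omega> x)\<^sup>2) + integral {s..l} (\<lambda>x. (\<rho> x)\<^sup>2)"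
proof -
  have "(\<lambda>x. (\<omega> x)\<^sup>2) integrable_on {0..s}" "(\<lambda>x. (\<rho> x)\<^sup>2) integrable_on {s..l}"
    by (rule integrable_subinterval_real[OF i(1)] integrable_subinterval_real[OF i(2)]; use s in auto)+
  note this[THEN integrable_integral]
  note ii = this
  have "((\<lambda>x. (if x \<le> s then \<omega> x else \<rho> x)\<^sup>2) has_integral integral {0..s} (\<lambda>x. (\<omega> x)\<^sup>2)) {0..s}"
    by (rule has_integral_eq[OF _ ii(1)]) simp
  moreover have "((\<lambda>x. (if x \<le> s then \<omega> x else \<rho> x)\<^sup>2) has_integral integral {s..l} (\<lambda>x. (\<rho> x)\<^sup>2)) {s..l}"
    by (rule has_integral_spike_finite[of "{s}", OF _ _ ii(2)]) auto
  ultimately have "((\<lambda>x. (if x \<le> s then \<omega> x else \<rho> x)\<^sup>2) has_integral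
     (integral {0..s} (\<lambda>x. (\<omega> x)\<^sup>2) + integral {s..l} (\<lambda>x. (\<rho> x)\<^sup>2))) {0..l}"
    by (rule has_integral_combine[rotated 2]) (use s in auto)
  then
  show "(\<lambda>x. (if x \<le> s then \<omega> x else \<rho> x)\<^sup>2) integrable_on {0..l}"
    "energy l (\<lambda>x. if x \<le> s then \<omega> x else \<rho> x) = integral {0..s} (\<lambda>x. (\<omega> x)\<^sup>2) + integral {s..l} (\<lambda>x. (\<rho> x)\<^sup>2)"
    unfolding energy_def by (auto simp: integral_unique)
qed

text \<open>Truncation of a peak or a valley; the plateau joins continuously at \<open>s2\<close>
  when \<open>\<theta> s1 = \<theta> s2\<close>.\<close>

definition flatten :: "real \<Rightarrow> real \<Rightarrow> (real \<Rightarrow> real) \<Rightarrow> real \<Rightarrow> real" where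
  "flatten s1 s2 \<theta> x = (if x \<le> s1 then \<theta> x else if x \<le> s2 then \<theta> s1 else \<theta> x)"

definition flatten_deriv :: "real \<Rightarrow> real \<Rightarrow> (real \<Rightarrow> real) \<Rightarrow> real \<Rightarrow> real" where
  "flatten_deriv s1 s2 \<omega> x = (if x \<le> s1 then \<omega> x else if x \<le> s2 then 0 else \<omega> x)"

lemma flatten:
  assumes p: "primitive_on 0 l \<theta> \<omega>" and i: "(\<lambda>x. (\<omega> x)\<^sup>2) integrable_on {0..l}"
    and s: "0 \<le> s1" "s1 \<le> s2" "s2 \<le> l" "\<theta> s1 = \<theta> s2"
  shows "primitive_on 0 l (flatten s1 s2 \<theta>) (flatten_deriv s1 s2 \<omega>)"
    "(\<lambda>x. (flatten_deriv s1 s2 \<omega> x)\<^sup>2) integrable_on {0..l}"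
    "energy l (flatten_deriv s1 s2 \<omega>) = energy l \<omega> - integral {s1..s2} (\<lambda>x. (\<omega> x)\<^sup>2)"
proof -
  have p1: "primitive_on 0 l (\<lambda>x. if x \<le> s2 then \<theta> s1 else \<theta> x) (\<lambda>x. if x \<le> s2 then 0 else \<omega> x)"
    by (rule primitive_on_switch[OF primitive_on_const p]) (use s in auto)
  show "primitive_on 0 l (flatten s1 s2 \<theta>) (flatten_deriv s1 s2 \<omega>)"
    unfolding flatten_def flatten_deriv_def by (rule primitive_on_switch[OF p p1]) (use s in auto)
  have i0: "(\<lambda>x::real. (0::real)\<^sup>2) integrable_on {0..l}" by (simp add: integrable_0)
  have s2: "s2 \<in> {0..l}" and s1: "s1 \<in> {0..l}" using s by auto
  note e1 = energy_switch[OF i0 i s2]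
  note e2 = energy_switch[OF i e1(1) s1]
  show "(\<lambda>x. (flatten_deriv s1 s2 \<omega> x)\<^sup>2) integrable_on {0..l}"
    unfolding flatten_deriv_def by (rule e2(1))
  have sub: "(\<lambda>x. (\<omega> x)\<^sup>2) integrable_on {s1..l}" by (rule integrable_subinterval_real[OF i]) (use s in auto)
  have sub': "(\<lambda>x. (if x \<le> s2 then 0 else \<omega> x)\<^sup>2) integrable_on {s1..l}"
    by (rule integrable_subinterval_real[OF e1(1)]) (use s in auto)
  have c1: "integral {s1..s2} (\<lambda>x. (if x \<le> s2 then 0 else \<omega> x)\<^sup>2) = 0"
  proof -
    have "integral {s1..s2} (\<lambda>x. (if x \<le> s2 then 0 else \<omega> x)\<^sup>2) = integral {s1..s2} (\<lambda>x. 0::real)"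
      by (rule integral_cong) simp
    then show ?thesis by simp
  qed
  have c2: "integral {s2..l} (\<lambda>x. (if x \<le> s2 then 0 else \<omega> x)\<^sup>2) = integral {s2..l} (\<lambda>x. (\<omega> x)\<^sup>2)"
    by (rule integral_spike[of "{s2}"]) auto
  have "integral {s1..l} (\<lambda>x. (if x \<le> s2 then 0 else \<omega> x)\<^sup>2) = integral {s2..l} (\<lambda>x. (\<omega> x)\<^sup>2)"
    using Henstock_Kurzweil_Integration.integral_combine[OF s(2,3) sub'] c1 c2 by simp
  moreover have "integral {0..s1} (\<lambda>x. (\<omega> x)\<^sup>2) + (integral {s1..s2} (\<lambda>x. (\<omega> x)\<^sup>2) + integral {s2..l} (\<lambda>x. (\<omega> x)\<^sup>2))
      = energy l \<omega>"
    unfolding energy_def using Henstock_Kurzweil_Integration.integral_combine[OF s(2,3) sub]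
      Henstock_Kurzweil_Integration.integral_combine[OF s(1) _ i, of ] s1 by simp
  ultimately show "energy l (flatten_deriv s1 s2 \<omega>) = energy l \<omega> - integral {s1..s2} (\<lambda>x. (\<omega> x)\<^sup>2)"
    using e2(2) unfolding flatten_deriv_def by simp
qed

lemma flatten_diff_integral_le:
  assumes p: "primitive_on 0 l \<theta> \<omega>" "0 \<le> s1" "s1 \<le> s2" "s2 \<le> l" "\<theta> s1 = \<theta> s2"
    and \<eta>: "\<And>x. x \<in> {s1..s2} \<Longrightarrow> \<bar>\<theta> s1 - \<theta> x\<bar> \<le> \<eta>"
  shows "integral {0..l} (\<lambda>x. \<bar>flatten s1 s2 \<theta> x - \<theta> x\<bar>) \<le> \<eta> * (s2 - s1)"
proof -
  have c: "continuous_on {0..l} \<theta>" by (rule primitive_on_continuous[OF p(1)])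
  have "primitive_on 0 l (\<lambda>x. if x \<le> s2 then \<theta> s1 else \<theta> x) (\<lambda>x. if x \<le> s2 then 0 else \<omega> x)"
    by (rule primitive_on_switch[OF primitive_on_const p(1)]) (use p in auto)
  from primitive_on_switch[OF p(1) this, of s1] have "continuous_on {0..l} (flatten s1 s2 \<theta>)"
    unfolding flatten_def using p by (intro primitive_on_continuous) auto
  then have i: "(\<lambda>x. \<bar>flatten s1 s2 \<theta> x - \<theta> x\<bar>) integrable_on {0..l}"
    by (intro integrable_continuous_real continuous_intros c)
  have "((\<lambda>t. indicat_real {s1..s2} t *\<^sub>R \<eta>) has_integral integral {s1..s2} (\<lambda>_. \<eta>)) {0..l}"
    by (rule has_integral_indicator_interval) (use p in auto)
  then have "((\<lambda>t. indicat_real {s1..s2} t *\<^sub>R \<eta>) has_integral (\<eta> * (s2 - s1))) {0..l}"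
    using p by (simp add: mult.commute)
  moreover have "\<bar>flatten s1 s2 \<theta> x - \<theta> x\<bar> \<le> indicat_real {s1..s2} x *\<^sub>R \<eta>" for x
    using \<eta>[of x] \<eta>[of s1] p(3) by (cases "x \<in> {s1..s2}") (auto simp: flatten_def)
  ultimately show ?thesis by (intro has_integral_le[OF integrable_integral[OF i]])
qed

section \<open>Reflection and reversal of arcs\<close>

lemma energy_uminus: "energy l (\<lambda>x. - \<omega> x) = energy l \<omega>"
  by (simp add: energy_def)

lemma s_arc_uminus:
  assumes "s_arc l \<theta> \<omega> V"
  shows "s_arc l (\<lambda>x. - \<theta> x) (\<lambda>x. - \<omega> x) (cnj V)"
proof -
  have "integral {0..l} (\<lambda>x. cis (- \<theta> x)) = cnj V"
    using integral_linear[OF cis_integrable[OF primitive_on_continuous] bounded_linear_cnj, of 0 l \<theta> \<omega>] assms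
    by (simp add: s_arc_def o_def cis_cnj)
  then show ?thesis using assms by (simp add: s_arc_def primitive_on_uminus s_shaped_uminus)
qed

lemma minimal_arc_uminus:
  assumes "minimal_arc l \<theta> \<omega> V"
  shows "minimal_arc l (\<lambda>x. - \<theta> x) (\<lambda>x. - \<omega> x) (cnj V)"
proof -
  have "energy l \<omega> \<le> energy l' \<omega>'"
    if "s_arc l' \<theta>' \<omega>' (cnj V)" "\<theta>' 0 = - \<theta> 0" "\<theta>' l' = - \<theta> l" for l' \<theta>' \<omega>'
  proof -
    have "s_arc l' (\<lambda>x. - \<theta>' x) (\<lambda>x. - \<omega>' x) V" using s_arc_uminus[OF that(1)] by simp
    moreover have "- \<theta>' 0 = \<theta> 0" "- \<theta>' l' = \<theta> l" using that by auto
    ultimately have "energy l \<omega> \<le> energy l' (\<lambda>x. - \<omega>' x)"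
      using assms[unfolded minimal_arc_def, THEN conjunct2, rule_format, of l' "\<lambda>x. - \<theta>' x" "\<lambda>x. - \<omega>' x"] by simp
    then show ?thesis by (simp add: energy_uminus)
  qed
  moreover have "s_arc l (\<lambda>x. - \<theta> x) (\<lambda>x. - \<omega> x) (cnj V)" using s_arc_uminus assms unfolding minimal_arc_def by blast
  ultimately show ?thesis unfolding minimal_arc_def energy_uminus by blast
qed

text \<open>The curve is run backwards and reflected in a point. Together this keeps the tangent
  directions and hence \<open>V\<close>; only the curvature changes its sign.\<close>

lemma s_arc_reverse:
  assumes a: "s_arc l \<theta> \<omega> V"
  shows "s_arc l (\<lambda>x. \<theta> (l - x)) (\<lambda>x. - \<omega> (l - x)) V" "energy l (\<lambda>x. - \<omega> (l - x)) = energy l \<omega>"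
proof -
  have refl: "(h has_integral y) {0..l} \<Longrightarrow> ((\<lambda>t. h (l - t)) has_integral y) {0..l}"
    for h :: "real \<Rightarrow> 'a::euclidean_space" and y l
  proof -
    assume "(h has_integral y) {0..l}"
    then have "((\<lambda>t. h (- t)) has_integral y) (cbox (- l) (- 0))"
      by (simp only: has_integral_reflect_real cbox_interval)
    from has_integral_affinity'[OF this, of 1 "- l"] show ?thesis by simp
  qed
  have "((\<lambda>x. cis (\<theta> x)) has_integral V) {0..l}"
    using cis_integrable[OF primitive_on_continuous, of 0 l \<theta> \<omega>] a by (auto simp: s_arc_def)
  from refl[OF this] have "integral {0..l} (\<lambda>x. cis (\<theta> (l - x))) = V" by (rule integral_unique)
  moreover have "((\<lambda>x. (- \<omega> (l - x))\<^sup>2) has_integral energy l \<omega>) {0..l}"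
    using refl[of "\<lambda>x. (\<omega> x)\<^sup>2" "energy l \<omega>" l] a by (auto simp: energy_def s_arc_def)
  ultimately show "s_arc l (\<lambda>x. \<theta> (l - x)) (\<lambda>x. - \<omega> (l - x)) V" "energy l (\<lambda>x. - \<omega> (l - x)) = energy l \<omega>"
    using a unfolding s_arc_def by (auto simp: primitive_on_reverse s_shaped_reverse energy_def integral_unique)
qed

lemma minimal_arc_reverse:
  assumes "minimal_arc l \<theta> \<omega> V"
  shows "minimal_arc l (\<lambda>x. \<theta> (l - x)) (\<lambda>x. - \<omega> (l - x)) V"
proof -
  have "energy l \<omega> \<le> energy l' \<omega>'"
    if "s_arc l' \<theta>' \<omega>' V" "\<theta>' 0 = \<theta> l" "\<theta>' l' = \<theta> 0" for l' \<theta>' \<omega>'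
  proof -
    have "energy l \<omega> \<le> energy l' (\<lambda>x. - \<omega>' (l' - x))"
      using assms[unfolded minimal_arc_def, THEN conjunct2, rule_format,
          of l' "\<lambda>x. \<theta>' (l' - x)" "\<lambda>x. - \<omega>' (l' - x)"] s_arc_reverse(1)[OF that(1)] that(2,3) by simp
    then show ?thesis using s_arc_reverse(2)[OF that(1)] by simp
  qed
  moreover have "s_arc l (\<lambda>x. \<theta> (l - x)) (\<lambda>x. - \<omega> (l - x)) V" "energy l (\<lambda>x. - \<omega> (l - x)) = energy l \<omega>"
    using s_arc_reverse assms unfolding minimal_arc_def by blast+
  ultimately show ?thesis unfolding minimal_arc_def by (simp, blast)
qed

text \<open>If the curvature jumped from \<open>k\<close> to \<open>- k\<close> at the peak,
  truncating the peak by a height \<open>\<eta>\<close> would save energy of order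
  \<open>k * \<eta>\<close>. The plateau has width of order \<open>\<eta> / k\<close>, so the L1
  change, and with it the cost of compensation, is of order \<open>\<eta>\<^sup>2\<close>
  only.\<close>

lemma no_corner_at_peak:
  assumes min: "minimal_arc l \<theta> \<omega> V" and nc: "x1 \<in> {0..l}" "y1 \<in> {0..l}" "\<theta> x1 < \<theta> y1"
    and mono: "mono_on {0..c} \<theta>" "antimono_on {c..l} \<theta>" and c: "0 < c" "c < l"
    and pc: "continuous_on {0..l} p"
    and ip: "\<And>u w. {u..w} \<subseteq> {0..l} \<Longrightarrow> integral {u..w} (\<lambda>x. (\<omega> x)\<^sup>2) = integral {u..w} p"
    and up: "\<And>x y. 0 \<le> x \<Longrightarrow> x \<le> y \<Longrightarrow> y \<le> c \<Longrightarrow> ((\<lambda>t. sqrt (p t)) has_integral (\<theta> y - \<theta> x)) {x..y}"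
    and down: "\<And>x y. c \<le> x \<Longrightarrow> x \<le> y \<Longrightarrow> y \<le> l \<Longrightarrow> ((\<lambda>t. sqrt (p t)) has_integral (\<theta> x - \<theta> y)) {x..y}"
    and turn: "\<bar>\<theta> c - \<theta> 0\<bar> \<le> pi" "\<bar>\<theta> l - \<theta> c\<bar> \<le> pi"
  shows "p c \<le> 0"
proof (rule ccontr)
  assume "\<not> p c \<le> 0"
  define k where "k = sqrt (p c)"
  have k: "0 < k" using \<open>\<not> p c \<le> 0\<close> by (simp add: k_def)
  have l: "0 < l" and prim: "primitive_on 0 l \<theta> \<omega>" and V: "displacement \<theta> 0 l = V"
    and i: "(\<lambda>x. (\<omega> x)\<^sup>2) integrable_on {0..l}"
    using min by (auto simp: minimal_arc_def s_arc_def displacement_def)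
  have cont: "continuous_on {0..l} \<theta>" by (rule primitive_on_continuous[OF prim])
  obtain C \<delta> where C: "0 \<le> C" "0 < \<delta>" and comp:
    "\<And>\<theta>' \<omega>'. primitive_on 0 l \<theta>' \<omega>' \<Longrightarrow> s_shaped 0 l \<theta>' \<Longrightarrow> (\<lambda>x. (\<omega>' x)\<^sup>2) integrable_on {0..l} \<Longrightarrow>
       integral {0..l} (\<lambda>x. \<bar>\<theta>' x - \<theta> x\<bar>) \<le> \<delta> \<Longrightarrow>
       \<exists>l'' \<theta>'' \<omega>''. s_arc l'' \<theta>'' \<omega>'' (displacement \<theta> 0 l) \<and> \<theta>'' 0 = \<theta>' 0 \<and> \<theta>'' l'' = \<theta>' l \<and>
         energy l'' \<omega>'' \<le> (1 + C * integral {0..l} (\<lambda>x. \<bar>\<theta>' x - \<theta> x\<bar>)) * energy l \<omega>'"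
    by (rule compensate_displacement[OF cont l nc]) blast
  have sc: "continuous_on {0..l} (\<lambda>t. sqrt (p t))" by (intro continuous_intros pc)
  obtain d where d: "d > 0" "\<And>t. t \<in> {0..l} \<Longrightarrow> dist t c < d \<Longrightarrow> dist (sqrt (p t)) k < k/2"
    using sc[unfolded continuous_on_iff, rule_format, of c "k/2"] c k unfolding k_def[symmetric] by auto
  define r where "r = min (d/2) (min c (l - c))"
  have r: "0 < r" "r \<le> c" "r \<le> l - c" "r < d" using d(1) c by (auto simp: r_def)
  have near: "k/2 \<le> sqrt (p t)" "sqrt (p t) \<le> 3*k/2" "k\<^sup>2/4 \<le> p t" if "t \<in> {c-r..c+r}" for t
  proof -
    have "\<bar>t - c\<bar> < d" using that r by auto
    then have *: "\<bar>sqrt (p t) - k\<bar> < k/2" using d(2)[of t] that r c by (auto simp: dist_real_def)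
    then show 1: "k/2 \<le> sqrt (p t)" "sqrt (p t) \<le> 3*k/2" unfolding abs_less_iff by linarith+
    have "0 \<le> p t" using 1(1) k real_sqrt_ge_0_iff[of "p t"] by linarith
    then have "p t = (sqrt (p t))\<^sup>2" by simp
    also have "\<dots> \<ge> (k/2)\<^sup>2" using 1(1) k by (intro power_mono) auto
    finally show "k\<^sup>2/4 \<le> p t" by (simp add: power_divide)
  qed
  have upb: "k/2 * (y - x) \<le> \<theta> y - \<theta> x" "\<theta> y - \<theta> x \<le> 3*k/2 * (y - x)" if "c - r \<le> x" "x \<le> y" "y \<le> c" for x y
    using has_integral_le[OF has_integral_const_real[of "k/2" x y] up[of x y]]
      has_integral_le[OF up[of x y] has_integral_const_real[of "3*k/2" x y]] near r that
    by (auto simp: mult.commute)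
  have downb: "k/2 * (y - x) \<le> \<theta> x - \<theta> y" "\<theta> x - \<theta> y \<le> 3*k/2 * (y - x)" if "c \<le> x" "x \<le> y" "y \<le> c + r" for x y
    using has_integral_le[OF has_integral_const_real[of "k/2" x y] down[of x y]]
      has_integral_le[OF down[of x y] has_integral_const_real[of "3*k/2" x y]] near r that
    by (auto simp: mult.commute)
  let ?E = "energy l \<omega>"
  have E0: "0 \<le> ?E" by (rule energy_nonneg)
  \<comment> \<open>The bound \<open>k * r / 4\<close> keeps the plateau inside the neighbourhood
    where \<open>sqrt p\<close> is close to \<open>k\<close>; 1 and \<open>k * \<delta> / 4\<close>
    ensure \<open>D \<le> \<delta>\<close>; the last bound makes the cost of compensation smaller
    than the energy saved.\<close>
  define \<eta> where "\<eta> = min (min (k * r / 4) 1) (min (k * \<delta> / 4) (k\<^sup>2 / (24 * (C * ?E + 1))))"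
  have CE: "0 < C * ?E + 1" using C E0 by (intro add_nonneg_pos mult_nonneg_nonneg) auto
  have "0 < \<eta>" using k r C CE by (simp add: \<eta>_def)
  moreover have "\<eta> \<le> k * r / 4" "\<eta> \<le> 1" unfolding \<eta>_def by (rule min.coboundedI1, rule min.cobounded1 min.cobounded2)+
  moreover have "\<eta> \<le> k * \<delta> / 4" "\<eta> \<le> k\<^sup>2 / (24 * (C * ?E + 1))"
    unfolding \<eta>_def by (rule min.coboundedI2, rule min.cobounded1 min.cobounded2)+
  ultimately have \<eta>: "0 < \<eta>" "\<eta> \<le> k * r / 4" "\<eta> \<le> 1" "\<eta> \<le> k * \<delta> / 4" "\<eta> \<le> k\<^sup>2 / (24 * (C * ?E + 1))"
    by blast+
  have "k/2 * r = 2 * (k * r / 4)" by simp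
  then have kr: "\<eta> < k/2 * r" using \<eta>(1,2) by linarith
  obtain s1 where s1: "c - r \<le> s1" "s1 \<le> c" "\<theta> s1 = \<theta> c - \<eta>"
  proof -
    have "continuous_on {c-r..c} \<theta>" by (rule continuous_on_subset[OF cont]) (use r c in auto)
    moreover have "\<theta> (c - r) \<le> \<theta> c - \<eta>" using upb(1)[of "c - r" c] r kr by simp
    ultimately show thesis using IVT'[of \<theta> "c - r" "\<theta> c - \<eta>" c] that \<eta> r by auto
  qed
  obtain s2 where s2: "c \<le> s2" "s2 \<le> c + r" "\<theta> s2 = \<theta> c - \<eta>"
  proof -
    have "continuous_on {c..c+r} \<theta>" by (rule continuous_on_subset[OF cont]) (use r c in auto)
    moreover have "\<theta> (c + r) \<le> \<theta> c - \<eta>" using downb(1)[of c "c + r"] r kr by simp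
    ultimately show thesis using IVT2'[of \<theta> "c + r" "\<theta> c - \<eta>" c] that \<eta> r by auto
  qed
  \<comment> \<open>The angle rises by \<open>\<eta>\<close> and falls by \<open>\<eta>\<close> at
    rates between \<open>k/2\<close> and \<open>3*k/2\<close>, so the width of the plateau lies
    between \<open>4*\<eta>/(3*k)\<close> and \<open>4*\<eta>/k\<close>.\<close>
  have w: "k/2 * (s2 - s1) \<le> 2 * \<eta>" "2 * \<eta> \<le> 3*k/2 * (s2 - s1)"
    using upb[of s1 c] downb[of c s2] s1 s2 by (simp_all add: algebra_simps)
  have s12: "0 \<le> s1" "s1 \<le> s2" "s2 \<le> l" "\<theta> s1 = \<theta> s2" using s1 s2 r c by auto
  let ?\<theta>' = "flatten s1 s2 \<theta>" and ?\<omega>' = "flatten_deriv s1 s2 \<omega>"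
  note fl = flatten[OF prim i s12]
  \<comment> \<open>As a minimum with a constant, the truncated angle is monotone on the same two
    phases.\<close>
  have flat: "?\<theta>' x = min (\<theta> x) (\<theta> c - \<eta>)" if "x \<in> {0..l}" for x
  proof -
    consider "x \<le> s1" | "s1 < x" "x \<le> c" | "c < x" "x \<le> s2" | "s2 < x" by linarith
    then show ?thesis
    proof cases
      case 1
      then have "\<theta> x \<le> \<theta> s1" using that s1 by (intro monotone_onD[OF mono(1)]) auto
      then show ?thesis using 1 s1 by (simp add: flatten_def)
    next
      case 2
      then have "\<theta> s1 \<le> \<theta> x" using that s1 s12 by (intro monotone_onD[OF mono(1)]) auto
      then show ?thesis using 2 s1 s2 by (simp add: flatten_def)
    next
      case 3
      then have "\<theta> s2 \<le> \<theta> x" using monotone_onD[OF mono(2), of x s2] that s2 s12 by auto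
      then show ?thesis using 3 s1 s2 by (simp add: flatten_def)
    next
      case 4
      then have "\<theta> x \<le> \<theta> s2" using monotone_onD[OF mono(2), of s2 x] that s2 s12 by auto
      then show ?thesis using 4 s1 s2 by (simp add: flatten_def)
    qed
  qed
  have ends: "?\<theta>' 0 = \<theta> 0" "?\<theta>' l = \<theta> l"
    using s12 s1 s2 c by (auto simp: flatten_def)
  have shape: "s_shaped 0 l ?\<theta>'"
    unfolding s_shaped_def
  proof (intro bexI[of _ c] conjI disjI1)
    show "mono_on {0..c} ?\<theta>'"
    proof (rule monotone_onI)
      fix x y assume "x \<in> {0..c}" "y \<in> {0..c}" "x \<le> y"
      then show "?\<theta>' x \<le> ?\<theta>' y" using monotone_onD[OF mono(1), of x y] flat[of x] flat[of y] c by auto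
    qed
    show "antimono_on {c..l} ?\<theta>'"
    proof (rule monotone_onI)
      fix x y assume "x \<in> {c..l}" "y \<in> {c..l}" "x \<le> y"
      then show "?\<theta>' y \<le> ?\<theta>' x" using monotone_onD[OF mono(2), of x y] flat[of x] flat[of y] c by auto
    qed
    have fc: "?\<theta>' c = \<theta> c - \<eta>" using flat[of c] c \<eta>(1) by simp
    have "\<theta> 0 \<le> \<theta> c - \<eta>" "\<theta> l \<le> \<theta> c - \<eta>" using flat[of 0] flat[of l] ends l by auto
    then show "\<bar>?\<theta>' c - ?\<theta>' 0\<bar> \<le> pi" "\<bar>?\<theta>' l - ?\<theta>' c\<bar> \<le> pi"
      using turn \<eta>(1) unfolding fc ends by auto
  qed (use c in auto)
  define D where "D = integral {0..l} (\<lambda>x. \<bar>?\<theta>' x - \<theta> x\<bar>)"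
  have D: "D \<le> \<eta> * (s2 - s1)" unfolding D_def
  proof (rule flatten_diff_integral_le[OF prim s12])
    fix x assume "x \<in> {s1..s2}"
    then have "\<theta> s1 \<le> \<theta> x \<and> \<theta> x \<le> \<theta> c"
    proof (cases "x \<le> c")
      case True
      then show ?thesis
        using \<open>x \<in> _\<close> s12 c by (intro conjI monotone_onD[OF mono(1)]) auto
    next
      case False
      then show ?thesis
        using \<open>x \<in> _\<close> s12 c monotone_onD[OF mono(2), of x s2] monotone_onD[OF mono(2), of c x] by auto
    qed
    then show "\<bar>\<theta> s1 - \<theta> x\<bar> \<le> \<eta>" using s1 by auto
  qed
  have D2: "D * k \<le> 4 * \<eta>\<^sup>2"
  proof -
    have "D * k \<le> \<eta> * (s2 - s1) * k" using D k by (intro mult_right_mono) auto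
    also have "\<dots> = 2 * \<eta> * (k/2 * (s2 - s1))" by (simp add: algebra_simps)
    also have "\<dots> \<le> 2 * \<eta> * (2 * \<eta>)" using w(1) \<eta>(1) by (intro mult_left_mono) auto
    finally show ?thesis by (simp add: power2_eq_square)
  qed
  have "D * k \<le> (4 * \<eta>) * \<eta>" using D2 by (simp add: power2_eq_square)
  also have "\<dots> \<le> (4 * \<eta>) * (k * \<delta> / 4)" using \<eta>(1) by (intro mult_left_mono \<eta>(4)) simp
  also have "\<dots> = \<eta> * (k * \<delta>)" by simp
  also have "\<dots> \<le> 1 * (k * \<delta>)" using k C by (intro mult_right_mono \<eta>(3)) simp
  finally have D\<delta>: "D \<le> \<delta>" using k by simp
  have D0: "0 \<le> D" unfolding D_def
    by (intro Henstock_Kurzweil_Integration.integral_nonneg integrable_continuous_real continuous_intros cont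
        primitive_on_continuous[OF fl(1)]) simp
  \<comment> \<open>At least \<open>k\<^sup>2/4\<close> is saved per unit length of the plateau,
    whose width is at least \<open>4*\<eta>/(3*k)\<close>.\<close>
  have E1: "energy l ?\<omega>' \<le> ?E - k * \<eta> / 3"
  proof -
    have "k\<^sup>2/4 * (s2 - s1) \<le> integral {s1..s2} p"
    proof -
      have "p integrable_on {s1..s2}"
        by (rule integrable_continuous_real[OF continuous_on_subset[OF pc]]) (use s12 in auto)
      from has_integral_le[OF has_integral_const_real integrable_integral[OF this], of "k\<^sup>2/4"]
      show ?thesis using near(3) s1 s2 s12 by (auto simp: mult.commute)
    qed
    moreover have "k * \<eta> / 3 \<le> k\<^sup>2/4 * (s2 - s1)"
      using mult_left_mono[OF w(2), of "k/6"] k by (simp add: power2_eq_square algebra_simps)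
    moreover have "integral {s1..s2} (\<lambda>x. (\<omega> x)\<^sup>2) = integral {s1..s2} p" by (rule ip) (use s12 in auto)
    ultimately show ?thesis unfolding fl(3) by linarith
  qed
  from comp[OF fl(1) shape fl(2) D\<delta>[unfolded D_def]]
  obtain l'' \<theta>'' \<omega>'' where a: "s_arc l'' \<theta>'' \<omega>'' (displacement \<theta> 0 l)" "\<theta>'' 0 = ?\<theta>' 0" "\<theta>'' l'' = ?\<theta>' l"
    "energy l'' \<omega>'' \<le> (1 + C * D) * energy l ?\<omega>'"
    unfolding D_def[symmetric] by blast
  have "?E \<le> energy l'' \<omega>''"
    using min[unfolded minimal_arc_def, THEN conjunct2, rule_format, of l'' \<theta>'' \<omega>''] a(1-3) ends V by simp
  also note a(4)
  also have "(1 + C * D) * energy l ?\<omega>' \<le> (1 + C * D) * (?E - k * \<eta> / 3)"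
    using C D0 by (intro mult_left_mono E1) simp
  finally have e: "?E \<le> (1 + C * D) * (?E - k * \<eta> / 3)" .
  have "k * \<eta> / 3 \<le> C * ?E * D"
  proof -
    have "0 \<le> C * D * (k * \<eta> / 3)" using C D0 k \<eta>(1) by simp
    then show ?thesis using e by (simp add: algebra_simps)
  qed
  then have "k * (k * \<eta> / 3) \<le> C * ?E * (D * k)" using k by (simp add: algebra_simps)
  also have "\<dots> \<le> C * ?E * (4 * \<eta>\<^sup>2)" using D2 C E0 by (intro mult_left_mono) auto
  also have "\<dots> \<le> (C * ?E + 1) * (4 * \<eta>\<^sup>2)" by (intro mult_right_mono) auto
  finally have "\<eta> * (k\<^sup>2 / 3) \<le> \<eta> * (4 * ((C * ?E + 1) * \<eta>))" by (simp add: power2_eq_square algebra_simps)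
  then have "k\<^sup>2 / 3 \<le> 4 * ((C * ?E + 1) * \<eta>)" using \<eta>(1) by (simp only: mult_le_cancel_left_pos)
  moreover have "(C * ?E + 1) * \<eta> \<le> k\<^sup>2 / 24" using \<eta>(5) CE by (simp add: field_simps)
  ultimately have "k\<^sup>2 / 3 \<le> k\<^sup>2 / 6" by linarith
  then show False using k by simp
qed

text \<open>The pointwise form of the Euler-Lagrange equation, with a continuous
  \<open>\<kappa>\<close> that is the derivative of the angle everywhere and not just almost
  everywhere. The multiplier \<open>\<Lambda>\<close> belongs to the displacement; there is none for
  the length, which is free.\<close>

definition elastica :: "real \<Rightarrow> (real \<Rightarrow> real) \<Rightarrow> complex \<Rightarrow> (real \<Rightarrow> real) \<Rightarrow> bool" where
  "elastica l \<theta> \<Lambda> \<kappa> \<longleftrightarrow> continuous_on {0..l} \<kappa> \<and>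
     (\<forall>x\<in>{0..l}. (\<kappa> x)\<^sup>2 = Re (cnj \<Lambda> * cis (\<theta> x))) \<and>
     (\<forall>x\<in>{0..l}. (\<theta> has_real_derivative \<kappa> x) (at x within {0..l}))"

lemma derivative_of_primitive:
  fixes \<theta> \<kappa> :: "real \<Rightarrow> real"
  assumes "continuous_on {0..l} \<kappa>" "\<And>x. x \<in> {0..l} \<Longrightarrow> (\<kappa> has_integral (\<theta> x - \<theta> 0)) {0..x}" "x \<in> {0..l}"
  shows "(\<theta> has_real_derivative \<kappa> x) (at x within {0..l})"
proof -
  have "((\<lambda>x. integral {0..x} \<kappa> + \<theta> 0) has_real_derivative \<kappa> x + 0) (at x within {0..l})"
    by (intro DERIV_add DERIV_const integral_has_real_derivative assms)
  then have "((\<lambda>x. integral {0..x} \<kappa> + \<theta> 0) has_real_derivative \<kappa> x) (at x within {0..l})" by simp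
  then show ?thesis
    by (rule has_field_derivative_transform_within[OF _ zero_less_one])
      (use assms(2)[THEN integral_unique] assms(3) in auto)
qed

text \<open>The phases fix the sign of the curvature, whose square is a continuous function
  \<open>p\<close>. The branches \<open>sqrt p\<close> and \<open>- sqrt p\<close> meet continuously
  because \<open>p\<close> vanishes at an interior peak.\<close>

lemma elastica_peak:
  assumes min: "minimal_arc l \<theta> \<omega> V" and nc: "x1 \<in> {0..l}" "y1 \<in> {0..l}" "\<theta> x1 < \<theta> y1"
    and c: "c \<in> {0..l}" and mono: "mono_on {0..c} \<theta>" "antimono_on {c..l} \<theta>"
    and turn: "\<bar>\<theta> c - \<theta> 0\<bar> \<le> pi" "\<bar>\<theta> l - \<theta> c\<bar> \<le> pi"
  shows "\<exists>\<Lambda> \<kappa>. elastica l \<theta> \<Lambda> \<kappa> \<and> energy l \<omega> = integral {0..l} (\<lambda>x. (\<kappa> x)\<^sup>2)"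
proof -
  have l: "0 < l" and prim: "primitive_on 0 l \<theta> \<omega>" and i: "(\<lambda>x. (\<omega> x)\<^sup>2) integrable_on {0..l}"
    using min by (auto simp: minimal_arc_def s_arc_def)
  have cont: "continuous_on {0..l} \<theta>" by (rule primitive_on_continuous[OF prim])
  obtain \<Lambda> where EL: "\<And>u w. {u..w} \<subseteq> {0..l} \<Longrightarrow>
      integral {u..w} (\<lambda>x. (\<omega> x)\<^sup>2) = Re (cnj \<Lambda> * displacement \<theta> u w)"
    by (rule euler_lagrange[OF min nc]) blast
  define p where "p x = Re (cnj \<Lambda> * cis (\<theta> x))" for x
  have pc: "continuous_on {0..l} p"
    unfolding p_def by (intro continuous_intros continuous_on_cis_angle cont)
  have ip: "integral {u..w} (\<lambda>x. (\<omega> x)\<^sup>2) = integral {u..w} p" if "{u..w} \<subseteq> {0..l}" for u w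
  proof -
    have "(\<lambda>x. cis (\<theta> x)) integrable_on {u..w}" by (rule cis_integrable[OF continuous_on_subset[OF cont that]])
    moreover have "bounded_linear (\<lambda>z. Re (cnj \<Lambda> * z))"
      by (intro bounded_linear_compose[OF bounded_linear_Re] bounded_linear_mult_right)
    ultimately have "integral {u..w} ((\<lambda>z. Re (cnj \<Lambda> * z)) \<circ> (\<lambda>x. cis (\<theta> x))) = Re (cnj \<Lambda> * displacement \<theta> u w)"
      unfolding displacement_def by (rule integral_linear)
    then show ?thesis unfolding EL[OF that] o_def p_def[symmetric] by (rule sym)
  qed
  obtain N where N: "negligible N" "\<And>x. x \<in> {0..l} - N \<Longrightarrow> (\<omega> x)\<^sup>2 = p x"
    by (rule ae_eq_of_integrals_eq[OF i pc]) (use ip in auto)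
  have p0: "0 \<le> p x" if "x \<in> {0..l}" for x
    by (rule continuous_nonneg_ae[OF pc l N(1) _ that]) (simp flip: N(2))
  have up: "((\<lambda>t. sqrt (p t)) has_integral (\<theta> y - \<theta> x)) {x..y}" if "0 \<le> x" "x \<le> y" "y \<le> c" for x y
    by (rule mono_phase_has_integral[OF prim N mono(1)]) (use that c in auto)
  have down: "((\<lambda>t. sqrt (p t)) has_integral (\<theta> x - \<theta> y)) {x..y}" if "c \<le> x" "x \<le> y" "y \<le> l" for x y
    by (rule antimono_phase_has_integral[OF prim N mono(2)]) (use that c in auto)
  have corner: "p c = 0" if "0 < c" "c < l"
    using no_corner_at_peak[OF min nc mono that pc ip up down turn] p0[OF c] by simp
  \<comment> \<open>At an interior peak one of the two terms is \<open>sqrt (p c) = 0\<close>, so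
    the formula is continuous without a case distinction at \<open>c\<close>. If \<open>c\<close> is
    an end of the interval, \<open>p c\<close> may be positive, but only one phase is
    present.\<close>
  define \<kappa> where "\<kappa> x = (if c = 0 then - sqrt (p x) else if c = l then sqrt (p x)
     else sqrt (p (min x c)) - sqrt (p (max x c)))" for x
  have k1: "\<kappa> x = sqrt (p x)" if "0 \<le> x" "x \<le> c" "0 < c" for x
    using corner that c by (auto simp: \<kappa>_def min_def max_def)
  have k2: "\<kappa> x = - sqrt (p x)" if "c \<le> x" "c < l" for x
    using corner that c by (auto simp: \<kappa>_def min_def max_def)
  have kc: "continuous_on {0..l} \<kappa>"
  proof -
    have "continuous_on {0..l} (\<lambda>x. p (min x c))" "continuous_on {0..l} (\<lambda>x. p (max x c))"
      by (rule continuous_on_compose2[OF pc]; use c in \<open>auto intro!: continuous_intros\<close>)+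
    then show ?thesis unfolding \<kappa>_def by (cases "c = 0"; cases "c = l") (auto intro!: continuous_intros pc)
  qed
  have ki: "(\<kappa> has_integral (\<theta> x - \<theta> 0)) {0..x}" if x: "x \<in> {0..l}" for x
  proof -
    have A: "(\<kappa> has_integral (\<theta> y - \<theta> 0)) {0..y}" if "0 \<le> y" "y \<le> c" for y
    proof (cases "c = 0")
      case False
      then show ?thesis using that c by (intro has_integral_eq[OF _ up[of 0 y]]) (auto simp: k1)
    qed (use that in auto)
    have B: "(\<kappa> has_integral (\<theta> y - \<theta> c)) {c..y}" if "c \<le> y" "y \<le> l" for y
    proof (cases "c = l")
      case False
      have "((\<lambda>t. - sqrt (p t)) has_integral - (\<theta> c - \<theta> y)) {c..y}"
        by (rule has_integral_neg[OF down]) (use that in auto)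
      then have "(\<kappa> has_integral - (\<theta> c - \<theta> y)) {c..y}"
        by (rule has_integral_eq[rotated]) (use False c k2 in auto)
      then show ?thesis by simp
    qed (use that in auto)
    show ?thesis
    proof (cases "x \<le> c")
      case True
      then show ?thesis using A x by auto
    next
      case False
      then show ?thesis using has_integral_combine[OF _ _ A[of c] B[of x]] x c by simp
    qed
  qed
  have k2p: "(\<kappa> x)\<^sup>2 = p x" if "x \<in> {0..l}" for x
    using k1[of x] k2[of x] p0[OF that] that c l by (cases "x \<le> c \<and> 0 < c") (auto simp: not_le)
  have "energy l \<omega> = integral {0..l} (\<lambda>x. (\<kappa> x)\<^sup>2)"
    unfolding energy_def ip[OF order_refl] by (rule integral_cong) (simp add: k2p)
  moreover have "elastica l \<theta> \<Lambda> \<kappa>"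
    unfolding elastica_def using kc k2p derivative_of_primitive[OF kc ki] by (simp add: p_def)
  ultimately show ?thesis by blast
qed

section \<open>Symmetries of the equation, and the curvature of every minimal arc\<close>

lemma elastica_uminus:
  assumes "elastica l \<theta> \<Lambda> \<kappa>"
  shows "elastica l (\<lambda>x. - \<theta> x) (cnj \<Lambda>) (\<lambda>x. - \<kappa> x)"
proof -
  have "Re (cnj (cnj \<Lambda>) * cis (- t)) = Re (cnj \<Lambda> * cis t)" for t by simp
  then show ?thesis using assms unfolding elastica_def
    by (simp only: power2_minus) (intro conjI ballI continuous_on_minus DERIV_minus; blast)
qed

lemma elastica_reverse:
  assumes "elastica l \<theta> \<Lambda> \<kappa>"
  shows "elastica l (\<lambda>x. \<theta> (l - x)) \<Lambda> (\<lambda>x. - \<kappa> (l - x))"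
  unfolding elastica_def
proof (intro conjI ballI)
  have k: "continuous_on {0..l} \<kappa>" and
    d: "\<And>x. x \<in> {0..l} \<Longrightarrow> (\<theta> has_real_derivative \<kappa> x) (at x within {0..l})" and
    e: "\<And>x. x \<in> {0..l} \<Longrightarrow> (\<kappa> x)\<^sup>2 = Re (cnj \<Lambda> * cis (\<theta> x))"
    using assms by (auto simp: elastica_def)
  show "continuous_on {0..l} (\<lambda>x. - \<kappa> (l - x))"
    by (intro continuous_intros continuous_on_compose2[OF k]) auto
  fix x assume x: "x \<in> {0..l}"
  show "(- \<kappa> (l - x))\<^sup>2 = Re (cnj \<Lambda> * cis (\<theta> (l - x)))" using e[of "l - x"] x by simp
  have "(\<theta> has_real_derivative \<kappa> (l - x)) (at (l - x) within (\<lambda>x. l - x) ` {0..l})"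
    using d[of "l - x"] x by (simp add: image_diff_atLeastAtMost)
  moreover have "((\<lambda>x. l - x) has_real_derivative - 1) (at x within {0..l})"
    by (auto intro!: derivative_eq_intros)
  ultimately have "(\<theta> \<circ> (\<lambda>x. l - x) has_real_derivative \<kappa> (l - x) * - 1) (at x within {0..l})"
    by (rule DERIV_image_chain)
  then show "((\<lambda>x. \<theta> (l - x)) has_real_derivative - \<kappa> (l - x)) (at x within {0..l})" by (simp add: o_def)
qed

lemma constant_or_rising:
  obtains "\<And>x y. x \<in> S \<Longrightarrow> y \<in> S \<Longrightarrow> \<theta> x = (\<theta> y :: real)" | x y where "x \<in> S" "y \<in> S" "\<theta> x < \<theta> y"
  by (metis linorder_neqE_linordered_idom)

lemma elastica_constant:
  assumes "\<And>x y. x \<in> {0..l} \<Longrightarrow> y \<in> {0..l} \<Longrightarrow> \<theta> x = \<theta> y" "x \<in> {0..l}"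
  shows "(\<theta> has_real_derivative 0) (at x within {0..l})"
proof -
  have "((\<lambda>_. \<theta> x) has_real_derivative 0) (at x within {0..l})" by simp
  then show ?thesis
    by (rule has_field_derivative_transform_within[OF _ zero_less_one assms(2)])
      (rule assms(1)[OF assms(2)])
qed

text \<open>A constant angle has no independent displacements, but its curvature is plainly 0. An
  arc that falls and then rises is the reflection of one that rises and then falls.\<close>

theorem minimal_arc_elastica:
  assumes min: "minimal_arc l \<theta> \<omega> V"
  obtains \<Lambda> \<kappa> where "elastica l \<theta> \<Lambda> \<kappa>" "energy l \<omega> = integral {0..l} (\<lambda>x. (\<kappa> x)\<^sup>2)"
proof (cases rule: constant_or_rising[of "{0..l}" \<theta>])
  case 1
  have l: "0 < l" and prim: "primitive_on 0 l \<theta> \<omega>" using min by (auto simp: minimal_arc_def s_arc_def)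
  obtain N where N: "negligible N"
    "\<And>x. x \<in> {0..l} - N \<Longrightarrow> (\<theta> has_real_derivative \<omega> x) (at x within {0..l})"
    by (rule primitive_on_ae_derivative[OF prim]) blast
  have "energy l \<omega> = integral {0..l} (\<lambda>x. 0)"
    unfolding energy_def
  proof (rule integral_spike[of "N \<union> {0, l}"])
    show "negligible (N \<union> {0, l})" using N(1) by (intro negligible_Un) auto
    fix x assume x: "x \<in> {0..l} - (N \<union> {0, l})"
    have "\<omega> x = 0"
      by (rule DERIV_within_Icc_unique[OF N(2) elastica_constant[OF 1]]) (use x in auto)
    then show "0 = (\<omega> x)\<^sup>2" by simp
  qed
  moreover have "elastica l \<theta> 0 (\<lambda>_. 0)" unfolding elastica_def
    by (intro conjI ballI elastica_constant[OF 1] continuous_on_const) simp_all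
  ultimately show thesis using that by simp
next
  case (2 x1 y1)
  obtain c where c: "c \<in> {0..l}"
     "mono_on {0..c} \<theta> \<and> antimono_on {c..l} \<theta> \<or> antimono_on {0..c} \<theta> \<and> mono_on {c..l} \<theta>"
     "\<bar>\<theta> c - \<theta> 0\<bar> \<le> pi" "\<bar>\<theta> l - \<theta> c\<bar> \<le> pi"
    using min unfolding minimal_arc_def s_arc_def s_shaped_def by blast
  from c(2) show thesis
  proof (elim disjE conjE)
    assume "mono_on {0..c} \<theta>" "antimono_on {c..l} \<theta>"
    from elastica_peak[OF min 2 c(1) this c(3,4)] show thesis by (elim exE conjE) (rule that)
  next
    assume "antimono_on {0..c} \<theta>" "mono_on {c..l} \<theta>"
    then have m: "mono_on {0..c} (\<lambda>x. - \<theta> x)" "antimono_on {c..l} (\<lambda>x. - \<theta> x)"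
      by (simp_all add: monotone_on_uminus_iff)
    have e: "energy l (\<lambda>x. - \<omega> x) = energy l \<omega>" by (simp add: energy_def)
    have "\<exists>\<Lambda> \<kappa>. elastica l (\<lambda>x. - \<theta> x) \<Lambda> \<kappa> \<and> energy l (\<lambda>x. - \<omega> x) = integral {0..l} (\<lambda>x. (\<kappa> x)\<^sup>2)"
      by (rule elastica_peak[OF minimal_arc_uminus[OF min] 2(2,1) _ c(1) m]) (use 2(3) c(3,4) in linarith)+
    then obtain \<Lambda> \<kappa> where k: "elastica l (\<lambda>x. - \<theta> x) \<Lambda> \<kappa>" "energy l \<omega> = integral {0..l} (\<lambda>x. (\<kappa> x)\<^sup>2)"
      unfolding e by (elim exE conjE)
    show thesis using that[of "cnj \<Lambda>" "\<lambda>x. - \<kappa> x"] elastica_uminus[OF k(1)] k(2) by simp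
  qed
qed

text \<open>The density of the angle is determined only almost everywhere. The continuous curvature,
  extended by 0 to a Borel function on the line, is a choice whose pointwise values are
  known.\<close>

lemma minimal_arc_use_curvature:
  assumes min: "minimal_arc l \<theta> \<omega> V" and k: "elastica l \<theta> \<Lambda> \<kappa>"
    and e: "energy l \<omega> = integral {0..l} (\<lambda>x. (\<kappa> x)\<^sup>2)"
  shows "minimal_arc l \<theta> (\<lambda>x. if x \<in> {0..l} then \<kappa> x else 0) V"
proof -
  let ?k = "\<lambda>x. if x \<in> {0..l} then \<kappa> x else 0"
  have kc: "continuous_on {0..l} \<kappa>" using k by (simp add: elastica_def)
  have "?k = (\<lambda>x. indicat_real {0..l} x *\<^sub>R \<kappa> x)" by (auto simp: indicator_def)
  then have b: "?k \<in> borel_measurable borel"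
    using borel_measurable_continuous_on_indicator[OF _ kc] by simp
  have "primitive_on 0 l \<theta> ?k"
    unfolding primitive_on_def
  proof (intro conjI b ballI)
    have "set_integrable lebesgue {0..l} ?k \<longleftrightarrow> set_integrable lebesgue {0..l} \<kappa>"
      by (rule set_integrable_cong) auto
    from this[THEN iffD2, OF absolutely_integrable_continuous_real[OF kc]]
    show "?k absolutely_integrable_on {0..l}" .
    fix x assume x: "x \<in> {0..l}"
    have "(\<kappa> has_integral (\<theta> x - \<theta> 0)) {0..x}"
    proof (rule fundamental_theorem_of_calculus)
      fix y assume "y \<in> {0..x}"
      then have "y \<in> {0..l}" "{0..x} \<subseteq> {0..l}" using x by auto
      moreover have "\<And>y. y \<in> {0..l} \<Longrightarrow> (\<theta> has_real_derivative \<kappa> y) (at y within {0..l})"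
        using k unfolding elastica_def by blast
      ultimately have "(\<theta> has_real_derivative \<kappa> y) (at y within {0..x})"
        by (rule_tac has_field_derivative_subset)
      then show "(\<theta> has_vector_derivative \<kappa> y) (at y within {0..x})"
        by (simp add: has_real_derivative_iff_has_vector_derivative)
    qed (use x in auto)
    then show "(?k has_integral (\<theta> x - \<theta> 0)) {0..x}" by (rule has_integral_eq[rotated]) (use x in auto)
  qed
  moreover have "(\<lambda>x. (?k x)\<^sup>2) integrable_on {0..l}"
  proof -
    have "(\<lambda>x. (\<kappa> x)\<^sup>2) integrable_on {0..l}" by (intro integrable_continuous_real continuous_intros kc)
    then show ?thesis by (rule integrable_eq) simp
  qed
  ultimately have A: "s_arc l \<theta> ?k V" using min unfolding minimal_arc_def s_arc_def by blast
  have "integral {0..l} (\<lambda>x. (?k x)\<^sup>2) = integral {0..l} (\<lambda>x. (\<kappa> x)\<^sup>2)" by (rule integral_cong) simp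
  then have E: "energy l ?k = energy l \<omega>" using e by (simp only: energy_def)
  show ?thesis using A min unfolding minimal_arc_def E by blast
qed

section \<open>Arcs of finite energy exist\<close>

text \<open>The curvature is made bounded by slowing down where it is large; the displacement is then repaired
  by changing the speed on two intervals with independent displacements.\<close>

lemma finite_energy_arc_exists:
  assumes l: "0 < l" and prim: "primitive_on 0 l \<theta> \<omega>" and s: "s_shaped 0 l \<theta>"
  obtains l' \<theta>' \<omega>' where "s_arc l' \<theta>' \<omega>' (displacement \<theta> 0 l)" "\<theta>' 0 = \<theta> 0" "\<theta>' l' = \<theta> l"
proof (cases rule: constant_or_rising[of "{0..l}" \<theta>])
  case 1
  have "primitive_on 0 l \<theta> (\<lambda>_. 0)"
    unfolding primitive_on_def
  proof (intro conjI ballI)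
    fix x assume "x \<in> {0..l}"
    then have "\<theta> x = \<theta> 0" by (rule 1) (use l in simp)
    then have "\<theta> x - \<theta> 0 = 0" by (simp only: right_minus_eq)
    then show "((\<lambda>_. 0) has_integral (\<theta> x - \<theta> 0)) {0..x}" by (simp only: has_integral_0)
  qed (simp_all add: set_integrable_def)
  then have "s_arc l \<theta> (\<lambda>_. 0) (displacement \<theta> 0 l)" using l s by (simp add: s_arc_def displacement_def integrable_0)
  then show thesis using that by blast
next
  case (2 x1 y1)
  have cont: "continuous_on {0..l} \<theta>" by (rule primitive_on_continuous[OF prim])
  have [measurable]: "\<omega> \<in> borel_measurable borel" and ai: "\<omega> absolutely_integrable_on {0..l}"
    using prim by (simp_all add: primitive_on_def)
  obtain p q p' q' where I: "p < q" "{p..q} \<subseteq> {0..l}" "p' < q'" "{p'..q'} \<subseteq> {0..l}"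
    and det0: "det2 (displacement \<theta> p q) (displacement \<theta> p' q') \<noteq> 0"
    by (rule independent_displacements[OF cont l 2])
  let ?A = "displacement \<theta> p q" and ?B = "displacement \<theta> p' q'"
  define d where "d = \<bar>det2 ?A ?B\<bar>"
  have d: "0 < d" using det0 by (simp add: d_def)
  \<comment> \<open>The large values of the curvature are added to the speed. Where
    \<open>\<bar>\<omega>\<bar> > n\<close> the speed is then at least
    \<open>\<bar>\<omega>\<bar>\<close>, so
    \<open>\<omega>\<^sup>2 / v \<le> \<bar>\<omega>\<bar>\<close>; elsewhere
    \<open>\<omega>\<close> is bounded by \<open>n\<close>.\<close>
  define big where "big n x = (if real n < \<bar>\<omega> x\<bar> then \<bar>\<omega> x\<bar> else 0) * indicat_real {0..l} x" for n x
  have big_borel [measurable]: "big n \<in> borel_measurable borel" for n unfolding big_def by measurable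
  have big0: "0 \<le> big n x" for n x by (simp add: big_def)
  have abs_int: "(\<lambda>x. \<bar>\<omega> x\<bar>) integrable_on {0..l}" using ai by (simp add: absolutely_integrable_on_def)
  have big_le: "norm (big n x) \<le> \<bar>\<omega> x\<bar>" for n x by (simp add: big_def indicator_def)
  have bigi: "big n integrable_on {0..l}" for n
  proof -
    have "big n \<in> borel_measurable (lebesgue_on {0..l})"
      by (intro measurable_restrict_space1 measurable_completion) simp
    from measurable_bounded_by_integrable_imp_absolutely_integrable[OF this _ abs_int big_le]
    show ?thesis by (intro set_lebesgue_integral_eq_integral(1)) simp
  qed
  have "(\<lambda>n. integral {0..l} (big n)) \<longlonglongrightarrow> integral {0..l} (\<lambda>x. 0)"
  proof (rule dominated_convergence(2)[OF _ abs_int])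
    show "big n integrable_on {0..l}" for n by (rule bigi)
    show "norm (big n x) \<le> \<bar>\<omega> x\<bar>" for n x by (rule big_le)
    fix x
    obtain n0 :: nat where "\<bar>\<omega> x\<bar> \<le> real n0" using real_arch_simple by blast
    then have "\<forall>\<^sub>F n in sequentially. big n x = 0"
      unfolding eventually_sequentially by (intro exI[of _ n0]) (auto simp: big_def)
    then show "(\<lambda>n. big n x) \<longlonglongrightarrow> 0" by (rule tendsto_eventually)
  qed
  then have lim: "(\<lambda>n. integral {0..l} (big n)) \<longlonglongrightarrow> 0" by simp
  \<comment> \<open>With this bound on the tail the corrections \<open>x\<close> and
    \<open>y\<close> are at most 1/4 in magnitude, so the bounded part \<open>h\<close> of the speed
    stays between 1/2 and 3/2.\<close>
  have "0 < d / (4 * l)" using d l by simp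
  from order_tendstoD(2)[OF lim this] obtain n where n: "integral {0..l} (big n) < d / (4 * l)"
    unfolding eventually_sequentially by auto
  have wi: "(\<lambda>x. big n x *\<^sub>R cis (\<theta> x)) integrable_on {0..l}"
  proof -
    have "big n \<in> borel_measurable (lebesgue_on {0..l})"
      by (intro measurable_restrict_space1 measurable_completion) simp
    moreover have "(\<lambda>x. cis (\<theta> x)) \<in> borel_measurable (lebesgue_on {0..l})"
      by (intro continuous_imp_measurable_on_sets_lebesgue continuous_on_cis_angle cont) simp
    ultimately have m: "(\<lambda>x. big n x *\<^sub>R cis (\<theta> x)) \<in> borel_measurable (lebesgue_on {0..l})"
      by (rule borel_measurable_scaleR)
    have "norm (big n x *\<^sub>R cis (\<theta> x)) \<le> \<bar>\<omega> x\<bar>" for x using big_le[of n x] by simp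
    from measurable_bounded_by_integrable_imp_absolutely_integrable[OF m _ abs_int this]
    show ?thesis by (intro set_lebesgue_integral_eq_integral(1)) simp
  qed
  define W where "W = integral {0..l} (\<lambda>x. big n x *\<^sub>R cis (\<theta> x))"
  have W: "norm W \<le> integral {0..l} (big n)"
    unfolding W_def by (rule Henstock_Kurzweil_Integration.integral_norm_bound_integral[OF wi bigi])
      (simp add: big0 abs_of_nonneg)
  define x y where "x = det2 (- W) ?B / det2 ?A ?B" and "y = det2 ?A (- W) / det2 ?A ?B"
  have xy: "\<bar>x\<bar> \<le> 1/4" "\<bar>y\<bar> \<le> 1/4"
  proof -
    have AB: "norm ?A \<le> l" "norm ?B \<le> l" using displacement_norm_le[OF cont _ l] I by auto
    have "norm (- W) \<le> d / (4 * l)" using W n by simp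
    then have "\<bar>det2 (- W) ?B\<bar> \<le> d / (4 * l) * l" "\<bar>det2 ?A (- W)\<bar> \<le> l * (d / (4 * l))"
      by (intro order_trans[OF abs_det2_le] mult_mono AB; use l d in simp)+
    then show "\<bar>x\<bar> \<le> 1/4" "\<bar>y\<bar> \<le> 1/4"
      using d l unfolding x_def y_def abs_divide d_def[symmetric] by (simp_all add: field_simps)
  qed
  have xyW: "x *\<^sub>R ?A + y *\<^sub>R ?B = - W" unfolding x_def y_def by (rule cramer[OF det0])
  define h where "h t = 1 + x * indicat_real {p..q} t + y * indicat_real {p'..q'} t" for t
  define v where "v t = h t + big n t" for t
  have h: "1/2 \<le> h t" "h t \<le> 3/2" for t using xy by (auto simp: h_def indicator_def abs_le_iff)
  have [measurable]: "h \<in> borel_measurable borel" unfolding h_def by measurable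
  have vb: "v \<in> borel_measurable borel" unfolding v_def by measurable
  have v2: "1/2 \<le> v t" for t using h(1)[of t] big0[of n t] by (simp add: v_def)
  have vi: "v integrable_on {u..w}" for u w
  proof -
    have "h integrable_on {u..w}" 
    proof (rule bounded_borel_integrable[of _ "3/2"])
      show "\<bar>h t\<bar> \<le> 3/2" for t using h[of t] by simp
    qed simp
    moreover have "big n integrable_on {u..w}"
    proof -
      have "(\<lambda>x. if x \<in> {0..l} then big n x else 0) integrable_on UNIV"
        using bigi by (simp only: integrable_restrict_UNIV)
      then have "big n integrable_on UNIV" by (rule integrable_eq) (auto simp: big_def)
      then show ?thesis by (rule integrable_on_subinterval) simp
    qed
    ultimately show ?thesis unfolding v_def by (rule integrable_add)
  qed
  have ci: "(\<lambda>t. cis (\<theta> t)) integrable_on {0..l}" by (rule cis_integrable[OF cont])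
  have "((\<lambda>t. (cis (\<theta> t) + x *\<^sub>R (indicat_real {p..q} t *\<^sub>R cis (\<theta> t)) + y *\<^sub>R (indicat_real {p'..q'} t *\<^sub>R cis (\<theta> t)))
      + big n t *\<^sub>R cis (\<theta> t)) has_integral ((displacement \<theta> 0 l + x *\<^sub>R ?A + y *\<^sub>R ?B) + W)) {0..l}"
    unfolding displacement_def W_def
    by (intro has_integral_add has_integral_cmul integrable_integral ci wi has_integral_indicator_interval I)
  moreover have "(displacement \<theta> 0 l + x *\<^sub>R ?A + y *\<^sub>R ?B) + W = displacement \<theta> 0 l"
    using xyW by (simp add: add.assoc)
  moreover have "(cis (\<theta> t) + x *\<^sub>R (indicat_real {p..q} t *\<^sub>R cis (\<theta> t)) + y *\<^sub>R (indicat_real {p'..q'} t *\<^sub>R cis (\<theta> t)))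
      + big n t *\<^sub>R cis (\<theta> t) = v t *\<^sub>R cis (\<theta> t)" for t by (simp add: v_def h_def scaleR_add_left)
  ultimately have V: "integral {0..l} (\<lambda>t. v t *\<^sub>R cis (\<theta> t)) = displacement \<theta> 0 l"
    by (simp add: integral_unique)
  have ei: "(\<lambda>t. (\<omega> t)\<^sup>2 / v t) integrable_on {0..l}"
  proof -
    have bnd: "norm ((\<omega> t)\<^sup>2 / v t) \<le> 2 * (real n)\<^sup>2 + \<bar>\<omega> t\<bar>" if "t \<in> {0..l}" for t
    proof (cases "real n < \<bar>\<omega> t\<bar>")
      case True
      then have "\<bar>\<omega> t\<bar> \<le> v t" using h(1)[of t] that by (simp add: v_def big_def)
      then have "\<bar>\<omega> t\<bar> * \<bar>\<omega> t\<bar> \<le> \<bar>\<omega> t\<bar> * v t" by (intro mult_left_mono) auto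
      then have "(\<omega> t)\<^sup>2 / v t \<le> \<bar>\<omega> t\<bar>" using v2[of t] by (simp add: pos_divide_le_eq power2_eq_square)
      moreover have "0 \<le> (\<omega> t)\<^sup>2 / v t" using v2[of t] by simp
      moreover have "0 \<le> (real n)\<^sup>2" by simp
      ultimately show ?thesis unfolding real_norm_def abs_of_nonneg[OF \<open>0 \<le> (\<omega> t)\<^sup>2 / v t\<close>] by linarith
    next
      case False
      then have "(\<omega> t)\<^sup>2 \<le> (real n)\<^sup>2" by (simp add: abs_le_square_iff[symmetric])
      then have "(\<omega> t)\<^sup>2 / v t \<le> (real n)\<^sup>2 / (1/2)" using v2[of t] by (intro frac_le) auto
      then have "(\<omega> t)\<^sup>2 / v t \<le> 2 * (real n)\<^sup>2" by (simp only: divide_divide_eq_right div_by_1 mult.commute)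
      moreover have "0 \<le> (\<omega> t)\<^sup>2 / v t" using v2[of t] by simp
      moreover have "0 \<le> (real n)\<^sup>2" by simp
      ultimately show ?thesis unfolding real_norm_def abs_of_nonneg[OF \<open>0 \<le> (\<omega> t)\<^sup>2 / v t\<close>] by linarith
    qed
    have gi: "(\<lambda>t. 2 * (real n)\<^sup>2 + \<bar>\<omega> t\<bar>) integrable_on {0..l}"
      by (intro integrable_add abs_int integrable_const_ivl)
    have "(\<lambda>t. (\<omega> t)\<^sup>2 / v t) \<in> borel_measurable borel" using vb by measurable
    then have "(\<lambda>t. (\<omega> t)\<^sup>2 / v t) \<in> borel_measurable (lebesgue_on {0..l})"
      by (intro measurable_restrict_space1 measurable_completion) simp
    from measurable_bounded_by_integrable_imp_absolutely_integrable[OF this _ gi bnd]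
    show ?thesis by (intro set_lebesgue_integral_eq_integral(1)) simp
  qed
  show thesis
    by (rule arc_change_speed_integrable[OF l prim s vb _ v2 vi ei V]) (simp, rule that)
qed

section \<open>Variation of an end angle\<close>

lemma last_point_le:
  fixes f :: "real \<Rightarrow> real"
  assumes cont: "continuous_on {a..b} f" and ab: "a \<le> b" and fa: "f a \<le> k"
  obtains p where "p \<in> {a..b}" "f p \<le> k" "\<And>x. x \<in> {p<..b} \<Longrightarrow> k < f x"
proof -
  let ?S = "{x \<in> {a..b}. f x \<le> k}"
  have "closed ?S" by (intro continuous_on_closed_Collect_le cont continuous_on_const closed_atLeastAtMost)
  moreover have "?S = {a..b} \<inter> ?S" by auto
  ultimately have "compact ?S" using compact_Int_closed[of "{a..b}" ?S] by (simp only: compact_Icc)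
  moreover have "?S \<noteq> {}" using ab fa by auto
  ultimately obtain p where p: "p \<in> ?S" "\<And>x. x \<in> ?S \<Longrightarrow> x \<le> p" using compact_attains_sup[of ?S] by blast
  show thesis
  proof (rule that[of p])
    fix x assume x: "x \<in> {p<..b}"
    show "k < f x"
    proof (rule ccontr)
      assume "\<not> k < f x"
      then have "x \<in> ?S" using x p(1) by auto
      then show False using p(2)[of x] x by auto
    qed
  qed (use p(1) in auto)
qed

lemma first_point_ge:
  fixes f :: "real \<Rightarrow> real"
  assumes cont: "continuous_on {a..b} f" and ab: "a \<le> b" and fb: "k \<le> f b"
  obtains q where "q \<in> {a..b}" "k \<le> f q" "\<And>x. x \<in> {a..<q} \<Longrightarrow> f x < k"
proof -
  have "continuous_on {- b..- a} (\<lambda>x. - f (- x))"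
    by (intro continuous_intros continuous_on_compose2[OF cont]) auto
  then obtain p where p: "p \<in> {- b..- a}" "- f (- p) \<le> - k" "\<And>x. x \<in> {p<..- a} \<Longrightarrow> - k < - f (- x)"
    by (rule last_point_le[of "- b" "- a" _ "- k"]) (use ab fb in auto)
  show thesis
  proof (rule that[of "- p"])
    fix x assume "x \<in> {a..<- p}"
    then show "f x < k" using p(3)[of "- x"] by auto
  qed (use p in auto)
qed

text \<open>Flattening a valley is taking the maximum with its level, which preserves both phases
  and does not increase the turns.\<close>

lemma s_shaped_flatten_valley:
  assumes mono: "antimono_on {0..c} \<theta>" "mono_on {c..l} \<theta>"
    and s: "0 \<le> s1" "s1 \<le> c" "c \<le> s2" "s2 \<le> l" "\<theta> s1 = \<theta> s2"
    and turn: "\<bar>\<theta> c - \<theta> 0\<bar> \<le> pi" "\<bar>\<theta> l - \<theta> c\<bar> \<le> pi"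
  shows "s_shaped 0 l (flatten s1 s2 \<theta>)"
proof -
  have flat: "flatten s1 s2 \<theta> x = max (\<theta> x) (\<theta> s1)" if "x \<in> {0..l}" for x
  proof -
    consider "x \<le> s1" | "s1 < x" "x \<le> c" | "c < x" "x \<le> s2" | "s2 < x" by linarith
    then show ?thesis
    proof cases
      case 1
      then show ?thesis using monotone_onD[OF mono(1), of x s1] that s by (simp add: flatten_def)
    next
      case 2
      then show ?thesis using monotone_onD[OF mono(1), of s1 x] that s by (simp add: flatten_def)
    next
      case 3
      then show ?thesis using monotone_onD[OF mono(2), of x s2] that s by (simp add: flatten_def)
    next
      case 4
      then show ?thesis using monotone_onD[OF mono(2), of s2 x] that s by (simp add: flatten_def)
    qed
  qed
  have c0: "\<theta> c \<le> \<theta> s1" "\<theta> s1 \<le> \<theta> 0" "\<theta> s2 \<le> \<theta> l"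
    using monotone_onD[OF mono(1), of s1 c] monotone_onD[OF mono(1), of 0 s1] monotone_onD[OF mono(2), of s2 l] s by auto
  show ?thesis
    unfolding s_shaped_def
  proof (intro bexI[of _ c] conjI disjI2)
    show "antimono_on {0..c} (flatten s1 s2 \<theta>)"
    proof (rule monotone_onI)
      fix x y assume "x \<in> {0..c}" "y \<in> {0..c}" "x \<le> y"
      then show "flatten s1 s2 \<theta> y \<le> flatten s1 s2 \<theta> x"
        using monotone_onD[OF mono(1), of x y] flat[of x] flat[of y] s by auto
    qed
    show "mono_on {c..l} (flatten s1 s2 \<theta>)"
    proof (rule monotone_onI)
      fix x y assume "x \<in> {c..l}" "y \<in> {c..l}" "x \<le> y"
      then show "flatten s1 s2 \<theta> x \<le> flatten s1 s2 \<theta> y"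
        using monotone_onD[OF mono(2), of x y] flat[of x] flat[of y] s by auto
    qed
    have "flatten s1 s2 \<theta> c = \<theta> s1" "flatten s1 s2 \<theta> 0 = \<theta> 0" "flatten s1 s2 \<theta> l = \<theta> l"
      using flat[of c] flat[of 0] flat[of l] s c0 by auto
    then show "\<bar>flatten s1 s2 \<theta> c - flatten s1 s2 \<theta> 0\<bar> \<le> pi" "\<bar>flatten s1 s2 \<theta> l - flatten s1 s2 \<theta> c\<bar> \<le> pi"
      using turn c0 s(5) by (simp_all only:)
  qed (use s in auto)
qed

text \<open>Formally \<open>2 * \<kappa> * \<kappa>' = - L * cos (\<theta> 0 - \<theta>) *
  \<kappa>\<close>. As differentiability of \<open>\<kappa>\<close> is not known beforehand,
  \<open>\<kappa>\<close> is written as a square root with the constant sign that it has near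
  \<open>x\<close>. The right-hand side of the equation vanishes at 0, so the curvature is zero at
  the start.\<close>

lemma curvature_derivative:
  assumes kc: "continuous_on {0..l} \<kappa>"
    and d: "\<And>x. x \<in> {0..l} \<Longrightarrow> (\<theta> has_real_derivative \<kappa> x) (at x within {0..l})"
    and k2: "\<And>x. x \<in> {0..l} \<Longrightarrow> (\<kappa> x)\<^sup>2 = L * sin (\<theta> 0 - \<theta> x)"
    and x: "0 < x" "x < l" and nz: "\<kappa> x \<noteq> 0"
  shows "(\<kappa> has_real_derivative - (L / 2) * cos (\<theta> 0 - \<theta> x)) (at x)"
proof -
  let ?U = "{y \<in> {0<..<l}. 0 < \<kappa> y * \<kappa> x}"
  have "continuous_on {0<..<l} (\<lambda>y. \<kappa> y * \<kappa> x)"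
    by (intro continuous_intros continuous_on_subset[OF kc]) auto
  then have "open ({0<..<l} \<inter> (\<lambda>y. \<kappa> y * \<kappa> x) -` {0<..})"
    by (rule continuous_open_preimage) simp_all
  moreover have "{0<..<l} \<inter> (\<lambda>y. \<kappa> y * \<kappa> x) -` {0<..} = ?U" by auto
  ultimately have U: "open ?U" by (simp only:)
  have xU: "x \<in> ?U" using x nz by (simp add: zero_less_mult_iff) linarith
  have kk: "sgn (\<kappa> x) * sqrt (L * sin (\<theta> 0 - \<theta> y)) = \<kappa> y" if y: "y \<in> ?U" for y
  proof -
    have "sqrt (L * sin (\<theta> 0 - \<theta> y)) = sqrt ((\<kappa> y)\<^sup>2)" using k2[of y] y by simp
    also have "\<dots> = \<bar>\<kappa> y\<bar>" by simp
    finally have eq: "sqrt (L * sin (\<theta> 0 - \<theta> y)) = \<bar>\<kappa> y\<bar>" .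
    show ?thesis unfolding eq using y by (auto simp: zero_less_mult_iff sgn_if)
  qed
  have "at x within {0..l} = at x" using x by (intro at_within_interior) simp
  then have dx: "(\<theta> has_real_derivative \<kappa> x) (at x)" using d[of x] x by simp
  have pos: "0 < L * sin (\<theta> 0 - \<theta> x)" using k2[of x] x nz by (metis atLeastAtMost_iff less_eq_real_def zero_less_power2)
  have sq: "sqrt (L * sin (\<theta> 0 - \<theta> x)) = \<bar>\<kappa> x\<bar>" using k2[of x] x by (metis atLeastAtMost_iff less_imp_le real_sqrt_abs)
  have "((\<lambda>y. L * sin (\<theta> 0 - \<theta> y)) has_real_derivative L * (cos (\<theta> 0 - \<theta> x) * (0 - \<kappa> x))) (at x)"
    by (intro DERIV_cmult DERIV_fun_sin DERIV_diff DERIV_const dx)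
  from DERIV_cmult[OF DERIV_chain2[where f=sqrt and g="\<lambda>y. L * sin (\<theta> 0 - \<theta> y)", OF DERIV_real_sqrt[OF pos] this], of "sgn (\<kappa> x)"]
  have "((\<lambda>y. sgn (\<kappa> x) * sqrt (L * sin (\<theta> 0 - \<theta> y))) has_real_derivative
      sgn (\<kappa> x) * (inverse (sqrt (L * sin (\<theta> 0 - \<theta> x))) / 2 * (L * (cos (\<theta> 0 - \<theta> x) * (0 - \<kappa> x))))) (at x)" .
  moreover have "sgn (\<kappa> x) * (inverse (sqrt (L * sin (\<theta> 0 - \<theta> x))) / 2 * (L * (cos (\<theta> 0 - \<theta> x) * (0 - \<kappa> x))))
      = - (L / 2) * cos (\<theta> 0 - \<theta> x)"
    unfolding sq using nz by (cases "\<kappa> x > 0") (auto simp: sgn_if field_simps)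
  ultimately have "((\<lambda>y. sgn (\<kappa> x) * sqrt (L * sin (\<theta> 0 - \<theta> y))) has_real_derivative - (L / 2) * cos (\<theta> 0 - \<theta> x)) (at x)"
    by (simp only:)
  then show ?thesis by (rule has_field_derivative_transform_within_open[OF _ U xU kk])
qed

text \<open>Up to the factor \<open>- 2 / L\<close> the cosine is the derivative of the curvature.
  So the displacement of a bend in the initial direction can be read off from the curvatures at its
  two ends.\<close>

lemma cos_integral_between_zeros:
  assumes kc: "continuous_on {0..l} \<kappa>"
    and d: "\<And>x. x \<in> {0..l} \<Longrightarrow> (\<theta> has_real_derivative \<kappa> x) (at x within {0..l})"
    and k2: "\<And>x. x \<in> {0..l} \<Longrightarrow> (\<kappa> x)\<^sup>2 = L * sin (\<theta> 0 - \<theta> x)"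
    and pq: "0 \<le> p" "p \<le> q" "q \<le> l" and L: "0 < L"
    and nz: "\<And>x. p < x \<Longrightarrow> x < q \<Longrightarrow> 0 < \<theta> 0 - \<theta> x \<and> \<theta> 0 - \<theta> x < pi"
  shows "((\<lambda>x. cos (\<theta> 0 - \<theta> x)) has_integral - (2 / L) * (\<kappa> q - \<kappa> p)) {p..q}"
proof -
  have "((\<lambda>x. - (L / 2) * cos (\<theta> 0 - \<theta> x)) has_integral (\<kappa> q - \<kappa> p)) {p..q}"
  proof (rule fundamental_theorem_of_calculus_interior[OF pq(2)])
    show "continuous_on {p..q} \<kappa>" by (rule continuous_on_subset[OF kc]) (use pq in auto)
    fix x assume x: "x \<in> {p<..<q}"
    have "0 < sin (\<theta> 0 - \<theta> x)" using nz[of x] x by (intro sin_gt_zero) auto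
    then have "(\<kappa> x)\<^sup>2 \<noteq> 0" using k2[of x] x pq L by auto
    then have "\<kappa> x \<noteq> 0" by simp
    from curvature_derivative[OF kc d k2 _ _ this] x pq
    show "(\<kappa> has_vector_derivative - (L / 2) * cos (\<theta> 0 - \<theta> x)) (at x)"
      by (simp add: has_real_derivative_iff_has_vector_derivative)
  qed
  from has_integral_mult_right[OF this, of "- (2 / L)"] show ?thesis using L by simp
qed

text \<open>As the first chord angle is acute, the straight segments in the initial direction are longer than the
  one in the opposite direction, so that part of the bend can be cut off at a smaller angle and the
  displacement be restored by shortening the straight segments.\<close>

lemma no_half_turn_inflection:
  assumes min: "minimal_arc l \<theta> \<omega> V" and e: "energy l \<omega> = integral {0..l} (\<lambda>x. (\<kappa> x)\<^sup>2)"
    and el: "elastica l \<theta> \<Lambda> \<kappa>"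
    and k2: "\<And>x. x \<in> {0..l} \<Longrightarrow> (\<kappa> x)\<^sup>2 = L * sin (\<theta> 0 - \<theta> x)" and L: "0 < L"
    and range: "\<And>x. x \<in> {0..l} \<Longrightarrow> 0 \<le> \<theta> 0 - \<theta> x \<and> \<theta> 0 - \<theta> x \<le> pi"
    and c: "0 < c" "c < l" and mono: "antimono_on {0..c} \<theta>" "mono_on {c..l} \<theta>"
    and half: "\<theta> 0 - \<theta> c = pi" and rise: "\<theta> c < \<theta> l"
    and X: "0 < Re (cnj V * cis (\<theta> 0))"
  shows False
proof -
  \<comment> \<open>The angle turned away from the start: it grows from 0 to \<open>pi\<close> on
    \<open>{0..c}\<close> and decreases to \<open>\<phi> l < pi\<close> afterwards.\<close>
  define \<phi> where "\<phi> x = \<theta> 0 - \<theta> x" for x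
  have kc: "continuous_on {0..l} \<kappa>"
    and d: "\<And>x. x \<in> {0..l} \<Longrightarrow> (\<theta> has_real_derivative \<kappa> x) (at x within {0..l})"
    using el by (auto simp: elastica_def)
  have l: "0 < l" and prim: "primitive_on 0 l \<theta> \<omega>" and V: "displacement \<theta> 0 l = V"
    using min by (auto simp: minimal_arc_def s_arc_def displacement_def)
  have cont: "continuous_on {0..l} \<theta>" by (rule primitive_on_continuous[OF prim])
  have fc: "continuous_on {0..l} \<phi>" unfolding \<phi>_def by (intro continuous_intros cont)
  have f0: "\<phi> 0 = 0" and fcp: "\<phi> c = pi" and fl: "\<phi> l < pi" using half rise by (auto simp: \<phi>_def)
  have rg: "0 \<le> \<phi> x" "\<phi> x \<le> pi" if "x \<in> {0..l}" for x using range[OF that] by (auto simp: \<phi>_def)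
  have up: "\<phi> x \<le> \<phi> y" if "0 \<le> x" "x \<le> y" "y \<le> c" for x y
    using monotone_onD[OF mono(1), of x y] that by (auto simp: \<phi>_def)
  have down: "\<phi> y \<le> \<phi> x" if "c \<le> x" "x \<le> y" "y \<le> l" for x y
    using monotone_onD[OF mono(2), of x y] that by (auto simp: \<phi>_def)
  have kz: "\<kappa> x = 0" if "x \<in> {0..l}" "\<phi> x = 0 \<or> \<phi> x = pi" for x
    using k2[OF that(1)] that(2) by (auto simp: \<phi>_def[symmetric])
  have sub: "continuous_on {u..w} \<phi>" if "0 \<le> u" "w \<le> l" for u w
    by (rule continuous_on_subset[OF fc]) (use that in auto)
  \<comment> \<open>The points \<open>p\<close>, \<open>q\<close>, \<open>q'\<close> and
    \<open>b'\<close> cut the arc into a segment in the initial direction, a half turn, a segment in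
    the opposite direction, a second bend and a last segment in the initial direction. The segments
    may be single points.\<close>
  obtain p where p: "p \<in> {0..c}" "\<phi> p \<le> 0" "\<And>x. x \<in> {p<..c} \<Longrightarrow> 0 < \<phi> x"
    by (rule last_point_le[of 0 c \<phi> 0]) (use sub c f0 in auto)
  have "p \<in> {0..l}" using p(1) c by auto
  then have pp0: "\<phi> p = 0" by (intro antisym[OF p(2)] rg)
  have "p \<noteq> c" using pp0 fcp pi_gt_zero by (metis less_irrefl)
  then have pp: "\<phi> p = 0" "p < c" using pp0 p(1) by simp_all
  obtain q where q: "q \<in> {p..c}" "pi \<le> \<phi> q" "\<And>x. x \<in> {p..<q} \<Longrightarrow> \<phi> x < pi"
    by (rule first_point_ge[of p c \<phi> pi]) (use sub[of p c] c fcp p in auto)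
  have "q \<in> {0..l}" using q(1) p(1) c by auto
  then have qq0: "\<phi> q = pi" by (intro antisym[OF _ q(2)] rg)
  have "p \<noteq> q" using qq0 pp(1) pi_gt_zero by (metis less_irrefl)
  then have qq: "\<phi> q = pi" "p < q" using qq0 q(1) by simp_all
  have "continuous_on {c..l} (\<lambda>x. - \<phi> x)" by (intro continuous_intros sub) (use c in auto)
  then obtain q' where q': "q' \<in> {c..l}" "- \<phi> q' \<le> - pi" "\<And>x. x \<in> {q'<..l} \<Longrightarrow> - pi < - \<phi> x"
    by (rule last_point_le[of c l "\<lambda>x. - \<phi> x" "- pi"]) (use c fcp in auto)
  have "q' \<in> {0..l}" using q'(1) c by auto
  then have "\<phi> q' \<le> pi" by (rule rg)
  then have qq0': "\<phi> q' = pi" using q'(2) by simp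
  have "q' \<noteq> l" using qq0' fl by (metis less_irrefl)
  then have qq': "\<phi> q' = pi" "q' < l" using qq0' q'(1) by simp_all
  \<comment> \<open>If the angle does not return to its initial value, \<open>b' = l\<close> and the
    last segment is a point. The conditions \<open>x < l\<close> and \<open>b' < l\<close> make the
    last two facts hold in this case as well.\<close>
  obtain b' where b': "q' < b'" "b' \<le> l" "\<And>x. x \<in> {q'..<b'} \<Longrightarrow> 0 < \<phi> x"
    "\<And>x. x \<in> {b'..l} \<Longrightarrow> x < l \<Longrightarrow> \<phi> x = 0" "\<And>x. x \<in> {b'..l} \<Longrightarrow> b' < l \<Longrightarrow> \<phi> x = 0"
  proof (cases "\<phi> l \<le> 0")
    case True
    have "continuous_on {q'..l} (\<lambda>x. - \<phi> x)" by (intro continuous_intros sub) (use q' c in auto)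
    then obtain b where b: "b \<in> {q'..l}" "0 \<le> - \<phi> b" "\<And>x. x \<in> {q'..<b} \<Longrightarrow> - \<phi> x < 0"
      by (rule first_point_ge[of q' l "\<lambda>x. - \<phi> x" 0]) (use qq' True in auto)
    have z: "\<phi> x = 0" if "x \<in> {b..l}" for x
      using down[of b x] that b q' c rg[of x] by auto
    have "b \<noteq> q'" using z[of b] b qq' pi_gt_zero by auto
    then show thesis using b by (intro that[of b] z) auto
  next
    case False
    then have "0 < \<phi> x" if "x \<in> {q'..<l}" for x using down[of x l] that q' by auto
    then show thesis using qq' by (intro that[of l]) auto
  qed
  have ord: "0 \<le> p" "p \<le> q" "q \<le> q'" "q' \<le> b'" "b' \<le> l" "p < q" "q' < b'" "q \<le> c" "c \<le> q'"
    using p(1) q(1) q'(1) b'(1,2) qq(2) by auto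
  \<comment> \<open>The total length of the segments in the initial direction.\<close>
  define K where "K = p + (l - b')"
  have i_p: "((\<lambda>x. cos (\<phi> x)) has_integral p) {0..p}"
  proof -
    have c1: "1 = cos (\<phi> x)" if "x \<in> {0..p}" for x
    proof -
      have "\<phi> x = 0" using up[of x p] that p(1) pp rg[of x] c by auto
      then show ?thesis by simp
    qed
    have "((\<lambda>_. 1::real) has_integral p) {0..p}"
      using has_integral_const_real[of "1::real" 0 p] p(1) by simp
    from has_integral_eq[OF c1 this] show ?thesis .
  qed
  have i_pq: "((\<lambda>x. cos (\<phi> x)) has_integral 0) {p..q}"
  proof -
    have "((\<lambda>x. cos (\<theta> 0 - \<theta> x)) has_integral - (2 / L) * (\<kappa> q - \<kappa> p)) {p..q}"
    proof (rule cos_integral_between_zeros[OF kc d k2 _ _ _ L])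
      fix x assume x: "p < x" "x < q"
      show "0 < \<theta> 0 - \<theta> x \<and> \<theta> 0 - \<theta> x < pi"
        using p(3)[of x] q(3)[of x] x q(1) by (simp add: \<phi>_def)
    qed (use p(1) q(1) c in auto)
    moreover have "\<kappa> p = 0" "\<kappa> q = 0" using kz[of p] kz[of q] pp qq p(1) q(1) c by auto
    ultimately show ?thesis by (simp add: \<phi>_def)
  qed
  have flat: "\<phi> x = pi" if "x \<in> {q..q'}" for x
  proof (cases "x \<le> c")
    case True
    then show ?thesis using up[of q x] that q(1) p(1) qq rg[of x] c by auto
  next
    case False
    then show ?thesis using down[of x q'] that q'(1) qq' rg[of x] c by auto
  qed
  have i_qq: "((\<lambda>x. cos (\<phi> x)) has_integral - (q' - q)) {q..q'}"
  proof -
    have "((\<lambda>_. -1::real) has_integral - (q' - q)) {q..q'}"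
      using has_integral_const_real[of "-1::real" q q'] q(1) q'(1) by simp
    then show ?thesis by (rule has_integral_eq[rotated]) (simp add: flat)
  qed
  \<comment> \<open>The angle rises up to \<open>b'\<close>, so it cannot have a negative derivative
    there.\<close>
  have kb: "0 \<le> \<kappa> b'"
  proof (rule ccontr)
    assume "\<not> 0 \<le> \<kappa> b'"
    then obtain h0 where h0: "h0 > 0" "\<And>h. h > 0 \<Longrightarrow> b' - h \<in> {0..l} \<Longrightarrow> h < h0 \<Longrightarrow> \<theta> b' < \<theta> (b' - h)"
      using has_real_derivative_neg_dec_left[OF d[of b']] b'(1,2) q'(1) c by auto
    define h where "h = min (h0/2) ((b' - q')/2)"
    have "h \<le> (b' - q')/2" unfolding h_def by (rule min.cobounded2)
    then have h: "0 < h" "h < h0" "h \<le> (b' - q')/2" using h0(1) b'(1) by (auto simp: h_def)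
    have "q' \<le> b' - h" using h(3) b'(1) by simp
    then have "\<theta> (b' - h) \<le> \<theta> b'" using monotone_onD[OF mono(2), of "b' - h" b'] h(1) b'(1,2) q'(1) by auto
    then show False using h0(2)[of h] h \<open>q' \<le> b' - h\<close> q'(1) b'(1,2) c by auto
  qed
  have i_qb: "((\<lambda>x. cos (\<phi> x)) has_integral - (2 / L) * \<kappa> b') {q'..b'}"
  proof -
    have "((\<lambda>x. cos (\<theta> 0 - \<theta> x)) has_integral - (2 / L) * (\<kappa> b' - \<kappa> q')) {q'..b'}"
    proof (rule cos_integral_between_zeros[OF kc d k2 _ _ _ L])
      fix x assume x: "q' < x" "x < b'"
      show "0 < \<theta> 0 - \<theta> x \<and> \<theta> 0 - \<theta> x < pi"
        using b'(3)[of x] q'(3)[of x] x b'(2) by (simp add: \<phi>_def)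
    qed (use q'(1) b'(1,2) c in auto)
    moreover have "\<kappa> q' = 0" using kz[of q'] qq' q'(1) c by auto
    ultimately show ?thesis by (simp add: \<phi>_def)
  qed
  have i_bl: "((\<lambda>x. cos (\<phi> x)) has_integral (l - b')) {b'..l}"
  proof -
    have "((\<lambda>x. cos (\<phi> x)) has_integral (l - b') *\<^sub>R 1) {b'..l}"
    proof (rule has_integral_spike_finite[of "{l}"])
      show "((\<lambda>_. 1) has_integral (l - b') *\<^sub>R (1::real)) {b'..l}" using has_integral_const_real[of "1::real" b' l] b' by simp
      show "cos (\<phi> x) = 1" if "x \<in> {b'..l} - {l}" for x using b'(4)[of x] that by auto
    qed simp
    then show ?thesis by simp
  qed
  \<comment> \<open>In the initial direction the half turn, running between zeros of the curvature,
    contributes nothing and the second bend a nonpositive amount. Hence positivity of this component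
    of \<open>V\<close> forces \<open>K > q' - q\<close>.\<close>
  have total: "((\<lambda>x. cos (\<phi> x)) has_integral (p + 0 + - (q' - q) + - (2 / L) * \<kappa> b' + (l - b'))) {0..l}"
  proof -
    note t1 = has_integral_combine[OF ord(1,2) i_p i_pq]
    note t2 = has_integral_combine[OF _ ord(3) t1 i_qq]
    note t3 = has_integral_combine[OF _ ord(4) t2 i_qb]
    from has_integral_combine[OF _ ord(5) t3 i_bl] show ?thesis using ord by simp
  qed
  have rot: "cis (\<theta> x) = cis (\<theta> 0) * cis (- \<phi> x)" for x by (simp add: \<phi>_def cis_mult)
  have Xint: "Re (cnj V * cis (\<theta> 0)) = integral {0..l} (\<lambda>x. cos (\<phi> x))"
  proof -
    have "bounded_linear (\<lambda>z. Re (cnj z * cis (\<theta> 0)))"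
      by (intro bounded_linear_compose[OF bounded_linear_Re] bounded_linear_compose[OF bounded_linear_mult_left]
          bounded_linear_cnj)
    from integral_linear[OF cis_integrable[OF cont] this]
    have "Re (cnj V * cis (\<theta> 0)) = integral {0..l} (\<lambda>x. Re (cnj (cis (\<theta> x)) * cis (\<theta> 0)))"
      using V by (simp only: displacement_def o_def)
    also have "\<dots> = integral {0..l} (\<lambda>x. cos (\<phi> x))"
      by (rule integral_cong) (simp add: \<phi>_def cos_diff mult.commute)
    finally show ?thesis .
  qed
  have "0 \<le> (2 / L) * \<kappa> b'" using L kb by simp
  then have gap: "q' - q < K" using X Xint integral_unique[OF total] by (simp add: K_def)
  \<comment> \<open>The new plateau will exceed \<open>{q..q'}\<close> by at most
    \<open>g / 2\<close> on each side, so its length \<open>T\<close> stays below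
    \<open>K\<close>.\<close>
  define g where "g = (K - (q' - q)) / 2"
  have g: "0 < g" using gap by (simp add: g_def)
  define u1 where "u1 = max ((p + q) / 2) (q - g/2)"
  define u2 where "u2 = min ((q' + b') / 2) (q' + g/2)"
  have u: "p < u1" "u1 < q" "q - g/2 \<le> u1" "q' < u2" "u2 < b'" "u2 \<le> q' + g/2"
    using qq(2) b'(1) g by (auto simp: u1_def u2_def less_max_iff_disj min_less_iff_disj le_max_iff_disj min_le_iff_disj)
  \<comment> \<open>The level of the cut: not below the angles at \<open>u1\<close> and
    \<open>u2\<close>, which keeps the cut short, and at least \<open>pi/2\<close>, so that
    \<open>cos \<nu> \<le> 0\<close>.\<close>
  define \<nu> where "\<nu> = max (pi/2) (max (\<phi> u1) (\<phi> u2))"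
  have \<nu>: "pi/2 \<le> \<nu>" "\<nu> < pi" "\<phi> u1 \<le> \<nu>" "\<phi> u2 \<le> \<nu>"
    using q(3)[of u1] q'(3)[of u2] u ord by (auto simp: \<nu>_def)
  obtain s1 where s1: "u1 \<le> s1" "s1 \<le> q" "\<phi> s1 = \<nu>"
    using IVT'[of \<phi> u1 \<nu> q] \<nu> qq(1) u sub[of u1 q] ord c by auto
  obtain s2 where s2: "q' \<le> s2" "s2 \<le> u2" "\<phi> s2 = \<nu>"
    using IVT2'[of \<phi> u2 \<nu> q'] \<nu> qq'(1) u sub[of q' u2] ord c by auto
  have s: "0 \<le> s1" "s1 \<le> s2" "s2 \<le> l" "\<theta> s1 = \<theta> s2" "s1 \<le> c" "c \<le> s2" "p < s1" "s2 < b'"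
    using s1 s2 u ord c by (auto simp: \<phi>_def)
  define T where "T = s2 - s1"
  have "s1 \<noteq> q" using s1(3) qq(1) \<nu>(2) by (metis less_irrefl)
  then have T: "0 < T" "T < K" using s1 s2 ord u g by (auto simp: T_def g_def field_simps)
  let ?k = "\<lambda>x. if x \<in> {0..l} then \<kappa> x else 0"
  have min': "minimal_arc l \<theta> ?k V" by (rule minimal_arc_use_curvature[OF min el e])
  then have prim': "primitive_on 0 l \<theta> ?k" and i': "(\<lambda>x. (?k x)\<^sup>2) integrable_on {0..l}"
    by (auto simp: minimal_arc_def s_arc_def)
  define R where "R = - integral {s1..s2} (\<lambda>x. cos (\<phi> x))"
  define S where "S = integral {s1..s2} (\<lambda>x. sin (\<phi> x))"
  have disp: "displacement \<theta> s1 s2 = cis (\<theta> 0) * Complex (- R) (- S)"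
  proof -
    have ci: "(\<lambda>x. cis (- \<phi> x)) integrable_on {s1..s2}"
      by (intro cis_integrable continuous_intros sub s)
    have "displacement \<theta> s1 s2 = integral {s1..s2} (\<lambda>x. cis (\<theta> 0) * cis (- \<phi> x))"
      unfolding displacement_def by (rule integral_cong) (rule rot)
    also have "\<dots> = cis (\<theta> 0) * integral {s1..s2} (\<lambda>x. cis (- \<phi> x))" by simp
    finally have "displacement \<theta> s1 s2 = cis (\<theta> 0) * integral {s1..s2} (\<lambda>x. cis (- \<phi> x))" .
    moreover have "integral {s1..s2} (\<lambda>x. cis (- \<phi> x)) = Complex (- R) (- S)"
      using integral_linear[OF ci bounded_linear_Re] integral_linear[OF ci bounded_linear_Im]
      by (simp add: complex_eq_iff R_def S_def o_def)
    ultimately show ?thesis by simp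
  qed
  have cs: "(\<lambda>x. cos (\<phi> x)) integrable_on {s1..s2}" "(\<lambda>x. sin (\<phi> x)) integrable_on {s1..s2}"
    by (intro integrable_continuous_real continuous_intros sub s)+
  have RT: "R \<le> T"
  proof -
    have "integral {s1..s2} (\<lambda>x. -1) \<le> integral {s1..s2} (\<lambda>x. cos (\<phi> x))"
      by (intro integral_le cs) auto
    then show ?thesis using s by (simp add: R_def T_def)
  qed
  have drop: "integral {s1..s2} (\<lambda>x. (?k x)\<^sup>2) = L * S"
  proof -
    have "integral {s1..s2} (\<lambda>x. (?k x)\<^sup>2) = integral {s1..s2} (\<lambda>x. L * sin (\<phi> x))"
      by (rule integral_cong) (use s k2 in \<open>auto simp: \<phi>_def\<close>)
    then show ?thesis by (simp add: S_def)
  qed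
  have sinnn: "0 \<le> sin (\<phi> x)" if "x \<in> {s1..s2}" for x
    using rg[of x] that s by (intro sin_ge_zero) auto
  have sin\<nu>: "0 < sin \<nu>" using \<nu> pi_gt_zero by (intro sin_gt_zero) linarith+
  have S: "0 < S"
  proof (rule ccontr)
    assume "\<not> 0 < S"
    moreover have "0 \<le> S" unfolding S_def by (intro Henstock_Kurzweil_Integration.integral_nonneg cs sinnn)
    ultimately have "S = 0" by simp
    moreover have "continuous_on {s1..s2} (\<lambda>x. sin (\<phi> x))" by (intro continuous_intros sub s)
    ultimately have "sin (\<phi> s1) = 0"
      using integral_eq_0_iff[of s1 s2 "\<lambda>x. sin (\<phi> x)"] sinnn T unfolding S_def T_def by auto
    then show False using sin\<nu> s1 by simp
  qed
  \<comment> \<open>The speed \<open>\<sigma>\<close> on the plateau reproduces the transverse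
    displacement \<open>S\<close> of the part cut off. The speed \<open>\<zeta>\<close> on the
    segments of total length \<open>K\<close> balances the component in the initial direction; it is
    positive because \<open>R \<le> T < K\<close> and \<open>cos \<nu> \<le> 0\<close>.\<close>
  define \<sigma> where "\<sigma> = S / (T * sin \<nu>)"
  define \<zeta> where "\<zeta> = 1 - (R + \<sigma> * T * cos \<nu>) / K"
  have K: "0 < K" using T by simp
  have \<sigma>: "0 < \<sigma>" "\<sigma> * T * sin \<nu> = S" using S T sin\<nu> by (auto simp: \<sigma>_def)
  have cos\<nu>: "cos \<nu> \<le> 0" using cos_monotone_0_pi_le[of "pi/2" "\<nu>"] \<nu> by simp
  have "R + \<sigma> * T * cos \<nu> \<le> R" using \<sigma> T cos\<nu> by (simp add: mult_nonneg_nonpos)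
  then have "R + \<sigma> * T * cos \<nu> < K" using RT T by linarith
  then have \<zeta>: "0 < \<zeta>" using K by (simp add: \<zeta>_def)
  have \<zeta>K: "(\<zeta> - 1) * K = - (R + \<sigma> * T * cos \<nu>)" using K by (simp add: \<zeta>_def)
  define v where "v x = 1 + (\<sigma> - 1) * indicat_real {s1..s2} x + (\<zeta> - 1) * indicat_real {0..p} x
     + (\<zeta> - 1) * indicat_real {b'..l} x" for x
  have vb: "v \<in> borel_measurable borel" unfolding v_def by measurable
  have vv: "v x = (if x \<in> {s1..s2} then \<sigma> else if x \<in> {0..p} \<union> {b'..l} then \<zeta> else 1)" for x
    using s(7,8) ord by (auto simp: v_def indicator_def)
  have vlo: "min 1 (min \<sigma> \<zeta>) \<le> v x" and vhi: "v x \<le> max 1 (max \<sigma> \<zeta>)" for x unfolding vv by (auto simp: min_le_iff_disj le_max_iff_disj)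
  let ?\<theta>' = "flatten s1 s2 \<theta>" and ?\<omega>' = "flatten_deriv s1 s2 ?k"
  note fl' = flatten[OF prim' i' s(1-4)]
  have shape: "s_shaped 0 l ?\<theta>'"
  proof (rule s_shaped_flatten_valley[OF mono s(1,5,6,3,4)])
    have "\<theta> c - \<theta> 0 = - pi" using half by simp
    then show "\<bar>\<theta> c - \<theta> 0\<bar> \<le> pi" by simp
    show "\<bar>\<theta> l - \<theta> c\<bar> \<le> pi" using rg[of l] fcp rise l by (simp add: \<phi>_def)
  qed
  have ci: "(\<lambda>t. cis (\<theta> t)) integrable_on {0..l}" by (rule cis_integrable[OF cont])
  have Vint: "integral {0..l} (\<lambda>x. v x *\<^sub>R cis (?\<theta>' x)) = V"
  proof -
    have cst: "((\<lambda>x. indicat_real {u..w} x *\<^sub>R z) has_integral (w - u) *\<^sub>R z) {0..l}"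
      if "0 \<le> u" "u \<le> w" "w \<le> l" for u w and z :: complex
      using has_integral_indicator_interval[of "\<lambda>_. z" l u w] that by auto
    have J: "{s1..s2} \<subseteq> {0..l}" using s by auto
    have sum: "((\<lambda>x. cis (\<theta> x) + (\<sigma> *\<^sub>R (indicat_real {s1..s2} x *\<^sub>R cis (\<theta> s1)) - indicat_real {s1..s2} x *\<^sub>R cis (\<theta> x))
       + ((\<zeta> - 1) *\<^sub>R (indicat_real {0..p} x *\<^sub>R cis (\<theta> 0)) + (\<zeta> - 1) *\<^sub>R (indicat_real {b'..l} x *\<^sub>R cis (\<theta> 0))))
       has_integral (V + (\<sigma> *\<^sub>R ((s2 - s1) *\<^sub>R cis (\<theta> s1)) - displacement \<theta> s1 s2)
       + ((\<zeta> - 1) *\<^sub>R ((p - 0) *\<^sub>R cis (\<theta> 0)) + (\<zeta> - 1) *\<^sub>R ((l - b') *\<^sub>R cis (\<theta> 0))))) {0..l}"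
      unfolding V[symmetric] displacement_def
      by (intro has_integral_add has_integral_diff has_integral_cmul cst integrable_integral ci
          has_integral_indicator_interval J) (use s(1-3) ord in auto)
    have val: "V + (\<sigma> *\<^sub>R ((s2 - s1) *\<^sub>R cis (\<theta> s1)) - displacement \<theta> s1 s2)
       + ((\<zeta> - 1) *\<^sub>R ((p - 0) *\<^sub>R cis (\<theta> 0)) + (\<zeta> - 1) *\<^sub>R ((l - b') *\<^sub>R cis (\<theta> 0))) = V"
    proof -
      have 1: "\<sigma> *\<^sub>R ((s2 - s1) *\<^sub>R cis (\<theta> s1)) = cis (\<theta> 0) * Complex (\<sigma> * T * cos \<nu>) (- (\<sigma> * T * sin \<nu>))"
        unfolding rot[of s1] s1(3) T_def by (simp add: complex_eq_iff algebra_simps)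
      have 2: "(\<zeta> - 1) *\<^sub>R ((p - 0) *\<^sub>R cis (\<theta> 0)) + (\<zeta> - 1) *\<^sub>R ((l - b') *\<^sub>R cis (\<theta> 0))
          = cis (\<theta> 0) * Complex ((\<zeta> - 1) * K) 0"
        by (simp add: complex_eq_iff K_def algebra_simps)
      have "\<sigma> *\<^sub>R ((s2 - s1) *\<^sub>R cis (\<theta> s1)) - displacement \<theta> s1 s2 + ((\<zeta> - 1) *\<^sub>R ((p - 0) *\<^sub>R cis (\<theta> 0))
          + (\<zeta> - 1) *\<^sub>R ((l - b') *\<^sub>R cis (\<theta> 0))) = cis (\<theta> 0) * 0"
        unfolding 1 2 disp right_diff_distrib[symmetric] distrib_left[symmetric]
        by (rule arg_cong[of _ _ "(*) (cis (\<theta> 0))"]) (simp add: complex_eq_iff \<zeta>K \<sigma>(2))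
      then show ?thesis by (simp add: add.assoc)
    qed
    have "((\<lambda>x. v x *\<^sub>R cis (?\<theta>' x)) has_integral V) {0..l}"
    proof (rule has_integral_spike_finite[of "{l}", OF _ _ sum[unfolded val]])
      fix x assume x: "x \<in> {0..l} - {l}"
      have "\<theta> x = \<theta> 0" if "x \<in> {0..p}" using up[of x p] that ord pp(1) rg[of x] c by (auto simp: \<phi>_def)
      moreover have "\<theta> x = \<theta> 0" if "x \<in> {b'..l}" using b'(4)[of x] x that by (auto simp: \<phi>_def)
      moreover have "?\<theta>' x = (if x \<in> {s1..s2} then \<theta> s1 else \<theta> x)" using s by (auto simp: flatten_def)
      ultimately show "v x *\<^sub>R cis (?\<theta>' x) = cis (\<theta> x) + (\<sigma> *\<^sub>R (indicat_real {s1..s2} x *\<^sub>R cis (\<theta> s1)) - indicat_real {s1..s2} x *\<^sub>R cis (\<theta> x))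
       + ((\<zeta> - 1) *\<^sub>R (indicat_real {0..p} x *\<^sub>R cis (\<theta> 0)) + (\<zeta> - 1) *\<^sub>R (indicat_real {b'..l} x *\<^sub>R cis (\<theta> 0)))"
        using s(7,8) ord by (auto simp: vv indicator_def algebra_simps)
    qed simp
    then show ?thesis by (rule integral_unique)
  qed
  have m0: "0 < min 1 (min \<sigma> \<zeta>)" using \<sigma> \<zeta> by simp
  obtain l'' \<theta>'' \<omega>'' where a: "s_arc l'' \<theta>'' \<omega>'' V" "\<theta>'' 0 = ?\<theta>' 0" "\<theta>'' l'' = ?\<theta>' l"
    "energy l'' \<omega>'' = integral {0..l} (\<lambda>x. (?\<omega>' x)\<^sup>2 / v x)"
    by (rule arc_change_speed[OF l fl'(1) shape fl'(2) vb m0 vlo vhi Vint])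
  \<comment> \<open>Up to two points, the speed differs from 1 only where the new curvature
    vanishes. So the repair costs nothing and the whole saving \<open>L * S\<close> remains.\<close>
  have "integral {0..l} (\<lambda>x. (?\<omega>' x)\<^sup>2 / v x) = energy l ?\<omega>'"
    unfolding energy_def
  proof (rule integral_spike[of "{s1, b'}"])
    fix x assume x: "x \<in> {0..l} - {s1, b'}"
    have "?\<omega>' x = 0" if "x \<in> {0..p}" using kz[of x] up[of x p] that ord pp(1) rg[of x] c s(7) x by (auto simp: flatten_deriv_def)
    moreover have "?\<omega>' x = 0" if "x \<in> {b'..l}" using kz[of x] b'(5)[of x] that s(8) x ord by (auto simp: flatten_deriv_def)
    moreover have "?\<omega>' x = 0" if "x \<in> {s1..s2}" using that x by (auto simp: flatten_deriv_def)
    ultimately show "(?\<omega>' x)\<^sup>2 = (?\<omega>' x)\<^sup>2 / v x" unfolding vv by auto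
  qed simp
  also have "\<dots> = energy l ?k - L * S" using fl'(3) drop by simp
  also have "\<dots> < energy l ?k" using L S by simp
  finally have "energy l'' \<omega>'' < energy l ?k" using a(4) by simp
  moreover have "energy l ?k \<le> energy l'' \<omega>''"
    using min'[unfolded minimal_arc_def, THEN conjunct2, rule_format, of l'' \<theta>'' \<omega>''] a(1-3) s b'
    by (simp add: flatten_def)
  ultimately show False by simp
qed

text \<open>A square is nonnegative, so the sine is, and by continuity the angle never leaves the
  half turn below \<open>\<theta> 0\<close>. At an interior valley the curvature is 0, so a complete
  half turn has been made there, which \<open>no_half_turn_inflection\<close> excludes. A total turn
  of \<open>pi\<close> would make the end tangents opposite, against the signs in \<open>X\<close>
  and \<open>Y\<close>.\<close>

lemma no_inflection_aux:
  assumes min: "minimal_arc l \<theta> \<omega> V" and e: "energy l \<omega> = integral {0..l} (\<lambda>x. (\<kappa> x)\<^sup>2)"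
    and el: "elastica l \<theta> \<Lambda> \<kappa>"
    and k2: "\<And>x. x \<in> {0..l} \<Longrightarrow> (\<kappa> x)\<^sup>2 = L * sin (\<theta> 0 - \<theta> x)" and L: "0 < L"
    and nc: "x1 \<in> {0..l}" "\<theta> x1 \<noteq> \<theta> 0"
    and X: "0 < Re (cnj V * cis (\<theta> 0))" and Y: "0 \<le> Re (cnj V * cis (\<theta> l))"
  shows "antimono_on {0..l} \<theta>" "\<theta> 0 - \<theta> l < pi"
proof -
  have l: "0 < l" and prim: "primitive_on 0 l \<theta> \<omega>" and s: "s_shaped 0 l \<theta>"
    using min by (auto simp: minimal_arc_def s_arc_def)
  have cont: "continuous_on {0..l} \<theta>" by (rule primitive_on_continuous[OF prim])
  have fc: "continuous_on {0..l} (\<lambda>x. \<theta> 0 - \<theta> x)" by (intro continuous_intros cont)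
  have d: "\<And>x. x \<in> {0..l} \<Longrightarrow> (\<theta> has_real_derivative \<kappa> x) (at x within {0..l})"
    using el by (auto simp: elastica_def)
  have sinnn: "0 \<le> sin (\<theta> 0 - \<theta> x)" if "x \<in> {0..l}" for x
    using k2[OF that] L zero_le_power2[of "\<kappa> x"] by (simp add: zero_le_mult_iff)
  have zero: "0 \<in> {0..l}" and ll: "l \<in> {0..l}" using l by auto
  have range: "0 \<le> \<theta> 0 - \<theta> x \<and> \<theta> 0 - \<theta> x \<le> pi" if x: "x \<in> {0..l}" for x
  proof (intro conjI; rule ccontr)
    assume *: "\<not> 0 \<le> \<theta> 0 - \<theta> x"
    \<comment> \<open>On its way to \<open>x\<close> the angle would pass a value with negative
      sine; \<open>- (pi/4)\<close> keeps the value in a range where the sign is known.\<close>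
    obtain z where z: "z \<in> {0..l}" "\<theta> 0 - \<theta> z = max (\<theta> 0 - \<theta> x) (- (pi/4))"
      by (rule continuous_attains_between[OF fc x zero, of "max (\<theta> 0 - \<theta> x) (- (pi/4))"]) (use * in auto)
    have "sin (\<theta> 0 - \<theta> z) < 0"
      unfolding z(2) using * by (intro sin_less_zero) (auto simp: less_max_iff_disj)
    then show False using sinnn[OF z(1)] by simp
  next
    assume *: "\<not> \<theta> 0 - \<theta> x \<le> pi"
    then have "\<theta> x \<le> \<theta> 0" using pi_gt_zero by linarith
    obtain z where z: "z \<in> {0..l}" "\<theta> 0 - \<theta> z = min (\<theta> 0 - \<theta> x) (3*pi/2)"
      by (rule continuous_attains_between[OF fc zero x, of "min (\<theta> 0 - \<theta> x) (3*pi/2)"]) (use * \<open>\<theta> x \<le> \<theta> 0\<close> in auto)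
    have "sin (\<theta> 0 - \<theta> z) < 0"
      unfolding z(2) using * pi_gt_zero by (intro sin_lt_zero) (auto simp: min_less_iff_disj)
    then show False using sinnn[OF z(1)] by simp
  qed
  obtain c where c: "c \<in> {0..l}"
     "mono_on {0..c} \<theta> \<and> antimono_on {c..l} \<theta> \<or> antimono_on {0..c} \<theta> \<and> mono_on {c..l} \<theta>"
    using s unfolding s_shaped_def by blast
  show anti: "antimono_on {0..l} \<theta>"
  proof (rule ccontr)
    assume na: "\<not> antimono_on {0..l} \<theta>"
    have glue: "antimono_on {0..l} \<theta>" if "antimono_on {0..c} \<theta>" "antimono_on {c..l} \<theta>"
    proof (rule monotone_onI)
      fix x y assume xy: "x \<in> {0..l}" "y \<in> {0..l}" "x \<le> y"
      consider "y \<le> c" | "c \<le> x" | "x < c" "c < y" by linarith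
      then show "\<theta> y \<le> \<theta> x"
      proof cases
        case 1 then show ?thesis using monotone_onD[OF that(1), of x y] xy by auto
      next
        case 2 then show ?thesis using monotone_onD[OF that(2), of x y] xy by auto
      next
        case 3 then show ?thesis
          using monotone_onD[OF that(1), of x c] monotone_onD[OF that(2), of c y] xy by auto
      qed
    qed
    from c(2) show False
    proof (elim disjE conjE)
      assume m: "mono_on {0..c} \<theta>" "antimono_on {c..l} \<theta>"
      have "\<theta> x = \<theta> 0" if "x \<in> {0..c}" for x
        using monotone_onD[OF m(1), of 0 x] range[of x] that c(1) by auto
      then have "antimono_on {0..c} \<theta>" by (intro monotone_onI) (metis order_refl)
      then show False using glue m(2) na by blast
    next
      assume m: "antimono_on {0..c} \<theta>" "mono_on {c..l} \<theta>"
      have c1: "\<theta> c < \<theta> l"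
      proof (rule ccontr)
        assume "\<not> \<theta> c < \<theta> l"
        then have "\<theta> x = \<theta> c" if "x \<in> {c..l}" for x
          using monotone_onD[OF m(2), of c x] monotone_onD[OF m(2), of x l] that c(1) by auto
        then have "antimono_on {c..l} \<theta>" by (intro monotone_onI) (metis order_refl)
        then show False using glue m(1) na by blast
      qed
      have c2: "\<theta> c < \<theta> 0" using c1 range[OF ll] by linarith
      then have c0: "0 < c" using c(1) by (cases "c = 0") auto
      have cl: "c < l" using c1 c(1) by (cases "c = l") auto
      have "(\<theta> has_real_derivative \<kappa> c) (at c)"
        using d[OF c(1)] at_within_interior[of c "{0..l}"] c0 cl by simp
      moreover have "0 < min c (l - c)" using c0 cl by simp
      moreover have "\<theta> c \<le> \<theta> y" if "\<bar>c - y\<bar> < min c (l - c)" for y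
        using monotone_onD[OF m(1), of y c] monotone_onD[OF m(2), of c y] that c0 cl
        by (cases "y \<le> c") (auto simp: abs_if split: if_splits)
      ultimately have "\<kappa> c = 0" by (intro DERIV_local_min[of \<theta> "\<kappa> c" c "min c (l - c)"]) auto
      then have sz: "sin (\<theta> 0 - \<theta> c) = 0" using k2[OF c(1)] L by simp
      have half: "\<theta> 0 - \<theta> c = pi"
      proof (rule ccontr)
        assume "\<theta> 0 - \<theta> c \<noteq> pi"
        then have "0 < sin (\<theta> 0 - \<theta> c)" using range[OF c(1)] c2 by (intro sin_gt_zero) auto
        then show False using sz by simp
      qed
      show False by (rule no_half_turn_inflection[OF min e el k2 L range c0 cl m half c1 X])
    qed
  qed
  show "\<theta> 0 - \<theta> l < pi"
  proof (rule ccontr)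
    assume "\<not> \<theta> 0 - \<theta> l < pi"
    then have "\<theta> 0 - \<theta> l = pi" using range[OF ll] by auto
    then have "\<theta> l = \<theta> 0 - pi" by simp
    then have "cis (\<theta> l) = - cis (\<theta> 0)" by (simp add: complex_eq_iff)
    then show False using X Y by simp
  qed
qed

text \<open>With \<open>\<kappa> 0 = 0\<close> the multiplier is perpendicular to the initial
  tangent and the equation reads \<open>\<kappa>\<^sup>2 = L * sin (\<theta> 0 - \<theta>)\<close>;
  the sign of \<open>L\<close> selects the falling or, by reflection, the rising case. The result is
  used for its consequence that the arc has room for one more phase at the start.\<close>

lemma monotone_if_no_start_curvature:
  assumes min: "minimal_arc l \<theta> \<omega> V" and e: "energy l \<omega> = integral {0..l} (\<lambda>x. (\<kappa> x)\<^sup>2)"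
    and el: "elastica l \<theta> \<Lambda> \<kappa>" and k0: "\<kappa> 0 = 0"
    and nc: "x1 \<in> {0..l}" "\<theta> x1 \<noteq> \<theta> 0"
    and X: "0 < Re (cnj V * cis (\<theta> 0))" and Y: "0 \<le> Re (cnj V * cis (\<theta> l))"
  shows "mono_on {0..l} \<theta> \<or> antimono_on {0..l} \<theta>" "\<bar>\<theta> l - \<theta> 0\<bar> < pi"
proof -
  have l: "0 < l" using min by (auto simp: minimal_arc_def s_arc_def)
  define L where "L = Im (cnj \<Lambda> * cis (\<theta> 0))"
  have k2: "(\<kappa> x)\<^sup>2 = Re (cnj \<Lambda> * cis (\<theta> x))" if "x \<in> {0..l}" for x
    using el that by (simp add: elastica_def)
  have R0: "Re (cnj \<Lambda> * cis (\<theta> 0)) = 0" using k2[of 0] k0 l by simp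
  have k2L: "(\<kappa> x)\<^sup>2 = L * sin (\<theta> 0 - \<theta> x)" if "x \<in> {0..l}" for x
  proof -
    have "cnj \<Lambda> * cis (\<theta> x) = (cnj \<Lambda> * cis (\<theta> 0)) * cis (\<theta> x - \<theta> 0)"
      by (simp add: mult.assoc cis_mult)
    then have "Re (cnj \<Lambda> * cis (\<theta> x)) = Re (cnj \<Lambda> * cis (\<theta> 0)) * cos (\<theta> x - \<theta> 0) - L * sin (\<theta> x - \<theta> 0)"
      unfolding L_def by (metis times_complex.sel(1) cis.sel)
    also have "\<dots> = L * sin (\<theta> 0 - \<theta> x)"
      unfolding R0 using sin_minus[of "\<theta> 0 - \<theta> x"] by simp
    finally show ?thesis using k2[OF that] by simp
  qed
  have "L \<noteq> 0"
  proof
    assume "L = 0"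
    then have "\<kappa> x = 0" if "x \<in> {0..l}" for x using k2L[OF that] by simp
    then have "(\<theta> has_real_derivative 0) (at x within {0..l})" if "x \<in> {0..l}" for x
      using el that unfolding elastica_def by metis
    then have "\<exists>k. \<forall>x\<in>{0..l}. \<theta> x = k"
      by (intro has_field_derivative_zero_constant) simp_all
    then obtain k where "\<forall>x\<in>{0..l}. \<theta> x = k" ..
    then have "\<theta> x1 = k" "\<theta> 0 = k" using nc(1) l by auto
    then show False using nc(2) by simp
  qed
  then consider "0 < L" | "0 < - L" by linarith
  then have "(mono_on {0..l} \<theta> \<or> antimono_on {0..l} \<theta>) \<and> \<bar>\<theta> l - \<theta> 0\<bar> < pi"
  proof cases
    case 1
    have "antimono_on {0..l} \<theta>" by (rule no_inflection_aux(1)[OF min e el k2L 1 nc X Y])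
    moreover have "\<theta> 0 - \<theta> l < pi" by (rule no_inflection_aux(2)[OF min e el k2L 1 nc X Y])
    ultimately
    show ?thesis using monotone_onD[of "{0..l}" "(\<le>)" "(\<ge>)" \<theta> 0 l] l by auto
  next
    case 2
    have m': "minimal_arc l (\<lambda>x. - \<theta> x) (\<lambda>x. - \<omega> x) (cnj V)" by (rule minimal_arc_uminus[OF min])
    have e': "energy l (\<lambda>x. - \<omega> x) = integral {0..l} (\<lambda>x. (- \<kappa> x)\<^sup>2)" using e by (simp add: energy_def)
    have k': "(- \<kappa> x)\<^sup>2 = - L * sin (- \<theta> 0 - - \<theta> x)" if "x \<in> {0..l}" for x
      using k2L[OF that] sin_minus[of "\<theta> 0 - \<theta> x"] by simp
    have X': "0 < Re (cnj (cnj V) * cis (- \<theta> 0))" "0 \<le> Re (cnj (cnj V) * cis (- \<theta> l))"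
      using X Y by simp_all
    have nc': "- \<theta> x1 \<noteq> - \<theta> 0" using nc(2) by simp
    have "antimono_on {0..l} (\<lambda>x. - \<theta> x)"
      by (rule no_inflection_aux(1)[OF m' e' elastica_uminus[OF el] k' 2 nc(1) nc' X'])
    moreover have "- \<theta> 0 - - \<theta> l < pi"
      by (rule no_inflection_aux(2)[OF m' e' elastica_uminus[OF el] k' 2 nc(1) nc' X'])
    ultimately have "mono_on {0..l} \<theta>" "\<theta> l - \<theta> 0 < pi" by (simp_all add: monotone_on_uminus_iff)
    then show ?thesis using monotone_onD[of "{0..l}" "(\<le>)" "(\<le>)" \<theta> 0 l] l by auto
  qed
  then show "mono_on {0..l} \<theta> \<or> antimono_on {0..l} \<theta>" "\<bar>\<theta> l - \<theta> 0\<bar> < pi" by auto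
qed

section \<open>Explicit variations of the start angle\<close>

lemma primitive_on_add_linear:
  assumes p: "primitive_on 0 l \<theta> \<omega>"
  shows "primitive_on 0 l (\<lambda>x. \<theta> x + (k * x + d)) (\<lambda>x. \<omega> x + k)"
  unfolding primitive_on_def
proof (intro conjI ballI)
  have [measurable]: "\<omega> \<in> borel_measurable borel" and ai: "\<omega> absolutely_integrable_on {0..l}"
    using p by (simp_all add: primitive_on_def)
  show "(\<lambda>x. \<omega> x + k) \<in> borel_measurable borel" by measurable
  show "(\<lambda>x. \<omega> x + k) absolutely_integrable_on {0..l}"
    by (intro set_integral_add ai absolutely_integrable_continuous_real continuous_on_const)
  fix x assume x: "x \<in> {0..l}"
  have "((\<lambda>x. \<omega> x + k) has_integral (\<theta> x - \<theta> 0 + (x - 0) *\<^sub>R k)) {0..x}"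
    using primitive_on_has_integral[OF p, of 0 x] has_integral_const_real[of k 0 x] x
    by (intro has_integral_add) auto
  then show "((\<lambda>x. \<omega> x + k) has_integral (\<theta> x + (k * x + d) - (\<theta> 0 + (k * 0 + d)))) {0..x}"
    by (simp add: algebra_simps)
qed

lemma energy_add_const:
  assumes p: "primitive_on 0 l \<theta> \<omega>" and i: "(\<lambda>x. (\<omega> x)\<^sup>2) integrable_on {0..l}" and u: "0 \<le> u" "u \<le> l"
  shows "((\<lambda>x. (\<omega> x + k)\<^sup>2) has_integral (integral {0..u} (\<lambda>x. (\<omega> x)\<^sup>2) + 2 * k * (\<theta> u - \<theta> 0) + k\<^sup>2 * u)) {0..u}"
proof -
  have "(\<lambda>x. (\<omega> x)\<^sup>2) integrable_on {0..u}" by (rule integrable_subinterval_real[OF i]) (use u in auto)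
  then have "((\<lambda>x. (\<omega> x)\<^sup>2 + 2 * k * \<omega> x + k\<^sup>2) has_integral
      (integral {0..u} (\<lambda>x. (\<omega> x)\<^sup>2) + 2 * k * (\<theta> u - \<theta> 0) + k\<^sup>2 * u)) {0..u}"
    using primitive_on_has_integral[OF p, of 0 u] has_integral_const_real[of "k\<^sup>2" 0 u] u
    by (intro has_integral_add has_integral_mult_right integrable_integral) (auto simp: mult.commute)
  moreover have "(\<omega> x)\<^sup>2 + 2 * k * \<omega> x + k\<^sup>2 = (\<omega> x + k)\<^sup>2" for x by (simp add: power2_sum algebra_simps)
  ultimately show ?thesis by (simp only:)
qed

definition tilt :: "real \<Rightarrow> real \<Rightarrow> (real \<Rightarrow> real) \<Rightarrow> real \<Rightarrow> real" where
  "tilt w \<epsilon> \<theta> x = (if x \<le> w then \<theta> x + (\<epsilon> / w * x + - \<epsilon>) else \<theta> x)"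

lemma tilt_eq: "0 < w \<Longrightarrow> tilt w \<epsilon> \<theta> x = \<theta> x - \<epsilon> * max 0 (1 - x / w)"
  by (auto simp: tilt_def max_def field_simps)

text \<open>A linear ramp of height \<open>\<epsilon>\<close> on \<open>{0..w}\<close> adds the
  constant \<open>\<epsilon> / w\<close> to the curvature. The first-order cost is
  \<open>2 * \<epsilon>\<close> times the mean curvature on \<open>{0..w}\<close>, which tends to
  the initial curvature as \<open>w\<close> shrinks.\<close>

lemma tilt:
  assumes p: "primitive_on 0 l \<theta> \<omega>" and i: "(\<lambda>x. (\<omega> x)\<^sup>2) integrable_on {0..l}"
    and w: "0 < w" "w < l" and \<epsilon>: "0 \<le> \<epsilon>"
  obtains \<omega>' where "primitive_on 0 l (tilt w \<epsilon> \<theta>) \<omega>'" "(\<lambda>x. (\<omega>' x)\<^sup>2) integrable_on {0..l}"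
    "energy l \<omega>' = energy l \<omega> + 2 * \<epsilon> * ((\<theta> w - \<theta> 0) / w) + \<epsilon>\<^sup>2 / w"
    "integral {0..l} (\<lambda>x. \<bar>tilt w \<epsilon> \<theta> x - \<theta> x\<bar>) \<le> \<epsilon> * w"
    "tilt w \<epsilon> \<theta> 0 = \<theta> 0 - \<epsilon>" "tilt w \<epsilon> \<theta> l = \<theta> l"
proof -
  let ?\<omega>' = "\<lambda>x. if x \<le> w then \<omega> x + \<epsilon> / w else \<omega> x"
  have wl: "w \<in> {0..l}" using w by auto
  have prim: "primitive_on 0 l (tilt w \<epsilon> \<theta>) ?\<omega>'"
    unfolding tilt_def by (rule primitive_on_switch[OF primitive_on_add_linear[OF p] p wl]) (use w in simp)
  have ia: "(\<lambda>x. (\<omega> x + \<epsilon> / w)\<^sup>2) integrable_on {0..l}"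
    using energy_add_const[OF p i, of l] w by (auto simp: integrable_on_def)
  note es = energy_switch[OF ia i wl]
  have en: "energy l ?\<omega>' = energy l \<omega> + 2 * \<epsilon> * ((\<theta> w - \<theta> 0) / w) + \<epsilon>\<^sup>2 / w"
  proof -
    have "integral {0..w} (\<lambda>x. (\<omega> x + \<epsilon> / w)\<^sup>2) =
        integral {0..w} (\<lambda>x. (\<omega> x)\<^sup>2) + 2 * (\<epsilon> / w) * (\<theta> w - \<theta> 0) + (\<epsilon> / w)\<^sup>2 * w"
      by (rule integral_unique[OF energy_add_const[OF p i]]) (use w in auto)
    moreover have "energy l \<omega> = integral {0..w} (\<lambda>x. (\<omega> x)\<^sup>2) + integral {w..l} (\<lambda>x. (\<omega> x)\<^sup>2)"
      unfolding energy_def using Henstock_Kurzweil_Integration.integral_combine[OF _ _ i, of w] w by simp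
    moreover have "(\<epsilon> / w)\<^sup>2 * w = \<epsilon>\<^sup>2 / w" using w by (simp add: power2_eq_square)
    ultimately show ?thesis using es(2) by simp
  qed
  have D: "integral {0..l} (\<lambda>x. \<bar>tilt w \<epsilon> \<theta> x - \<theta> x\<bar>) \<le> \<epsilon> * w"
  proof -
    have "((\<lambda>t. indicat_real {0..w} t *\<^sub>R \<epsilon>) has_integral integral {0..w} (\<lambda>_. \<epsilon>)) {0..l}"
      by (rule has_integral_indicator_interval) (use w in auto)
    then have "((\<lambda>t. indicat_real {0..w} t *\<^sub>R \<epsilon>) has_integral (\<epsilon> * w)) {0..l}" using w by (simp add: mult.commute)
    moreover have "(\<lambda>x. \<bar>tilt w \<epsilon> \<theta> x - \<theta> x\<bar>) integrable_on {0..l}"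
      by (intro integrable_continuous_real continuous_intros primitive_on_continuous[OF prim] primitive_on_continuous[OF p])
    moreover have "\<bar>tilt w \<epsilon> \<theta> x - \<theta> x\<bar> \<le> indicat_real {0..w} x *\<^sub>R \<epsilon>" if "x \<in> {0..l}" for x
    proof (cases "x \<le> w")
      case True
      then have "0 \<le> x / w" "x / w \<le> 1" using that w by auto
      then have "\<epsilon> * max 0 (1 - x / w) \<le> \<epsilon> * 1" "0 \<le> \<epsilon> * max 0 (1 - x / w)"
        using \<epsilon> by (intro mult_left_mono mult_nonneg_nonneg; simp)+
      then show ?thesis using True that by (simp add: tilt_eq[OF w(1)])
    next
      case False
      then show ?thesis by (simp add: tilt_def)
    qed
    ultimately show ?thesis by (intro has_integral_le[OF integrable_integral])
  qed
  show thesis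
    by (rule that[OF prim es(1) en D]) (use w in \<open>auto simp: tilt_def\<close>)
qed

text \<open>Compensation costs about \<open>C * \<epsilon> * w\<close> times the energy, and the
  variation itself \<open>2 * \<epsilon> * q w + \<epsilon>\<^sup>2 / w\<close>. A small
  \<open>w\<close> is fixed for which the first-order coefficient is below
  \<open>2 * k + \<eta>\<close>; for \<open>\<epsilon>\<close> small against this \<open>w\<close>
  the quadratic terms are absorbed.\<close>

lemma side_variation_from_family:
  assumes min: "minimal_arc l \<theta> \<omega> V" and nc: "x1 \<in> {0..l}" "y1 \<in> {0..l}" "\<theta> x1 < \<theta> y1"
    and q: "(q \<longlongrightarrow> k) (at_right 0)" and w0: "0 < w0"
    and fam: "\<And>w. 0 < w \<Longrightarrow> w < w0 \<Longrightarrow> \<exists>\<epsilon>1>0. \<forall>\<epsilon>. 0 < \<epsilon> \<and> \<epsilon> < \<epsilon>1 \<longrightarrow> (\<exists>\<theta>' \<omega>'. primitive_on 0 l \<theta>' \<omega>' \<and>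
        s_shaped 0 l \<theta>' \<and> (\<lambda>x. (\<omega>' x)\<^sup>2) integrable_on {0..l} \<and> \<theta>' 0 = \<theta> 0 - \<epsilon> \<and> \<theta>' l = \<theta> l \<and>
        integral {0..l} (\<lambda>x. \<bar>\<theta>' x - \<theta> x\<bar>) \<le> \<epsilon> * w \<and> energy l \<omega>' \<le> energy l \<omega> + 2 * \<epsilon> * q w + \<epsilon>\<^sup>2 / w)"
    and \<eta>: "0 < \<eta>"
  shows "\<exists>\<epsilon>0>0. \<forall>\<epsilon>. 0 < \<epsilon> \<and> \<epsilon> < \<epsilon>0 \<longrightarrow> (\<exists>l' \<theta>' \<omega>'. s_arc l' \<theta>' \<omega>' V \<and> \<theta>' 0 = \<theta> 0 - \<epsilon> \<and>
     \<theta>' l' = \<theta> l \<and> energy l' \<omega>' \<le> energy l \<omega> + \<epsilon> * (2 * k + \<eta>))"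
proof -
  have l: "0 < l" and prim: "primitive_on 0 l \<theta> \<omega>" and V: "displacement \<theta> 0 l = V"
    using min by (auto simp: minimal_arc_def s_arc_def displacement_def)
  have cont: "continuous_on {0..l} \<theta>" by (rule primitive_on_continuous[OF prim])
  let ?E = "energy l \<omega>"
  have E0: "0 \<le> ?E" by (rule energy_nonneg)
  obtain C \<delta> where C: "0 \<le> C" "0 < \<delta>" and comp:
    "\<And>\<theta>' \<omega>'. primitive_on 0 l \<theta>' \<omega>' \<Longrightarrow> s_shaped 0 l \<theta>' \<Longrightarrow> (\<lambda>x. (\<omega>' x)\<^sup>2) integrable_on {0..l} \<Longrightarrow>
       integral {0..l} (\<lambda>x. \<bar>\<theta>' x - \<theta> x\<bar>) \<le> \<delta> \<Longrightarrow>
       \<exists>l'' \<theta>'' \<omega>''. s_arc l'' \<theta>'' \<omega>'' (displacement \<theta> 0 l) \<and> \<theta>'' 0 = \<theta>' 0 \<and> \<theta>'' l'' = \<theta>' l \<and>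
         energy l'' \<omega>'' \<le> (1 + C * integral {0..l} (\<lambda>x. \<bar>\<theta>' x - \<theta> x\<bar>)) * energy l \<omega>'"
    by (rule compensate_displacement[OF cont l nc]) blast
  have "((\<lambda>w. C * w * ?E + 2 * q w) \<longlongrightarrow> C * 0 * ?E + 2 * k) (at_right 0)"
    by (intro tendsto_intros q)
  then have "\<forall>\<^sub>F w in at_right 0. C * w * ?E + 2 * q w < 2 * k + \<eta>"
    using \<eta> by (intro order_tendstoD(2)) auto
  moreover have "\<forall>\<^sub>F w in at_right 0. w < w0"
    using w0 by (intro order_tendstoD(2)[OF tendsto_ident_at])
  moreover have "\<forall>\<^sub>F w in at_right 0. 0 < (w::real)" by (simp add: eventually_at_right_less)
  ultimately have "\<forall>\<^sub>F w in at_right 0. C * w * ?E + 2 * q w < 2 * k + \<eta> \<and> w < w0 \<and> 0 < w"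
    by eventually_elim simp
  then obtain w where w: "C * w * ?E + 2 * q w < 2 * k + \<eta>" "w < w0" "0 < w"
    using eventually_happens[of _ "at_right (0::real)"] trivial_limit_at_right_real by blast
  obtain \<epsilon>1 where \<epsilon>1: "0 < \<epsilon>1" and fam': "\<And>\<epsilon>. 0 < \<epsilon> \<and> \<epsilon> < \<epsilon>1 \<Longrightarrow> (\<exists>\<theta>' \<omega>'. primitive_on 0 l \<theta>' \<omega>' \<and>
        s_shaped 0 l \<theta>' \<and> (\<lambda>x. (\<omega>' x)\<^sup>2) integrable_on {0..l} \<and> \<theta>' 0 = \<theta> 0 - \<epsilon> \<and> \<theta>' l = \<theta> l \<and>
        integral {0..l} (\<lambda>x. \<bar>\<theta>' x - \<theta> x\<bar>) \<le> \<epsilon> * w \<and> energy l \<omega>' \<le> ?E + 2 * \<epsilon> * q w + \<epsilon>\<^sup>2 / w)"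
    using fam[OF w(3,2)] by blast
  have "((\<lambda>\<epsilon>. C * w * ?E + (1 + C * (\<epsilon> * w)) * (2 * q w + \<epsilon> / w)) \<longlongrightarrow>
      C * w * ?E + (1 + C * (0 * w)) * (2 * q w + 0 / w)) (at_right 0)"
    using w(3) by (intro tendsto_intros) auto
  then have "\<forall>\<^sub>F \<epsilon> in at_right 0. C * w * ?E + (1 + C * (\<epsilon> * w)) * (2 * q w + \<epsilon> / w) < 2 * k + \<eta>"
    using w(1) by (intro order_tendstoD(2)) auto
  then obtain \<epsilon>2 where \<epsilon>2: "0 < \<epsilon>2" "\<And>\<epsilon>. 0 < \<epsilon> \<Longrightarrow> \<epsilon> < \<epsilon>2 \<Longrightarrow>
      C * w * ?E + (1 + C * (\<epsilon> * w)) * (2 * q w + \<epsilon> / w) < 2 * k + \<eta>"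
    unfolding eventually_at_right_field by blast
  show ?thesis
  proof (rule exI[of _ "min (min \<epsilon>1 \<epsilon>2) (\<delta> / w)"], intro conjI allI impI)
    show "0 < min (min \<epsilon>1 \<epsilon>2) (\<delta> / w)" using \<epsilon>1 \<epsilon>2(1) C w(3) by simp
    fix \<epsilon> assume "0 < \<epsilon> \<and> \<epsilon> < min (min \<epsilon>1 \<epsilon>2) (\<delta> / w)"
    then have e: "0 < \<epsilon>" "\<epsilon> < \<epsilon>1" "\<epsilon> < \<epsilon>2" "\<epsilon> * w < \<delta>" using w(3) by (auto simp: pos_less_divide_eq)
    from fam'[OF conjI[OF e(1,2)]]
    obtain \<theta>' \<omega>' where t: "primitive_on 0 l \<theta>' \<omega>'"
        "s_shaped 0 l \<theta>'" "(\<lambda>x. (\<omega>' x)\<^sup>2) integrable_on {0..l}" "\<theta>' 0 = \<theta> 0 - \<epsilon>" "\<theta>' l = \<theta> l"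
        "integral {0..l} (\<lambda>x. \<bar>\<theta>' x - \<theta> x\<bar>) \<le> \<epsilon> * w" "energy l \<omega>' \<le> ?E + 2 * \<epsilon> * q w + \<epsilon>\<^sup>2 / w"
      by (elim exE conjE) (rule that)
    define D where "D = integral {0..l} (\<lambda>x. \<bar>\<theta>' x - \<theta> x\<bar>)"
    have D\<delta>: "D \<le> \<delta>" using t(6) e(4) by (simp add: D_def)
    obtain l'' \<theta>'' \<omega>'' where a: "s_arc l'' \<theta>'' \<omega>'' V" "\<theta>'' 0 = \<theta>' 0" "\<theta>'' l'' = \<theta>' l"
       "energy l'' \<omega>'' \<le> (1 + C * D) * energy l \<omega>'"
      using comp[OF t(1-3) D\<delta>[unfolded D_def]] unfolding V D_def[symmetric] by blast
    note a(4)
    also have "(1 + C * D) * energy l \<omega>' \<le> (1 + C * (\<epsilon> * w)) * energy l \<omega>'"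
      using t(6) C by (intro mult_right_mono energy_nonneg add_left_mono mult_left_mono) (auto simp: D_def)
    also have "\<dots> \<le> (1 + C * (\<epsilon> * w)) * (?E + 2 * \<epsilon> * q w + \<epsilon>\<^sup>2 / w)"
      using C e(1) w(3) by (intro mult_left_mono t(7)) auto
    also have "\<dots> = ?E + \<epsilon> * (C * w * ?E + (1 + C * (\<epsilon> * w)) * (2 * q w + \<epsilon> / w))"
      by (simp add: algebra_simps power2_eq_square)
    also have "\<dots> \<le> ?E + \<epsilon> * (2 * k + \<eta>)"
      using \<epsilon>2(2)[OF e(1,3)] e(1) by (intro add_left_mono mult_left_mono) auto
    finally show "\<exists>l' \<theta>' \<omega>'. s_arc l' \<theta>' \<omega>' V \<and> \<theta>' 0 = \<theta> 0 - \<epsilon> \<and> \<theta>' l' = \<theta> l \<and> energy l' \<omega>' \<le> ?E + \<epsilon> * (2 * k + \<eta>)"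
      using a(1-3) t(4,5) by metis
  qed
qed

lemma has_integral_cis_linear:
  assumes "k \<noteq> 0" "u \<le> w"
  shows "((\<lambda>x. cis (A + k * x)) has_integral (- \<i> / of_real k) * (cis (A + k * w) - cis (A + k * u))) {u..w}"
proof -
  have "((\<lambda>z. (- \<i> / of_real k) * exp (\<i> * (of_real A + of_real k * z))) has_field_derivative
      exp (\<i> * (of_real A + of_real k * of_real x))) (at (of_real x))" for x
    using assms(1) by (auto intro!: derivative_eq_intros simp: field_simps)
  then have "((\<lambda>x. (- \<i> / of_real k) * exp (\<i> * (of_real A + of_real k * of_real x))) has_vector_derivative
      exp (\<i> * (of_real A + of_real k * of_real x))) (at x within {u..w})" for x
    by (rule has_vector_derivative_real_field)
  then have "((\<lambda>x. exp (\<i> * (of_real A + of_real k * of_real x))) has_integral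
     ((- \<i> / of_real k) * exp (\<i> * (of_real A + of_real k * of_real w))
      - (- \<i> / of_real k) * exp (\<i> * (of_real A + of_real k * of_real u)))) {u..w}"
    by (intro fundamental_theorem_of_calculus assms(2))
  moreover have "exp (\<i> * (of_real A + of_real k * of_real x)) = cis (A + k * x)" for x
    by (simp add: cis_conv_exp)
  ultimately show ?thesis by (simp add: right_diff_distrib)
qed

text \<open>Three circular arcs run through the angles from \<open>t - \<epsilon>\<close> to
  \<open>t\<close>, on to \<open>t + \<epsilon>\<close> and back to \<open>t\<close>. The first has
  half the curvature of the others, so all angles of \<open>[t - \<epsilon>, t + \<epsilon>]\<close>
  occur with the same weight and the displacement has direction \<open>t\<close> by symmetry. The
  energy is quadratic in \<open>\<epsilon>\<close>, in accordance with curvature 0.\<close>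

lemma straight_variation:
  assumes l: "0 < l" and \<epsilon>: "0 < \<epsilon>" "\<epsilon> \<le> pi/2"
  obtains l' \<theta>' \<omega>' where "s_arc l' \<theta>' \<omega>' (l *\<^sub>R cis t)" "\<theta>' 0 = t - \<epsilon>" "\<theta>' l' = t" "energy l' \<omega>' \<le> 14 * \<epsilon>\<^sup>2 / l"
proof -
  have sn: "0 < sin \<epsilon>" using \<epsilon> by (intro sin_gt_zero) auto
  have sne: "sin \<epsilon> \<le> \<epsilon>" using \<epsilon> by (intro sin_x_le_x) simp
  \<comment> \<open>The displacement will have length
    \<open>4 * h * sin \<epsilon> / \<epsilon>\<close>, which is to be \<open>l\<close>.\<close>
  define h where "h = l * \<epsilon> / sin \<epsilon> / 4"
  have h: "0 < h" "4 * h * sin \<epsilon> = l * \<epsilon>" using l \<epsilon> sn by (simp_all add: h_def)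
  have "l * sin \<epsilon> \<le> l * \<epsilon>" using sne l by (intro mult_left_mono) auto
  then have lh: "l \<le> 4 * h" using sn by (simp add: h_def field_simps)
  let ?f1 = "\<lambda>x. (t - \<epsilon>) + (\<epsilon> / (2*h)) * x" and ?f2 = "\<lambda>x. (t - 2*\<epsilon>) + (\<epsilon> / h) * x" and ?f3 = "\<lambda>x. (t + 4*\<epsilon>) + (- \<epsilon> / h) * x"
  let ?g = "\<lambda>x. if x \<le> 2*h then ?f1 x else ?f2 x"
  let ?\<theta> = "\<lambda>x. if x \<le> 3*h then ?g x else ?f3 x"
  let ?d = "\<lambda>x::real. if x \<le> 2*h then \<epsilon> / (2*h) else \<epsilon> / h"
  let ?\<omega> = "\<lambda>x. if x \<le> 3*h then ?d x else - \<epsilon> / h"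
  have lin: "primitive_on 0 (4*h) (\<lambda>x. A + k * x) (\<lambda>_. k)" for A k
    using primitive_on_add_linear[OF primitive_on_const[of "4*h" A], of k 0] by simp
  have p1: "primitive_on 0 (4*h) ?g ?d"
    by (rule primitive_on_switch[OF lin lin]) (use h in \<open>auto simp: field_simps\<close>)
  have prim: "primitive_on 0 (4*h) ?\<theta> ?\<omega>"
    by (rule primitive_on_switch[OF p1 lin]) (use h in \<open>auto simp: field_simps\<close>)
  have ic: "(\<lambda>x::real. k\<^sup>2) integrable_on {0..4*h}" for k :: real by (rule integrable_const_ivl)
  have h2: "2*h \<in> {0..4*h}" and h3: "3*h \<in> {0..4*h}" using h by auto
  note e1 = energy_switch[OF ic ic h2, of "\<epsilon> / (2*h)" "\<epsilon> / h"]
  note e2 = energy_switch[OF e1(1) ic h3, of "- \<epsilon> / h"]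
  \<comment> \<open>Extending the second arc to \<open>4 * h\<close> only increases the energy. The
    bound \<open>7/2 * \<epsilon>\<^sup>2 / h\<close> thus obtained is
    \<open>14 * \<epsilon>\<^sup>2 / (4 * h)\<close>.\<close>
  have "integral {0..3*h} (\<lambda>x. (?d x)\<^sup>2) \<le> integral {0..4*h} (\<lambda>x. (?d x)\<^sup>2)"
    by (rule integral_subset_le[OF _ integrable_subinterval_real[OF e1(1)] e1(1)]) (use h in auto)
  moreover have "integral {0..4*h} (\<lambda>x. (?d x)\<^sup>2) = (\<epsilon> / (2*h))\<^sup>2 * (2*h) + (\<epsilon> / h)\<^sup>2 * (2*h)"
    using e1(2) h by (simp add: energy_def mult.commute)
  moreover have "integral {3*h..4*h} (\<lambda>x. (- \<epsilon> / h)\<^sup>2) = (\<epsilon> / h)\<^sup>2 * h"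
    using h by (simp add: mult.commute)
  ultimately have "energy (4*h) ?\<omega> \<le> (\<epsilon> / (2*h))\<^sup>2 * (2*h) + (\<epsilon> / h)\<^sup>2 * (2*h) + (\<epsilon> / h)\<^sup>2 * h"
    using e2(2) by linarith
  also have "\<dots> = 14 * \<epsilon>\<^sup>2 / (4 * h)" using h by (simp add: power2_eq_square field_simps)
  also have "\<dots> \<le> 14 * \<epsilon>\<^sup>2 / l" using lh l by (intro divide_left_mono) auto
  finally have en: "energy (4*h) ?\<omega> \<le> 14 * \<epsilon>\<^sup>2 / l" .
  have disp: "integral {0..4*h} (\<lambda>x. cis (?\<theta> x)) = l *\<^sub>R cis t"
  proof -
    have A: "?f1 0 = t - \<epsilon>" "?f1 (2*h) = t" "?f2 (2*h) = t" "?f2 (3*h) = t + \<epsilon>" "?f3 (3*h) = t + \<epsilon>" "?f3 (4*h) = t"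
      using h(1) by (simp_all add: field_simps)
    have k: "\<epsilon> / (2*h) \<noteq> 0" "\<epsilon> / h \<noteq> 0" "- \<epsilon> / h \<noteq> 0" using \<epsilon> h by auto
    have i1: "((\<lambda>x. cis (?\<theta> x)) has_integral (- \<i> / of_real (\<epsilon> / (2*h))) * (cis t - cis (t - \<epsilon>))) {0..2*h}"
    proof (rule has_integral_eq)
      show "((\<lambda>x. cis (?f1 x)) has_integral (- \<i> / of_real (\<epsilon> / (2*h))) * (cis t - cis (t - \<epsilon>))) {0..2*h}"
        using has_integral_cis_linear[OF k(1), of 0 "2*h" "t - \<epsilon>"] h(1) unfolding A by simp
      show "cis (?f1 x) = cis (?\<theta> x)" if "x \<in> {0..2*h}" for x using that h(1) by simp
    qed
    have i2: "((\<lambda>x. cis (?\<theta> x)) has_integral (- \<i> / of_real (\<epsilon> / h)) * (cis (t + \<epsilon>) - cis t)) {2*h..3*h}"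
    proof (rule has_integral_spike_finite)
      show "((\<lambda>x. cis (?f2 x)) has_integral (- \<i> / of_real (\<epsilon> / h)) * (cis (t + \<epsilon>) - cis t)) {2*h..3*h}"
        using has_integral_cis_linear[OF k(2), of "2*h" "3*h" "t - 2*\<epsilon>"] h(1) unfolding A by simp
      show "cis (?\<theta> x) = cis (?f2 x)" if "x \<in> {2*h..3*h} - {2*h}" for x using that h(1) by simp
    qed simp
    have i3: "((\<lambda>x. cis (?\<theta> x)) has_integral (- \<i> / of_real (- \<epsilon> / h)) * (cis t - cis (t + \<epsilon>))) {3*h..4*h}"
    proof (rule has_integral_spike_finite)
      show "((\<lambda>x. cis (?f3 x)) has_integral (- \<i> / of_real (- \<epsilon> / h)) * (cis t - cis (t + \<epsilon>))) {3*h..4*h}"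
        using has_integral_cis_linear[OF k(3), of "3*h" "4*h" "t + 4*\<epsilon>"] h(1) unfolding A by simp
      show "cis (?\<theta> x) = cis (?f3 x)" if "x \<in> {3*h..4*h} - {3*h}" for x using that h(1) by simp
    qed simp
    have "((\<lambda>x. cis (?\<theta> x)) has_integral (- \<i> / of_real (\<epsilon> / (2*h))) * (cis t - cis (t - \<epsilon>))
      + (- \<i> / of_real (\<epsilon> / h)) * (cis (t + \<epsilon>) - cis t)) {0..3*h}"
      by (rule has_integral_combine[OF _ _ i1 i2]) (use h in auto)
    from has_integral_combine[OF _ _ this i3]
    have "integral {0..4*h} (\<lambda>x. cis (?\<theta> x)) = (- \<i> / of_real (\<epsilon> / (2*h))) * (cis t - cis (t - \<epsilon>))
      + (- \<i> / of_real (\<epsilon> / h)) * (cis (t + \<epsilon>) - cis t) + (- \<i> / of_real (- \<epsilon> / h)) * (cis t - cis (t + \<epsilon>))"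
      using h by (intro integral_unique) auto
    also have "\<dots> = (- 2 * \<i> * of_real (h / \<epsilon>)) * (cis (t + \<epsilon>) - cis (t - \<epsilon>))"
      using \<epsilon> h by (simp add: field_simps)
    also have "cis (t + \<epsilon>) - cis (t - \<epsilon>) = 2 * \<i> * of_real (sin \<epsilon>) * cis t"
      by (simp add: complex_eq_iff cos_add cos_diff sin_add sin_diff)
    also have "(- 2 * \<i> * of_real (h / \<epsilon>)) * (2 * \<i> * of_real (sin \<epsilon>) * cis t) = of_real (4 * h * sin \<epsilon> / \<epsilon>) * cis t"
      by (simp add: complex_eq_iff algebra_simps)
    also have "4 * h * sin \<epsilon> / \<epsilon> = l" using h(2) \<epsilon> by simp
    finally show ?thesis by (simp add: scaleR_conv_of_real)
  qed
  have g_max: "?g x = max (?f1 x) (?f2 x)" for x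
  proof -
    have eq: "?f1 x - ?f2 x = \<epsilon> / (2*h) * (2*h - x)" using h(1) by (simp add: field_simps)
    have K: "0 < \<epsilon> / (2*h)" using \<epsilon> h by simp
    show ?thesis
    proof (cases "x \<le> 2*h")
      case True
      then have "0 \<le> ?f1 x - ?f2 x" unfolding eq using K by (intro mult_nonneg_nonneg) auto
      then show ?thesis using True by simp
    next
      case False
      then have "?f1 x - ?f2 x \<le> 0" unfolding eq using K by (intro mult_nonneg_nonpos) auto
      then show ?thesis using False by simp
    qed
  qed
  have shape: "s_shaped 0 (4*h) ?\<theta>"
    unfolding s_shaped_def
  proof (intro bexI[of _ "3*h"] conjI disjI1)
    show "mono_on {0..3*h} ?\<theta>"
    proof (rule monotone_onI)
      fix x y assume xy: "x \<in> {0..3*h}" "y \<in> {0..3*h}" "x \<le> y"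
      have "\<epsilon> / (2*h) * x \<le> \<epsilon> / (2*h) * y" "\<epsilon> / h * x \<le> \<epsilon> / h * y"
        using xy \<epsilon> h by (intro mult_left_mono; simp)+
      then have "max (?f1 x) (?f2 x) \<le> max (?f1 y) (?f2 y)" by (intro max.mono) simp_all
      then show "?\<theta> x \<le> ?\<theta> y" unfolding g_max using xy by simp
    qed
    have three: "?\<theta> x = ?f3 x" if "x \<in> {3*h..4*h}" for x using that h(1) by (auto simp: field_simps)
    show "antimono_on {3*h..4*h} ?\<theta>"
    proof (rule monotone_onI)
      fix x y assume xy: "x \<in> {3*h..4*h}" "y \<in> {3*h..4*h}" "x \<le> y"
      have "- \<epsilon> / h * y \<le> - \<epsilon> / h * x" using xy \<epsilon> h by (intro mult_left_mono_neg) auto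
      then show "?\<theta> y \<le> ?\<theta> x" unfolding three[OF xy(1)] three[OF xy(2)] by simp
    qed
    have v: "?\<theta> 0 = t - \<epsilon>" "?\<theta> (3*h) = t + \<epsilon>" "?\<theta> (4*h) = t" using h(1) by (simp_all add: field_simps)
    show "\<bar>?\<theta> (3*h) - ?\<theta> 0\<bar> \<le> pi" "\<bar>?\<theta> (4*h) - ?\<theta> (3*h)\<bar> \<le> pi" unfolding v using \<epsilon> by auto
  qed (use h in auto)
  have "s_arc (4*h) ?\<theta> ?\<omega> (l *\<^sub>R cis t)"
    unfolding s_arc_def using prim shape disp e2(1) h(1) by (intro conjI) simp_all
  then show thesis by (rule that[OF _ _ _ en]) (use h(1) in \<open>simp_all add: field_simps\<close>)
qed

text \<open>Lowering the start steepens a rising phase and increases its turn by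
  \<open>\<epsilon>\<close>, for which the bound \<open>pi\<close> must leave room.\<close>

lemma s_shaped_tilt_rising:
  assumes mono: "mono_on {0..c} \<theta>" "antimono_on {c..l} \<theta>" and w: "0 < w" "w \<le> c" "c \<le> l"
    and \<epsilon>: "0 \<le> \<epsilon>" and turn: "\<theta> c - \<theta> 0 + \<epsilon> \<le> pi" "\<bar>\<theta> l - \<theta> c\<bar> \<le> pi"
  shows "s_shaped 0 l (tilt w \<epsilon> \<theta>)"
  unfolding s_shaped_def
proof (intro bexI[of _ c] conjI disjI1)
  have far: "tilt w \<epsilon> \<theta> x = \<theta> x" if "c \<le> x" for x
    using that w by (cases "x = w") (auto simp: tilt_def)
  show "mono_on {0..c} (tilt w \<epsilon> \<theta>)"
  proof (rule monotone_onI)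
    fix x y assume xy: "x \<in> {0..c}" "y \<in> {0..c}" "x \<le> y"
    have "x / w \<le> y / w" using xy(3) w(1) by (simp add: divide_right_mono)
    then have "\<epsilon> * max 0 (1 - y / w) \<le> \<epsilon> * max 0 (1 - x / w)" using \<epsilon> by (intro mult_left_mono max.mono) auto
    then show "tilt w \<epsilon> \<theta> x \<le> tilt w \<epsilon> \<theta> y"
      using monotone_onD[OF mono(1) xy] by (simp add: tilt_eq[OF w(1)])
  qed
  show "antimono_on {c..l} (tilt w \<epsilon> \<theta>)"
  proof (rule monotone_onI)
    fix x y assume xy: "x \<in> {c..l}" "y \<in> {c..l}" "x \<le> y"
    then show "tilt w \<epsilon> \<theta> y \<le> tilt w \<epsilon> \<theta> x" using monotone_onD[OF mono(2) xy] far by simp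
  qed
  have "\<theta> 0 \<le> \<theta> c" using monotone_onD[OF mono(1), of 0 c] w by simp
  moreover have "tilt w \<epsilon> \<theta> 0 = \<theta> 0 - \<epsilon>" using w by (simp add: tilt_def)
  ultimately show "\<bar>tilt w \<epsilon> \<theta> c - tilt w \<epsilon> \<theta> 0\<bar> \<le> pi" using far[of c] turn \<epsilon> by simp
  show "\<bar>tilt w \<epsilon> \<theta> l - tilt w \<epsilon> \<theta> c\<bar> \<le> pi" using far[of c] far[of l] turn w by simp
qed (use w in auto)

text \<open>The ramp added to the angle rises at the rate \<open>\<epsilon> / w \<le> k\<close>, no
  faster than the angle is known to fall on \<open>{0..w}\<close>, so the sum still falls.\<close>

lemma s_shaped_tilt_falling:
  assumes mono: "antimono_on {0..c} \<theta>" "mono_on {c..l} \<theta>" and w: "0 < w" "w \<le> c" "c \<le> l"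
    and \<epsilon>: "0 \<le> \<epsilon>" "\<epsilon> \<le> k * w"
    and slope: "\<And>x y. 0 \<le> x \<Longrightarrow> x \<le> y \<Longrightarrow> y \<le> w \<Longrightarrow> k * (y - x) \<le> \<theta> x - \<theta> y"
    and turn: "\<bar>\<theta> c - \<theta> 0\<bar> \<le> pi" "\<bar>\<theta> l - \<theta> c\<bar> \<le> pi"
  shows "s_shaped 0 l (tilt w \<epsilon> \<theta>)"
  unfolding s_shaped_def
proof (intro bexI[of _ c] conjI disjI2)
  have far: "tilt w \<epsilon> \<theta> x = \<theta> x" if "w \<le> x" for x
    using that w by (cases "x = w") (auto simp: tilt_def)
  have near: "tilt w \<epsilon> \<theta> y \<le> tilt w \<epsilon> \<theta> x" if "0 \<le> x" "x \<le> y" "y \<le> w" for x y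
  proof -
    have "\<epsilon> / w * (y - x) \<le> k * (y - x)" using \<epsilon> w that by (intro mult_right_mono) (auto simp: pos_divide_le_eq)
    also have "\<dots> \<le> \<theta> x - \<theta> y" by (rule slope[OF that])
    finally show ?thesis using that by (simp add: tilt_def right_diff_distrib)
  qed
  have beyond: "tilt w \<epsilon> \<theta> y \<le> tilt w \<epsilon> \<theta> x" if "w \<le> x" "x \<le> y" "y \<le> c" for x y
    using far[of x] far[of y] monotone_onD[OF mono(1), of x y] that w by simp
  show "antimono_on {0..c} (tilt w \<epsilon> \<theta>)"
  proof (rule monotone_onI)
    fix x y assume xy: "x \<in> {0..c}" "y \<in> {0..c}" "x \<le> y"
    consider "y \<le> w" | "w \<le> x" | "x < w" "w < y" by linarith
    then show "tilt w \<epsilon> \<theta> y \<le> tilt w \<epsilon> \<theta> x"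
    proof cases
      case 1 then show ?thesis using near xy by auto
    next
      case 2 then show ?thesis using beyond xy by auto
    next
      case 3 then show ?thesis using near[of x w] beyond[of w y] xy w by auto
    qed
  qed
  show "mono_on {c..l} (tilt w \<epsilon> \<theta>)"
  proof (rule monotone_onI)
    fix x y assume xy: "x \<in> {c..l}" "y \<in> {c..l}" "x \<le> y"
    then show "tilt w \<epsilon> \<theta> x \<le> tilt w \<epsilon> \<theta> y" using monotone_onD[OF mono(2) xy] far[of x] far[of y] w by simp
  qed
  have "\<theta> c \<le> \<theta> w" using monotone_onD[OF mono(1), of w c] w by simp
  moreover have "k * w \<le> \<theta> 0 - \<theta> w" using slope[of 0 w] w by simp
  moreover have "tilt w \<epsilon> \<theta> 0 = \<theta> 0 - \<epsilon>" using w by (simp add: tilt_def)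
  ultimately show "\<bar>tilt w \<epsilon> \<theta> c - tilt w \<epsilon> \<theta> 0\<bar> \<le> pi" using far[of c] turn \<epsilon> w by simp
  show "\<bar>tilt w \<epsilon> \<theta> l - tilt w \<epsilon> \<theta> c\<bar> \<le> pi" using far[of c] far[of l] turn w by simp
qed (use w in auto)

text \<open>For a falling angle that starts with zero curvature, the start is lowered along the ramp
  \<open>\<theta> 0 - \<epsilon> + \<epsilon> / w * x\<close> until the ramp meets the graph of the angle.\<close>

lemma ramp_family:
  assumes p: "primitive_on 0 l \<theta> \<omega>" and i: "(\<lambda>x. (\<omega> x)\<^sup>2) integrable_on {0..l}"
    and anti: "antimono_on {0..l} \<theta>" and turn: "\<theta> 0 - \<theta> l \<le> pi"
    and w: "0 < w" "w < l" and \<epsilon>: "0 < \<epsilon>" "\<epsilon> \<le> pi"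
  shows "\<exists>\<theta>' \<omega>'. primitive_on 0 l \<theta>' \<omega>' \<and> s_shaped 0 l \<theta>' \<and> (\<lambda>x. (\<omega>' x)\<^sup>2) integrable_on {0..l} \<and>
     \<theta>' 0 = \<theta> 0 - \<epsilon> \<and> \<theta>' l = \<theta> l \<and> integral {0..l} (\<lambda>x. \<bar>\<theta>' x - \<theta> x\<bar>) \<le> \<epsilon> * w \<and>
     energy l \<omega>' \<le> energy l \<omega> + 2 * \<epsilon> * 0 + \<epsilon>\<^sup>2 / w"
proof -
  have cont: "continuous_on {0..l} \<theta>" by (rule primitive_on_continuous[OF p])
  let ?r = "\<lambda>x. (\<theta> 0 - \<epsilon>) + (\<epsilon> / w) * x"
  have tw: "\<theta> w \<le> \<theta> 0" using monotone_onD[OF anti, of 0 w] w by simp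
  \<comment> \<open>At 0 the ramp lies below the graph, and at \<open>w\<close> it has reached
    \<open>\<theta> 0\<close>, which is at least \<open>\<theta> w\<close>.\<close>
  obtain s where s: "0 \<le> s" "s \<le> w" "\<theta> s - ?r s = 0"
  proof -
    have "continuous_on {0..w} (\<lambda>x. \<theta> x - ?r x)"
      by (intro continuous_intros continuous_on_subset[OF cont]) (use w in auto)
    moreover have "\<theta> w - ?r w \<le> 0" "0 \<le> \<theta> 0 - ?r 0" using tw w \<epsilon> by auto
    ultimately show thesis using IVT2'[of "\<lambda>x. \<theta> x - ?r x" w 0 0] w that by auto
  qed
  have "s \<noteq> 0" using s(3) \<epsilon> by auto
  then have s0: "0 < s" using s(1) by simp
  have sl: "s \<in> {0..l}" using s w by auto
  let ?\<theta>' = "\<lambda>x. if x \<le> s then ?r x else \<theta> x" and ?\<omega>' = "\<lambda>x. if x \<le> s then \<epsilon> / w else \<omega> x"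
  have lin: "primitive_on 0 l ?r (\<lambda>_. \<epsilon> / w)"
    using primitive_on_add_linear[OF primitive_on_const[of l "\<theta> 0 - \<epsilon>"], of "\<epsilon> / w" 0] by simp
  have prim: "primitive_on 0 l ?\<theta>' ?\<omega>'" by (rule primitive_on_switch[OF lin p sl]) (use s(3) in simp)
  have ic: "(\<lambda>x::real. (\<epsilon> / w)\<^sup>2) integrable_on {0..l}" by (rule integrable_const_ivl)
  note es = energy_switch[OF ic i sl]
  have en: "energy l ?\<omega>' \<le> energy l \<omega> + 2 * \<epsilon> * 0 + \<epsilon>\<^sup>2 / w"
  proof -
    have "integral {0..s} (\<lambda>x. (\<epsilon> / w)\<^sup>2) = (\<epsilon> / w)\<^sup>2 * s" using s by (simp add: mult.commute)
    also have "\<dots> \<le> (\<epsilon> / w)\<^sup>2 * w" using s by (intro mult_left_mono) auto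
    also have "\<dots> = \<epsilon>\<^sup>2 / w" using w by (simp add: power2_eq_square)
    finally have 1: "integral {0..s} (\<lambda>x. (\<epsilon> / w)\<^sup>2) \<le> \<epsilon>\<^sup>2 / w" .
    have "integral {s..l} (\<lambda>x. (\<omega> x)\<^sup>2) \<le> energy l \<omega>"
      unfolding energy_def by (rule integral_subset_le[OF _ integrable_subinterval_real[OF i] i]) (use s in auto)
    then show ?thesis using es(2) 1 by simp
  qed
  have rb: "\<theta> 0 - \<epsilon> \<le> ?r x" "?r x \<le> \<theta> 0" if "0 \<le> x" "x \<le> s" for x
  proof -
    have "0 \<le> \<epsilon> / w * x" using that \<epsilon> w by simp
    moreover have "\<epsilon> / w * x \<le> \<epsilon> / w * w" using that s \<epsilon> w by (intro mult_left_mono) auto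
    ultimately show "\<theta> 0 - \<epsilon> \<le> ?r x" "?r x \<le> \<theta> 0" using w by auto
  qed
  have D: "integral {0..l} (\<lambda>x. \<bar>?\<theta>' x - \<theta> x\<bar>) \<le> \<epsilon> * w"
  proof -
    have "((\<lambda>t. indicat_real {0..w} t *\<^sub>R \<epsilon>) has_integral integral {0..w} (\<lambda>_. \<epsilon>)) {0..l}"
      by (rule has_integral_indicator_interval) (use w in auto)
    then have "((\<lambda>t. indicat_real {0..w} t *\<^sub>R \<epsilon>) has_integral (\<epsilon> * w)) {0..l}" using w by (simp add: mult.commute)
    moreover have "(\<lambda>x. \<bar>?\<theta>' x - \<theta> x\<bar>) integrable_on {0..l}"
      by (intro integrable_continuous_real continuous_on_rabs continuous_on_diff primitive_on_continuous[OF prim] cont)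
    moreover have "\<bar>?\<theta>' x - \<theta> x\<bar> \<le> indicat_real {0..w} x *\<^sub>R \<epsilon>" if x: "x \<in> {0..l}" for x
    proof (cases "x \<le> s")
      case True
      have "\<theta> s \<le> \<theta> x" "\<theta> x \<le> \<theta> 0"
        using monotone_onD[OF anti, of x s] monotone_onD[OF anti, of 0 x] x True sl w by auto
      moreover have "\<theta> 0 - \<epsilon> \<le> \<theta> s" using rb(1)[of s] s by simp
      ultimately have "\<bar>?r x - \<theta> x\<bar> \<le> \<epsilon>" using rb[of x] True x unfolding abs_le_iff by auto
      then show ?thesis using True x s by simp
    qed (use \<epsilon> in simp)
    ultimately show ?thesis by (intro has_integral_le[OF integrable_integral])
  qed
  have shape: "s_shaped 0 l ?\<theta>'"
    unfolding s_shaped_def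
  proof (intro bexI[of _ s] conjI disjI1 sl)
    show "mono_on {0..s} ?\<theta>'"
    proof (rule monotone_onI)
      fix x y assume xy: "x \<in> {0..s}" "y \<in> {0..s}" "x \<le> y"
      have "\<epsilon> / w * x \<le> \<epsilon> / w * y" using xy \<epsilon> w by (intro mult_left_mono) auto
      then show "?\<theta>' x \<le> ?\<theta>' y" using xy by simp
    qed
    have far: "?\<theta>' x = \<theta> x" if "s \<le> x" for x using that s(3) by (cases "x = s") auto
    show "antimono_on {s..l} ?\<theta>'"
    proof (rule monotone_onI)
      fix x y assume xy: "x \<in> {s..l}" "y \<in> {s..l}" "x \<le> y"
      then have "\<theta> y \<le> \<theta> x" using monotone_onD[OF anti, of x y] s by auto
      moreover have "?\<theta>' x = \<theta> x" "?\<theta>' y = \<theta> y" by (rule far; use xy in simp)+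
      ultimately show "?\<theta>' y \<le> ?\<theta>' x" by (simp only:)
    qed
    have "?\<theta>' 0 = \<theta> 0 - \<epsilon>" using s by simp
    moreover have "\<theta> 0 - \<epsilon> \<le> \<theta> s" "\<theta> s \<le> \<theta> 0" using rb[of s] s by auto
    ultimately show "\<bar>?\<theta>' s - ?\<theta>' 0\<bar> \<le> pi" using far[of s] \<epsilon> unfolding abs_le_iff by auto
    have "\<theta> l \<le> \<theta> s" using monotone_onD[OF anti, of s l] sl by auto
    then show "\<bar>?\<theta>' l - ?\<theta>' s\<bar> \<le> pi"
      using far[of s] far[of l] turn \<open>\<theta> s \<le> \<theta> 0\<close> sl unfolding abs_le_iff by auto
  qed
  have "?\<theta>' 0 = \<theta> 0 - \<epsilon>" "?\<theta>' l = \<theta> l" using s w by auto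
  then show ?thesis using prim shape es(1) D en by (intro exI[of _ ?\<theta>'] exI[of _ ?\<omega>'] conjI)
qed

text \<open>A positive derivative at the start forbids a falling phase of positive length there. If
  the first phase is falling it is therefore a point, the angle rises throughout, and
  \<open>l\<close> serves as the turning point.\<close>

lemma rising_start_shape:
  assumes s: "s_shaped 0 l \<theta>" and l: "0 < l"
    and d: "(\<theta> has_real_derivative k) (at 0 within {0..l})" and k: "0 < k"
  obtains c where "0 < c" "c \<le> l" "mono_on {0..c} \<theta>" "antimono_on {c..l} \<theta>"
    "\<bar>\<theta> c - \<theta> 0\<bar> \<le> pi" "\<bar>\<theta> l - \<theta> c\<bar> \<le> pi"
proof -
  obtain h where h: "0 < h" "\<And>x. 0 < x \<Longrightarrow> x \<in> {0..l} \<Longrightarrow> x < h \<Longrightarrow> \<theta> 0 < \<theta> x"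
    using has_real_derivative_pos_inc_right[OF d k] by auto
  have rise: "\<not> antimono_on {0..u} \<theta>" if "0 < u" "u \<le> l" for u
  proof
    assume a: "antimono_on {0..u} \<theta>"
    define x where "x = min u (h/2)"
    have x: "0 < x" "x \<le> u" "x < h" using that h(1) by (auto simp: x_def)
    then have "\<theta> x \<le> \<theta> 0" using monotone_onD[OF a, of 0 x] by simp
    then show False using h(2)[of x] x that by simp
  qed
  obtain c where c: "c \<in> {0..l}"
     "mono_on {0..c} \<theta> \<and> antimono_on {c..l} \<theta> \<or> antimono_on {0..c} \<theta> \<and> mono_on {c..l} \<theta>"
     "\<bar>\<theta> c - \<theta> 0\<bar> \<le> pi" "\<bar>\<theta> l - \<theta> c\<bar> \<le> pi"
    using s unfolding s_shaped_def by blast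
  from c(2) show thesis
  proof (elim disjE conjE)
    assume m: "mono_on {0..c} \<theta>" "antimono_on {c..l} \<theta>"
    have "c \<noteq> 0" using rise[of l] m(2) l by auto
    then show thesis using m c by (intro that[of c]) auto
  next
    assume m: "antimono_on {0..c} \<theta>" "mono_on {c..l} \<theta>"
    have "\<not> 0 < c" using rise[of c] m(1) c(1) by auto
    then have c0: "c = 0" using c(1) by simp
    have "antimono_on {l..l} \<theta>" by (intro monotone_onI) simp
    then show thesis using m(2) c(4) l unfolding c0 by (intro that[of l]) auto
  qed
qed

lemma tilt_family:
  assumes p: "primitive_on 0 l \<theta> \<omega>" and i: "(\<lambda>x. (\<omega> x)\<^sup>2) integrable_on {0..l}"
    and w: "0 < w" "w < l" and \<epsilon>: "0 < \<epsilon>" and s: "s_shaped 0 l (tilt w \<epsilon> \<theta>)"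
  shows "\<exists>\<theta>' \<omega>'. primitive_on 0 l \<theta>' \<omega>' \<and> s_shaped 0 l \<theta>' \<and> (\<lambda>x. (\<omega>' x)\<^sup>2) integrable_on {0..l} \<and>
     \<theta>' 0 = \<theta> 0 - \<epsilon> \<and> \<theta>' l = \<theta> l \<and> integral {0..l} (\<lambda>x. \<bar>\<theta>' x - \<theta> x\<bar>) \<le> \<epsilon> * w \<and>
     energy l \<omega>' \<le> energy l \<omega> + 2 * \<epsilon> * ((\<theta> w - \<theta> 0) / w) + \<epsilon>\<^sup>2 / w"
proof -
  obtain \<omega>' where "primitive_on 0 l (tilt w \<epsilon> \<theta>) \<omega>'" "(\<lambda>x. (\<omega>' x)\<^sup>2) integrable_on {0..l}"
    "energy l \<omega>' = energy l \<omega> + 2 * \<epsilon> * ((\<theta> w - \<theta> 0) / w) + \<epsilon>\<^sup>2 / w"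
    "integral {0..l} (\<lambda>x. \<bar>tilt w \<epsilon> \<theta> x - \<theta> x\<bar>) \<le> \<epsilon> * w"
    "tilt w \<epsilon> \<theta> 0 = \<theta> 0 - \<epsilon>" "tilt w \<epsilon> \<theta> l = \<theta> l"
    by (rule tilt[OF p i w less_imp_le[OF \<epsilon>]])
  then show ?thesis using s by (intro exI[of _ "tilt w \<epsilon> \<theta>"] exI[of _ \<omega>'] conjI) simp_all
qed

text \<open>By continuity the curvature stays below \<open>- k\<close> near the start, and the angle
  is its integral.\<close>

lemma slope_near_start:
  assumes kc: "continuous_on {0..l} \<kappa>" and l: "0 < l"
    and d: "\<And>x. x \<in> {0..l} \<Longrightarrow> (\<theta> has_real_derivative \<kappa> x) (at x within {0..l})" and k: "k < - \<kappa> 0"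
  obtains w where "0 < w" "w \<le> l" "\<And>x y. 0 \<le> x \<Longrightarrow> x \<le> y \<Longrightarrow> y \<le> w \<Longrightarrow> k * (y - x) \<le> \<theta> x - \<theta> y"
proof -
  obtain r where r: "0 < r" "\<And>x. x \<in> {0..l} \<Longrightarrow> dist x 0 < r \<Longrightarrow> dist (\<kappa> x) (\<kappa> 0) < - \<kappa> 0 - k"
    using kc[unfolded continuous_on_iff, rule_format, of 0 "- \<kappa> 0 - k"] l k by auto
  define w where "w = min l (r/2)"
  have w: "0 < w" "w \<le> l" "w < r" using l r(1) by (auto simp: w_def)
  show thesis
  proof (rule that[OF w(1,2)])
    fix x y assume xy: "0 \<le> x" "x \<le> y" "y \<le> w"
    have "(\<kappa> has_integral (\<theta> y - \<theta> x)) {x..y}"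
    proof (rule fundamental_theorem_of_calculus[OF xy(2)])
      fix z assume "z \<in> {x..y}"
      then have "z \<in> {0..l}" "{x..y} \<subseteq> {0..l}" using xy w by auto
      then have "(\<theta> has_real_derivative \<kappa> z) (at z within {x..y})"
        using has_field_derivative_subset[OF d] by blast
      then show "(\<theta> has_vector_derivative \<kappa> z) (at z within {x..y})"
        by (simp add: has_real_derivative_iff_has_vector_derivative)
    qed
    moreover have "\<kappa> z \<le> - k" if "z \<in> {x..y}" for z
      using r(2)[of z] that xy w by (simp add: dist_real_def abs_less_iff)
    ultimately have "\<theta> y - \<theta> x \<le> (y - x) *\<^sub>R (- k)"
      using has_integral_le[OF _ has_integral_const_real[of "- k" x y], of \<kappa> "\<theta> y - \<theta> x"] xy by simp
    then show "k * (y - x) \<le> \<theta> x - \<theta> y" by (simp add: algebra_simps)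
  qed
qed

text \<open>The cases follow the initial curvature. A positive one allows tilting, which steepens
  the first phase; a start with negative curvature keeps falling after a small tilt. With curvature
  0 the arc is monotone by \<open>X\<close> and \<open>Y\<close>: a rising one is tilted, a falling
  one receives a ramp. A constant angle is treated by \<open>straight_variation\<close>.\<close>

theorem start_angle_variation:
  assumes min: "minimal_arc l \<theta> \<omega> V" and el: "elastica l \<theta> \<Lambda> \<kappa>"
    and e: "energy l \<omega> = integral {0..l} (\<lambda>x. (\<kappa> x)\<^sup>2)"
    and X: "0 < Re (cnj V * cis (\<theta> 0))" and Y: "0 \<le> Re (cnj V * cis (\<theta> l))" and \<eta>: "0 < \<eta>"
  shows "\<exists>\<epsilon>0>0. \<forall>\<epsilon>. 0 < \<epsilon> \<and> \<epsilon> < \<epsilon>0 \<longrightarrow> (\<exists>l' \<theta>' \<omega>'. s_arc l' \<theta>' \<omega>' V \<and> \<theta>' 0 = \<theta> 0 - \<epsilon> \<and>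
     \<theta>' l' = \<theta> l \<and> energy l' \<omega>' \<le> energy l \<omega> + \<epsilon> * (2 * \<kappa> 0 + \<eta>))"
proof -
  have l: "0 < l" and prim: "primitive_on 0 l \<theta> \<omega>" and s: "s_shaped 0 l \<theta>" and V: "displacement \<theta> 0 l = V"
    and i: "(\<lambda>x. (\<omega> x)\<^sup>2) integrable_on {0..l}"
    using min by (auto simp: minimal_arc_def s_arc_def displacement_def)
  have kc: "continuous_on {0..l} \<kappa>"
    and d: "\<And>x. x \<in> {0..l} \<Longrightarrow> (\<theta> has_real_derivative \<kappa> x) (at x within {0..l})"
    using el by (auto simp: elastica_def)
  have zero: "0 \<in> {0..l}" using l by simp
  have d0: "(\<theta> has_real_derivative \<kappa> 0) (at 0 within {0..l})" by (rule d[OF zero])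
  show ?thesis
  proof (cases "\<exists>x\<in>{0..l}. \<theta> x \<noteq> \<theta> 0")
    case False
    have tc: "\<theta> x = \<theta> 0" if "x \<in> {0..l}" for x using False that by blast
    have k0: "\<kappa> 0 = 0"
    proof (rule ccontr)
      assume "\<kappa> 0 \<noteq> 0"
      then consider "0 < \<kappa> 0" | "\<kappa> 0 < 0" by linarith
      then obtain h where h: "0 < h" "\<And>x. 0 < x \<Longrightarrow> x \<in> {0..l} \<Longrightarrow> x < h \<Longrightarrow> \<theta> x \<noteq> \<theta> 0"
      proof cases
        case 1
        obtain h where h: "h > 0" "\<forall>x>0. 0 + x \<in> {0..l} \<longrightarrow> x < h \<longrightarrow> \<theta> 0 < \<theta> (0 + x)"
          using has_real_derivative_pos_inc_right[OF d0 1] by blast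
        show thesis
        proof (rule that[OF h(1)])
          fix x assume "0 < x" "x \<in> {0..l}" "x < h"
          then show "\<theta> x \<noteq> \<theta> 0" using h(2)[rule_format, of x] by simp
        qed
      next
        case 2
        obtain h where h: "h > 0" "\<forall>x>0. 0 + x \<in> {0..l} \<longrightarrow> x < h \<longrightarrow> \<theta> 0 > \<theta> (0 + x)"
          using has_real_derivative_neg_dec_right[OF d0 2] by blast
        show thesis
        proof (rule that[OF h(1)])
          fix x assume "0 < x" "x \<in> {0..l}" "x < h"
          then show "\<theta> x \<noteq> \<theta> 0" using h(2)[rule_format, of x] by simp
        qed
      qed
      define x where "x = min l (h/2)"
      have x: "0 < x" "x \<in> {0..l}" "x < h" using l h(1) by (auto simp: x_def)
      show False by (rule notE[OF h(2)[OF x] tc[OF x(2)]])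
    qed
    have "V = integral {0..l} (\<lambda>x. cis (\<theta> 0))"
      unfolding V[symmetric] displacement_def by (rule integral_cong) (rule arg_cong[where f=cis], rule tc)
    then have V': "V = l *\<^sub>R cis (\<theta> 0)" using l by simp
    have tl: "\<theta> l = \<theta> 0" by (rule tc) (use l in simp)
    \<comment> \<open>The second bound turns the quadratic energy
      \<open>14 * \<epsilon>\<^sup>2 / l\<close> into at most
      \<open>\<epsilon> * \<eta>\<close>.\<close>
    show ?thesis
    proof (rule exI[of _ "min (pi/2) (\<eta> * l / 14)"], intro conjI allI impI)
      show "0 < min (pi/2) (\<eta> * l / 14)" using \<eta> l by simp
      fix \<epsilon> assume "0 < \<epsilon> \<and> \<epsilon> < min (pi/2) (\<eta> * l / 14)"
      then have \<epsilon>: "0 < \<epsilon>" "\<epsilon> \<le> pi/2" "14 * \<epsilon> \<le> \<eta> * l" by auto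
      obtain l' \<theta>' \<omega>' where a: "s_arc l' \<theta>' \<omega>' (l *\<^sub>R cis (\<theta> 0))" "\<theta>' 0 = \<theta> 0 - \<epsilon>" "\<theta>' l' = \<theta> 0"
        "energy l' \<omega>' \<le> 14 * \<epsilon>\<^sup>2 / l"
        by (rule straight_variation[OF l \<epsilon>(1,2)])
      have "\<epsilon> * (14 * \<epsilon>) \<le> \<epsilon> * (\<eta> * l)" using \<epsilon> by (intro mult_left_mono) auto
      then have "14 * \<epsilon>\<^sup>2 / l \<le> \<epsilon> * \<eta>" using l by (simp add: pos_divide_le_eq power2_eq_square algebra_simps)
      then have "energy l' \<omega>' \<le> energy l \<omega> + \<epsilon> * (2 * \<kappa> 0 + \<eta>)"
        using a(4) energy_nonneg[of l \<omega>] k0 by simp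
      then show "\<exists>l' \<theta>' \<omega>'. s_arc l' \<theta>' \<omega>' V \<and> \<theta>' 0 = \<theta> 0 - \<epsilon> \<and> \<theta>' l' = \<theta> l \<and>
          energy l' \<omega>' \<le> energy l \<omega> + \<epsilon> * (2 * \<kappa> 0 + \<eta>)"
        using a(1-3) unfolding V' tl by blast
    qed
  next
    case True
    then obtain x1 where x1: "x1 \<in> {0..l}" "\<theta> x1 \<noteq> \<theta> 0" by blast
    obtain u w where nc: "u \<in> {0..l}" "w \<in> {0..l}" "\<theta> u < \<theta> w"
    proof (cases "\<theta> x1 < \<theta> 0")
      case True
      show thesis by (rule that[OF x1(1) zero True])
    next
      case False
      then have "\<theta> 0 < \<theta> x1" using x1(2) by linarith
      then show thesis by (rule that[OF zero x1(1)])
    qed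
    have q: "((\<lambda>w. (\<theta> w - \<theta> 0) / w) \<longlongrightarrow> \<kappa> 0) (at_right 0)"
      using d0 l by (simp add: has_field_derivative_iff at_within_Icc_at_right)
    consider (pos) "0 < \<kappa> 0" | (neg) "\<kappa> 0 < 0" | (zero) "\<kappa> 0 = 0" by linarith
    then show ?thesis
    proof cases
      case pos
      obtain c where c: "0 < c" "c \<le> l" "mono_on {0..c} \<theta>" "antimono_on {c..l} \<theta>"
        "\<bar>\<theta> c - \<theta> 0\<bar> \<le> pi" "\<bar>\<theta> l - \<theta> c\<bar> \<le> pi"
        by (rule rising_start_shape[OF s l d0 pos])
      \<comment> \<open>After a half turn the tangent is reversed, so the Euler-Lagrange equation
        would give \<open>(\<kappa> c)\<^sup>2\<close> the value
        \<open>- (\<kappa> 0)\<^sup>2 < 0\<close>.\<close>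
      have "\<theta> c - \<theta> 0 \<noteq> pi"
      proof
        assume "\<theta> c - \<theta> 0 = pi"
        then have "\<theta> c = \<theta> 0 + pi" by simp
        then have "cis (\<theta> c) = - cis (\<theta> 0)" by (simp add: complex_eq_iff)
        moreover have "(\<kappa> c)\<^sup>2 = Re (cnj \<Lambda> * cis (\<theta> c))" "(\<kappa> 0)\<^sup>2 = Re (cnj \<Lambda> * cis (\<theta> 0))"
          using el c l by (auto simp: elastica_def)
        ultimately have "(\<kappa> c)\<^sup>2 = - (\<kappa> 0)\<^sup>2" by simp
        moreover have "0 < (\<kappa> 0)\<^sup>2" using pos by simp
        ultimately show False using zero_le_power2[of "\<kappa> c"] by linarith
      qed
      then have lt: "\<theta> c - \<theta> 0 < pi" using c(5) by (simp add: abs_le_iff)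
      show ?thesis
      proof (rule side_variation_from_family[OF min nc q c(1) _ \<eta>])
        fix w assume w: "0 < w" "w < c"
        show "\<exists>\<epsilon>1>0. \<forall>\<epsilon>. 0 < \<epsilon> \<and> \<epsilon> < \<epsilon>1 \<longrightarrow> (\<exists>\<theta>' \<omega>'. primitive_on 0 l \<theta>' \<omega>' \<and>
          s_shaped 0 l \<theta>' \<and> (\<lambda>x. (\<omega>' x)\<^sup>2) integrable_on {0..l} \<and> \<theta>' 0 = \<theta> 0 - \<epsilon> \<and> \<theta>' l = \<theta> l \<and>
          integral {0..l} (\<lambda>x. \<bar>\<theta>' x - \<theta> x\<bar>) \<le> \<epsilon> * w \<and>
          energy l \<omega>' \<le> energy l \<omega> + 2 * \<epsilon> * ((\<theta> w - \<theta> 0) / w) + \<epsilon>\<^sup>2 / w)"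
          by (rule exI[of _ "pi - (\<theta> c - \<theta> 0)"], intro conjI allI impI tilt_family[OF prim i] s_shaped_tilt_rising[OF c(3,4)])
            (use w c(1,2,5,6) lt in auto)
      qed
    next
      case neg
      have k: "- \<kappa> 0 / 2 < - \<kappa> 0" using neg by simp
      obtain r where r: "0 < r" "r \<le> l" "\<And>x y. 0 \<le> x \<Longrightarrow> x \<le> y \<Longrightarrow> y \<le> r \<Longrightarrow> - \<kappa> 0 / 2 * (y - x) \<le> \<theta> x - \<theta> y"
        by (rule slope_near_start[OF kc l d k]) ((assumption | rule that)+)
      have dm: "((\<lambda>x. - \<theta> x) has_real_derivative - \<kappa> 0) (at 0 within {0..l})" by (rule DERIV_minus[OF d0])
      have neg': "0 < - \<kappa> 0" using neg by simp
      have sm: "s_shaped 0 l (\<lambda>x. - \<theta> x)" using s by (simp only: s_shaped_uminus)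
      obtain c where c: "0 < c" "c \<le> l" "mono_on {0..c} (\<lambda>x. - \<theta> x)" "antimono_on {c..l} (\<lambda>x. - \<theta> x)"
        "\<bar>- \<theta> c - - \<theta> 0\<bar> \<le> pi" "\<bar>- \<theta> l - - \<theta> c\<bar> \<le> pi"
        by (rule rising_start_shape[OF sm l dm neg'])
      have m: "antimono_on {0..c} \<theta>" "mono_on {c..l} \<theta>" using c(3,4) by (simp_all add: monotone_on_uminus_iff)
      have turn: "\<bar>\<theta> c - \<theta> 0\<bar> \<le> pi" "\<bar>\<theta> l - \<theta> c\<bar> \<le> pi" using c(5,6) by linarith+
      have rc: "0 < min r c" using r c by simp
      show ?thesis
      proof (rule side_variation_from_family[OF min nc q rc _ \<eta>])
        fix w assume w: "0 < w" "w < min r c"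
        then have wl: "w < l" using r by simp
        have fam: "\<exists>\<theta>' \<omega>'. primitive_on 0 l \<theta>' \<omega>' \<and> s_shaped 0 l \<theta>' \<and> (\<lambda>x. (\<omega>' x)\<^sup>2) integrable_on {0..l} \<and>
          \<theta>' 0 = \<theta> 0 - \<epsilon> \<and> \<theta>' l = \<theta> l \<and> integral {0..l} (\<lambda>x. \<bar>\<theta>' x - \<theta> x\<bar>) \<le> \<epsilon> * w \<and>
          energy l \<omega>' \<le> energy l \<omega> + 2 * \<epsilon> * ((\<theta> w - \<theta> 0) / w) + \<epsilon>\<^sup>2 / w"
          if \<epsilon>: "0 < \<epsilon> \<and> \<epsilon> < - \<kappa> 0 / 2 * w" for \<epsilon>
        proof (rule tilt_family[OF prim i w(1) wl])
          show "0 < \<epsilon>" using \<epsilon> by simp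
          show "s_shaped 0 l (tilt w \<epsilon> \<theta>)"
          proof (rule s_shaped_tilt_falling[OF m w(1) _ c(2) _ _ _ turn])
            fix x y assume "0 \<le> x" "x \<le> y" "y \<le> w"
            then show "- \<kappa> 0 / 2 * (y - x) \<le> \<theta> x - \<theta> y" using w by (intro r(3)) auto
          qed (use w \<epsilon> in auto)
        qed
        moreover have "0 < - \<kappa> 0 / 2 * w" using neg w by (simp add: mult_neg_pos)
        ultimately show "\<exists>\<epsilon>1>0. \<forall>\<epsilon>. 0 < \<epsilon> \<and> \<epsilon> < \<epsilon>1 \<longrightarrow> (\<exists>\<theta>' \<omega>'. primitive_on 0 l \<theta>' \<omega>' \<and>
          s_shaped 0 l \<theta>' \<and> (\<lambda>x. (\<omega>' x)\<^sup>2) integrable_on {0..l} \<and> \<theta>' 0 = \<theta> 0 - \<epsilon> \<and> \<theta>' l = \<theta> l \<and>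
          integral {0..l} (\<lambda>x. \<bar>\<theta>' x - \<theta> x\<bar>) \<le> \<epsilon> * w \<and>
          energy l \<omega>' \<le> energy l \<omega> + 2 * \<epsilon> * ((\<theta> w - \<theta> 0) / w) + \<epsilon>\<^sup>2 / w)"
          by (intro exI[of _ "- \<kappa> 0 / 2 * w"] conjI allI impI)
      qed
    next
      case zero
      have turn: "\<bar>\<theta> l - \<theta> 0\<bar> < pi" by (rule monotone_if_no_start_curvature(2)[OF min e el zero x1 X Y])
      have "mono_on {0..l} \<theta> \<or> antimono_on {0..l} \<theta>"
        by (rule monotone_if_no_start_curvature(1)[OF min e el zero x1 X Y])
      then show ?thesis
      proof
        assume m: "mono_on {0..l} \<theta>"
        have a: "antimono_on {l..l} \<theta>" by (intro monotone_onI) simp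
        show ?thesis
        proof (rule side_variation_from_family[OF min nc q l _ \<eta>])
          fix w assume w: "0 < w" "w < l"
          show "\<exists>\<epsilon>1>0. \<forall>\<epsilon>. 0 < \<epsilon> \<and> \<epsilon> < \<epsilon>1 \<longrightarrow> (\<exists>\<theta>' \<omega>'. primitive_on 0 l \<theta>' \<omega>' \<and>
            s_shaped 0 l \<theta>' \<and> (\<lambda>x. (\<omega>' x)\<^sup>2) integrable_on {0..l} \<and> \<theta>' 0 = \<theta> 0 - \<epsilon> \<and> \<theta>' l = \<theta> l \<and>
            integral {0..l} (\<lambda>x. \<bar>\<theta>' x - \<theta> x\<bar>) \<le> \<epsilon> * w \<and>
            energy l \<omega>' \<le> energy l \<omega> + 2 * \<epsilon> * ((\<theta> w - \<theta> 0) / w) + \<epsilon>\<^sup>2 / w)"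
            by (rule exI[of _ "pi - (\<theta> l - \<theta> 0)"], intro conjI allI impI tilt_family[OF prim i] s_shaped_tilt_rising[OF m a])
              (use w turn in \<open>auto simp: abs_less_iff\<close>)
        qed
      next
        assume m: "antimono_on {0..l} \<theta>"
        \<comment> \<open>The ramp adds no energy to first order, so the mean curvature is replaced
          by the constant 0, its limit.\<close>
        have "((\<lambda>w. 0) \<longlongrightarrow> \<kappa> 0) (at_right (0::real))" using zero by simp
        then show ?thesis
        proof (rule side_variation_from_family[OF min nc _ l _ \<eta>])
          fix w assume w: "0 < w" "w < l"
          have t: "\<theta> 0 - \<theta> l \<le> pi" using turn by (simp add: abs_less_iff)
          show "\<exists>\<epsilon>1>0. \<forall>\<epsilon>. 0 < \<epsilon> \<and> \<epsilon> < \<epsilon>1 \<longrightarrow> (\<exists>\<theta>' \<omega>'. primitive_on 0 l \<theta>' \<omega>' \<and>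
            s_shaped 0 l \<theta>' \<and> (\<lambda>x. (\<omega>' x)\<^sup>2) integrable_on {0..l} \<and> \<theta>' 0 = \<theta> 0 - \<epsilon> \<and> \<theta>' l = \<theta> l \<and>
            integral {0..l} (\<lambda>x. \<bar>\<theta>' x - \<theta> x\<bar>) \<le> \<epsilon> * w \<and>
            energy l \<omega>' \<le> energy l \<omega> + 2 * \<epsilon> * 0 + \<epsilon>\<^sup>2 / w)"
            by (rule exI[of _ pi], intro conjI allI impI ramp_family[OF prim i m t w]) auto
        qed
      qed
    qed
  qed
qed

text \<open>The versions for either sign and either end follow from one by reflection and reversal.\<close>

lemma start_angle_variation_signed:
  assumes min: "minimal_arc l \<theta> \<omega> V" and el: "elastica l \<theta> \<Lambda> \<kappa>"
    and e: "energy l \<omega> = integral {0..l} (\<lambda>x. (\<kappa> x)\<^sup>2)"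
    and X: "0 < Re (cnj V * cis (\<theta> 0))" and Y: "0 \<le> Re (cnj V * cis (\<theta> l))" and \<eta>: "0 < \<eta>"
    and \<sigma>: "\<sigma> \<in> {1, -1}"
  shows "\<exists>\<epsilon>0>0. \<forall>\<epsilon>. 0 < \<epsilon> \<and> \<epsilon> < \<epsilon>0 \<longrightarrow> (\<exists>l' \<theta>' \<omega>'. s_arc l' \<theta>' \<omega>' V \<and> \<theta>' 0 = \<theta> 0 + \<sigma> * \<epsilon> \<and>
     \<theta>' l' = \<theta> l \<and> energy l' \<omega>' \<le> energy l \<omega> + \<epsilon> * (- 2 * \<sigma> * \<kappa> 0 + \<eta>))"
proof (cases "\<sigma> = -1")
  case True
  then show ?thesis using start_angle_variation[OF min el e X Y \<eta>] by simp
next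
  case False
  then have s1: "\<sigma> = 1" using \<sigma> by simp
  have e': "energy l (\<lambda>x. - \<omega> x) = integral {0..l} (\<lambda>x. (- \<kappa> x)\<^sup>2)" using e by (simp add: energy_uminus)
  have X': "0 < Re (cnj (cnj V) * cis (- \<theta> 0))" and Y': "0 \<le> Re (cnj (cnj V) * cis (- \<theta> l))" using X Y by simp_all
  obtain \<epsilon>0 where \<epsilon>0: "0 < \<epsilon>0" and a: "\<forall>\<epsilon>. 0 < \<epsilon> \<and> \<epsilon> < \<epsilon>0 \<longrightarrow> (\<exists>l' \<theta>' \<omega>'. s_arc l' \<theta>' \<omega>' (cnj V) \<and>
     \<theta>' 0 = - \<theta> 0 - \<epsilon> \<and> \<theta>' l' = - \<theta> l \<and> energy l' \<omega>' \<le> energy l (\<lambda>x. - \<omega> x) + \<epsilon> * (2 * - \<kappa> 0 + \<eta>))"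
    using start_angle_variation[OF minimal_arc_uminus[OF min] elastica_uminus[OF el] e' X' Y' \<eta>]
    by (elim exE conjE) (rule that)
  show ?thesis
  proof (rule exI[of _ \<epsilon>0], intro conjI allI impI \<epsilon>0)
    fix \<epsilon> assume "0 < \<epsilon> \<and> \<epsilon> < \<epsilon>0"
    from mp[OF spec[OF a] this] obtain l' \<theta>' \<omega>' where b: "s_arc l' \<theta>' \<omega>' (cnj V)" "\<theta>' 0 = - \<theta> 0 - \<epsilon>" "\<theta>' l' = - \<theta> l"
      "energy l' \<omega>' \<le> energy l (\<lambda>x. - \<omega> x) + \<epsilon> * (2 * - \<kappa> 0 + \<eta>)" by (elim exE conjE) (rule that)
    show "\<exists>l' \<theta>' \<omega>'. s_arc l' \<theta>' \<omega>' V \<and> \<theta>' 0 = \<theta> 0 + \<sigma> * \<epsilon> \<and> \<theta>' l' = \<theta> l \<and>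
        energy l' \<omega>' \<le> energy l \<omega> + \<epsilon> * (- 2 * \<sigma> * \<kappa> 0 + \<eta>)"
    proof (rule exI[of _ l'], rule exI[of _ "\<lambda>x. - \<theta>' x"], rule exI[of _ "\<lambda>x. - \<omega>' x"], intro conjI)
      show "s_arc l' (\<lambda>x. - \<theta>' x) (\<lambda>x. - \<omega>' x) V" using s_arc_uminus[OF b(1)] by simp
    qed (use b s1 in \<open>simp_all add: energy_uminus\<close>)
  qed
qed

lemma end_angle_variation_signed:
  assumes min: "minimal_arc l \<theta> \<omega> V" and el: "elastica l \<theta> \<Lambda> \<kappa>"
    and e: "energy l \<omega> = integral {0..l} (\<lambda>x. (\<kappa> x)\<^sup>2)"
    and X: "0 \<le> Re (cnj V * cis (\<theta> 0))" and Y: "0 < Re (cnj V * cis (\<theta> l))" and \<eta>: "0 < \<eta>"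
    and \<sigma>: "\<sigma> \<in> {1, -1}"
  shows "\<exists>\<epsilon>0>0. \<forall>\<epsilon>. 0 < \<epsilon> \<and> \<epsilon> < \<epsilon>0 \<longrightarrow> (\<exists>l' \<theta>' \<omega>'. s_arc l' \<theta>' \<omega>' V \<and> \<theta>' 0 = \<theta> 0 \<and>
     \<theta>' l' = \<theta> l + \<sigma> * \<epsilon> \<and> energy l' \<omega>' \<le> energy l \<omega> + \<epsilon> * (2 * \<sigma> * \<kappa> l + \<eta>))"
proof -
  have arc: "s_arc l \<theta> \<omega> V" using min by (simp add: minimal_arc_def)
  have er: "energy l (\<lambda>x. - \<omega> (l - x)) = energy l \<omega>" by (rule s_arc_reverse(2)[OF arc])
  have kc: "continuous_on {0..l} \<kappa>" using el by (simp add: elastica_def)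
  have "((\<lambda>x. (\<kappa> x)\<^sup>2) has_integral energy l \<omega>) {0..l}"
    unfolding e by (intro integrable_integral integrable_continuous_real continuous_intros kc)
  then have "((\<lambda>t. (\<kappa> (- t))\<^sup>2) has_integral energy l \<omega>) (cbox (- l) (- 0))"
    by (simp only: has_integral_reflect_real[of "\<lambda>x. (\<kappa> x)\<^sup>2"] cbox_interval)
  from has_integral_affinity'[OF this, of 1 "- l"]
  have "((\<lambda>x. (- \<kappa> (l - x))\<^sup>2) has_integral energy l \<omega>) {0..l}" by simp
  then have e': "energy l (\<lambda>x. - \<omega> (l - x)) = integral {0..l} (\<lambda>x. (- \<kappa> (l - x))\<^sup>2)"
    unfolding er by (rule integral_unique[symmetric])
  have X': "0 < Re (cnj V * cis (\<theta> (l - 0)))" and Y': "0 \<le> Re (cnj V * cis (\<theta> (l - l)))" using X Y by simp_all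
  obtain \<epsilon>0 where \<epsilon>0: "0 < \<epsilon>0" and a: "\<forall>\<epsilon>. 0 < \<epsilon> \<and> \<epsilon> < \<epsilon>0 \<longrightarrow> (\<exists>l' \<theta>' \<omega>'. s_arc l' \<theta>' \<omega>' V \<and>
     \<theta>' 0 = \<theta> (l - 0) + \<sigma> * \<epsilon> \<and> \<theta>' l' = \<theta> (l - l) \<and>
     energy l' \<omega>' \<le> energy l (\<lambda>x. - \<omega> (l - x)) + \<epsilon> * (- 2 * \<sigma> * - \<kappa> (l - 0) + \<eta>))"
    using start_angle_variation_signed[OF minimal_arc_reverse[OF min] elastica_reverse[OF el] e' X' Y' \<eta> \<sigma>]
    by (elim exE conjE) (rule that)
  show ?thesis
  proof (rule exI[of _ \<epsilon>0], intro conjI allI impI \<epsilon>0)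
    fix \<epsilon> assume "0 < \<epsilon> \<and> \<epsilon> < \<epsilon>0"
    from mp[OF spec[OF a] this] obtain l' \<theta>' \<omega>' where b: "s_arc l' \<theta>' \<omega>' V" "\<theta>' 0 = \<theta> (l - 0) + \<sigma> * \<epsilon>" "\<theta>' l' = \<theta> (l - l)"
      "energy l' \<omega>' \<le> energy l (\<lambda>x. - \<omega> (l - x)) + \<epsilon> * (- 2 * \<sigma> * - \<kappa> (l - 0) + \<eta>)" by (elim exE conjE) (rule that)
    show "\<exists>l' \<theta>' \<omega>'. s_arc l' \<theta>' \<omega>' V \<and> \<theta>' 0 = \<theta> 0 \<and> \<theta>' l' = \<theta> l + \<sigma> * \<epsilon> \<and>
        energy l' \<omega>' \<le> energy l \<omega> + \<epsilon> * (2 * \<sigma> * \<kappa> l + \<eta>)"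
    proof (rule exI[of _ l'], rule exI[of _ "\<lambda>x. \<theta>' (l' - x)"], rule exI[of _ "\<lambda>x. - \<omega>' (l' - x)"], intro conjI)
      show "s_arc l' (\<lambda>x. \<theta>' (l' - x)) (\<lambda>x. - \<omega>' (l' - x)) V" by (rule s_arc_reverse(1)[OF b(1)])
      show "energy l' (\<lambda>x. - \<omega>' (l' - x)) \<le> energy l \<omega> + \<epsilon> * (2 * \<sigma> * \<kappa> l + \<eta>)"
        using b(4) unfolding s_arc_reverse(2)[OF b(1)] er by simp
    qed (use b in simp_all)
  qed
qed

section \<open>Chains of arcs as interpolating curves\<close>

text \<open>In contrast to \<open>primitive_on_switch\<close>, each of the two functions is given on
  its own side of \<open>c\<close> only.\<close>

lemma primitive_on_append:
  assumes f: "primitive_on a c f \<omega>" and g: "primitive_on c b g \<rho>" and c: "a \<le> c" "c \<le> b" and eq: "f c = g c"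
  shows "primitive_on a b (\<lambda>x. if x \<le> c then f x else g x) (\<lambda>x. if x \<le> c then \<omega> x else \<rho> x)"
  unfolding primitive_on_def
proof (intro conjI ballI)
  let ?h = "\<lambda>x. if x \<le> c then \<omega> x else \<rho> x"
  have [measurable]: "\<omega> \<in> borel_measurable borel" "\<rho> \<in> borel_measurable borel"
    using f g by (simp_all add: primitive_on_def)
  show b: "?h \<in> borel_measurable borel" by measurable
  have 1: "set_integrable lborel {a..c} \<omega>" "set_integrable lborel {c..b} \<rho>"
    by (rule primitive_on_integrable_lborel[OF f] primitive_on_integrable_lborel[OF g])+
  \<comment> \<open>At \<open>c\<close> both closed intervals contribute; the term with
    \<open>{c}\<close> removes the value of \<open>\<rho>\<close>.\<close>
  have "set_integrable lborel {a..b} (\<lambda>x. indicat_real {a..c} x *\<^sub>R \<omega> x + indicat_real {c..b} x *\<^sub>R \<rho> x - indicat_real {c} x *\<^sub>R \<rho> x)"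
  proof -
    have "integrable lborel (\<lambda>x. indicat_real {a..c} x *\<^sub>R \<omega> x + indicat_real {c..b} x *\<^sub>R \<rho> x - indicat_real {c} x *\<^sub>R \<rho> x)"
    proof (intro Bochner_Integration.integrable_add Bochner_Integration.integrable_diff)
      have "integrable lborel (\<lambda>x. indicat_real {c} x *\<^sub>R \<rho> c)" by simp
      moreover have "indicat_real {c} x *\<^sub>R \<rho> c = indicat_real {c} x *\<^sub>R \<rho> x" for x by (simp add: indicator_def)
      ultimately show "integrable lborel (\<lambda>x. indicat_real {c} x *\<^sub>R \<rho> x)" by (simp only:)
    qed (use 1 in \<open>simp_all only: set_integrable_def\<close>)
    then show ?thesis unfolding set_integrable_def
      by (rule integrable_mult_indicator[rotated]) simp
  qed
  moreover have "indicat_real {a..c} x *\<^sub>R \<omega> x + indicat_real {c..b} x *\<^sub>R \<rho> x - indicat_real {c} x *\<^sub>R \<rho> x = ?h x"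
    if "x \<in> {a..b}" for x using that c by (auto simp: indicator_def)
  ultimately have "set_integrable lborel {a..b} ?h" by (rule set_integrable_cong[OF refl refl, THEN iffD1, rotated])
  then show "?h absolutely_integrable_on {a..b}" using absolutely_integrable_on_iff_lborel[OF b] by simp
  have A: "(?h has_integral (f y - f a)) {a..y}" if "a \<le> y" "y \<le> c" for y
    by (rule has_integral_eq[OF _ primitive_on_has_integral[OF f]]) (use that in auto)
  fix x assume x: "x \<in> {a..b}"
  have B: "(?h has_integral (g x - g c)) {c..x}" if "c \<le> x"
    by (rule has_integral_spike_finite[of "{c}", OF _ _ primitive_on_has_integral[OF g]]) (use that x in auto)
  show "(?h has_integral ((if x \<le> c then f x else g x) - (if a \<le> c then f a else g a))) {a..x}"
  proof (cases "x \<le> c")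
    case True
    then show ?thesis using A[of x] x c by simp
  next
    case False
    then have "c \<le> x" by simp
    from has_integral_combine[OF c(1) this A[OF c(1) order_refl] B[OF this]] show ?thesis
      using False c eq by simp
  qed
qed

text \<open>By dominated convergence, as the values above the level \<open>n\<close> disappear
  pointwise when \<open>n\<close> grows.\<close>

lemma integrable_small_tail:
  fixes \<omega> :: "real \<Rightarrow> real"
  assumes b [measurable]: "\<omega> \<in> borel_measurable borel" and ai: "\<omega> absolutely_integrable_on {a..b}" and e: "0 < e"
  obtains n :: nat where "(\<lambda>x. if real n < \<bar>\<omega> x\<bar> then \<bar>\<omega> x\<bar> else 0) integrable_on {a..b}"
    "integral {a..b} (\<lambda>x. if real n < \<bar>\<omega> x\<bar> then \<bar>\<omega> x\<bar> else 0) < e"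
proof -
  define big where "big n = (\<lambda>x. if real n < \<bar>\<omega> x\<bar> then \<bar>\<omega> x\<bar> else 0)" for n
  have abs_int: "(\<lambda>x. \<bar>\<omega> x\<bar>) integrable_on {a..b}" using ai by (simp add: absolutely_integrable_on_def)
  have big_le: "norm (big n x) \<le> \<bar>\<omega> x\<bar>" for n x by (simp add: big_def)
  have bigi: "big n integrable_on {a..b}" for n
  proof -
    have "big n \<in> borel_measurable borel" unfolding big_def by measurable
    then have "big n \<in> borel_measurable (lebesgue_on {a..b})"
      by (intro measurable_restrict_space1 measurable_completion) simp
    from measurable_bounded_by_integrable_imp_absolutely_integrable[OF this _ abs_int big_le]
    show ?thesis by (intro set_lebesgue_integral_eq_integral(1)) simp
  qed
  have "(\<lambda>n. integral {a..b} (big n)) \<longlonglongrightarrow> integral {a..b} (\<lambda>x. 0)"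
  proof (rule dominated_convergence(2)[OF bigi abs_int big_le])
    fix x
    obtain n0 :: nat where "\<bar>\<omega> x\<bar> \<le> real n0" using real_arch_simple by blast
    then have "\<forall>\<^sub>F n in sequentially. big n x = 0"
      unfolding eventually_sequentially by (intro exI[of _ n0]) (auto simp: big_def)
    then show "(\<lambda>n. big n x) \<longlonglongrightarrow> 0" by (rule tendsto_eventually)
  qed
  then have "(\<lambda>n. integral {a..b} (big n)) \<longlonglongrightarrow> 0" by simp
  from eventually_happens'[OF sequentially_bot order_tendstoD(2)[OF this e]]
  obtain n where "integral {a..b} (big n) < e" ..
  then show thesis using bigi[of n] unfolding big_def by (intro that)
qed

text \<open>Up to a remainder with integral below \<open>\<epsilon> / 2\<close> the density is
  bounded by some \<open>n\<close>, and the bounded part contributes at most \<open>n\<close> times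
  the total length of the division.\<close>

lemma primitive_on_abs_cont:
  assumes p: "primitive_on a b \<theta> \<omega>"
  shows "abs_cont a b \<theta>"
  unfolding abs_cont_def
proof (intro allI impI)
  fix \<epsilon> :: real assume e: "0 < \<epsilon>"
  have [measurable]: "\<omega> \<in> borel_measurable borel" and ai: "\<omega> absolutely_integrable_on {a..b}"
    using p by (simp_all add: primitive_on_def)
  obtain n where n: "(\<lambda>x. if real n < \<bar>\<omega> x\<bar> then \<bar>\<omega> x\<bar> else 0) integrable_on {a..b}"
      "integral {a..b} (\<lambda>x. if real n < \<bar>\<omega> x\<bar> then \<bar>\<omega> x\<bar> else 0) < \<epsilon> / 2"
    by (rule integrable_small_tail[of \<omega> a b "\<epsilon>/2"]) (use ai e in auto)
  let ?B = "\<lambda>x. if real n < \<bar>\<omega> x\<bar> then \<bar>\<omega> x\<bar> else 0"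
  show "\<exists>\<delta>>0. \<forall>D. D division_of \<Union>D \<and> \<Union>D \<subseteq> {a..b} \<and> (\<Sum>k\<in>D. measure lborel k) < \<delta> \<longrightarrow>
      (\<Sum>k\<in>D. norm (\<theta> (Sup k) - \<theta> (Inf k))) < \<epsilon>"
  proof (rule exI[of _ "\<epsilon> / (2 * (real n + 1))"], intro conjI allI impI; (elim conjE)?)
    show "0 < \<epsilon> / (2 * (real n + 1))" using e by simp
    fix D assume D: "D division_of \<Union>D" "\<Union>D \<subseteq> {a..b}" "(\<Sum>k\<in>D. measure lborel k) < \<epsilon> / (2 * (real n + 1))"
    have one: "norm (\<theta> (Sup k) - \<theta> (Inf k)) \<le> real n * measure lborel k + integral k ?B" if k: "k \<in> D" for k
    proof -
      obtain u v where uv: "k = {u..v}" using division_ofD(4)[OF D(1) k] by auto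
      have "k \<noteq> {}" by (rule division_ofD(3)[OF D(1) k])
      then have le: "u \<le> v" using uv by simp
      have "k \<subseteq> {a..b}" using k D(2) by blast
      then have ab: "a \<le> u" "v \<le> b" using uv le by auto
      have i1: "(\<omega> has_integral (\<theta> v - \<theta> u)) {u..v}" by (rule primitive_on_has_integral[OF p ab(1) le ab(2)])
      have i2: "?B integrable_on {u..v}" by (rule integrable_subinterval_real[OF n(1)]) (use ab in auto)
      have i3: "((\<lambda>x. real n + ?B x) has_integral ((v - u) *\<^sub>R real n + integral {u..v} ?B)) {u..v}"
        using has_integral_const_real[of "real n" u v] le by (intro has_integral_add integrable_integral i2) simp
      have "norm (integral {u..v} \<omega>) \<le> integral {u..v} (\<lambda>x. real n + ?B x)"
        by (rule Henstock_Kurzweil_Integration.integral_norm_bound_integral) (use i1 i3 in auto)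
      then show ?thesis using integral_unique[OF i1] integral_unique[OF i3] uv le by (simp add: mult.commute)
    qed
    have "(\<Sum>k\<in>D. norm (\<theta> (Sup k) - \<theta> (Inf k))) \<le> real n * (\<Sum>k\<in>D. measure lborel k) + (\<Sum>k\<in>D. integral k ?B)"
      using sum_mono[of D, OF one] by (simp add: sum.distrib sum_distrib_left)
    also have "(\<Sum>k\<in>D. integral k ?B) = integral (\<Union>D) ?B"
      by (rule integral_combine_division_topdown[symmetric, OF integrable_on_subdivision[OF D(1) n(1) D(2)] D(1)])
    also have "integral (\<Union>D) ?B \<le> integral {a..b} ?B"
      by (rule integral_subset_le[OF D(2) integrable_on_subdivision[OF D(1) n(1) D(2)] n(1)]) simp
    also have "\<dots> < \<epsilon> / 2" by (rule n(2))
    also have "real n * (\<Sum>k\<in>D. measure lborel k) \<le> real n * (\<epsilon> / (2 * (real n + 1)))"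
      using D(3) by (intro mult_left_mono) auto
    also have "\<dots> \<le> \<epsilon> / 2" using e by (simp add: field_simps)
    finally show "(\<Sum>k\<in>D. norm (\<theta> (Sup k) - \<theta> (Inf k))) < \<epsilon>" by simp
  qed
qed

lemma deriv_on_eq:
  "a < b \<Longrightarrow> x \<in> {a..b} \<Longrightarrow> (f has_vector_derivative D) (at x within {a..b}) \<Longrightarrow> deriv_on a b f x = D"
  by (intro vector_derivative_within_cbox[of a b x f D, unfolded cbox_interval]) simp_all

text \<open>The derivative \<open>cis \<Theta>\<close> has modulus 1, and \<open>cis\<close> does
  not increase distances, so absolute continuity passes from the angle to the derivative.\<close>

lemma is_curve_of_angle:
  assumes ab: "a < b" and p: "primitive_on a b \<Theta> \<Omega>"
    and d: "\<And>x. x \<in> {a..b} \<Longrightarrow> (G has_vector_derivative cis (\<Theta> x)) (at x within {a..b})"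
  shows "is_curve a b G"
proof -
  have D: "deriv_on a b G x = cis (\<Theta> x)" if "x \<in> {a..b}" for x by (rule deriv_on_eq[OF ab that d[OF that]])
  have "absolutely_continuous_fun a b (deriv_on a b G)"
    unfolding absolutely_continuous_fun_def
  proof (intro allI impI)
    fix \<epsilon> :: real assume "0 < \<epsilon>"
    with primitive_on_abs_cont[OF p, unfolded abs_cont_def, rule_format, OF this]
    obtain \<delta> where \<delta>: "\<delta> > 0" "\<forall>D. D division_of \<Union>D \<and> \<Union>D \<subseteq> {a..b} \<and> (\<Sum>k\<in>D. measure lborel k) < \<delta> \<longrightarrow>
        (\<Sum>k\<in>D. norm (\<Theta> (Sup k) - \<Theta> (Inf k))) < \<epsilon>" by (elim exE conjE) (rule that)
    show "\<exists>\<delta>>0. \<forall>D. D division_of \<Union>D \<and> \<Union>D \<subseteq> {a..b} \<and> (\<Sum>k\<in>D. measure lborel k) < \<delta> \<longrightarrow>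
        (\<Sum>k\<in>D. norm (deriv_on a b G (Sup k) - deriv_on a b G (Inf k))) < \<epsilon>"
    proof (rule exI[of _ \<delta>], intro conjI allI impI \<delta>(1))
      fix D assume DD: "D division_of \<Union>D \<and> \<Union>D \<subseteq> {a..b} \<and> (\<Sum>k\<in>D. measure lborel k) < \<delta>"
      have "norm (deriv_on a b G (Sup k) - deriv_on a b G (Inf k)) \<le> norm (\<Theta> (Sup k) - \<Theta> (Inf k))" if k: "k \<in> D" for k
      proof -
        obtain u v where uv: "k = {u..v}" using division_ofD(4)[OF DD[THEN conjunct1] k] by auto
        have "k \<noteq> {}" by (rule division_ofD(3)[OF DD[THEN conjunct1] k])
        moreover have "k \<subseteq> {a..b}" using k DD by blast
        ultimately have "Sup k \<in> {a..b}" "Inf k \<in> {a..b}" using uv by auto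
        then show ?thesis using norm_cis_diff_le by (simp add: D)
      qed
      then have "(\<Sum>k\<in>D. norm (deriv_on a b G (Sup k) - deriv_on a b G (Inf k))) \<le> (\<Sum>k\<in>D. norm (\<Theta> (Sup k) - \<Theta> (Inf k)))"
        by (rule sum_mono)
      also have "\<dots> < \<epsilon>" using \<delta>(2)[THEN spec, of D] DD by blast
      finally show "(\<Sum>k\<in>D. norm (deriv_on a b G (Sup k) - deriv_on a b G (Inf k))) < \<epsilon>" .
    qed
  qed
  moreover have "deriv_on a b G x \<noteq> 0" if "x \<in> {a..b}" for x unfolding D[OF that] by simp
  moreover have "G differentiable (at x within {a..b})" if "x \<in> {a..b}" for x
    using d[OF that] by (rule differentiableI_vector)
  ultimately show ?thesis using ab unfolding is_curve_def by blast
qed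

lemma sum_indicators_telescope:
  assumes "1 \<le> m" "\<And>j. j \<in> {1..<m} \<Longrightarrow> S j \<le> S (Suc j)"
  shows "S 1 \<le> S m \<and> (\<Sum>j\<in>{1..<m}. indicator {S j..<S (Suc j)} s) = (indicator {S 1..<S m} (s::real) :: ennreal)"
  using assms
proof (induction m rule: dec_induct)
  case base
  then show ?case by simp
next
  case (step m)
  have IH: "S 1 \<le> S m" "(\<Sum>j\<in>{1..<m}. indicator {S j..<S (Suc j)} s) = (indicator {S 1..<S m} s :: ennreal)"
    using step.IH step.prems by auto
  have le: "S m \<le> S (Suc m)" using step by simp
  have split: "{1..<Suc m} = insert m {1..<m}" using step.hyps by auto
  have "(\<Sum>j\<in>{1..<Suc m}. indicator {S j..<S (Suc j)} s) = (indicator {S 1..<S m} s + indicator {S m..<S (Suc m)} s :: ennreal)"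
    unfolding split by (subst sum.insert, simp, simp, subst IH(2), rule add.commute)
  also have "\<dots> = indicator {S 1..<S (Suc m)} s" using IH(1) le by (auto simp: indicator_def)
  finally show ?case using IH(1) le by simp
qed

lemma nn_integral_shift:
  fixes h :: "real \<Rightarrow> ennreal"
  assumes "h \<in> borel_measurable borel"
  shows "(\<integral>\<^sup>+s. h (s - c) * indicator {c..<c+l} s \<partial>lborel) = (\<integral>\<^sup>+x\<in>{0..l}. h x \<partial>lborel)"
proof -
  note [measurable] = assms
  have "(\<integral>\<^sup>+s. h (s - c) * indicator {c..<c+l} s \<partial>lborel) = (\<integral>\<^sup>+x. h (c + 1 * x - c) * indicator {c..<c+l} (c + 1 * x) \<partial>lborel)"
    by (subst nn_integral_real_affine[where c=1 and t=c]) simp_all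
  also have "\<dots> = (\<integral>\<^sup>+x. h x * indicator {0..l} x \<partial>lborel)"
  proof (rule nn_integral_cong_AE)
    show "AE x in lborel. h (c + 1 * x - c) * indicator {c..<c+l} (c + 1 * x) = h x * indicator {0..l} x"
      using AE_lborel_singleton[of l] by eventually_elim (auto simp: indicator_def)
  qed
  finally show ?thesis .
qed

lemma cis_has_vector_derivative:
  assumes "(\<theta> has_real_derivative k) (at x within A)"
  shows "((\<lambda>s. cis (\<theta> s)) has_vector_derivative k *\<^sub>R (\<i> * cis (\<theta> x))) (at x within A)"
proof -
  have "((\<lambda>z. exp (\<i> * z)) has_field_derivative \<i> * exp (\<i> * complex_of_real (\<theta> x))) (at (complex_of_real (\<theta> x)))"
    by (auto intro!: derivative_eq_intros)
  then have "((\<lambda>t. exp (\<i> * complex_of_real t)) has_vector_derivative \<i> * exp (\<i> * complex_of_real (\<theta> x))) (at (\<theta> x) within \<theta> ` A)"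
    by (rule has_vector_derivative_real_field)
  from vector_diff_chain_within[OF assms[unfolded has_real_derivative_iff_has_vector_derivative] this]
  show ?thesis by (simp add: o_def cis_conv_exp)
qed

text \<open>Inside each piece the signed curvature is \<open>\<omega> j\<close> almost everywhere,
  by differentiation of the angle, and the nodes form a null set. \<open>T\<close> may be any
  function that agrees with the tangents of the pieces, so the lemma serves both for the curve built
  from a chain and for a given curve.\<close>

lemma curvature_energy:
  assumes m: "2 \<le> m" and l: "\<And>j. j \<in> {1..<m} \<Longrightarrow> 0 < l j"
    and p: "\<And>j. j \<in> {1..<m} \<Longrightarrow> primitive_on 0 (l j) (\<theta> j) (\<omega> j)"
    and S: "S 1 = 0" "\<And>j. j \<in> {1..<m} \<Longrightarrow> S (Suc j) = S j + l j"
    and T: "\<And>j x. j \<in> {1..<m} \<Longrightarrow> x \<in> {0..l j} \<Longrightarrow> T (S j + x) = cis (\<theta> j x)"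
  shows "(\<integral>\<^sup>+s\<in>{0..S m}. ennreal ((Im (cnj (T s) * vector_derivative T (at s within {0..S m})))\<^sup>2) \<partial>lebesgue)
    = (\<Sum>j\<in>{1..<m}. \<integral>\<^sup>+x\<in>{0..l j}. ennreal ((\<omega> j x)\<^sup>2) \<partial>lborel)"
proof -
  define f where "f s = ennreal ((Im (cnj (T s) * vector_derivative T (at s within {0..S m})))\<^sup>2)" for s
  define I where "I j = {S j..<S (Suc j)}" for j
  have Sle: "S j \<le> S (Suc j)" if "j \<in> {1..<m}" for j using S(2)[OF that] l[OF that] by simp
  have S_ge: "S 1 \<le> S j" if "j \<in> {1..m}" for j
    by (rule sum_indicators_telescope[THEN conjunct1]) (use Sle that in auto)
  have S_le: "S j \<le> S m" if "j \<in> {1..m}" for j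
  proof -
    have "i \<le> m \<Longrightarrow> S j \<le> S i" if "j \<le> i" for i
      using that
    proof (induction i rule: dec_induct)
      case (step i)
      then have "S i \<le> S (Suc i)" using \<open>j \<in> {1..m}\<close> by (intro Sle) auto
      then show ?case using step by simp
    qed simp
    then show ?thesis using that by simp
  qed
  \<comment> \<open>With half-open intervals no node is counted twice.\<close>
  have ind: "indicator {0..<S m} s = (\<Sum>j\<in>{1..<m}. indicator (I j) s :: ennreal)" for s
    using sum_indicators_telescope[of m S s] Sle m S(1) by (simp add: I_def)
  have bm: "\<omega> j \<in> borel_measurable borel" if "j \<in> {1..<m}" for j using p[OF that] by (simp add: primitive_on_def)
  have piece: "AE s in lebesgue. f s * indicator (I j) s = ennreal ((\<omega> j (s - S j))\<^sup>2) * indicator (I j) s"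
    if j: "j \<in> {1..<m}" for j
  proof -
    have psh: "primitive_on (S j) (S (Suc j)) (\<lambda>s. \<theta> j (s - S j)) (\<lambda>s. \<omega> j (s - S j))"
      using primitive_on_shift[OF p[OF j], of "S j"] S(2)[OF j] by (simp add: add.commute)
    obtain N where N: "negligible N" "\<And>s. s \<in> {S j..S (Suc j)} - N \<Longrightarrow>
       ((\<lambda>s. \<theta> j (s - S j)) has_real_derivative \<omega> j (s - S j)) (at s within {S j..S (Suc j)})"
      by (rule primitive_on_ae_derivative[OF psh]) blast
    have val: "f s = ennreal ((\<omega> j (s - S j))\<^sup>2)" if s: "s \<in> {S j<..<S (Suc j)}" "s \<notin> N" for s
    proof -
      have "at s within {S j..S (Suc j)} = at s" using s(1) by (intro at_within_interior) simp
      then have d: "((\<lambda>s. \<theta> j (s - S j)) has_real_derivative \<omega> j (s - S j)) (at s)" using N(2)[of s] s by auto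
      have "((\<lambda>s. cis (\<theta> j (s - S j))) has_vector_derivative \<omega> j (s - S j) *\<^sub>R (\<i> * cis (\<theta> j (s - S j)))) (at s)"
        by (rule cis_has_vector_derivative[OF d])
      then have dT: "(T has_vector_derivative \<omega> j (s - S j) *\<^sub>R (\<i> * cis (\<theta> j (s - S j)))) (at s)"
      proof (rule has_vector_derivative_transform_within_open[OF _ _ s(1)])
        show "cis (\<theta> j (y - S j)) = T y" if "y \<in> {S j<..<S (Suc j)}" for y
          using T[OF j, of "y - S j"] that S(2)[OF j] by simp
      qed simp
      have "at s within {0..S m} = at s"
        using s(1) S_ge[of j] S_le[of "Suc j"] S(1) j by (intro at_within_interior) auto
      then have "vector_derivative T (at s within {0..S m}) = \<omega> j (s - S j) *\<^sub>R (\<i> * cis (\<theta> j (s - S j)))"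
        using vector_derivative_at[OF dT] by simp
      moreover have "T s = cis (\<theta> j (s - S j))" using T[OF j, of "s - S j"] s(1) S(2)[OF j] by simp
      moreover have "Im (cnj (cis u) * (w *\<^sub>R (\<i> * cis u))) = w" for u w
      proof -
        have "Im (cnj (cis u) * (w *\<^sub>R (\<i> * cis u))) = w * ((cos u)\<^sup>2 + (sin u)\<^sup>2)"
          by (simp add: power2_eq_square algebra_simps)
        then show ?thesis by simp
      qed
      ultimately show ?thesis by (simp add: f_def)
    qed
    have "AE s in lebesgue. s \<notin> N \<union> {S j}"
    proof -
      have "negligible (N \<union> {S j})" using N(1) by (intro negligible_Un) auto
      then show ?thesis by (intro AE_not_in) (simp add: negligible_iff_null_sets)
    qed
    then show ?thesis
    proof eventually_elim
      case (elim s)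
      then show ?case using val[of s] by (cases "s \<in> I j") (auto simp: I_def)
    qed
  qed
  have all: "AE s in lebesgue. \<forall>j\<in>{1..<m}. f s * indicator (I j) s = ennreal ((\<omega> j (s - S j))\<^sup>2) * indicator (I j) s"
    using piece by (intro AE_ball_countable[THEN iffD2]) auto
  have last: "AE s in lebesgue. s \<noteq> S m" by (intro AE_completion AE_lborel_singleton)
  have "(\<integral>\<^sup>+s\<in>{0..S m}. f s \<partial>lebesgue) = (\<integral>\<^sup>+s. (\<Sum>j\<in>{1..<m}. ennreal ((\<omega> j (s - S j))\<^sup>2) * indicator (I j) s) \<partial>lebesgue)"
  proof (rule nn_integral_cong_AE)
    show "AE s in lebesgue. f s * indicator {0..S m} s = (\<Sum>j\<in>{1..<m}. ennreal ((\<omega> j (s - S j))\<^sup>2) * indicator (I j) s)"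
      using all last
    proof eventually_elim
      case (elim s)
      have "f s * indicator {0..S m} s = f s * indicator {0..<S m} s" using elim(2) by (auto simp: indicator_def)
      also have "\<dots> = (\<Sum>j\<in>{1..<m}. f s * indicator (I j) s)" unfolding ind by (rule sum_distrib_left)
      also have "\<dots> = (\<Sum>j\<in>{1..<m}. ennreal ((\<omega> j (s - S j))\<^sup>2) * indicator (I j) s)"
        by (rule sum.cong[OF refl]) (use elim(1) in blast)
      finally show ?case .
    qed
  qed
  also have "\<dots> = (\<integral>\<^sup>+s. (\<Sum>j\<in>{1..<m}. ennreal ((\<omega> j (s - S j))\<^sup>2) * indicator (I j) s) \<partial>lborel)"
    by (rule nn_integral_completion)
  also have "\<dots> = (\<Sum>j\<in>{1..<m}. \<integral>\<^sup>+s. ennreal ((\<omega> j (s - S j))\<^sup>2) * indicator (I j) s \<partial>lborel)"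
    using bm by (intro nn_integral_sum) (auto simp: I_def)
  also have "\<dots> = (\<Sum>j\<in>{1..<m}. \<integral>\<^sup>+x\<in>{0..l j}. ennreal ((\<omega> j x)\<^sup>2) \<partial>lborel)"
  proof (rule sum.cong[OF refl])
    fix j assume j: "j \<in> {1..<m}"
    show "(\<integral>\<^sup>+s. ennreal ((\<omega> j (s - S j))\<^sup>2) * indicator (I j) s \<partial>lborel) = (\<integral>\<^sup>+x\<in>{0..l j}. ennreal ((\<omega> j x)\<^sup>2) \<partial>lborel)"
      unfolding I_def S(2)[OF j] by (rule nn_integral_shift[of "\<lambda>x. ennreal ((\<omega> j x)\<^sup>2)"]) (use bm[OF j] in measurable)
  qed
  finally show ?thesis unfolding f_def .
qed

text \<open>The energy of the arcs may be infinite. Tangents, not angles, match at the nodes, since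
  each arc has its own branch of the angle. The conditions on the chord angles appear as signs of
  inner products of tangent and chord.\<close>

definition chain ::
    "nat \<Rightarrow> (nat \<Rightarrow> complex) \<Rightarrow> (nat \<Rightarrow> real) \<Rightarrow> (nat \<Rightarrow> real \<Rightarrow> real) \<Rightarrow> (nat \<Rightarrow> real \<Rightarrow> real) \<Rightarrow> bool" where
  "chain m P l \<theta> \<omega> \<longleftrightarrow>
     (\<forall>j\<in>{1..<m}. 0 < l j \<and> primitive_on 0 (l j) (\<theta> j) (\<omega> j) \<and> s_shaped 0 (l j) (\<theta> j) \<and>
        displacement (\<theta> j) 0 (l j) = P (Suc j) - P j \<and>
        0 \<le> Re (cnj (P (Suc j) - P j) * cis (\<theta> j 0)) \<and>
        0 \<le> Re (cnj (P (Suc j) - P j) * cis (\<theta> j (l j)))) \<and>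
     (\<forall>j\<in>{1..<m}. Suc j < m \<longrightarrow> cis (\<theta> j (l j)) = cis (\<theta> (Suc j) 0))"

text \<open>Four times the bending energy, in the extended reals because finiteness is not yet
  known.\<close>

definition chain_energy :: "nat \<Rightarrow> (nat \<Rightarrow> real) \<Rightarrow> (nat \<Rightarrow> real \<Rightarrow> real) \<Rightarrow> ennreal" where
  "chain_energy m l \<omega> = (\<Sum>j\<in>{1..<m}. \<integral>\<^sup>+x\<in>{0..l j}. ennreal ((\<omega> j x)\<^sup>2) \<partial>lborel)"

text \<open>The arclength at which arc \<open>j\<close> begins; arcs are counted from 1.\<close>

definition node :: "(nat \<Rightarrow> real) \<Rightarrow> nat \<Rightarrow> real" where
  "node l j = (\<Sum>i\<in>{1..<j}. l i)"

lemma node_1 [simp]: "node l (Suc 0) = 0"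
  by (simp add: node_def)

lemma node_Suc: "1 \<le> j \<Longrightarrow> node l (Suc j) = node l j + l j"
  by (simp add: node_def)

lemma node_le:
  assumes pos: "\<And>j. j \<in> {1..<m} \<Longrightarrow> 0 < l j" and ij: "1 \<le> i" "i \<le> j" "j \<le> m"
  shows "node l i \<le> node l j"
  using ij(2,3)
proof (induction j rule: dec_induct)
  case (step j)
  then have "0 < l j" using ij(1) by (intro pos) simp
  then show ?case using step ij(1) by (simp add: node_Suc)
qed simp

lemma primitive_on_add_const:
  "primitive_on a b \<theta> \<omega> \<Longrightarrow> primitive_on a b (\<lambda>x. \<theta> x + d) \<omega>"
  by (simp add: primitive_on_def)

text \<open>At a node the branches of adjacent arcs differ by a multiple of \<open>2 * pi\<close>.
  Adding these constants successively makes one continuous angle of all arcs.\<close>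

lemma chain_global_angle:
  assumes l: "\<And>j. j \<in> {1..<m} \<Longrightarrow> 0 < l j"
    and p: "\<And>j. j \<in> {1..<m} \<Longrightarrow> primitive_on 0 (l j) (\<theta> j) (\<omega> j)"
    and link: "\<And>j. j \<in> {1..<m} \<Longrightarrow> Suc j < m \<Longrightarrow> cis (\<theta> j (l j)) = cis (\<theta> (Suc j) 0)"
    and k: "1 \<le> k" "k \<le> m"
  shows "\<exists>\<Theta> \<Omega>. primitive_on 0 (node l k) \<Theta> \<Omega> \<and>
     (\<forall>j\<in>{1..<k}. \<exists>c. cis c = 1 \<and> (\<forall>x\<in>{0..l j}. \<Theta> (node l j + x) = \<theta> j x + c)) \<and>
     (k < m \<longrightarrow> cis (\<Theta> (node l k)) = cis (\<theta> k 0))"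
  using k
proof (induction k rule: dec_induct)
  case base
  have "primitive_on 0 (node l 1) (\<lambda>_. \<theta> 1 0) (\<lambda>_. 0)" by (rule primitive_on_const)
  then show ?case by (intro exI[of _ "\<lambda>_. \<theta> 1 0"] exI[of _ "\<lambda>_. 0"]) simp
next
  case (step k)
  then have km: "k \<in> {1..<m}" by simp
  obtain \<Theta> \<Omega> where \<Theta>: "primitive_on 0 (node l k) \<Theta> \<Omega>"
      "\<forall>j\<in>{1..<k}. \<exists>c. cis c = 1 \<and> (\<forall>x\<in>{0..l j}. \<Theta> (node l j + x) = \<theta> j x + c)"
      "cis (\<Theta> (node l k)) = cis (\<theta> k 0)"
    using step.IH step.prems km by auto
  define d where "d = \<Theta> (node l k) - \<theta> k 0"
  have d1: "cis d = 1" unfolding d_def cis_divide[symmetric] \<Theta>(3) by simp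
  have pos: "0 < l k" by (rule l[OF km])
  have nk: "node l (Suc k) = node l k + l k" using step.hyps by (intro node_Suc)
  have n0: "0 \<le> node l k" using node_le[OF l, where i=1 and j=k] km by simp
  have "primitive_on (0 + node l k) (l k + node l k) (\<lambda>x. \<theta> k (x - node l k)) (\<lambda>x. \<omega> k (x - node l k))"
    by (rule primitive_on_shift[OF p[OF km]])
  then have g: "primitive_on (node l k) (node l (Suc k)) (\<lambda>x. \<theta> k (x - node l k) + d) (\<lambda>x. \<omega> k (x - node l k))"
    unfolding nk by (intro primitive_on_add_const) (simp add: add.commute)
  define \<Theta>' where "\<Theta>' = (\<lambda>x. if x \<le> node l k then \<Theta> x else \<theta> k (x - node l k) + d)"
  define \<Omega>' where "\<Omega>' = (\<lambda>x. if x \<le> node l k then \<Omega> x else \<omega> k (x - node l k))"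
  have P': "primitive_on 0 (node l (Suc k)) \<Theta>' \<Omega>'" unfolding \<Theta>'_def \<Omega>'_def
    by (rule primitive_on_append[OF \<Theta>(1) g n0]) (use nk pos in \<open>auto simp: d_def\<close>)
  have last: "\<Theta>' (node l k + x) = \<theta> k x + d" if "x \<in> {0..l k}" for x
    using that by (cases "x = 0") (auto simp: \<Theta>'_def d_def)
  have pieces: "\<exists>c. cis c = 1 \<and> (\<forall>x\<in>{0..l j}. \<Theta>' (node l j + x) = \<theta> j x + c)" if j: "j \<in> {1..<Suc k}" for j
  proof (cases "j = k")
    case True
    then show ?thesis using d1 last by blast
  next
    case False
    then have jk: "j \<in> {1..<k}" using j by simp
    obtain c where c: "cis c = 1" "\<forall>x\<in>{0..l j}. \<Theta> (node l j + x) = \<theta> j x + c" using \<Theta>(2)[THEN bspec, OF jk] by (elim exE conjE) (rule that)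
    have "node l (Suc j) \<le> node l k" by (rule node_le[OF l]) (use jk km in auto)
    then have "node l j + x \<le> node l k" if "x \<in> {0..l j}" for x using that jk by (simp add: node_Suc)
    then show ?thesis using c by (intro exI[of _ c]) (simp add: \<Theta>'_def)
  qed
  have "cis (\<Theta>' (node l (Suc k))) = cis (\<theta> (Suc k) 0)" if "Suc k < m"
  proof -
    have "\<Theta>' (node l (Suc k)) = \<theta> k (l k) + d" unfolding nk using pos by (intro last) simp
    then show ?thesis using link[OF km that] d1 by (simp add: cis_mult[symmetric])
  qed
  then show ?case using P' pieces by (intro exI[of _ \<Theta>'] exI[of _ \<Omega>']) blast
qed

lemma unit_speed_curve:
  assumes L: "0 < L" and d: "\<And>x. x \<in> {0..L} \<Longrightarrow> (G has_vector_derivative cis (\<Theta> x)) (at x within {0..L})"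
  shows "arclength 0 L G = L" and "\<And>s. s \<in> {0..L} \<Longrightarrow> unit_tangent 0 L G s = cis (\<Theta> s)"
proof -
  have D: "deriv_on 0 L G x = cis (\<Theta> x)" if "x \<in> {0..L}" for x by (rule deriv_on_eq[OF L that d[OF that]])
  have A: "arclength_fun 0 L G s = s" if "s \<in> {0..L}" for s
  proof -
    have "integral {0..s} (\<lambda>u. norm (deriv_on 0 L G u)) = integral {0..s} (\<lambda>u. 1)"
      by (rule Henstock_Kurzweil_Integration.integral_cong) (use that D in auto)
    then show ?thesis using that by (simp add: arclength_fun_def)
  qed
  have inv: "inv_into {0..L} (arclength_fun 0 L G) s = s" if "s \<in> {0..L}" for s
    using that by (intro inv_into_f_eq) (simp_all add: inj_on_def A)
  show al: "arclength 0 L G = L" using A[of L] L by (simp add: arclength_def)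
  fix s assume s: "s \<in> {0..L}"
  have "(arclength_param 0 L G has_vector_derivative cis (\<Theta> s)) (at s within {0..L})"
    by (rule has_vector_derivative_transform[OF s _ d[OF s]]) (simp add: arclength_param_def inv)
  then show "unit_tangent 0 L G s = cis (\<Theta> s)" unfolding unit_tangent_def al by (rule deriv_on_eq[OF L s])
qed

lemma mult_pos_sign: "0 < k \<Longrightarrow> 0 \<le> x * k \<longleftrightarrow> 0 \<le> x" "0 < k \<Longrightarrow> 0 < x * k \<longleftrightarrow> 0 < x" for k x :: real
  by (simp_all add: zero_le_mult_iff zero_less_mult_iff)

text \<open>The cosine of the argument has the sign of the inner product
  \<open>Re (cnj V * u)\<close>, and the cosine decreases on \<open>[0, pi]\<close>.\<close>

lemma abs_Arg_divide_le_half_pi: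
  assumes "u \<noteq> 0" "V \<noteq> 0"
  shows "\<bar>Arg (u / V)\<bar> \<le> pi / 2 \<longleftrightarrow> 0 \<le> Re (cnj V * u)"
    and "\<bar>Arg (u / V)\<bar> < pi / 2 \<longleftrightarrow> 0 < Re (cnj V * u)"
proof -
  let ?A = "\<bar>Arg (u / V)\<bar>"
  have "cos ?A = Re (u / V) / norm (u / V)" using assms cos_Arg[of "u / V"] by simp
  also have "Re (u / V) = Re (cnj V * u) / (norm V)\<^sup>2"
    by (simp add: complex_div_cnj[of u V] mult.commute del: complex_cnj_cnj)
  finally have c: "cos ?A = Re (cnj V * u) * (1 / ((norm V)\<^sup>2 * norm (u / V)))" by simp
  have pos: "0 < 1 / ((norm V)\<^sup>2 * norm (u / V))" using assms by simp
  have A: "0 \<le> ?A" "?A \<le> pi" using Arg_bounded[of "u / V"] by auto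
  have "?A \<le> pi / 2 \<longleftrightarrow> cos (pi / 2) \<le> cos ?A" using A cos_mono_le_eq[of "pi/2" ?A] by simp
  also have "\<dots> \<longleftrightarrow> 0 \<le> Re (cnj V * u)" unfolding c cos_pi_half by (rule mult_pos_sign(1)[OF pos])
  finally show "?A \<le> pi / 2 \<longleftrightarrow> 0 \<le> Re (cnj V * u)" .
  have "?A < pi / 2 \<longleftrightarrow> cos (pi / 2) < cos ?A" using A cos_mono_less_eq[of "pi/2" ?A] by simp
  also have "\<dots> \<longleftrightarrow> 0 < Re (cnj V * u)" unfolding c cos_pi_half by (rule mult_pos_sign(2)[OF pos])
  finally show "?A < pi / 2 \<longleftrightarrow> 0 < Re (cnj V * u)" .
qed

lemma s_shaped_translate:
  assumes "s_shaped 0 l \<theta>" and eq: "\<And>x. x \<in> {0..l} \<Longrightarrow> \<Theta> (p + x) = \<theta> x + d"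
  shows "s_shaped p (p + l) \<Theta>"
proof -
  obtain c where c: "c \<in> {0..l}" "mono_on {0..c} \<theta> \<and> antimono_on {c..l} \<theta> \<or> antimono_on {0..c} \<theta> \<and> mono_on {c..l} \<theta>"
      "\<bar>\<theta> c - \<theta> 0\<bar> \<le> pi" "\<bar>\<theta> l - \<theta> c\<bar> \<le> pi"
    using assms(1) unfolding s_shaped_def by (elim bexE conjE) (rule that)
  have e: "\<Theta> x = \<theta> (x - p) + d" if "p \<le> x" "x \<le> p + l" for x using eq[of "x - p"] that by simp
  have m: "mono_on {p + u..p + v} \<Theta>" if "mono_on {u..v} \<theta>" "0 \<le> u" "v \<le> l" for u v
    using that by (intro monotone_onI) (auto simp: e elim!: monotone_onD)
  have a: "antimono_on {p + u..p + v} \<Theta>" if "antimono_on {u..v} \<theta>" "0 \<le> u" "v \<le> l" for u v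
    using that by (intro monotone_onI) (auto simp: e elim!: monotone_onD)
  have "mono_on {p + 0..p + c} \<Theta> \<and> antimono_on {p + c..p + l} \<Theta> \<or> antimono_on {p + 0..p + c} \<Theta> \<and> mono_on {p + c..p + l} \<Theta>"
    using c(1,2) m[of 0 c] m[of c l] a[of 0 c] a[of c l] by auto
  then show ?thesis unfolding s_shaped_def
    using c(1,3,4) e[of p] e[of "p + c"] e[of "p + l"] by (intro bexI[of _ "p + c"]) auto
qed

text \<open>The curve is obtained by integrating the unit tangent \<open>cis \<Theta>\<close> of a
  global angle from \<open>P 1\<close>; the prescribed displacements make it pass through the points
  \<open>P j\<close> at the nodes. It is parametrised by arclength.\<close>

lemma chain_curve:
  assumes ch: "chain m P l \<theta> \<omega>" and m: "2 \<le> m" and P: "\<And>j. j \<in> {1..<m} \<Longrightarrow> P j \<noteq> P (Suc j)"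
  obtains u G where "(u, G) \<in> A_half_pi m P" "bending_energy (u 1) (u m) G = chain_energy m l \<omega> / 4"
proof -
  have l: "\<And>j. j \<in> {1..<m} \<Longrightarrow> 0 < l j"
    and p: "\<And>j. j \<in> {1..<m} \<Longrightarrow> primitive_on 0 (l j) (\<theta> j) (\<omega> j)"
    and s: "\<And>j. j \<in> {1..<m} \<Longrightarrow> s_shaped 0 (l j) (\<theta> j)"
    and V: "\<And>j. j \<in> {1..<m} \<Longrightarrow> displacement (\<theta> j) 0 (l j) = P (Suc j) - P j"
    and a: "\<And>j. j \<in> {1..<m} \<Longrightarrow> 0 \<le> Re (cnj (P (Suc j) - P j) * cis (\<theta> j 0))"
    and b: "\<And>j. j \<in> {1..<m} \<Longrightarrow> 0 \<le> Re (cnj (P (Suc j) - P j) * cis (\<theta> j (l j)))"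
    and link: "\<And>j. j \<in> {1..<m} \<Longrightarrow> Suc j < m \<Longrightarrow> cis (\<theta> j (l j)) = cis (\<theta> (Suc j) 0)"
    using ch unfolding chain_def by blast+
  have "1 \<le> m" using m by simp
  have "\<exists>\<Theta> \<Omega>. primitive_on 0 (node l m) \<Theta> \<Omega> \<and>
     (\<forall>j\<in>{1..<m}. \<exists>c. cis c = 1 \<and> (\<forall>x\<in>{0..l j}. \<Theta> (node l j + x) = \<theta> j x + c)) \<and>
     (m < m \<longrightarrow> cis (\<Theta> (node l m)) = cis (\<theta> m 0))"
    by (rule chain_global_angle) (fact l p link \<open>1 \<le> m\<close> order_refl)+
  then
  obtain \<Theta> \<Omega> where \<Theta>: "primitive_on 0 (node l m) \<Theta> \<Omega>"
    and \<Theta>j: "\<forall>j\<in>{1..<m}. \<exists>c. cis c = 1 \<and> (\<forall>x\<in>{0..l j}. \<Theta> (node l j + x) = \<theta> j x + c)"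
    by (elim exE conjE) (rule that)
  define L where "L = node l m"
  define G where "G x = P 1 + integral {0..x} (\<lambda>y. cis (\<Theta> y))" for x
  have nS: "node l (Suc j) = node l j + l j" if "j \<in> {1..<m}" for j using that by (intro node_Suc) simp
  have nlt: "node l j < node l (Suc j)" if "j \<in> {1..<m}" for j using nS[OF that] l[OF that] by simp
  have n0: "0 \<le> node l j" if "j \<in> {1..m}" for j using node_le[OF l, where i=1 and j=j] that by simp
  have nm: "node l j \<le> L" if "j \<in> {1..m}" for j unfolding L_def by (rule node_le[OF l]) (use that in auto)
  have L: "0 < L" using nlt[of 1] nm[of "Suc 1"] m by (simp add: numeral_2_eq_2)
  have cis\<Theta>: "cis (\<Theta> (node l j + x)) = cis (\<theta> j x)" if j: "j \<in> {1..<m}" and x: "x \<in> {0..l j}" for j x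
  proof -
    obtain c where "cis c = 1" "\<forall>x\<in>{0..l j}. \<Theta> (node l j + x) = \<theta> j x + c" using \<Theta>j[THEN bspec, OF j] by (elim exE conjE) (rule that)
    then show ?thesis using x by (simp add: cis_mult[symmetric])
  qed
  have cont: "continuous_on {0..L} (\<lambda>y. cis (\<Theta> y))"
    by (rule continuous_on_cis_angle[OF primitive_on_continuous[OF \<Theta>[folded L_def]]])
  have dG: "(G has_vector_derivative cis (\<Theta> x)) (at x within {0..L})" if "x \<in> {0..L}" for x
    unfolding G_def using has_vector_derivative_add[OF has_vector_derivative_const integral_has_vector_derivative[OF cont that], of "P 1"] by simp
  have GP: "1 \<le> j \<Longrightarrow> j \<le> m \<Longrightarrow> G (node l j) = P j" for j
  proof (induction j rule: nat_induct_at_least)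
    case base
    then show ?case by (simp add: G_def)
  next
    case (Suc j)
    then have j: "j \<in> {1..<m}" by simp
    have i: "(\<lambda>y. cis (\<Theta> y)) integrable_on {0..node l (Suc j)}"
      by (rule integrable_on_subinterval[OF integrable_continuous_interval[OF cont]]) (use nm[of "Suc j"] j in auto)
    have "integral {0..node l (Suc j)} (\<lambda>y. cis (\<Theta> y)) = integral {0..node l j} (\<lambda>y. cis (\<Theta> y)) + integral {node l j..node l (Suc j)} (\<lambda>y. cis (\<Theta> y))"
      by (rule Henstock_Kurzweil_Integration.integral_combine[symmetric, OF _ _ i]) (use n0[of j] nlt[OF j] j in auto)
    moreover have "integral {node l j..node l (Suc j)} (\<lambda>y. cis (\<Theta> y)) = integral {0..l j} ((\<lambda>y. cis (\<Theta> y)) \<circ> (\<lambda>x. x + node l j))"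
    proof (subst integral_shift)
      show "continuous_on {0 + node l j..l j + node l j} (\<lambda>y. cis (\<Theta> y))"
        by (rule continuous_on_subset[OF cont]) (use n0[of j] nm[of "Suc j"] nS[OF j] j in auto)
    qed (simp add: nS[OF j] add.commute)
    moreover have "integral {0..l j} ((\<lambda>y. cis (\<Theta> y)) \<circ> (\<lambda>x. x + node l j)) = displacement (\<theta> j) 0 (l j)"
      unfolding displacement_def
      by (rule Henstock_Kurzweil_Integration.integral_cong) (use cis\<Theta>[OF j] in \<open>simp add: add.commute\<close>)
    moreover have "G (node l j) = P j" using Suc by simp
    ultimately have e: "integral {0..node l (Suc j)} (\<lambda>y. cis (\<Theta> y)) = integral {0..node l j} (\<lambda>y. cis (\<Theta> y)) + (P (Suc j) - P j)"
      "P 1 + integral {0..node l j} (\<lambda>y. cis (\<Theta> y)) = P j"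
      using V[OF j] by (simp_all only: G_def)
    show ?case unfolding G_def e(1) using e(2) by (simp add: add.assoc[symmetric])
  qed
  have curve: "is_curve p q G" if "0 \<le> p" "p < q" "q \<le> L" for p q
  proof (rule is_curve_of_angle[OF that(2) primitive_on_subinterval[OF \<Theta>[folded L_def] that(1,3)]])
    show "(G has_vector_derivative cis (\<Theta> x)) (at x within {p..q})" if "x \<in> {p..q}" for x
      by (rule has_vector_derivative_within_subset[OF dG]) (use that \<open>0 \<le> p\<close> \<open>q \<le> L\<close> in auto)
  qed
  have piece: "s_curve (node l j) (node l (Suc j)) G \<and> \<bar>initial_chord_angle (node l j) (node l (Suc j)) G\<bar> \<le> pi / 2 \<and>
        \<bar>terminal_chord_angle (node l j) (node l (Suc j)) G\<bar> \<le> pi / 2" if j: "j \<in> {1..<m}" for j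
  proof -
    let ?p = "node l j" and ?q = "node l (Suc j)"
    have pq: "0 \<le> ?p" "?p < ?q" "?q \<le> L" using n0[of j] nlt[OF j] nm[of "Suc j"] j by auto
    have D: "deriv_on ?p ?q G x = cis (\<Theta> x)" if "x \<in> {?p..?q}" for x
      by (rule deriv_on_eq[OF pq(2) that has_vector_derivative_within_subset[OF dG]]) (use that pq in auto)
    have "continuous_on {?p..?q} \<Theta>"
      by (rule primitive_on_continuous[OF primitive_on_subinterval[OF \<Theta>[folded L_def] pq(1,3)]])
    then have ta: "tangent_angle ?p ?q G \<Theta>" unfolding tangent_angle_def by (simp add: D cis_rcis_eq)
    obtain c where c: "cis c = 1" "\<forall>x\<in>{0..l j}. \<Theta> (node l j + x) = \<theta> j x + c" using \<Theta>j[THEN bspec, OF j] by (elim exE conjE) (rule that)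
    have "s_shaped ?p ?q \<Theta>" unfolding nS[OF j]
      by (rule s_shaped_translate[OF s[OF j], where d=c]) (use c(2) in blast)
    then have sc: "s_curve ?p ?q G" unfolding s_curve_def s_shaped_def using curve[OF pq] ta by blast
    have G: "G ?q - G ?p = P (Suc j) - P j" using GP[of j] GP[of "Suc j"] j by simp
    have V0: "P (Suc j) - P j \<noteq> 0" using P[OF j] by simp
    have "deriv_on ?p ?q G ?p = cis (\<theta> j 0)" using D[of ?p] cis\<Theta>[OF j, of 0] l[OF j] pq(2) by simp
    then have "\<bar>initial_chord_angle ?p ?q G\<bar> \<le> pi / 2"
      unfolding initial_chord_angle_def G using abs_Arg_divide_le_half_pi(1)[OF cis_neq_zero V0] a[OF j] by simp
    moreover have "deriv_on ?p ?q G ?q = cis (\<theta> j (l j))" using D[of ?q] cis\<Theta>[OF j, of "l j"] l[OF j] pq(2) nS[OF j] by simp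
    then have "\<bar>terminal_chord_angle ?p ?q G\<bar> \<le> pi / 2"
      unfolding terminal_chord_angle_def G using abs_Arg_divide_le_half_pi(1)[OF cis_neq_zero V0] b[OF j] by simp
    ultimately show ?thesis using sc by simp
  qed
  have "interpolating_curve m P (node l) G"
    unfolding interpolating_curve_def using curve[OF order_refl L order_refl] nlt GP by (simp add: L_def)
  then have mem: "(node l, G) \<in> A_half_pi m P" unfolding A_half_pi_def using piece by blast
  have us: "arclength 0 L G = L" "\<And>s. s \<in> {0..L} \<Longrightarrow> unit_tangent 0 L G s = cis (\<Theta> s)"
    using unit_speed_curve[of L G \<Theta>, OF L dG] by blast+
  have "(\<integral>\<^sup>+s\<in>{0..node l m}. ennreal ((Im (cnj (unit_tangent 0 L G s) * vector_derivative (unit_tangent 0 L G) (at s within {0..node l m})))\<^sup>2) \<partial>lebesgue)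
    = chain_energy m l \<omega>"
    unfolding chain_energy_def
  proof (rule curvature_energy[where S="node l" and l=l and \<theta>=\<theta> and \<omega>=\<omega> and m=m])
    show "unit_tangent 0 L G (node l j + x) = cis (\<theta> j x)" if "j \<in> {1..<m}" "x \<in> {0..l j}" for j x
    proof -
      have "node l j + x \<in> {0..L}" using that n0[of j] nm[of "Suc j"] nS[OF that(1)] by auto
      then show ?thesis using us(2) cis\<Theta>[OF that] by simp
    qed
  qed (use m l p nS in simp_all)
  then have "bending_energy 0 L G = chain_energy m l \<omega> / 4"
    unfolding bending_energy_def signed_curvature_def us(1) L_def[symmetric] by simp
  then show thesis using that[OF mem] by (simp add: L_def)
qed

section \<open>From curves back to chains\<close>

lemma abs_cont_uniformly_continuous:
  assumes h: "abs_cont a b h" and e: "0 < \<epsilon>"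
  obtains \<delta> where "0 < \<delta>" "\<And>x y. x \<in> {a..b} \<Longrightarrow> y \<in> {a..b} \<Longrightarrow> \<bar>y - x\<bar> < \<delta> \<Longrightarrow> norm (h y - h x) < \<epsilon>"
proof -
  obtain \<delta> where \<delta>: "0 < \<delta>" "\<forall>D. D division_of \<Union>D \<and> \<Union>D \<subseteq> {a..b} \<and> (\<Sum>k\<in>D. measure lborel k) < \<delta> \<longrightarrow>
        (\<Sum>k\<in>D. norm (h (Sup k) - h (Inf k))) < \<epsilon>"
    using h[unfolded abs_cont_def, THEN spec, THEN mp, OF e] by (elim exE conjE) (rule that)
  have le: "norm (h y - h x) < \<epsilon>" if "x \<in> {a..b}" "y \<in> {a..b}" "y - x < \<delta>" "x \<le> y" for x y
  proof -
    have "{cbox x y} division_of cbox x y" using that(4) by (intro division_of_self) simp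
    then have "{{x..y}} division_of \<Union>{{x..y}} \<and> \<Union>{{x..y}} \<subseteq> {a..b} \<and> (\<Sum>k\<in>{{x..y}}. measure lborel k) < \<delta>"
      using that by auto
    from \<delta>(2)[THEN spec, THEN mp, OF this] show ?thesis using that(4) by simp
  qed
  show thesis
  proof (rule that[OF \<delta>(1)])
    fix x y assume "x \<in> {a..b}" "y \<in> {a..b}" "\<bar>y - x\<bar> < \<delta>"
    then show "norm (h y - h x) < \<epsilon>" using le[of x y] le[of y x] norm_minus_commute[of "h y" "h x"] by (cases "x \<le> y") auto
  qed
qed

lemma abs_cont_continuous_on:
  assumes "abs_cont a b h"
  shows "continuous_on {a..b} h"
  unfolding continuous_on_iff
proof (intro ballI allI impI)
  fix x \<epsilon> :: real assume x: "x \<in> {a..b}" and e: "0 < \<epsilon>"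
  obtain \<delta> where \<delta>: "0 < \<delta>" "\<And>x y. x \<in> {a..b} \<Longrightarrow> y \<in> {a..b} \<Longrightarrow> \<bar>y - x\<bar> < \<delta> \<Longrightarrow> norm (h y - h x) < \<epsilon>"
    by (rule abs_cont_uniformly_continuous[OF assms e]) (rule that)
  show "\<exists>d>0. \<forall>x'\<in>{a..b}. dist x' x < d \<longrightarrow> dist (h x') (h x) < \<epsilon>"
    by (rule exI[of _ \<delta>], intro conjI ballI impI \<delta>(1)) (simp only: dist_norm real_norm_def, rule \<delta>(2)[OF x])
qed

text \<open>A division of total length below \<open>\<delta>1\<close> consists of intervals shorter
  than \<open>\<delta>1\<close>, to which the local estimate applies one by one.\<close>

lemma abs_cont_locally_dominated:
  assumes h: "abs_cont a b h" and pq: "a \<le> p" "q \<le> b" and K: "0 < K" and d1: "0 < \<delta>1"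
    and dom: "\<And>x y. x \<in> {p..q} \<Longrightarrow> y \<in> {p..q} \<Longrightarrow> \<bar>y - x\<bar> < \<delta>1 \<Longrightarrow> norm (g y - g x) \<le> K * norm (h y - h x)"
  shows "abs_cont p q g"
  unfolding abs_cont_def
proof (intro allI impI)
  fix \<epsilon> :: real assume e: "0 < \<epsilon>"
  have eK: "0 < \<epsilon> / K" using e K by simp
  obtain \<delta> where \<delta>: "0 < \<delta>" "\<forall>D. D division_of \<Union>D \<and> \<Union>D \<subseteq> {a..b} \<and> (\<Sum>k\<in>D. measure lborel k) < \<delta> \<longrightarrow>
        (\<Sum>k\<in>D. norm (h (Sup k) - h (Inf k))) < \<epsilon> / K"
    using h[unfolded abs_cont_def, THEN spec, THEN mp, OF eK] by (elim exE conjE) (rule that)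
  show "\<exists>\<delta>>0. \<forall>D. D division_of \<Union>D \<and> \<Union>D \<subseteq> {p..q} \<and> (\<Sum>k\<in>D. measure lborel k) < \<delta> \<longrightarrow>
        (\<Sum>k\<in>D. norm (g (Sup k) - g (Inf k))) < \<epsilon>"
  proof (rule exI[of _ "min \<delta> \<delta>1"], intro conjI allI impI; (elim conjE)?)
    show "0 < min \<delta> \<delta>1" using \<delta>(1) d1 by simp
    fix D assume D: "D division_of \<Union>D" "\<Union>D \<subseteq> {p..q}" "(\<Sum>k\<in>D. measure lborel k) < min \<delta> \<delta>1"
    have one: "norm (g (Sup k) - g (Inf k)) \<le> K * norm (h (Sup k) - h (Inf k))" if k: "k \<in> D" for k
    proof (rule dom)
      obtain u v where uv: "k = {u..v}" using division_ofD(4)[OF D(1) k] by auto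
      have "k \<noteq> {}" by (rule division_ofD(3)[OF D(1) k])
      then have le: "u \<le> v" using uv by simp
      have sub: "k \<subseteq> {p..q}" using k D(2) by blast
      then show "Inf k \<in> {p..q}" "Sup k \<in> {p..q}" using uv le by auto
      have "measure lborel k \<le> (\<Sum>k\<in>D. measure lborel k)"
        by (rule member_le_sum[OF k]) (use division_ofD(1)[OF D(1)] in auto)
      then show "\<bar>Sup k - Inf k\<bar> < \<delta>1" using D(3) uv le by simp
    qed
    have "(\<Sum>k\<in>D. norm (g (Sup k) - g (Inf k))) \<le> K * (\<Sum>k\<in>D. norm (h (Sup k) - h (Inf k)))"
      using sum_mono[of D, OF one] by (simp add: sum_distrib_left)
    also have "\<dots> < K * (\<epsilon> / K)"
    proof (rule mult_strict_left_mono[OF _ K])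
      have "\<Union>D \<subseteq> {a..b}" using D(2) pq by auto
      then show "(\<Sum>k\<in>D. norm (h (Sup k) - h (Inf k))) < \<epsilon> / K" using \<delta>(2)[THEN spec, THEN mp, of D] D(1,3) by simp
    qed
    also have "\<dots> = \<epsilon>" using K by simp
    finally show "(\<Sum>k\<in>D. norm (g (Sup k) - g (Inf k))) < \<epsilon>" .
  qed
qed

lemma abs_cont_monotone_primitive:
  assumes ab: "a \<le> b" and mono: "mono_on {a..b} \<theta> \<or> antimono_on {a..b} \<theta>"
    and cont: "continuous_on {a..b} \<theta>" and ac: "abs_cont a b \<theta>"
  shows "\<exists>\<omega>. primitive_on a b \<theta> \<omega>"
proof -
  have main: "\<exists>\<omega>. primitive_on a b f \<omega>" if f: "mono_on {a..b} f" "continuous_on {a..b} f" "abs_cont a b f" for f :: "real \<Rightarrow> real"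
  proof -
    obtain g where g: "g \<in> borel_measurable borel" "\<And>x. 0 \<le> g x"
        "\<And>x. x \<in> {a..b} \<Longrightarrow> (g has_integral (f x - f a)) {a..x}"
      by (rule abs_cont_mono_density[OF ab f]) (rule that)
    have "g absolutely_integrable_on {a..b}"
      using g(3)[of b] g(2) ab by (intro nonnegative_absolutely_integrable_1) auto
    then have "primitive_on a b f g" unfolding primitive_on_def using g(1,3) by blast
    then show ?thesis by (rule exI[of _ g])
  qed
  show ?thesis using mono
  proof
    assume "mono_on {a..b} \<theta>" then show ?thesis using cont ac by (rule main)
  next
    assume "antimono_on {a..b} \<theta>"
    then have "mono_on {a..b} (\<lambda>x. - \<theta> x)" by (simp add: monotone_on_uminus_iff)
    moreover have "abs_cont a b (\<lambda>x. - \<theta> x)"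
      by (rule abs_cont_locally_dominated[OF ac order_refl order_refl, of 1 1]) auto
    ultimately obtain \<omega> where "primitive_on a b (\<lambda>x. - \<theta> x) \<omega>"
      using main[OF _ continuous_on_minus[OF cont]] by blast
    from primitive_on_uminus[OF this] show ?thesis by auto
  qed
qed

text \<open>Each monotone phase has a density by \<open>abs_cont_monotone_primitive\<close>; the two
  are joined at the turning point.\<close>

lemma s_shaped_primitive:
  assumes s: "s_shaped a b \<theta>" and cont: "continuous_on {a..b} \<theta>" and ac: "abs_cont a b \<theta>"
  shows "\<exists>\<omega>. primitive_on a b \<theta> \<omega>"
proof -
  obtain c where c: "c \<in> {a..b}" "mono_on {a..c} \<theta> \<and> antimono_on {c..b} \<theta> \<or> antimono_on {a..c} \<theta> \<and> mono_on {c..b} \<theta>"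
    using s unfolding s_shaped_def by blast
  have ac': "abs_cont p q \<theta>" "continuous_on {p..q} \<theta>" if "a \<le> p" "q \<le> b" for p q
    by (rule abs_cont_locally_dominated[OF ac that, of 1 1], simp_all) (rule continuous_on_subset[OF cont], use that in auto)
  have "\<exists>\<omega>. primitive_on a c \<theta> \<omega>" by (rule abs_cont_monotone_primitive) (use c ac' in auto)
  moreover have "\<exists>\<omega>. primitive_on c b \<theta> \<omega>" by (rule abs_cont_monotone_primitive) (use c ac' in auto)
  ultimately obtain \<omega> \<rho> where "primitive_on a c \<theta> \<omega>" "primitive_on c b \<theta> \<rho>" by blast
  from primitive_on_append[OF this] c(1) show ?thesis by auto
qed

text \<open>On \<open>[0, 1]\<close> the cosine is at least \<open>cos (pi / 3) = 1/2\<close>, hence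
  \<open>sin d \<ge> d / 2\<close>. This local inverse of \<open>norm_cis_diff_le\<close> recovers
  the angle from the tangent.\<close>

lemma abs_diff_le_norm_cis:
  assumes "\<bar>x - y\<bar> \<le> 1"
  shows "\<bar>x - y\<bar> \<le> 2 * norm (cis x - cis y)"
proof -
  have pos: "d \<le> 2 * sin d" if d: "0 \<le> d" "d \<le> 1" for d :: real
  proof (cases "d = 0")
    case False
    then obtain z where z: "0 < z" "z < d" "sin d - sin 0 = (d - 0) * cos z"
      using d MVT2[of 0 d sin cos] by (auto intro: DERIV_sin)
    have "cos (pi / 3) \<le> cos z" using z d pi_gt3 by (intro cos_monotone_0_pi_le) auto
    then have "d * (1 / 2) \<le> d * cos z" using d by (intro mult_left_mono) (simp_all add: cos_60)
    then show ?thesis using z(3) by simp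
  qed simp
  have "\<bar>x - y\<bar> \<le> 2 * \<bar>sin (x - y)\<bar>"
    using assms pos[of "x - y"] pos[of "y - x"] sin_minus[of "x - y"] by (cases "y \<le> x") auto
  also have "\<bar>sin (x - y)\<bar> = \<bar>Im ((cis x - cis y) * cnj (cis y))\<bar>"
    by (simp add: sin_diff algebra_simps)
  also have "\<dots> \<le> norm ((cis x - cis y) * cnj (cis y))" by (rule abs_Im_le_cmod)
  also have "\<dots> = norm (cis x - cis y)" by (simp add: norm_mult)
  finally show ?thesis by simp
qed

lemma norm_sgn_diff_le:
  fixes z w :: "'a::real_normed_vector"
  assumes "0 < \<mu>" "\<mu> \<le> norm z" "\<mu> \<le> norm w"
  shows "norm (sgn z - sgn w) \<le> 2 / \<mu> * norm (z - w)"
proof -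
  have nz: "0 < norm z" "0 < norm w" using assms by auto
  have "sgn z - sgn w = (1 / norm z) *\<^sub>R (z - w) + ((norm w - norm z) / norm z) *\<^sub>R sgn w"
    using nz by (simp add: sgn_div_norm algebra_simps diff_divide_distrib divide_inverse)
  then have "norm (sgn z - sgn w) \<le> norm ((1 / norm z) *\<^sub>R (z - w)) + norm (((norm w - norm z) / norm z) *\<^sub>R sgn w)"
    using norm_triangle_ineq by metis
  also have "\<dots> = norm (z - w) / norm z + \<bar>norm w - norm z\<bar> / norm z" using nz by (simp add: norm_sgn)
  also have "\<dots> \<le> norm (z - w) / norm z + norm (z - w) / norm z"
    using norm_triangle_ineq3[of w z] norm_minus_commute[of w z] by (intro add_left_mono divide_right_mono) simp_all
  also have "\<dots> \<le> norm (z - w) / \<mu> + norm (z - w) / \<mu>"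
    using assms by (intro add_mono divide_left_mono mult_pos_pos) auto
  finally show ?thesis by simp
qed

text \<open>By uniform continuity nearby angles differ by at most 1, so their difference is
  controlled by that of the unit tangents. Normalisation is Lipschitz where the derivative is
  bounded away from 0, and the constants combine to \<open>2 * (2 / \<mu>)\<close>.\<close>

lemma tangent_angle_abs_cont:
  assumes h: "abs_cont a b D" and pq: "a \<le> p" "q \<le> b" and \<mu>: "0 < \<mu>" "\<And>x. x \<in> {p..q} \<Longrightarrow> \<mu> \<le> norm (D x)"
    and \<theta>: "continuous_on {p..q} \<theta>" "\<And>x. x \<in> {p..q} \<Longrightarrow> sgn (D x) = cis (\<theta> x)"
  shows "abs_cont p q \<theta>"
proof -
  have "uniformly_continuous_on {p..q} \<theta>" by (rule compact_uniformly_continuous[OF \<theta>(1)]) simp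
  from this[unfolded uniformly_continuous_on_def, THEN spec, THEN mp, OF zero_less_one]
  obtain d where d: "0 < d" "\<forall>x\<in>{p..q}. \<forall>x'\<in>{p..q}. dist x' x < d \<longrightarrow> dist (\<theta> x') (\<theta> x) < 1"
    by (elim exE conjE) (rule that)
  show ?thesis
  proof (rule abs_cont_locally_dominated[OF h pq _ d(1)])
    show "0 < 4 / \<mu>" using \<mu>(1) by simp
    fix x y assume xy: "x \<in> {p..q}" "y \<in> {p..q}" "\<bar>y - x\<bar> < d"
    then have "\<bar>\<theta> y - \<theta> x\<bar> \<le> 1" using d(2)[THEN bspec, OF xy(1), THEN bspec, OF xy(2)] by (simp add: dist_real_def)
    from abs_diff_le_norm_cis[OF this] have "\<bar>\<theta> y - \<theta> x\<bar> \<le> 2 * norm (sgn (D y) - sgn (D x))" using \<theta>(2) xy by simp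
    also have "\<dots> \<le> 2 * (2 / \<mu> * norm (D y - D x))"
      by (intro mult_left_mono norm_sgn_diff_le) (use \<mu> xy in auto)
    finally show "norm (\<theta> y - \<theta> x) \<le> 4 / \<mu> * norm (D y - D x)" by simp
  qed
qed

lemma is_curve_deriv:
  assumes F: "is_curve a b F"
  shows "abs_cont a b (deriv_on a b F)" "continuous_on {a..b} (deriv_on a b F)"
    and "\<And>x. x \<in> {a..b} \<Longrightarrow> (F has_vector_derivative deriv_on a b F x) (at x within {a..b})"
proof -
  show 1: "abs_cont a b (deriv_on a b F)"
    using F unfolding is_curve_def absolutely_continuous_fun_def abs_cont_def by blast
  show "continuous_on {a..b} (deriv_on a b F)" by (rule abs_cont_continuous_on[OF 1])
  show "(F has_vector_derivative deriv_on a b F x) (at x within {a..b})" if "x \<in> {a..b}" for x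
    using F that unfolding is_curve_def by (intro vector_derivative_works[THEN iffD1]) blast
qed

text \<open>Clamping the argument extends the speed to a positive function on the whole line.\<close>

definition speed :: "real \<Rightarrow> real \<Rightarrow> (real \<Rightarrow> complex) \<Rightarrow> real \<Rightarrow> real" where
  "speed a b F t = norm (deriv_on a b F (max a (min b t)))"

lemma speed_eq: "t \<in> {a..b} \<Longrightarrow> speed a b F t = norm (deriv_on a b F t)"
  by (simp add: speed_def)

lemma is_curve_positive_speed:
  assumes F: "is_curve a b F"
  shows "\<exists>\<mu>. positive_speed (speed a b F) \<mu> \<and> 0 < \<mu> \<and> (\<forall>x\<in>{a..b}. \<mu> \<le> norm (deriv_on a b F x))"
proof -
  have ab: "a < b" using F by (simp add: is_curve_def)
  have nc: "continuous_on {a..b} (\<lambda>x. norm (deriv_on a b F x))" by (intro continuous_on_norm is_curve_deriv(2)[OF F])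
  have "{a..b} \<noteq> {}" using ab by simp
  from continuous_attains_inf[OF compact_Icc this nc]
  obtain x0 where x0: "x0 \<in> {a..b}" "\<forall>x\<in>{a..b}. norm (deriv_on a b F x0) \<le> norm (deriv_on a b F x)" by blast
  let ?\<mu> = "norm (deriv_on a b F x0)"
  have mu: "0 < ?\<mu>" using F x0(1) by (simp add: is_curve_def)
  have cl: "max a (min b t) \<in> {a..b}" for t using ab by auto
  have cont: "continuous_on UNIV (speed a b F)" unfolding speed_def
    by (rule continuous_on_compose2[OF nc]) (use ab in \<open>auto intro!: continuous_intros\<close>)
  have "positive_speed (speed a b F) ?\<mu>"
  proof
    show "speed a b F \<in> borel_measurable borel" by (rule borel_measurable_continuous_onI[OF cont])
    show "speed a b F integrable_on {x..y}" for x y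
      by (rule integrable_continuous_interval[OF continuous_on_subset[OF cont]]) simp
    show "?\<mu> \<le> speed a b F x" for x unfolding speed_def using x0(2)[THEN bspec, OF cl] .
  qed (rule mu)
  then show ?thesis using mu x0(2) by blast
qed

context
  fixes a b :: real and F :: "real \<Rightarrow> complex" and \<mu> :: real
  assumes F: "is_curve a b F" and sp: "positive_speed (speed a b F) \<mu>"
begin

interpretation positive_speed a "speed a b F" \<mu> by (rule sp)

lemma deriv_on_has_integral:
  assumes "a \<le> p" "p \<le> q" "q \<le> b"
  shows "(deriv_on a b F has_integral (F q - F p)) {p..q}"
proof (rule fundamental_theorem_of_calculus[OF assms(2)])
  show "(F has_vector_derivative deriv_on a b F x) (at x within {p..q})" if "x \<in> {p..q}" for x
    by (rule has_vector_derivative_within_subset[OF is_curve_deriv(3)[OF F]]) (use that assms in auto)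
qed

lemma arclength_fun_eq_travel: "t \<in> {a..b} \<Longrightarrow> arclength_fun a b F t = travel t"
proof -
  assume t: "t \<in> {a..b}"
  have "integral {a..t} (\<lambda>u. norm (deriv_on a b F u)) = integral {a..t} (speed a b F)"
    by (rule Henstock_Kurzweil_Integration.integral_cong) (use t speed_eq in auto)
  then show ?thesis using travel_diff[of a t] t by (simp add: arclength_fun_def)
qed

lemma sgn_deriv_continuous: "continuous_on {a..b} (\<lambda>x. sgn (deriv_on a b F x))"
  using F by (intro continuous_on_sgn is_curve_deriv(2)[OF F]) (simp add: is_curve_def)

lemma speed_scaleR_sgn: "t \<in> {a..b} \<Longrightarrow> speed a b F t *\<^sub>R sgn (deriv_on a b F t) = deriv_on a b F t"
  by (cases "deriv_on a b F t = 0") (simp_all add: speed_eq sgn_div_norm)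

text \<open>Substitution shows that the curve in terms of arclength is the integral of the
  continuous normalised derivative, whence its derivative. So no differentiation of the inverse
  function \<open>time_at\<close> is involved.\<close>

lemma unit_tangent_eq_sgn:
  shows "arclength a b F = travel b"
    and "\<And>s. s \<in> {0..travel b} \<Longrightarrow> unit_tangent a b F s = sgn (deriv_on a b F (time_at s))"
proof -
  have ab: "a < b" using F by (simp add: is_curve_def)
  have L: "0 < travel b" using travel_less_iff[of a b] ab by simp
  have range: "time_at s \<in> {a..b}" if "s \<in> {0..travel b}" for s
    using that time_at_le_iff[of "travel a" s, unfolded time_at_travel] time_at_le_iff[of s "travel b", unfolded time_at_travel] by simp
  show al: "arclength a b F = travel b" unfolding arclength_def using arclength_fun_eq_travel[of b] ab by simp
  have inv: "inv_into {a..b} (arclength_fun a b F) s = time_at s" if "s \<in> {0..travel b}" for s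
    by (rule inv_into_f_eq) (use range[OF that] in \<open>simp_all add: arclength_fun_eq_travel inj_on_def\<close>)
  have cont: "continuous_on {0..travel b} (\<lambda>s. sgn (deriv_on a b F (time_at s)))"
    by (rule continuous_on_compose2[OF sgn_deriv_continuous time_at_continuous]) (use range in blast)
  have int: "F (time_at s) = F a + integral {0..s} (\<lambda>s. sgn (deriv_on a b F (time_at s)))" if s: "s \<in> {0..travel b}" for s
  proof -
    have "integral {travel a..travel (time_at s)} (\<lambda>s. sgn (deriv_on a b F (time_at s)))
        = integral {a..time_at s} (\<lambda>t. speed a b F t *\<^sub>R sgn (deriv_on a b F t))"
      by (rule integral_continuous_travel[OF continuous_on_subset[OF sgn_deriv_continuous]]) (use range[OF s] in auto)
    also have "\<dots> = integral {a..time_at s} (deriv_on a b F)"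
      by (rule Henstock_Kurzweil_Integration.integral_cong) (use range[OF s] in \<open>auto intro!: speed_scaleR_sgn\<close>)
    also have "\<dots> = F (time_at s) - F a"
      by (rule integral_unique[OF deriv_on_has_integral]) (use range[OF s] in auto)
    finally show ?thesis by simp
  qed
  fix s assume s: "s \<in> {0..travel b}"
  have "((\<lambda>s. F a + integral {0..s} (\<lambda>s. sgn (deriv_on a b F (time_at s)))) has_vector_derivative sgn (deriv_on a b F (time_at s))) (at s within {0..travel b})"
    using has_vector_derivative_add[OF has_vector_derivative_const integral_has_vector_derivative[OF cont s], of "F a"] by simp
  then have "(arclength_param a b F has_vector_derivative sgn (deriv_on a b F (time_at s))) (at s within {0..travel b})"
    by (rule has_vector_derivative_transform[OF s, rotated]) (simp add: arclength_param_def inv int)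
  then show "unit_tangent a b F s = sgn (deriv_on a b F (time_at s))" unfolding unit_tangent_def al by (rule deriv_on_eq[OF L s])
qed

text \<open>The angle of the piece is absolutely continuous and piecewise monotone, so it has a
  density with respect to the parameter; the change to arclength and a shift to start at 0 make it
  an arc.\<close>

lemma s_curve_arc:
  assumes pq: "a \<le> p" "q \<le> b" and s: "s_curve p q F"
    and \<mu>: "0 < \<mu>'" "\<forall>x\<in>{a..b}. \<mu>' \<le> norm (deriv_on a b F x)"
  shows "\<exists>\<theta> \<omega>. primitive_on 0 (travel q - travel p) \<theta> \<omega> \<and> s_shaped 0 (travel q - travel p) \<theta> \<and>
     displacement \<theta> 0 (travel q - travel p) = F q - F p \<and>
     (\<forall>x\<in>{0..travel q - travel p}. cis (\<theta> x) = sgn (deriv_on a b F (time_at (travel p + x))))"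
proof -
  have lt: "p < q" using s by (simp add: s_curve_def is_curve_def)
  have D: "deriv_on p q F x = deriv_on a b F x" if "x \<in> {p..q}" for x
    by (rule deriv_on_eq[OF lt that has_vector_derivative_within_subset[OF is_curve_deriv(3)[OF F]]]) (use that pq in auto)
  obtain \<phi> where ta: "tangent_angle p q F \<phi>" and sh: "s_shaped p q \<phi>"
    using s unfolding s_curve_def s_shaped_def by blast
  have cont: "continuous_on {p..q} \<phi>" using ta by (simp add: tangent_angle_def)
  have sg: "sgn (deriv_on a b F x) = cis (\<phi> x)" if x: "x \<in> {p..q}" for x
  proof -
    have "deriv_on p q F x = rcis (norm (deriv_on p q F x)) (\<phi> x)" using ta x unfolding tangent_angle_def by blast
    then have "deriv_on a b F x = norm (deriv_on a b F x) *\<^sub>R cis (\<phi> x)" unfolding D[OF x] by (simp add: rcis_def scaleR_conv_of_real)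
    moreover have "0 < norm (deriv_on a b F x)" using F x pq by (simp add: is_curve_def)
    ultimately have "sgn (deriv_on a b F x) = sgn (cis (\<phi> x))" by (metis sgn_scaleR sgn_pos scaleR_one)
    then show ?thesis by (simp add: sgn_div_norm)
  qed
  have "abs_cont p q \<phi>"
    by (rule tangent_angle_abs_cont[OF is_curve_deriv(1)[OF F] pq \<mu>(1) _ cont sg]) (use \<mu>(2) pq in auto)
  from s_shaped_primitive[OF sh cont this] obtain \<rho> where "primitive_on p q \<phi> \<rho>" ..
  from primitive_on_shift[OF primitive_on_travel[OF this], of "- travel p"]
  have prim: "primitive_on 0 (travel q - travel p) (\<lambda>x. \<phi> (time_at (travel p + x)))
     (\<lambda>x. \<rho> (time_at (travel p + x)) / speed a b F (time_at (travel p + x)))" by (simp add: add.commute)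
  have range: "time_at (travel p + x) \<in> {p..q}" if "x \<in> {0..travel q - travel p}" for x
    using that time_at_le_iff[of "travel p" "travel p + x"] time_at_le_iff[of "travel p + x" "travel q"] by simp
  have shp: "s_shaped 0 (travel q - travel p) (\<lambda>x. \<phi> (time_at (travel p + x)))"
  proof (rule s_shaped_monotone_image[OF sh])
    show "\<exists>y\<in>{0..travel q - travel p}. time_at (travel p + y) = x" if "x \<in> {p..q}" for x
      using that by (intro bexI[of _ "travel x - travel p"]) auto
  qed (use range lt in \<open>auto simp: less_imp_le\<close>)
  have cs: "continuous_on {p..q} (\<lambda>x. cis (\<phi> x))" by (rule continuous_on_cis_angle[OF cont])
  have "displacement (\<lambda>x. \<phi> (time_at (travel p + x))) 0 (travel q - travel p)
      = integral {0..travel q - travel p} ((\<lambda>s. cis (\<phi> (time_at s))) \<circ> (\<lambda>x. x + travel p))"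
    by (simp add: displacement_def o_def add.commute)
  also have "\<dots> = integral {travel p..travel q} (\<lambda>s. cis (\<phi> (time_at s)))"
  proof (subst integral_shift)
    have "time_at s \<in> {p..q}" if "s \<in> {travel p..travel q}" for s
      using that time_at_le_iff[of "travel p" s] time_at_le_iff[of s "travel q"] by simp
    then show "continuous_on {0 + travel p..travel q - travel p + travel p} (\<lambda>s. cis (\<phi> (time_at s)))"
      by (intro continuous_on_compose2[OF cs time_at_continuous]) auto
  qed simp
  also have "\<dots> = integral {p..q} (\<lambda>t. speed a b F t *\<^sub>R cis (\<phi> t))" by (rule integral_continuous_travel[OF cs])
  also have "\<dots> = integral {p..q} (deriv_on a b F)"
  proof (rule Henstock_Kurzweil_Integration.integral_cong)
    fix x assume x: "x \<in> {p..q}"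
    then have "x \<in> {a..b}" using pq by auto
    then show "speed a b F x *\<^sub>R cis (\<phi> x) = deriv_on a b F x" using speed_scaleR_sgn[of x] sg[OF x] by simp
  qed
  also have "\<dots> = F q - F p" by (rule integral_unique[OF deriv_on_has_integral]) (use pq lt in auto)
  finally have disp: "displacement (\<lambda>x. \<phi> (time_at (travel p + x))) 0 (travel q - travel p) = F q - F p" .
  have "\<forall>x\<in>{0..travel q - travel p}. cis (\<phi> (time_at (travel p + x))) = sgn (deriv_on a b F (time_at (travel p + x)))"
    using sg[OF range] by simp
  with prim shp disp show ?thesis by blast
qed

end

lemma bchoice2:
  "\<forall>x\<in>A. \<exists>y z. Q x y z \<Longrightarrow> \<exists>f g. \<forall>x\<in>A. Q x (f x) (g x)"
  by metis

text \<open>Together with \<open>chain_curve\<close>, this makes minimising over curves the same as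
  minimising over chains. The strict chord angle conditions become strict signs.\<close>

lemma curve_chain:
  assumes mem: "(t, F) \<in> A_half_pi m P" and m: "2 \<le> m" and P: "\<And>j. j \<in> {1..<m} \<Longrightarrow> P j \<noteq> P (Suc j)"
  obtains l \<theta> \<omega> where "chain m P l \<theta> \<omega>" "bending_energy (t 1) (t m) F = chain_energy m l \<omega> / 4"
    "arclength (t 1) (t m) F = node l m"
    "\<And>j x. j \<in> {1..<m} \<Longrightarrow> x \<in> {0..l j} \<Longrightarrow> unit_tangent (t 1) (t m) F (node l j + x) = cis (\<theta> j x)"
    "\<And>j. j \<in> {1..<m} \<Longrightarrow> \<bar>initial_chord_angle (t j) (t (Suc j)) F\<bar> < pi / 2 \<longleftrightarrow> 0 < Re (cnj (P (Suc j) - P j) * cis (\<theta> j 0))"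
    "\<And>j. j \<in> {1..<m} \<Longrightarrow> \<bar>terminal_chord_angle (t j) (t (Suc j)) F\<bar> < pi / 2 \<longleftrightarrow> 0 < Re (cnj (P (Suc j) - P j) * cis (\<theta> j (l j)))"
proof -
  define a b where "a = t 1" and "b = t m"
  have F: "is_curve a b F" and tlt: "\<And>j. j \<in> {1..<m} \<Longrightarrow> t j < t (Suc j)" and FP: "\<And>j. j \<in> {1..m} \<Longrightarrow> F (t j) = P j"
    and sc: "\<And>j. j \<in> {1..<m} \<Longrightarrow> s_curve (t j) (t (Suc j)) F"
    and ia: "\<And>j. j \<in> {1..<m} \<Longrightarrow> \<bar>initial_chord_angle (t j) (t (Suc j)) F\<bar> \<le> pi / 2"
    and te: "\<And>j. j \<in> {1..<m} \<Longrightarrow> \<bar>terminal_chord_angle (t j) (t (Suc j)) F\<bar> \<le> pi / 2"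
    using mem unfolding A_half_pi_def interpolating_curve_def a_def b_def by blast+
  obtain \<mu> where sp: "positive_speed (speed a b F) \<mu>" and \<mu>: "0 < \<mu>" "\<forall>x\<in>{a..b}. \<mu> \<le> norm (deriv_on a b F x)"
    using is_curve_positive_speed[OF F] by (elim exE conjE) (rule that)
  interpret positive_speed a "speed a b F" \<mu> by (rule sp)
  have mono: "t i \<le> t j" if "1 \<le> i" "i \<le> j" "j \<le> m" for i j
    using that(2,3)
  proof (induction j rule: dec_induct)
    case (step j)
    then have "t j < t (Suc j)" using that(1) by (intro tlt) simp
    then show ?case using step by simp
  qed simp
  have tab: "t j \<in> {a..b}" if "j \<in> {1..m}" for j unfolding a_def b_def using mono[of 1 j] mono[of j m] that by simp
  define l where "l j = travel (t (Suc j)) - travel (t j)" for j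
  define D where "D = deriv_on a b F"
  have ex: "\<exists>\<theta> \<omega>. primitive_on 0 (l j) \<theta> \<omega> \<and> s_shaped 0 (l j) \<theta> \<and>
     displacement \<theta> 0 (l j) = F (t (Suc j)) - F (t j) \<and>
     (\<forall>x\<in>{0..l j}. cis (\<theta> x) = sgn (D (time_at (travel (t j) + x))))" if j: "j \<in> {1..<m}" for j
    unfolding l_def D_def
    by (rule s_curve_arc[OF F sp _ _ sc[OF j] \<mu>]) (use tab[of j] tab[of "Suc j"] j in auto)
  obtain \<theta> \<omega> where arc: "\<And>j. j \<in> {1..<m} \<Longrightarrow> primitive_on 0 (l j) (\<theta> j) (\<omega> j) \<and> s_shaped 0 (l j) (\<theta> j) \<and>
     displacement (\<theta> j) 0 (l j) = F (t (Suc j)) - F (t j) \<and>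
     (\<forall>x\<in>{0..l j}. cis (\<theta> j x) = sgn (D (time_at (travel (t j) + x))))"
  proof -
    have "\<forall>j\<in>{1..<m}. \<exists>\<theta> \<omega>. primitive_on 0 (l j) \<theta> \<omega> \<and> s_shaped 0 (l j) \<theta> \<and>
       displacement \<theta> 0 (l j) = F (t (Suc j)) - F (t j) \<and>
       (\<forall>x\<in>{0..l j}. cis (\<theta> x) = sgn (D (time_at (travel (t j) + x))))"
      by (rule ballI) (rule ex)
    from bchoice2[OF this] show thesis by (elim exE) (rule that, erule bspec)
  qed
  have lpos: "0 < l j" if "j \<in> {1..<m}" for j unfolding l_def using tlt[OF that] by simp
  have cs: "cis (\<theta> j x) = sgn (D (time_at (travel (t j) + x)))" if "j \<in> {1..<m}" "x \<in> {0..l j}" for j x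
    using arc[OF that(1)] that(2) by blast
  have cis0: "cis (\<theta> j 0) = sgn (D (t j))" if "j \<in> {1..<m}" for j using cs[OF that, of 0] lpos[OF that] by simp
  have cis1: "cis (\<theta> j (l j)) = sgn (D (t (Suc j)))" if "j \<in> {1..<m}" for j
    using cs[OF that, of "l j"] lpos[OF that] by (simp add: l_def)
  have Dj: "deriv_on (t j) (t (Suc j)) F x = D x" if j: "j \<in> {1..<m}" and x: "x \<in> {t j..t (Suc j)}" for j x
    unfolding D_def
    by (rule deriv_on_eq[OF tlt[OF j] x has_vector_derivative_within_subset[OF is_curve_deriv(3)[OF F]]])
      (use x tab[of j] tab[of "Suc j"] j in auto)
  have D0: "D x \<noteq> 0" if "x \<in> {a..b}" for x using F that by (simp add: D_def is_curve_def)
  have Re_sgn: "Re (cnj V * sgn z) = Re (cnj V * z) / norm z" for V z :: complex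
    by (simp add: sgn_div_norm divide_inverse algebra_simps)
  have P0: "P (Suc j) - P j \<noteq> 0" if "j \<in> {1..<m}" for j using P[OF that] by simp
  have FV: "F (t (Suc j)) - F (t j) = P (Suc j) - P j" if "j \<in> {1..<m}" for j using FP[of j] FP[of "Suc j"] that by simp
  have t1: "\<bar>initial_chord_angle (t j) (t (Suc j)) F\<bar> = \<bar>Arg (D (t j) / (P (Suc j) - P j))\<bar>"
    and t2: "\<bar>terminal_chord_angle (t j) (t (Suc j)) F\<bar> = \<bar>Arg (D (t (Suc j)) / (P (Suc j) - P j))\<bar>" if j: "j \<in> {1..<m}" for j
    unfolding initial_chord_angle_def terminal_chord_angle_def FV[OF j] using tlt[OF j] by (simp_all add: Dj[OF j])
  have S: "node l j = travel (t j)" if "1 \<le> j" for j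
    using that
  proof (induction j rule: nat_induct_at_least)
    case base
    show ?case by (simp add: a_def[symmetric, simplified])
  next
    case (Suc j)
    then show ?case by (simp add: node_Suc l_def)
  qed
  have Sm: "node l m = travel b" using S[of m] m by (simp add: b_def)
  note ut = unit_tangent_eq_sgn[OF F sp]
  have tang: "unit_tangent a b F (node l j + x) = cis (\<theta> j x)" if j: "j \<in> {1..<m}" and x: "x \<in> {0..l j}" for j x
  proof -
    have "0 \<le> travel (t j)" "travel (t (Suc j)) \<le> travel b"
      using travel_le_iff[of a "t j"] tab[of j] travel_le_iff[of "t (Suc j)" b] tab[of "Suc j"] j by simp_all
    then have "node l j + x \<in> {0..travel b}" using x S[of j] j by (simp add: l_def del: travel_le_iff)
    from ut(2)[OF this] show ?thesis using cs[OF j x] S[of j] j by (simp add: D_def)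
  qed
  have ch: "chain m P l \<theta> \<omega>" unfolding chain_def
  proof (intro conjI ballI impI)
    fix j assume j: "j \<in> {1..<m}"
    have nz: "D (t j) \<noteq> 0" "D (t (Suc j)) \<noteq> 0" using D0[OF tab[of j]] D0[OF tab[of "Suc j"]] j by simp_all
    show "0 \<le> Re (cnj (P (Suc j) - P j) * cis (\<theta> j 0))"
      unfolding cis0[OF j] Re_sgn using ia[OF j] abs_Arg_divide_le_half_pi(1)[OF nz(1) P0[OF j]] unfolding t1[OF j] by simp
    show "0 \<le> Re (cnj (P (Suc j) - P j) * cis (\<theta> j (l j)))"
      unfolding cis1[OF j] Re_sgn using te[OF j] abs_Arg_divide_le_half_pi(1)[OF nz(2) P0[OF j]] unfolding t2[OF j] by simp
    show "cis (\<theta> j (l j)) = cis (\<theta> (Suc j) 0)" if "Suc j < m"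
      unfolding cis1[OF j] by (rule cis0[symmetric]) (use that in simp)
  qed (use arc lpos FV in simp_all)
  have energy: "bending_energy a b F = chain_energy m l \<omega> / 4"
  proof -
    have "(\<integral>\<^sup>+s\<in>{0..node l m}. ennreal ((Im (cnj (unit_tangent a b F s) * vector_derivative (unit_tangent a b F) (at s within {0..node l m})))\<^sup>2) \<partial>lebesgue)
      = chain_energy m l \<omega>"
      unfolding chain_energy_def
      by (rule curvature_energy[where S="node l" and l=l and \<theta>=\<theta> and \<omega>=\<omega> and m=m])
        (use m lpos arc tang node_Suc in simp_all)
    then show ?thesis unfolding bending_energy_def signed_curvature_def ut(1) Sm by simp
  qed
  show thesis
  proof (rule that[OF ch energy[unfolded a_def b_def] ut(1)[folded Sm, unfolded a_def b_def] tang[unfolded a_def b_def]])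
    fix j assume j: "j \<in> {1..<m}"
    have nz: "D (t j) \<noteq> 0" "D (t (Suc j)) \<noteq> 0" using D0[OF tab[of j]] D0[OF tab[of "Suc j"]] j by simp_all
    show "\<bar>initial_chord_angle (t j) (t (Suc j)) F\<bar> < pi / 2 \<longleftrightarrow> 0 < Re (cnj (P (Suc j) - P j) * cis (\<theta> j 0))"
      unfolding cis0[OF j] Re_sgn t1[OF j] abs_Arg_divide_le_half_pi(2)[OF nz(1) P0[OF j]] using nz by (simp add: zero_less_divide_iff)
    show "\<bar>terminal_chord_angle (t j) (t (Suc j)) F\<bar> < pi / 2 \<longleftrightarrow> 0 < Re (cnj (P (Suc j) - P j) * cis (\<theta> j (l j)))"
      unfolding cis1[OF j] Re_sgn t2[OF j] abs_Arg_divide_le_half_pi(2)[OF nz(2) P0[OF j]] using nz by (simp add: zero_less_divide_iff)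
  qed
qed

section \<open>Curvature at the nodes\<close>

lemma node_cover:
  assumes l: "\<And>j. j \<in> {1..<m} \<Longrightarrow> 0 < l j" and m: "2 \<le> m" and s: "s \<in> {0..node l m}"
  shows "\<exists>j\<in>{1..<m}. \<exists>x\<in>{0..l j}. s = node l j + x"
proof -
  have "s \<in> {0..node l k} \<longrightarrow> (\<exists>j\<in>{1..<k}. \<exists>x\<in>{0..l j}. s = node l j + x)" if "2 \<le> k" for k
    using that
  proof (induction k rule: dec_induct)
    case base
    have "node l 2 = l 1" using node_Suc[of 1 l] by (simp add: numeral_2_eq_2)
    then show ?case by (intro impI bexI[of _ 1] bexI[of _ s]) auto
  next
    case (step k)
    show ?case
    proof
      assume s: "s \<in> {0..node l (Suc k)}"
      show "\<exists>j\<in>{1..<Suc k}. \<exists>x\<in>{0..l j}. s = node l j + x"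
      proof (cases "s \<le> node l k")
        case True
        then obtain j x where "j \<in> {1..<k}" "x \<in> {0..l j}" "s = node l j + x" using step.IH s by auto
        then show ?thesis by (intro bexI[of _ j] bexI[of _ x]) auto
      next
        case False
        then show ?thesis using s step.hyps by (intro bexI[of _ k] bexI[of _ "s - node l k"]) (auto simp: node_Suc)
      qed
    qed
  qed
  then show ?thesis using m s by blast
qed

lemma glue_continuous:
  fixes \<kappa> :: "nat \<Rightarrow> real \<Rightarrow> real"
  assumes l: "\<And>j. j \<in> {1..<m} \<Longrightarrow> 0 < l j"
    and c: "\<And>j. j \<in> {1..<m} \<Longrightarrow> continuous_on {0..l j} (\<kappa> j)"
    and match: "\<And>j. j \<in> {1..<m} \<Longrightarrow> Suc j < m \<Longrightarrow> \<kappa> j (l j) = \<kappa> (Suc j) 0"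
    and k: "1 \<le> k" "k \<le> m"
  shows "\<exists>K. continuous_on {0..node l k} K \<and> (\<forall>j\<in>{1..<k}. \<forall>x\<in>{0..l j}. K (node l j + x) = \<kappa> j x) \<and>
     (k < m \<longrightarrow> K (node l k) = \<kappa> k 0)"
  using k
proof (induction k rule: dec_induct)
  case base
  show ?case by (rule exI[of _ "\<lambda>_. \<kappa> 1 0"]) simp
next
  case (step k)
  then have km: "k \<in> {1..<m}" by simp
  obtain K where K: "continuous_on {0..node l k} K" "\<forall>j\<in>{1..<k}. \<forall>x\<in>{0..l j}. K (node l j + x) = \<kappa> j x"
      "K (node l k) = \<kappa> k 0"
    using step.IH step.prems km by auto
  have pos: "0 < l k" by (rule l[OF km])
  have nk: "node l (Suc k) = node l k + l k" using step.hyps by (intro node_Suc)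
  have n0: "0 \<le> node l k" using node_le[OF l, where i=1 and j=k] km by simp
  define K' where "K' x = (if x \<le> node l k then K x else \<kappa> k (x - node l k))" for x
  have last: "K' (node l k + x) = \<kappa> k x" if "x \<in> {0..l k}" for x
    using that K(3) by (cases "x = 0") (auto simp: K'_def)
  have "continuous_on {node l k..node l (Suc k)} (\<lambda>x. \<kappa> k (x - node l k))"
    by (rule continuous_on_compose2[OF c[OF km]]) (auto simp: nk intro!: continuous_intros)
  then have "continuous_on ({0..node l k} \<union> {node l k..node l (Suc k)}) K'"
    unfolding K'_def
    by (intro continuous_on_If K(1)) (use K(3) in auto)
  moreover have "{0..node l k} \<union> {node l k..node l (Suc k)} = {0..node l (Suc k)}" using n0 nk pos by auto
  ultimately have "continuous_on {0..node l (Suc k)} K'" by simp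
  moreover have "\<forall>x\<in>{0..l j}. K' (node l j + x) = \<kappa> j x" if j: "j \<in> {1..<Suc k}" for j
  proof (cases "j = k")
    case True
    then show ?thesis using last by blast
  next
    case False
    then have jk: "j \<in> {1..<k}" using j by simp
    have "node l (Suc j) \<le> node l k" by (rule node_le[OF l]) (use jk km in auto)
    then have "node l j + x \<le> node l k" if "x \<in> {0..l j}" for x using that jk by (simp add: node_Suc)
    then show ?thesis using K(2)[THEN bspec, OF jk] by (simp add: K'_def)
  qed
  moreover have "K' (node l (Suc k)) = \<kappa> (Suc k) 0" if "Suc k < m"
    using last[of "l k"] pos match[OF km that] by (simp add: nk)
  ultimately show ?case by (intro exI[of _ K']) blast
qed

text \<open>The glued curvature \<open>K\<close> is the derivative of the global angle away from the
  nodes. Being continuous, it is so at the nodes too, because the angle is the integral of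
  \<open>K\<close>.\<close>

lemma G2_criterion:
  assumes F: "is_curve a b F" and m: "2 \<le> m" and len: "arclength a b F = node l m"
    and l: "\<And>j. j \<in> {1..<m} \<Longrightarrow> 0 < l j"
    and p: "\<And>j. j \<in> {1..<m} \<Longrightarrow> primitive_on 0 (l j) (\<theta> j) (\<omega> j)"
    and link: "\<And>j. j \<in> {1..<m} \<Longrightarrow> Suc j < m \<Longrightarrow> cis (\<theta> j (l j)) = cis (\<theta> (Suc j) 0)"
    and T: "\<And>j x. j \<in> {1..<m} \<Longrightarrow> x \<in> {0..l j} \<Longrightarrow> unit_tangent a b F (node l j + x) = cis (\<theta> j x)"
    and c: "\<And>j. j \<in> {1..<m} \<Longrightarrow> continuous_on {0..l j} (\<kappa> j)"
    and d: "\<And>j x. j \<in> {1..<m} \<Longrightarrow> x \<in> {0..l j} \<Longrightarrow> (\<theta> j has_real_derivative \<kappa> j x) (at x within {0..l j})"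
    and match: "\<And>j. j \<in> {1..<m} \<Longrightarrow> Suc j < m \<Longrightarrow> \<kappa> j (l j) = \<kappa> (Suc j) 0"
  shows "G2 a b F"
proof -
  define L where "L = node l m"
  have m1: "1 \<le> m" using m by simp
  have "\<exists>K. continuous_on {0..node l m} K \<and> (\<forall>j\<in>{1..<m}. \<forall>x\<in>{0..l j}. K (node l j + x) = \<kappa> j x) \<and>
     (m < m \<longrightarrow> K (node l m) = \<kappa> m 0)"
    by (rule glue_continuous) (fact l c match m1 order_refl)+
  then obtain K where K: "continuous_on {0..L} K" "\<forall>j\<in>{1..<m}. \<forall>x\<in>{0..l j}. K (node l j + x) = \<kappa> j x"
    unfolding L_def[symmetric] by (elim exE conjE) (rule that)
  have "\<exists>\<Theta> \<Omega>. primitive_on 0 (node l m) \<Theta> \<Omega> \<and>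
     (\<forall>j\<in>{1..<m}. \<exists>c. cis c = 1 \<and> (\<forall>x\<in>{0..l j}. \<Theta> (node l j + x) = \<theta> j x + c)) \<and>
     (m < m \<longrightarrow> cis (\<Theta> (node l m)) = cis (\<theta> m 0))"
    by (rule chain_global_angle) (fact l p link m1 order_refl)+
  then obtain \<Theta> \<Omega> where \<Theta>: "primitive_on 0 L \<Theta> \<Omega>"
    and \<Theta>j: "\<forall>j\<in>{1..<m}. \<exists>c. cis c = 1 \<and> (\<forall>x\<in>{0..l j}. \<Theta> (node l j + x) = \<theta> j x + c)"
    unfolding L_def[symmetric] by (elim exE conjE) (rule that)
  have cont: "continuous_on {0..L} \<Theta>" by (rule primitive_on_continuous[OF \<Theta>])
  have nS: "node l (Suc j) = node l j + l j" if "j \<in> {1..<m}" for j using that by (intro node_Suc) simp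
  have cover: "\<exists>j\<in>{1..<m}. \<exists>x\<in>{0..l j}. s = node l j + x" if "s \<in> {0..L}" for s
    by (rule node_cover[OF l m that[unfolded L_def]])
  have L: "0 < L"
  proof -
    have "node l (Suc 1) \<le> node l m" by (rule node_le[OF l]) (use m in auto)
    then show ?thesis using nS[of 1] l[of 1] m by (simp add: L_def)
  qed
  have TE: "unit_tangent a b F s = cis (\<Theta> s)" if s: "s \<in> {0..L}" for s
  proof -
    obtain j x where j: "j \<in> {1..<m}" "x \<in> {0..l j}" "s = node l j + x" using cover[OF s] by blast
    obtain c where "cis c = 1" "\<forall>x\<in>{0..l j}. \<Theta> (node l j + x) = \<theta> j x + c" using \<Theta>j[THEN bspec, OF j(1)] by (elim exE conjE) (rule that)
    then show ?thesis using T[OF j(1,2)] j(2) unfolding j(3) by (simp add: cis_mult[symmetric])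
  qed
  have inner: "(\<Theta> has_real_derivative K s) (at s)" if s: "s \<in> {0..L}" "s \<notin> node l ` {1..m}" for s
  proof -
    obtain j x where j: "j \<in> {1..<m}" "x \<in> {0..l j}" "s = node l j + x" using cover[OF s(1)] by blast
    have "s \<noteq> node l j" using s(2) j(1) by (auto simp del: One_nat_def)
    moreover have "s \<noteq> node l (Suc j)" using s(2) j(1) by (auto simp del: One_nat_def intro!: imageI)
    ultimately have x: "x \<in> {0<..<l j}" using j nS[OF j(1)] by auto
    obtain c where \<Theta>c: "\<forall>x\<in>{0..l j}. \<Theta> (node l j + x) = \<theta> j x + c" using \<Theta>j[THEN bspec, OF j(1)] by (elim exE conjE) (rule that)
    have "at x within {0..l j} = at x" using x by (intro at_within_interior) simp
    then have "(\<theta> j has_real_derivative \<kappa> j x) (at x)" using d[OF j(1,2)] by simp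
    then have "(\<theta> j has_real_derivative \<kappa> j x) (at (s + - node l j))" by (simp add: j(3))
    then have "((\<lambda>y. \<theta> j (y + - node l j)) has_real_derivative \<kappa> j x) (at s)" by (simp only: DERIV_shift)
    then have "((\<lambda>y. \<theta> j (y + - node l j) + c) has_real_derivative \<kappa> j x) (at s)" by (auto intro!: derivative_eq_intros)
    then have "(\<Theta> has_real_derivative \<kappa> j x) (at s)"
    proof (rule has_field_derivative_transform_within_open[where S="{node l j<..<node l j + l j}"])
      show "\<theta> j (y + - node l j) + c = \<Theta> y" if "y \<in> {node l j<..<node l j + l j}" for y
        using \<Theta>c[THEN bspec, of "y - node l j"] that by simp
    qed (use x in \<open>auto simp: j(3)\<close>)
    then show ?thesis using K(2)[THEN bspec, OF j(1), THEN bspec, OF j(2)] by (simp add: j(3))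
  qed
  \<comment> \<open>Finitely many exceptional points are harmless, as \<open>\<Theta>\<close> is
    continuous.\<close>
  have int: "(K has_integral (\<Theta> s - \<Theta> 0)) {0..s}" if s: "s \<in> {0..L}" for s
  proof (rule fundamental_theorem_of_calculus_interior_strong[of "node l ` {1..m}"])
    show "(\<Theta> has_vector_derivative K x) (at x)" if "x \<in> {0<..<s} - node l ` {1..m}" for x
      using inner[of x] that s by (simp add: has_real_derivative_iff_has_vector_derivative)
    show "continuous_on {0..s} \<Theta>" by (rule continuous_on_subset[OF cont]) (use s in auto)
  qed (use s in auto)
  have dT: "(unit_tangent a b F has_vector_derivative K s *\<^sub>R (\<i> * cis (\<Theta> s))) (at s within {0..L})" if s: "s \<in> {0..L}" for s
    by (rule has_vector_derivative_transform[OF s TE cis_has_vector_derivative[OF derivative_of_primitive[OF K(1) int s]]])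
  have sc: "signed_curvature a b F s = K s" if s: "s \<in> {0..L}" for s
  proof -
    have "signed_curvature a b F s = Im (cnj (cis (\<Theta> s)) * (K s *\<^sub>R (\<i> * cis (\<Theta> s))))"
      unfolding signed_curvature_def len L_def[symmetric] TE[OF s] deriv_on_eq[OF L s dT[OF s]] ..
    also have "\<dots> = K s * ((cos (\<Theta> s))\<^sup>2 + (sin (\<Theta> s))\<^sup>2)" by (simp add: power2_eq_square algebra_simps)
    finally show ?thesis by simp
  qed
  show ?thesis unfolding G2_def len L_def[symmetric]
  proof (intro conjI ballI F)
    show "continuous_on {0..L} (unit_tangent a b F)"
      by (rule continuous_on_cong[THEN iffD2, OF refl TE continuous_on_cis_angle[OF cont]])
    show "unit_tangent a b F differentiable at s within {0..L}" if "s \<in> {0..L}" for s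
      by (rule differentiableI_vector[OF dT[OF that]])
    show "continuous_on {0..L} (signed_curvature a b F)"
      by (rule continuous_on_cong[THEN iffD2, OF refl sc K(1)])
  qed
qed

section \<open>Minimal chains of finite energy and the rotation at a node\<close>

definition arcs ::
    "nat \<Rightarrow> (nat \<Rightarrow> complex) \<Rightarrow> (nat \<Rightarrow> real) \<Rightarrow> (nat \<Rightarrow> real \<Rightarrow> real) \<Rightarrow> (nat \<Rightarrow> real \<Rightarrow> real) \<Rightarrow> bool" where
  "arcs m P l \<theta> \<omega> \<longleftrightarrow>
     (\<forall>j\<in>{1..<m}. s_arc (l j) (\<theta> j) (\<omega> j) (P (Suc j) - P j) \<and>
        0 \<le> Re (cnj (P (Suc j) - P j) * cis (\<theta> j 0)) \<and>
        0 \<le> Re (cnj (P (Suc j) - P j) * cis (\<theta> j (l j)))) \<and>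
     (\<forall>j\<in>{1..<m}. Suc j < m \<longrightarrow> cis (\<theta> j (l j)) = cis (\<theta> (Suc j) 0))"

text \<open>Competitors have finite energy, so that real sums can be compared and single terms
  cancelled.\<close>

definition minimal_arcs ::
    "nat \<Rightarrow> (nat \<Rightarrow> complex) \<Rightarrow> (nat \<Rightarrow> real) \<Rightarrow> (nat \<Rightarrow> real \<Rightarrow> real) \<Rightarrow> (nat \<Rightarrow> real \<Rightarrow> real) \<Rightarrow> bool" where
  "minimal_arcs m P l \<theta> \<omega> \<longleftrightarrow> arcs m P l \<theta> \<omega> \<and>
     (\<forall>l' \<theta>' \<omega>'. arcs m P l' \<theta>' \<omega>' \<longrightarrow> (\<Sum>j\<in>{1..<m}. energy (l j) (\<omega> j)) \<le> (\<Sum>j\<in>{1..<m}. energy (l' j) (\<omega>' j)))"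

lemma s_arc_nn_integral:
  assumes "s_arc l \<theta> \<omega> V"
  shows "(\<integral>\<^sup>+x\<in>{0..l}. ennreal ((\<omega> x)\<^sup>2) \<partial>lborel) = ennreal (energy l \<omega>)"
  unfolding energy_def by (rule nn_integral_interval_eq_integral) (use assms in \<open>simp_all add: s_arc_def\<close>)

lemma arcs_imp_chain:
  assumes "arcs m P l \<theta> \<omega>"
  shows "chain m P l \<theta> \<omega>" and "chain_energy m l \<omega> = ennreal (\<Sum>j\<in>{1..<m}. energy (l j) (\<omega> j))"
proof -
  show "chain m P l \<theta> \<omega>" using assms unfolding arcs_def chain_def s_arc_def displacement_def by blast
  have "chain_energy m l \<omega> = (\<Sum>j\<in>{1..<m}. ennreal (energy (l j) (\<omega> j)))"
    unfolding chain_energy_def by (rule sum.cong[OF refl], rule s_arc_nn_integral) (use assms in \<open>auto simp: arcs_def\<close>)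
  then show "chain_energy m l \<omega> = ennreal (\<Sum>j\<in>{1..<m}. energy (l j) (\<omega> j))"
    by (simp add: sum_ennreal energy_nonneg)
qed

lemma sum_fun_upd:
  fixes f :: "'a \<Rightarrow> 'b::ab_group_add"
  assumes "finite A" "j \<in> A"
  shows "sum (f(j := y)) A = sum f A - f j + y"
proof -
  have "sum (f(j := y)) (A - {j}) = sum f (A - {j})" by (rule sum.cong) auto
  then show ?thesis using sum.remove[OF assms, of f] sum.remove[OF assms, of "f(j := y)"] by simp
qed

lemma energy_fun_upd:
  "(\<lambda>i. energy ((l(j := l1)) i) (((\<omega>)(j := \<omega>1)) i)) = (\<lambda>i. energy (l i) (\<omega> i))(j := energy l1 \<omega>1)"
  by auto

lemma arcs_fun_upd:
  assumes A: "arcs m P l \<theta> \<omega>" and j: "j \<in> {1..<m}" and s: "s_arc l1 \<theta>1 \<omega>1 (P (Suc j) - P j)"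
    and e: "\<theta>1 0 = \<theta> j 0" "\<theta>1 l1 = \<theta> j (l j)"
  shows "arcs m P (l(j := l1)) (\<theta>(j := \<theta>1)) ((\<omega>)(j := \<omega>1))"
  using A j s unfolding arcs_def by (auto simp: e)

text \<open>Rotating the common tangent at a node by the same \<open>\<epsilon>\<close> for both
  arcs keeps the tangents equal; the hypotheses \<open>r1\<close> and \<open>r2\<close> keep the two
  chord angles there admissible.\<close>

lemma arcs_fun_upd2:
  assumes A: "arcs m P l \<theta> \<omega>" and j: "j \<in> {1..<m}" "Suc j < m"
    and s1: "s_arc l1 \<theta>1 \<omega>1 (P (Suc j) - P j)" and e1: "\<theta>1 0 = \<theta> j 0" "\<theta>1 l1 = \<theta> j (l j) + \<epsilon>"
    and s2: "s_arc l2 \<theta>2 \<omega>2 (P (Suc (Suc j)) - P (Suc j))"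
    and e2: "\<theta>2 0 = \<theta> (Suc j) 0 + \<epsilon>" "\<theta>2 l2 = \<theta> (Suc j) (l (Suc j))"
    and r1: "0 \<le> Re (cnj (P (Suc j) - P j) * cis (\<theta> j (l j) + \<epsilon>))"
    and r2: "0 \<le> Re (cnj (P (Suc (Suc j)) - P (Suc j)) * cis (\<theta> (Suc j) 0 + \<epsilon>))"
  shows "arcs m P (l(j := l1, Suc j := l2)) (\<theta>(j := \<theta>1, Suc j := \<theta>2)) ((\<omega>)(j := \<omega>1, Suc j := \<omega>2))"
proof -
  have c: "cis (\<theta>1 l1) = cis (\<theta>2 0)"
    unfolding e1 e2 cis_mult[symmetric] using A j by (simp add: arcs_def)
  show ?thesis unfolding arcs_def
  proof (intro conjI ballI impI)
    fix i assume i: "i \<in> {1..<m}"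
    have A1: "s_arc (l i) (\<theta> i) (\<omega> i) (P (Suc i) - P i)" "0 \<le> Re (cnj (P (Suc i) - P i) * cis (\<theta> i 0))"
        "0 \<le> Re (cnj (P (Suc i) - P i) * cis (\<theta> i (l i)))"
      and A2: "Suc i < m \<Longrightarrow> cis (\<theta> i (l i)) = cis (\<theta> (Suc i) 0)"
      using A i unfolding arcs_def by blast+
    consider "i = j" | "i = Suc j" | "i \<noteq> j" "i \<noteq> Suc j" by blast
    note cs = this
    show "s_arc ((l(j := l1, Suc j := l2)) i) ((\<theta>(j := \<theta>1, Suc j := \<theta>2)) i) (((\<omega>)(j := \<omega>1, Suc j := \<omega>2)) i) (P (Suc i) - P i)"
      by (cases rule: cs) (simp_all only: fun_upd_def s1 s2 A1 if_True if_False simp_thms n_not_Suc_n Suc_n_not_n)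
    show "0 \<le> Re (cnj (P (Suc i) - P i) * cis ((\<theta>(j := \<theta>1, Suc j := \<theta>2)) i 0))"
      by (cases rule: cs) (use A1(2) r2 in \<open>simp_all only: fun_upd_def e1 e2 if_True if_False simp_thms n_not_Suc_n Suc_n_not_n\<close>)
    show "0 \<le> Re (cnj (P (Suc i) - P i) * cis ((\<theta>(j := \<theta>1, Suc j := \<theta>2)) i ((l(j := l1, Suc j := l2)) i)))"
      by (cases rule: cs) (use A1(3) r1 in \<open>simp_all only: fun_upd_def e1 e2 if_True if_False simp_thms n_not_Suc_n Suc_n_not_n\<close>)
    assume "Suc i < m"
    from A2[OF this] show "cis ((\<theta>(j := \<theta>1, Suc j := \<theta>2)) i ((l(j := l1, Suc j := l2)) i)) = cis ((\<theta>(j := \<theta>1, Suc j := \<theta>2)) (Suc i) 0)"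
      using c by (cases rule: cs) (auto simp: e1 e2)
  qed
qed

lemma minimal_arcs_piece:
  assumes M: "minimal_arcs m P l \<theta> \<omega>" and j: "j \<in> {1..<m}"
  shows "minimal_arc (l j) (\<theta> j) (\<omega> j) (P (Suc j) - P j)"
  unfolding minimal_arc_def
proof (intro conjI allI impI; (elim conjE)?)
  have A: "arcs m P l \<theta> \<omega>" using M by (simp add: minimal_arcs_def)
  then show "s_arc (l j) (\<theta> j) (\<omega> j) (P (Suc j) - P j)" using j by (simp add: arcs_def)
  fix l1 \<theta>1 \<omega>1 assume s: "s_arc l1 \<theta>1 \<omega>1 (P (Suc j) - P j)" "\<theta>1 0 = \<theta> j 0" "\<theta>1 l1 = \<theta> j (l j)"
  from arcs_fun_upd[OF A j s]
  have "(\<Sum>i\<in>{1..<m}. energy (l i) (\<omega> i)) \<le> (\<Sum>i\<in>{1..<m}. energy ((l(j := l1)) i) (((\<omega>)(j := \<omega>1)) i))"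
    using M unfolding minimal_arcs_def by blast
  then show "energy (l j) (\<omega> j) \<le> energy l1 \<omega>1"
    unfolding energy_fun_upd sum_fun_upd[OF finite_atLeastLessThan j] by linarith
qed

lemma Re_cis_perturb:
  assumes "0 < Re (V * cis \<phi>)"
  shows "\<exists>\<epsilon>0>0. \<forall>\<epsilon>. \<bar>\<epsilon>\<bar> < \<epsilon>0 \<longrightarrow> 0 \<le> Re (V * cis (\<phi> + \<epsilon>))"
proof -
  define k where "k = Re (V * cis \<phi>) / (norm V + 1)"
  have k: "0 < k" using assms unfolding k_def by (intro divide_pos_pos add_nonneg_pos) auto
  have "0 \<le> Re (V * cis (\<phi> + \<epsilon>))" if "\<bar>\<epsilon>\<bar> < k" for \<epsilon>
  proof -
    have "Re (V * cis \<phi>) - Re (V * cis (\<phi> + \<epsilon>)) = Re (V * (cis \<phi> - cis (\<phi> + \<epsilon>)))" by (simp add: algebra_simps)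
    also have "\<dots> \<le> norm V * norm (cis \<phi> - cis (\<phi> + \<epsilon>))" using complex_Re_le_cmod norm_mult by metis
    also have "\<dots> \<le> norm V * \<bar>\<epsilon>\<bar>" using norm_cis_diff_le[of \<phi> "\<phi> + \<epsilon>"] by (intro mult_left_mono) auto
    also have "\<dots> \<le> (norm V + 1) * k" using that by (intro mult_mono) auto
    also have "\<dots> = Re (V * cis \<phi>)" using norm_ge_zero[of V] by (simp add: k_def add_nonneg_eq_0_iff)
    finally show ?thesis by simp
  qed
  then show ?thesis using k by blast
qed

text \<open>To first order, turning the node by \<open>\<sigma> * \<epsilon>\<close> changes the
  total energy by at most \<open>2 * \<epsilon> * \<sigma> * (\<kappa> (l j) - \<kappa>' 0)\<close>,
  which is negative for one of the signs unless the curvatures agree.\<close>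

lemma minimal_arcs_node:
  assumes M: "minimal_arcs m P l \<theta> \<omega>" and j: "j \<in> {1..<m}" "Suc j < m"
    and el: "elastica (l j) (\<theta> j) \<Lambda> \<kappa>" "energy (l j) (\<omega> j) = integral {0..l j} (\<lambda>x. (\<kappa> x)\<^sup>2)"
    and el': "elastica (l (Suc j)) (\<theta> (Suc j)) \<Lambda>' \<kappa>'" "energy (l (Suc j)) (\<omega> (Suc j)) = integral {0..l (Suc j)} (\<lambda>x. (\<kappa>' x)\<^sup>2)"
    and Y: "0 < Re (cnj (P (Suc j) - P j) * cis (\<theta> j (l j)))"
    and X: "0 < Re (cnj (P (Suc (Suc j)) - P (Suc j)) * cis (\<theta> (Suc j) 0))"
  shows "\<kappa> (l j) = \<kappa>' 0"
proof (rule ccontr)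
  assume ne: "\<kappa> (l j) \<noteq> \<kappa>' 0"
  define \<Delta> where "\<Delta> = \<kappa> (l j) - \<kappa>' 0"
  \<comment> \<open>The sign opposite to that of the jump \<open>\<Delta>\<close>.\<close>
  define \<sigma> :: real where "\<sigma> = (if 0 < \<Delta> then -1 else 1)"
  \<comment> \<open>With this tolerance for each of the two arcs, the total change is at most
    \<open>\<epsilon> * (- 2 * \<bar>\<Delta>\<bar> + 2 * \<eta>) = - \<epsilon> *
    \<bar>\<Delta>\<bar>\<close>.\<close>
  define \<eta> where "\<eta> = \<bar>\<Delta>\<bar> / 2"
  have \<eta>: "0 < \<eta>" using ne by (simp add: \<eta>_def \<Delta>_def)
  have \<sigma>: "\<sigma> \<in> {1, -1}" "\<sigma> * \<Delta> = - \<bar>\<Delta>\<bar>" "\<bar>\<sigma>\<bar> = 1" by (simp_all add: \<sigma>_def)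
  have A: "arcs m P l \<theta> \<omega>" using M by (simp add: minimal_arcs_def)
  have j': "Suc j \<in> {1..<m}" using j by simp
  have X0: "0 \<le> Re (cnj (P (Suc j) - P j) * cis (\<theta> j 0))" using A j(1) unfolding arcs_def by blast
  have Y0: "0 \<le> Re (cnj (P (Suc (Suc j)) - P (Suc j)) * cis (\<theta> (Suc j) (l (Suc j))))" using A j' unfolding arcs_def by blast
  obtain \<epsilon>1 where \<epsilon>1: "\<epsilon>1 > 0" "\<forall>\<epsilon>. 0 < \<epsilon> \<and> \<epsilon> < \<epsilon>1 \<longrightarrow> (\<exists>l' \<theta>' \<omega>'. s_arc l' \<theta>' \<omega>' (P (Suc j) - P j) \<and> \<theta>' 0 = \<theta> j 0 \<and>
     \<theta>' l' = \<theta> j (l j) + \<sigma> * \<epsilon> \<and> energy l' \<omega>' \<le> energy (l j) (\<omega> j) + \<epsilon> * (2 * \<sigma> * \<kappa> (l j) + \<eta>))"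
    using end_angle_variation_signed[OF minimal_arcs_piece[OF M j(1)] el X0 Y \<eta> \<sigma>(1)] by (elim exE conjE) (rule that)
  obtain \<epsilon>2 where \<epsilon>2: "\<epsilon>2 > 0" "\<forall>\<epsilon>. 0 < \<epsilon> \<and> \<epsilon> < \<epsilon>2 \<longrightarrow> (\<exists>l' \<theta>' \<omega>'. s_arc l' \<theta>' \<omega>' (P (Suc (Suc j)) - P (Suc j)) \<and> \<theta>' 0 = \<theta> (Suc j) 0 + \<sigma> * \<epsilon> \<and>
     \<theta>' l' = \<theta> (Suc j) (l (Suc j)) \<and> energy l' \<omega>' \<le> energy (l (Suc j)) (\<omega> (Suc j)) + \<epsilon> * (- 2 * \<sigma> * \<kappa>' 0 + \<eta>))"
    using start_angle_variation_signed[OF minimal_arcs_piece[OF M j'] el' X Y0 \<eta> \<sigma>(1)] by (elim exE conjE) (rule that)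
  obtain \<epsilon>3 where \<epsilon>3: "\<epsilon>3 > 0" "\<forall>\<epsilon>. \<bar>\<epsilon>\<bar> < \<epsilon>3 \<longrightarrow> 0 \<le> Re (cnj (P (Suc j) - P j) * cis (\<theta> j (l j) + \<epsilon>))"
    using Re_cis_perturb[OF Y] by (elim exE conjE) (rule that)
  obtain \<epsilon>4 where \<epsilon>4: "\<epsilon>4 > 0" "\<forall>\<epsilon>. \<bar>\<epsilon>\<bar> < \<epsilon>4 \<longrightarrow> 0 \<le> Re (cnj (P (Suc (Suc j)) - P (Suc j)) * cis (\<theta> (Suc j) 0 + \<epsilon>))"
    using Re_cis_perturb[OF X] by (elim exE conjE) (rule that)
  define \<epsilon> where "\<epsilon> = min (min \<epsilon>1 \<epsilon>2) (min \<epsilon>3 \<epsilon>4) / 2"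
  have \<epsilon>: "0 < \<epsilon>" "\<epsilon> < \<epsilon>1" "\<epsilon> < \<epsilon>2" "\<epsilon> < \<epsilon>3" "\<epsilon> < \<epsilon>4" using \<epsilon>1(1) \<epsilon>2(1) \<epsilon>3(1) \<epsilon>4(1) unfolding \<epsilon>_def by linarith+
  have \<sigma>\<epsilon>: "\<bar>\<sigma> * \<epsilon>\<bar> = \<epsilon>" using \<sigma>(3) \<epsilon>(1) by (simp add: abs_mult)
  obtain l1 \<theta>1 \<omega>1 where 1: "s_arc l1 \<theta>1 \<omega>1 (P (Suc j) - P j)" "\<theta>1 0 = \<theta> j 0" "\<theta>1 l1 = \<theta> j (l j) + \<sigma> * \<epsilon>"
      "energy l1 \<omega>1 \<le> energy (l j) (\<omega> j) + \<epsilon> * (2 * \<sigma> * \<kappa> (l j) + \<eta>)"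
    using \<epsilon>1(2)[THEN spec, THEN mp, OF conjI[OF \<epsilon>(1,2)]] by (elim exE conjE) (rule that)
  obtain l2 \<theta>2 \<omega>2 where 2: "s_arc l2 \<theta>2 \<omega>2 (P (Suc (Suc j)) - P (Suc j))" "\<theta>2 0 = \<theta> (Suc j) 0 + \<sigma> * \<epsilon>"
      "\<theta>2 l2 = \<theta> (Suc j) (l (Suc j))" "energy l2 \<omega>2 \<le> energy (l (Suc j)) (\<omega> (Suc j)) + \<epsilon> * (- 2 * \<sigma> * \<kappa>' 0 + \<eta>)"
    using \<epsilon>2(2)[THEN spec, THEN mp, OF conjI[OF \<epsilon>(1,3)]] by (elim exE conjE) (rule that)
  have "arcs m P (l(j := l1, Suc j := l2)) (\<theta>(j := \<theta>1, Suc j := \<theta>2)) ((\<omega>)(j := \<omega>1, Suc j := \<omega>2))"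
    by (rule arcs_fun_upd2[OF A j 1(1-3) 2(1-3)]) (use \<epsilon>3(2) \<epsilon>4(2) \<sigma>\<epsilon> \<epsilon>(4,5) in simp_all)
  then have "(\<Sum>i\<in>{1..<m}. energy (l i) (\<omega> i))
      \<le> (\<Sum>i\<in>{1..<m}. energy ((l(j := l1, Suc j := l2)) i) (((\<omega>)(j := \<omega>1, Suc j := \<omega>2)) i))"
    using M unfolding minimal_arcs_def by blast
  also have "\<dots> = (\<Sum>i\<in>{1..<m}. energy (l i) (\<omega> i)) - energy (l j) (\<omega> j) + energy l1 \<omega>1 - energy (l (Suc j)) (\<omega> (Suc j)) + energy l2 \<omega>2"
  proof -
    have "(\<Sum>i\<in>{1..<m}. energy ((l(j := l1, Suc j := l2)) i) (((\<omega>)(j := \<omega>1, Suc j := \<omega>2)) i))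
        = sum ((\<lambda>i. energy (l i) (\<omega> i))(j := energy l1 \<omega>1, Suc j := energy l2 \<omega>2)) {1..<m}"
      unfolding energy_fun_upd ..
    also have "\<dots> = (\<Sum>i\<in>{1..<m}. energy (l i) (\<omega> i)) - energy (l j) (\<omega> j) + energy l1 \<omega>1
        - ((\<lambda>i. energy (l i) (\<omega> i))(j := energy l1 \<omega>1)) (Suc j) + energy l2 \<omega>2"
      by (simp only: sum_fun_upd[OF finite_atLeastLessThan j'] sum_fun_upd[OF finite_atLeastLessThan j(1)])
    finally show ?thesis by simp
  qed
  finally have "energy (l j) (\<omega> j) + energy (l (Suc j)) (\<omega> (Suc j)) \<le> energy l1 \<omega>1 + energy l2 \<omega>2" by simp
  then have "0 \<le> \<epsilon> * (2 * \<sigma> * \<kappa> (l j) + \<eta>) + \<epsilon> * (- 2 * \<sigma> * \<kappa>' 0 + \<eta>)" using 1(4) 2(4) by simp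
  also have "\<dots> = \<epsilon> * (2 * (\<sigma> * \<Delta>) + 2 * \<eta>)" by (simp add: \<Delta>_def algebra_simps)
  also have "\<dots> = - (\<epsilon> * \<bar>\<Delta>\<bar>)" unfolding \<sigma>(2) \<eta>_def by (simp add: algebra_simps)
  finally show False using mult_pos_pos[OF \<epsilon>(1), of "\<bar>\<Delta>\<bar>"] \<eta> by (simp add: \<eta>_def)
qed

lemma bchoice3:
  "\<forall>x\<in>A. \<exists>y z w. Q x y z w \<Longrightarrow> \<exists>f g h. \<forall>x\<in>A. Q x (f x) (g x) (h x)"
  by metis

text \<open>Each arc is replaced by one of finite energy with the same end angles and displacement,
  so the tangents still match and the chord angles are unchanged.\<close>

lemma chain_finite_energy:
  assumes ch: "chain m P l \<theta> \<omega>"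
  shows "\<exists>l' \<theta>' \<omega>'. arcs m P l' \<theta>' \<omega>'"
proof -
  have "\<exists>l' \<theta>' \<omega>'. s_arc l' \<theta>' \<omega>' (P (Suc j) - P j) \<and> \<theta>' 0 = \<theta> j 0 \<and> \<theta>' l' = \<theta> j (l j)" if j: "j \<in> {1..<m}" for j
  proof -
    have V: "displacement (\<theta> j) 0 (l j) = P (Suc j) - P j"
      using ch j unfolding chain_def by blast
    have "0 < l j" "primitive_on 0 (l j) (\<theta> j) (\<omega> j)" "s_shaped 0 (l j) (\<theta> j)"
      using ch j unfolding chain_def by blast+
    then obtain l' \<theta>' \<omega>' where "s_arc l' \<theta>' \<omega>' (displacement (\<theta> j) 0 (l j))" "\<theta>' 0 = \<theta> j 0" "\<theta>' l' = \<theta> j (l j)"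
      by (rule finite_energy_arc_exists)
    then show ?thesis unfolding V by blast
  qed
  then have "\<forall>j\<in>{1..<m}. \<exists>l' \<theta>' \<omega>'. s_arc l' \<theta>' \<omega>' (P (Suc j) - P j) \<and> \<theta>' 0 = \<theta> j 0 \<and> \<theta>' l' = \<theta> j (l j)"
    by (rule ballI)
  from bchoice3[OF this] obtain l' \<theta>' \<omega>' where
    s: "\<forall>j\<in>{1..<m}. s_arc (l' j) (\<theta>' j) (\<omega>' j) (P (Suc j) - P j) \<and> \<theta>' j 0 = \<theta> j 0 \<and> \<theta>' j (l' j) = \<theta> j (l j)"
    by (elim exE) (rule that)
  have "arcs m P l' \<theta>' \<omega>'" unfolding arcs_def
  proof (intro conjI ballI impI)
    fix j assume j: "j \<in> {1..<m}"
    have c: "0 \<le> Re (cnj (P (Suc j) - P j) * cis (\<theta> j 0))" "0 \<le> Re (cnj (P (Suc j) - P j) * cis (\<theta> j (l j)))"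
      "Suc j < m \<longrightarrow> cis (\<theta> j (l j)) = cis (\<theta> (Suc j) 0)"
      using ch j unfolding chain_def by blast+
    have e: "\<theta>' j 0 = \<theta> j 0" "\<theta>' j (l' j) = \<theta> j (l j)" using s j by blast+
    show "s_arc (l' j) (\<theta>' j) (\<omega>' j) (P (Suc j) - P j)" using s j by blast
    show "0 \<le> Re (cnj (P (Suc j) - P j) * cis (\<theta>' j 0))" unfolding e(1) by (rule c(1))
    show "0 \<le> Re (cnj (P (Suc j) - P j) * cis (\<theta>' j (l' j)))" unfolding e(2) by (rule c(2))
    show "cis (\<theta>' j (l' j)) = cis (\<theta>' (Suc j) 0)" if "Suc j < m"
    proof -
      have "\<theta>' (Suc j) 0 = \<theta> (Suc j) 0" using s that by simp
      then show ?thesis using e(2) c(3) that by simp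
    qed
  qed
  then show ?thesis by blast
qed

text \<open>Comparison with a chain of finite energy bounds the minimum, so every one of its arcs
  has finite energy and the extended sums become real ones.\<close>

lemma chain_minimal_arcs:
  assumes ch: "chain m P l \<theta> \<omega>"
    and min: "\<And>l' \<theta>' \<omega>'. chain m P l' \<theta>' \<omega>' \<Longrightarrow> chain_energy m l \<omega> \<le> chain_energy m l' \<omega>'"
  shows "minimal_arcs m P l \<theta> \<omega>"
proof -
  obtain l0 \<theta>0 \<omega>0 where A0: "arcs m P l0 \<theta>0 \<omega>0" using chain_finite_energy[OF ch] by blast
  have fin: "chain_energy m l \<omega> < top"
    by (rule order_le_less_trans[OF min[OF arcs_imp_chain(1)[OF A0]]]) (simp add: arcs_imp_chain(2)[OF A0])
  have s: "s_arc (l j) (\<theta> j) (\<omega> j) (P (Suc j) - P j)" if j: "j \<in> {1..<m}" for j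
  proof -
    have c: "0 < l j" "primitive_on 0 (l j) (\<theta> j) (\<omega> j)" "s_shaped 0 (l j) (\<theta> j)" "displacement (\<theta> j) 0 (l j) = P (Suc j) - P j"
      using ch j unfolding chain_def by blast+
    have [measurable]: "\<omega> j \<in> borel_measurable borel" using c(2) by (simp add: primitive_on_def)
    have "(\<integral>\<^sup>+x\<in>{0..l j}. ennreal ((\<omega> j x)\<^sup>2) \<partial>lborel) \<le> chain_energy m l \<omega>"
      unfolding chain_energy_def by (rule member_le_sum[OF j]) auto
    then have "(\<lambda>x. (\<omega> j x)\<^sup>2) integrable_on {0..l j}"
      using fin by (intro nn_integral_finite_imp_integrable) (auto intro: order_le_less_trans)
    then show ?thesis unfolding s_arc_def using c unfolding displacement_def by blast
  qed
  have A: "arcs m P l \<theta> \<omega>" using ch s unfolding arcs_def chain_def by blast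
  have "(\<Sum>j\<in>{1..<m}. energy (l j) (\<omega> j)) \<le> (\<Sum>j\<in>{1..<m}. energy (l' j) (\<omega>' j))" if A': "arcs m P l' \<theta>' \<omega>'" for l' \<theta>' \<omega>'
    using min[OF arcs_imp_chain(1)[OF A']] unfolding arcs_imp_chain(2)[OF A] arcs_imp_chain(2)[OF A']
    by (simp add: ennreal_le_iff sum_nonneg energy_nonneg)
  then show ?thesis using A unfolding minimal_arcs_def by blast
qed

theorem corollary1p2:
  fixes m :: nat and P :: "nat \<Rightarrow> complex"
    and t :: "nat \<Rightarrow> real" and F_opt :: "real \<Rightarrow> complex"
    and \<alpha> \<beta> :: "nat \<Rightarrow> real"
  assumes "m \<ge> 2"
    and "\<And>j. j \<in> {1..<m} \<Longrightarrow> P j \<noteq> P (Suc j)"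
    and "(t, F_opt) \<in> A_half_pi m P"
    and "\<And>u G. (u, G) \<in> A_half_pi m P \<Longrightarrow>
           bending_energy (t 1) (t m) F_opt \<le> bending_energy (u 1) (u m) G"
    and "\<And>j. j \<in> {1..<m} \<Longrightarrow> \<alpha> j = initial_chord_angle (t j) (t (Suc j)) F_opt"
    and "\<And>j. j \<in> {1..<m} \<Longrightarrow> \<beta> (Suc j) = terminal_chord_angle (t j) (t (Suc j)) F_opt"
    and "\<And>j. j \<in> {2..<m} \<Longrightarrow> \<bar>\<beta> j\<bar> < pi / 2 \<and> \<bar>\<alpha> j\<bar> < pi / 2"
  shows "G2 (t 1) (t m) F_opt"
proof -
  note m = assms(1) and P = assms(2)
  obtain l \<theta> \<omega> where ch: "chain m P l \<theta> \<omega>" and en: "bending_energy (t 1) (t m) F_opt = chain_energy m l \<omega> / 4"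
    and len: "arclength (t 1) (t m) F_opt = node l m"
    and T: "\<And>j x. j \<in> {1..<m} \<Longrightarrow> x \<in> {0..l j} \<Longrightarrow> unit_tangent (t 1) (t m) F_opt (node l j + x) = cis (\<theta> j x)"
    and ia: "\<And>j. j \<in> {1..<m} \<Longrightarrow> \<bar>initial_chord_angle (t j) (t (Suc j)) F_opt\<bar> < pi / 2 \<longleftrightarrow> 0 < Re (cnj (P (Suc j) - P j) * cis (\<theta> j 0))"
    and ta: "\<And>j. j \<in> {1..<m} \<Longrightarrow> \<bar>terminal_chord_angle (t j) (t (Suc j)) F_opt\<bar> < pi / 2 \<longleftrightarrow> 0 < Re (cnj (P (Suc j) - P j) * cis (\<theta> j (l j)))"
    by (rule curve_chain[OF assms(3) m P], assumption) (rule that)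
  have times4: "x / 4 * 4 = x" for x :: ennreal by (simp add: ennreal_divide_times)
  \<comment> \<open>Every chain is realised by an admissible curve, so minimality passes from curves
    to chains; the factor 1/4 is cancelled at the end.\<close>
  have "chain_energy m l \<omega> \<le> chain_energy m l' \<omega>'" if ch': "chain m P l' \<theta>' \<omega>'" for l' \<theta>' \<omega>'
  proof -
    obtain u G where "(u, G) \<in> A_half_pi m P" "bending_energy (u 1) (u m) G = chain_energy m l' \<omega>' / 4"
      by (rule chain_curve[OF ch' m P], assumption) (rule that)
    then have "chain_energy m l \<omega> / 4 \<le> chain_energy m l' \<omega>' / 4" using assms(4)[of u G] en by simp
    from mult_right_mono[OF this, of 4] show ?thesis unfolding times4 by simp
  qed
  with ch have M: "minimal_arcs m P l \<theta> \<omega>" by (rule chain_minimal_arcs)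
  have "\<exists>\<Lambda> \<kappa>. elastica (l j) (\<theta> j) \<Lambda> \<kappa> \<and> energy (l j) (\<omega> j) = integral {0..l j} (\<lambda>x. (\<kappa> x)\<^sup>2)" if j: "j \<in> {1..<m}" for j
  proof -
    obtain \<Lambda> \<kappa> where "elastica (l j) (\<theta> j) \<Lambda> \<kappa>" "energy (l j) (\<omega> j) = integral {0..l j} (\<lambda>x. (\<kappa> x)\<^sup>2)"
      by (rule minimal_arc_elastica[OF minimal_arcs_piece[OF M j]]) (rule that)
    then show ?thesis by blast
  qed
  then have "\<forall>j\<in>{1..<m}. \<exists>\<Lambda> \<kappa>. elastica (l j) (\<theta> j) \<Lambda> \<kappa> \<and> energy (l j) (\<omega> j) = integral {0..l j} (\<lambda>x. (\<kappa> x)\<^sup>2)"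
    by (rule ballI)
  from bchoice2[OF this] obtain \<Lambda> \<kappa> where
    el: "\<forall>j\<in>{1..<m}. elastica (l j) (\<theta> j) (\<Lambda> j) (\<kappa> j) \<and> energy (l j) (\<omega> j) = integral {0..l j} (\<lambda>x. (\<kappa> j x)\<^sup>2)"
    by (elim exE) (rule that)
  show ?thesis
  proof (rule G2_criterion[where l=l and \<theta>=\<theta> and \<omega>=\<omega> and \<kappa>=\<kappa> and m=m])
    show "is_curve (t 1) (t m) F_opt" using assms(3) by (simp add: A_half_pi_def interpolating_curve_def)
    fix j assume j: "j \<in> {1..<m}"
    show "0 < l j" "primitive_on 0 (l j) (\<theta> j) (\<omega> j)" using ch j unfolding chain_def by blast+
    show "unit_tangent (t 1) (t m) F_opt (node l j + x) = cis (\<theta> j x)" if "x \<in> {0..l j}" for x by (rule T[OF j that])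
    have e: "elastica (l j) (\<theta> j) (\<Lambda> j) (\<kappa> j)" "energy (l j) (\<omega> j) = integral {0..l j} (\<lambda>x. (\<kappa> j x)\<^sup>2)" using el j by blast+
    show "continuous_on {0..l j} (\<kappa> j)" using e(1) by (simp add: elastica_def)
    show "(\<theta> j has_real_derivative \<kappa> j x) (at x within {0..l j})" if "x \<in> {0..l j}" for x
      using e(1) that unfolding elastica_def by blast
    assume Sj: "Suc j < m"
    show "cis (\<theta> j (l j)) = cis (\<theta> (Suc j) 0)" using ch j Sj unfolding chain_def by blast
    have j': "Suc j \<in> {1..<m}" "Suc j \<in> {2..<m}" using j Sj by auto
    have e': "elastica (l (Suc j)) (\<theta> (Suc j)) (\<Lambda> (Suc j)) (\<kappa> (Suc j))"
        "energy (l (Suc j)) (\<omega> (Suc j)) = integral {0..l (Suc j)} (\<lambda>x. (\<kappa> (Suc j) x)\<^sup>2)" using el j'(1) by blast+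
    \<comment> \<open>The index \<open>Suc j\<close> is that of an interior node: its terminal chord
      angle belongs to arc \<open>j\<close>, its initial one to arc \<open>Suc j\<close>.\<close>
    show "\<kappa> j (l j) = \<kappa> (Suc j) 0"
    proof (rule minimal_arcs_node[OF M j Sj e e'])
      show "0 < Re (cnj (P (Suc j) - P j) * cis (\<theta> j (l j)))"
        using assms(7)[OF j'(2)] unfolding assms(6)[OF j] ta[OF j] by (rule conjunct1)
      show "0 < Re (cnj (P (Suc (Suc j)) - P (Suc j)) * cis (\<theta> (Suc j) 0))"
        using assms(7)[OF j'(2)] unfolding assms(5)[OF j'(1)] ia[OF j'(1)] by (rule conjunct2)
    qed
  qed (use m len in simp_all)
qed

end
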